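(* The Marchenko-Ostrovsky mapping $\psi=(\psi_{1,n},\psi_{2,n})_{n=1}^{N-1}:\mathcal{H}^2\to\mathbb{R}^{2N-2}$ (constructed from the Dirichlet eigenvalues $\nu_n$ of the $N$-periodic Jacobi operator with coefficients $a_n=e^{x_n}$, $b_n$, $q=(x,b)\in\mathcal{H}^2$) is a real analytic isomorphism between the Hilbert spaces $\mathcal{H}^2$ and $\mathbb{R}^{2N-2}$, i.e. $\psi$ is bijective and both $\psi$ and $\psi^{-1}$ are real analytic.
   Context: Let $N\in\mathbb{N}$, and write $\mathbb{Z}_m=\{1,\dots,m\}$. Let $\mathcal{H}=\{b\in\mathbb{R}^N:\sum_{n=1}^N b_n=0\}$ and $q=(x,b)=(x_n,b_n)_{n\in\mathbb{Z}_N}\in\mathcal{H}^2$ (so $x\in\mathcal{H}$ and $b\in\mathcal{H}$). Put $a_n=e^{x_n}>0$ and extend $a_n,b_n$ to all $n\in\mathbb{Z}$ as $N$-periodic sequences (in particular $a_0=a_N$). Let $\varphi=(\varphi_n(\lambda,q))_{n\in\mathbb{Z}}$ and $\vartheta=(\vartheta_n(\lambda,q))_{n\in\mathbb{Z}}$ be the solutions of $$a_{n-1}y_{n-1}+b_ny_n+a_ny_{n+1}=\lambda y_n,\quad (\lambda,n)\in\mathbb{C}\times\mathbb{Z},$$ with $\varphi_0=\vartheta_1=0$, $\varphi_1=\vartheta_0=1$. The Lyapunov function is $\Delta(\lambda,q)=\frac12(\varphi_{N+1}(\lambda,q)+\vartheta_N(\lambda,q))$. The roots of $\Delta^2(\lambda,q)=1$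 (with multiplicity) are real and are denoted $$\lambda_0^+<\lambda_1^-\le\lambda_1^+<\dots<\lambda_{N-1}^-\le\lambda_{N-1}^+<\lambda_N^-.$$ For each $n\in\mathbb{Z}_{N-1}$ there is exactly one point $\lambda_n=\lambda_n(q)\in[\lambda_n^-,\lambda_n^+]$ with $\Delta'(\lambda_n,q)=0$ (where $'=\partial/\partial\lambda$); it satisfies $(-1)^{N-n}\Delta(\lambda_n,q)\ge1$. The Dirichlet eigenvalues $\nu_n=\nu_n(q)$, $n\in\mathbb{Z}_{N-1}$, are the zeros of the polynomial $\lambda\mapsto\varphi_N(\lambda,q)$, numbered so that $\nu_n\in[\lambda_n^-,\lambda_n^+]$. The mapping $\psi:\mathcal{H}^2\to\mathbb{R}^{2N-2}$ is $\psi=(\psi_n)_{n\in\mathbb{Z}_{N-1}}$, $\psi_n=(\psi_{1,n},\psi_{2,n})\in\mathbb{R}^2$, where $$\psi_{1,n}=\log\bigl((-1)^{N-n}\varphi_{N+1}(\nu_n,q)\bigr),\qquad \psi_{2,n}=\bigl(|\psi_n|^2-\psi_{1,n}^2\bigr)^{1/2}\,\mathrm{sign}(\lambda_n-\nu_n),$$ and $|\psi_n|\ge0$ is determined by $\cosh|\psi_n|=(-1)^{N-n}\Delta(\lambda_n,q)$. (One has $(-1)^{N-n}\Delta(\nu_n,q)=\cosh\psi_{1,n}$, so that $|\psi_n|^2-\psi_{1,n}^2\ge0$ and $\psi$ is well defined.) *)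

theory Defs
  imports
    "HOL-Analysis.Analysis"
    "HOL-Computational_Algebra.Polynomial"
    "HOL-Library.Multiset"
begin

text \<open>Vectors of length \<open>m\<close> are indexed by \<open>{1..m}\<close> and extended by \<open>0\<close>, so that
  equality of functions is equality of vectors.\<close>

definition Rn :: "nat \<Rightarrow> (nat \<Rightarrow> real) set" where
  "Rn m = {v. \<forall>i. i \<notin> {1..m} \<longrightarrow> v i = 0}"

definition Hspace :: "nat \<Rightarrow> (nat \<Rightarrow> real) set" where
  "Hspace N = {v \<in> Rn N. (\<Sum>n=1..N. v n) = 0}"

definition periodic :: "nat \<Rightarrow> (nat \<Rightarrow> real) \<Rightarrow> int \<Rightarrow> real" where
  "periodic N v n = v (nat ((n - 1) mod int N) + 1)"

definition acoeff :: "nat \<Rightarrow> (nat \<Rightarrow> real) \<Rightarrow> int \<Rightarrow> real" where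
  "acoeff N x = periodic N (\<lambda>n. exp (x n))"

definition bcoeff :: "nat \<Rightarrow> (nat \<Rightarrow> real) \<Rightarrow> int \<Rightarrow> real" where
  "bcoeff N b = periodic N b"

definition jacobi_solution ::
  "(int \<Rightarrow> real) \<Rightarrow> (int \<Rightarrow> real) \<Rightarrow> complex \<Rightarrow> (int \<Rightarrow> complex) \<Rightarrow> bool" where
  "jacobi_solution a b z y \<longleftrightarrow>
     (\<forall>n. of_real (a (n - 1)) * y (n - 1) + of_real (b n) * y n + of_real (a n) * y (n + 1)
          = z * y n)"

text \<open>The solution with \<open>y\<^sub>0 = u\<close> and \<open>y\<^sub>1 = v\<close>, at the indices \<open>n \<ge> 0\<close>, as a polynomial in
  the spectral parameter; \<open>jacobi_solution_eq_poly\<close> below relates it to the solutions on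
  the whole of \<open>\<int>\<close> for complex \<open>z\<close>.\<close>

fun jacobi_poly ::
  "(int \<Rightarrow> real) \<Rightarrow> (int \<Rightarrow> real) \<Rightarrow> real \<Rightarrow> real \<Rightarrow> nat \<Rightarrow> real poly" where
  "jacobi_poly a b u v 0 = [:u:]"
| "jacobi_poly a b u v (Suc 0) = [:v:]"
| "jacobi_poly a b u v (Suc (Suc n)) =
     smult (1 / a (int n + 1))
       ([:- b (int n + 1), 1:] * jacobi_poly a b u v (Suc n)
        - smult (a (int n)) (jacobi_poly a b u v n))"

lemma jacobi_solution_eq_poly:
  assumes a: "\<And>n. a n \<noteq> 0" and sol: "jacobi_solution a b z y"
    and y0: "y 0 = of_real u" and y1: "y 1 = of_real v"
  shows "y (int n) = poly (map_poly of_real (jacobi_poly a b u v n)) z"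
proof -
  let ?E = "\<lambda>p. poly (map_poly of_real p) z"
  have E_diff: "?E (p - q) = ?E p - ?E q" for p q
  proof -
    have "map_poly complex_of_real (p - q) = map_poly of_real p - map_poly of_real q"
      by (rule poly_eqI) (simp add: coeff_map_poly)
    then show ?thesis by simp
  qed
  have E_add: "?E (p + q) = ?E p + ?E q" for p q
  proof -
    have "map_poly complex_of_real (p + q) = map_poly of_real p + map_poly of_real q"
      by (rule poly_eqI) (simp add: coeff_map_poly)
    then show ?thesis by simp
  qed
  have E_smult: "?E (smult c p) = of_real c * ?E p" for c p
    by (simp add: map_poly_smult)
  have E_shift: "?E ([:c, 1:] * p) = (of_real c + z) * ?E p" for c p
    by (simp add: E_add E_smult map_poly_pCons algebra_simps)
  have step: "y (int n + 2) = ((z - of_real (b (int n + 1))) * y (int n + 1)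
      - of_real (a (int n)) * y (int n)) / of_real (a (int n + 1))" for n
  proof -
    have "of_real (a (int n)) * y (int n) + of_real (b (int n + 1)) * y (int n + 1)
        + of_real (a (int n + 1)) * y (int n + 2) = z * y (int n + 1)"
      using sol[unfolded jacobi_solution_def, rule_format, of "int n + 1"]
      by (simp add: add.assoc)
    then show ?thesis using a[of "int n + 1"]
      by (simp add: eq_divide_eq algebra_simps)
  qed
  show ?thesis
  proof (induction n rule: induct_nat_012)
    case 0
    then show ?case using y0 by (simp add: map_poly_pCons)
  next
    case 1
    then show ?case using y1 by (simp add: map_poly_pCons)
  next
    case (ge2 n)
    have "y (int (Suc (Suc n))) = y (int n + 2)" by (simp add: algebra_simps)
    also have "\<dots> = ?E (jacobi_poly a b u v (Suc (Suc n)))"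
      using ge2 unfolding step jacobi_poly.simps E_smult E_diff E_shift
      by (simp add: algebra_simps add_divide_distrib diff_divide_distrib)
    finally show ?case .
  qed
qed

definition phi :: "nat \<Rightarrow> (nat \<Rightarrow> real) \<times> (nat \<Rightarrow> real) \<Rightarrow> nat \<Rightarrow> real poly" where
  "phi N = (\<lambda>(x, b). jacobi_poly (acoeff N x) (bcoeff N b) 0 1)"

definition theta :: "nat \<Rightarrow> (nat \<Rightarrow> real) \<times> (nat \<Rightarrow> real) \<Rightarrow> nat \<Rightarrow> real poly" where
  "theta N = (\<lambda>(x, b). jacobi_poly (acoeff N x) (bcoeff N b) 1 0)"

definition Lyapunov :: "nat \<Rightarrow> (nat \<Rightarrow> real) \<times> (nat \<Rightarrow> real) \<Rightarrow> real poly" where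
  "Lyapunov N q = smult (1/2) (phi N q (N + 1) + theta N q N)"

text \<open>The increasing list, with multiplicities, of the roots of \<open>\<Delta>\<^sup>2 = 1\<close>:
  \<open>[\<lambda>\<^sub>0\<^sup>+, \<lambda>\<^sub>1\<^sup>-, \<lambda>\<^sub>1\<^sup>+, \<dots>, \<lambda>\<^sub>N\<^sup>-]\<close>. All complex roots are real, so it has length \<open>2N\<close>.\<close>

definition edges :: "nat \<Rightarrow> (nat \<Rightarrow> real) \<times> (nat \<Rightarrow> real) \<Rightarrow> real list" where
  "edges N q = sorted_list_of_multiset (proots ((Lyapunov N q)\<^sup>2 - 1))"

definition edge_minus :: "nat \<Rightarrow> (nat \<Rightarrow> real) \<times> (nat \<Rightarrow> real) \<Rightarrow> nat \<Rightarrow> real" where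
  "edge_minus N q n = edges N q ! (2 * n - 1)"

definition edge_plus :: "nat \<Rightarrow> (nat \<Rightarrow> real) \<times> (nat \<Rightarrow> real) \<Rightarrow> nat \<Rightarrow> real" where
  "edge_plus N q n = edges N q ! (2 * n)"

definition crit :: "nat \<Rightarrow> (nat \<Rightarrow> real) \<times> (nat \<Rightarrow> real) \<Rightarrow> nat \<Rightarrow> real" where
  "crit N q n = (THE t. t \<in> {edge_minus N q n..edge_plus N q n} \<and>
                        poly (pderiv (Lyapunov N q)) t = 0)"

definition dirichlet :: "nat \<Rightarrow> (nat \<Rightarrow> real) \<times> (nat \<Rightarrow> real) \<Rightarrow> nat \<Rightarrow> real" where
  "dirichlet N q n = (THE t. t \<in> {edge_minus N q n..edge_plus N q n} \<and>
                             poly (phi N q N) t = 0)"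

definition psi1 :: "nat \<Rightarrow> (nat \<Rightarrow> real) \<times> (nat \<Rightarrow> real) \<Rightarrow> nat \<Rightarrow> real" where
  "psi1 N q n = ln ((-1) ^ (N - n) * poly (phi N q (N + 1)) (dirichlet N q n))"

definition psi_abs :: "nat \<Rightarrow> (nat \<Rightarrow> real) \<times> (nat \<Rightarrow> real) \<Rightarrow> nat \<Rightarrow> real" where
  "psi_abs N q n =
     (THE r. r \<ge> 0 \<and> cosh r = (-1) ^ (N - n) * poly (Lyapunov N q) (crit N q n))"

definition psi2 :: "nat \<Rightarrow> (nat \<Rightarrow> real) \<times> (nat \<Rightarrow> real) \<Rightarrow> nat \<Rightarrow> real" where
  "psi2 N q n = sqrt ((psi_abs N q n)\<^sup>2 - (psi1 N q n)\<^sup>2) * sgn (crit N q n - dirichlet N q n)"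

definition psi ::
  "nat \<Rightarrow> (nat \<Rightarrow> real) \<times> (nat \<Rightarrow> real) \<Rightarrow> (nat \<Rightarrow> real) \<times> (nat \<Rightarrow> real)" where
  "psi N q = ((\<lambda>n. if n \<in> {1..N-1} then psi1 N q n else 0),
              (\<lambda>n. if n \<in> {1..N-1} then psi2 N q n else 0))"

text \<open>A pair of vectors of length \<open>m\<close> has coordinates indexed by \<open>{1..m} <+> {1..m}\<close>.\<close>

definition coords :: "(nat \<Rightarrow> real) \<times> (nat \<Rightarrow> real) \<Rightarrow> nat + nat \<Rightarrow> real" where
  "coords = (\<lambda>(u, v). case_sum u v)"

definition multi_indices :: "'i set \<Rightarrow> ('i \<Rightarrow> nat) set" where
  "multi_indices I = {\<alpha>. \<forall>i. i \<notin> I \<longrightarrow> \<alpha> i = 0}"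

text \<open>A function on a set \<open>S \<subseteq> \<real>\<^sup>m \<times> \<real>\<^sup>m\<close> is real analytic if near each point of \<open>S\<close> it is the
  restriction to \<open>S\<close> of the sum of a power series that converges absolutely on a
  neighbourhood of that point in \<open>\<real>\<^sup>m \<times> \<real>\<^sup>m\<close>. If \<open>S\<close> is a linear subspace, this is
  analyticity on \<open>S\<close> as a Euclidean space in its own right, since a function on \<open>S\<close> extends
  by composition with a linear projection onto \<open>S\<close>.\<close>

definition real_analytic_fun ::
  "nat \<Rightarrow> ((nat \<Rightarrow> real) \<times> (nat \<Rightarrow> real)) set \<Rightarrow>
   ((nat \<Rightarrow> real) \<times> (nat \<Rightarrow> real) \<Rightarrow> real) \<Rightarrow> bool" where
  "real_analytic_fun m S f \<longleftrightarrow>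
     (let I = {1..m} <+> {1..m} in
      \<forall>p\<in>S. \<exists>r>0. \<exists>c :: (nat + nat \<Rightarrow> nat) \<Rightarrow> real.
        \<forall>z \<in> Rn m \<times> Rn m. (\<forall>i\<in>I. \<bar>coords z i - coords p i\<bar> < r) \<longrightarrow>
          (\<lambda>\<alpha>. c \<alpha> * (\<Prod>i\<in>I. (coords z i - coords p i) ^ \<alpha> i)) summable_on multi_indices I \<and>
          (z \<in> S \<longrightarrow>
             f z = (\<Sum>\<^sub>\<infinity>\<alpha>\<in>multi_indices I. c \<alpha> * (\<Prod>i\<in>I. (coords z i - coords p i) ^ \<alpha> i))))"

definition real_analytic_map ::
  "nat \<Rightarrow> nat \<Rightarrow> ((nat \<Rightarrow> real) \<times> (nat \<Rightarrow> real)) set \<Rightarrow>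
   ((nat \<Rightarrow> real) \<times> (nat \<Rightarrow> real) \<Rightarrow> (nat \<Rightarrow> real) \<times> (nat \<Rightarrow> real)) \<Rightarrow> bool" where
  "real_analytic_map m k S F \<longleftrightarrow>
     (\<forall>j \<in> {1..k} <+> {1..k}. real_analytic_fun m S (\<lambda>q. coords (F q) j))"

end

theory Submission
  imports Defs "HOL-Complex_Analysis.Complex_Analysis"
begin

text \<open>For \<open>N = 1\<close> both spaces are a single point. Let \<open>N \<ge> 2\<close> and, for \<open>q = (x, b)\<close>, let \<open>\<Delta>\<close> be the
Lyapunov function, \<open>A = \<phi>\<^sub>N\<^sub>+\<^sub>1\<close> and \<open>B\<close> the monic multiple of \<open>\<phi>\<^sub>N\<close>, whose roots are the Dirichlet
eigenvalues \<open>\<nu>\<^sub>n\<close>; write \<open>s\<^sub>n = (-1)\<^sup>N\<^sup>-\<^sup>n\<close>. Since \<open>x\<close> and \<open>b\<close> have zero sum, \<open>A\<close> is monic of degree \<open>N\<close>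
without a term of degree \<open>N - 1\<close>, and \<open>\<Delta>\<close> has leading coefficient \<open>1/2\<close> and no term of degree \<open>N - 1\<close>.

The mapping is bijective because \<open>\<psi>(q)\<close> can be read backwards, one piece at a time.

\<^item> \<open>\<Delta>\<close> from the numbers \<open>|\<psi>\<^sub>n|\<close>. The critical values of \<open>\<Delta>\<close> are \<open>s\<^sub>n cosh |\<psi>\<^sub>n|\<close>, and a normalized polynomial
  with simple real roots is determined by its critical values, which can be prescribed arbitrarily subject
  to alternating signs (\<open>critval_surj\<close>, \<open>critval_inj\<close>). This is the heart of the proof. Locally it is the
  implicit function theorem: moving the coefficient of \<open>\<lambda>\<^sup>k\<close> changes the \<open>j\<close>-th critical value at the rate
  \<open>\<lambda>\<^sub>j\<^sup>k\<close>, so the Jacobian is a Vandermonde matrix (\<open>critval_local_inverse\<close>). Globally, the map from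
  polynomials to critical values is proper (\<open>critval_proper\<close>), because a large gap between consecutive
  critical points would force a large difference of critical values. Hence, along a segment of alternating
  sequences, both having a preimage and having two preimages are open and closed conditions. There is a
  sequence with a preimage, and the sequence \<open>s\<^sub>n\<close> has only one: a polynomial with these critical values is
  a Chebyshev polynomial, as it satisfies the Chebyshev differential equation (\<open>equioscillating_unique\<close>).

\<^item> \<open>\<nu>\<^sub>n\<close> from \<open>\<Delta>\<close>, \<open>\<psi>\<^sub>1\<^sub>,\<^sub>n\<close> and the sign of \<open>\<psi>\<^sub>2\<^sub>,\<^sub>n\<close>. By the Wronskian identity, \<open>\<Delta> = (A + 1/A)/2\<close> at the roots
  of \<open>B\<close>, so that \<open>s\<^sub>n \<Delta>(\<nu>\<^sub>n) = cosh \<psi>\<^sub>1\<^sub>,\<^sub>n\<close>. Between two consecutive roots of \<open>\<Delta>\<close> the function \<open>s\<^sub>n \<Delta>\<close> increases up to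
  \<open>\<lambda>\<^sub>n\<close> and decreases afterwards; it takes a value below its maximum once on each side of \<open>\<lambda>\<^sub>n\<close>, and the sign
  of \<open>\<psi>\<^sub>2\<^sub>,\<^sub>n\<close> tells the side (\<open>level_point_exists\<close>, \<open>level_point_unique\<close>).

\<^item> \<open>A\<close> and \<open>B\<close> from \<open>\<nu>\<close> and \<open>\<psi>\<^sub>1\<close>. The \<open>\<nu>\<^sub>n\<close> are the roots of \<open>B\<close>, and \<open>A\<close> is the polynomial with the
  prescribed top coefficients and the values \<open>s\<^sub>n exp \<psi>\<^sub>1\<^sub>,\<^sub>n\<close> at \<open>\<nu>\<^sub>n\<close>.

\<^item> \<open>q\<close> from \<open>A\<close> and \<open>B\<close>. The three-term recurrence, run backwards, is division with remainder; it succeeds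
  as soon as the signs of \<open>A\<close> at the roots of \<open>B\<close> alternate (\<open>jmonic_inverse\<close>, \<open>periodic_data_inverse\<close>).

Every step in either direction is a composition of arithmetic, \<open>exp\<close>, \<open>ln\<close>, simple roots of polynomials and
the implicit function theorem, hence analytic. The exceptions are \<open>\<psi>\<^sub>2\<^sub>,\<^sub>n\<close> as a function of \<open>q\<close> and \<open>\<nu>\<^sub>n\<close> as a
function of \<open>\<psi>\<close>: their definitions involve a square root of a quantity that may vanish, multiplied by a sign.
With \<open>C(y) = cosh \<surd>y\<close>, an entire function, and \<open>C(u) - C(v) = (u - v) K(u, v)\<close>, one has
\<open>\<psi>\<^sub>2\<^sub>,\<^sub>n\<^sup>2 K(|\<psi>\<^sub>n|\<^sup>2, \<psi>\<^sub>1\<^sub>,\<^sub>n\<^sup>2) = s\<^sub>n \<Delta>(\<lambda>\<^sub>n) - s\<^sub>n \<Delta>(\<nu>\<^sub>n) = (\<lambda>\<^sub>n - \<nu>\<^sub>n)\<^sup>2 R(\<nu>\<^sub>n)\<close> with analytic \<open>K, R > 0\<close>. The definition of the sign of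
\<open>\<psi>\<^sub>2\<^sub>,\<^sub>n\<close> turns this into \<open>\<psi>\<^sub>2\<^sub>,\<^sub>n \<surd>K = (\<lambda>\<^sub>n - \<nu>\<^sub>n) \<surd>R\<close>, which can be solved analytically both for \<open>\<psi>\<^sub>2\<^sub>,\<^sub>n\<close>
(\<open>psi2_formula\<close>) and for \<open>\<nu>\<^sub>n\<close> (\<open>ranalytic_inv_dirichlet\<close>).

Real analyticity is handled as the existence of a holomorphic extension to a complex neighbourhood; for such
functions, closure under composition and limits is immediate, and Osgood's lemma recovers the power series
(\<open>holo_power_series\<close>, \<open>real_analytic_funI\<close>).\<close>

section \<open>Holomorphic functions of several variables and real analyticity\<close>

text \<open>Holomorphy is tested on analytic discs: \<open>F\<close> is continuous and holomorphic along every map into \<open>U\<close> with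
holomorphic coordinates. This makes composition trivial and asks nothing about the index set of the coordinates,
so that parameters and unknowns can be adjoined freely. On polydiscs in finitely many variables
\<open>holo_power_series\<close> yields the power series expansion.\<close>

definition holo :: "('i \<Rightarrow> complex) set \<Rightarrow> (('i \<Rightarrow> complex) \<Rightarrow> complex) \<Rightarrow> bool" where
  "holo U F \<longleftrightarrow> continuous_on U F \<and>
     (\<forall>\<gamma> T. open T \<longrightarrow> (\<forall>i. (\<lambda>t. \<gamma> t i) holomorphic_on T) \<longrightarrow> \<gamma> ` T \<subseteq> U \<longrightarrow>
            (\<lambda>t. F (\<gamma> t)) holomorphic_on T)"

lemma holoI:
  assumes "continuous_on U F"
    and "\<And>\<gamma> T. \<lbrakk>open T; \<And>i. (\<lambda>t. \<gamma> t i) holomorphic_on T; \<And>t. t \<in> T \<Longrightarrow> \<gamma> t \<in> U\<rbrakk>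
          \<Longrightarrow> (\<lambda>t. F (\<gamma> t)) holomorphic_on T"
  shows "holo U F"
  using assms unfolding holo_def by blast

lemma holo_continuous: "holo U F \<Longrightarrow> continuous_on U F"
  by (simp add: holo_def)

lemma holo_disc:
  "\<lbrakk>holo U F; open T; \<And>i. (\<lambda>t. \<gamma> t i) holomorphic_on T; \<And>t. t \<in> T \<Longrightarrow> \<gamma> t \<in> U\<rbrakk>
    \<Longrightarrow> (\<lambda>t. F (\<gamma> t)) holomorphic_on T"
  unfolding holo_def by blast

lemma holo_subset: "holo U F \<Longrightarrow> V \<subseteq> U \<Longrightarrow> holo V F"
  unfolding holo_def by (meson continuous_on_subset subset_trans)

lemma holo_const [intro]: "holo U (\<lambda>z. c)"
  by (rule holoI) auto

lemma holo_coord [intro]: "holo U (\<lambda>z. z i)"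
  by (rule holoI) (auto intro: continuous_on_subset[OF continuous_on_product_coordinates])

lemma holo_add [intro]: "holo U F \<Longrightarrow> holo U G \<Longrightarrow> holo U (\<lambda>z. F z + G z)"
  by (rule holoI) (auto intro!: continuous_intros holomorphic_intros dest: holo_continuous holo_disc)

lemma holo_diff [intro]: "holo U F \<Longrightarrow> holo U G \<Longrightarrow> holo U (\<lambda>z. F z - G z)"
  by (rule holoI) (auto intro!: continuous_intros holomorphic_intros dest: holo_continuous holo_disc)

lemma holo_mult [intro]: "holo U F \<Longrightarrow> holo U G \<Longrightarrow> holo U (\<lambda>z. F z * G z)"
  by (rule holoI) (auto intro!: continuous_intros holomorphic_intros dest: holo_continuous holo_disc)

lemma holo_sum [intro]: "(\<And>k. k \<in> A \<Longrightarrow> holo U (F k)) \<Longrightarrow> holo U (\<lambda>z. \<Sum>k\<in>A. F k z)"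
  by (induction A rule: infinite_finite_induct) auto

lemma holo_compose:
  assumes G: "holo V G" and \<Phi>: "\<And>i. holo U (\<lambda>z. \<Phi> z i)" and sub: "\<And>z. z \<in> U \<Longrightarrow> \<Phi> z \<in> V"
  shows "holo U (\<lambda>z. G (\<Phi> z))"
proof (rule holoI)
  have "continuous_on U \<Phi>"
    by (rule continuous_on_coordinatewise_then_product) (rule holo_continuous[OF \<Phi>])
  then show "continuous_on U (\<lambda>z. G (\<Phi> z))"
    by (rule continuous_on_compose2[OF holo_continuous[OF G]]) (use sub in auto)
next
  fix \<gamma> T assume "open T" "\<And>i. (\<lambda>t. \<gamma> t i) holomorphic_on T" "\<And>t. t \<in> T \<Longrightarrow> \<gamma> t \<in> U"
  then show "(\<lambda>t. G (\<Phi> (\<gamma> t))) holomorphic_on T"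
    by (intro holo_disc[OF G, where \<gamma> = "\<lambda>t. \<Phi> (\<gamma> t)"] holo_disc[OF \<Phi>] sub) auto
qed

lemma holo_compose_holomorphic:
  assumes g: "g holomorphic_on A" and F: "holo U F" and sub: "\<And>z. z \<in> U \<Longrightarrow> F z \<in> A"
  shows "holo U (\<lambda>z. g (F z))"
proof (rule holoI)
  show "continuous_on U (\<lambda>z. g (F z))"
    by (rule continuous_on_compose2[OF holomorphic_on_imp_continuous_on[OF g] holo_continuous[OF F]])
       (use sub in auto)
next
  fix \<gamma> T assume T: "open T" "\<And>i. (\<lambda>t. \<gamma> t i) holomorphic_on T" "\<And>t. t \<in> T \<Longrightarrow> \<gamma> t \<in> U"
  have "(g \<circ> (\<lambda>t. F (\<gamma> t))) holomorphic_on T"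
    by (rule holomorphic_on_compose_gen[OF holo_disc[OF F T] g]) (use sub T(3) in auto)
  then show "(\<lambda>t. g (F (\<gamma> t))) holomorphic_on T" by (simp add: o_def)
qed

lemma holo_uniform_limit:
  assumes f: "\<And>n. holo U (f n)" and lim: "uniform_limit U f g sequentially"
  shows "holo U g"
proof (rule holoI)
  show "continuous_on U g"
    by (rule uniform_limit_theorem[OF _ lim]) (simp_all add: holo_continuous f)
next
  fix \<gamma> T assume T: "open T" "\<And>i. (\<lambda>t. \<gamma> t i) holomorphic_on T" "\<And>t. t \<in> T \<Longrightarrow> \<gamma> t \<in> U"
  have lim': "uniform_limit T (\<lambda>n t. f n (\<gamma> t)) (\<lambda>t. g (\<gamma> t)) sequentially"
    by (rule uniform_limit_compose'[OF lim]) (use T(3) in auto)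
  show "(\<lambda>t. g (\<gamma> t)) holomorphic_on T"
  proof (rule holomorphic_uniform_sequence[OF T(1)])
    show "(\<lambda>t. f n (\<gamma> t)) holomorphic_on T" for n by (rule holo_disc[OF f T])
    show "\<exists>d>0. cball x d \<subseteq> T \<and> uniform_limit (cball x d) (\<lambda>n t. f n (\<gamma> t)) (\<lambda>t. g (\<gamma> t)) sequentially"
      if "x \<in> T" for x
    proof -
      obtain d where "d > 0" "cball x d \<subseteq> T" using T(1) \<open>x \<in> T\<close> open_contains_cball by metis
      then show ?thesis using uniform_limit_on_subset[OF lim'] by blast
    qed
  qed
qed

lemma holo_suminf:
  assumes "\<And>n. holo U (f n)" and "\<And>n z. z \<in> U \<Longrightarrow> norm (f n z) \<le> M n" and "summable M"
  shows "holo U (\<lambda>z. \<Sum>n. f n z)"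
  by (rule holo_uniform_limit[where f = "\<lambda>n z. \<Sum>k<n. f k z"])
     (use assms in \<open>auto intro!: Weierstrass_m_test\<close>)

definition cplx :: "('i \<Rightarrow> real) \<Rightarrow> 'i \<Rightarrow> complex" where
  "cplx z = (\<lambda>i. of_real (z i))"

lemma cplx_apply [simp]: "cplx z i = of_real (z i)" by (simp add: cplx_def)

lemma continuous_on_cplx: "continuous_on S cplx"
  unfolding cplx_def
  by (intro continuous_on_coordinatewise_then_product continuous_on_of_real
            continuous_on_subset[OF continuous_on_product_coordinates]) auto

definition ranalytic :: "(('i \<Rightarrow> real) \<Rightarrow> real) \<Rightarrow> ('i \<Rightarrow> real) \<Rightarrow> bool" where
  "ranalytic f p \<longleftrightarrow> (\<exists>U F. open U \<and> cplx p \<in> U \<and> holo U F \<and>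
      (\<forall>z. cplx z \<in> U \<longrightarrow> F (cplx z) = of_real (f z)))"

lemma ranalyticI:
  "\<lbrakk>open U; cplx p \<in> U; holo U F; \<And>z. cplx z \<in> U \<Longrightarrow> F (cplx z) = of_real (f z)\<rbrakk> \<Longrightarrow> ranalytic f p"
  unfolding ranalytic_def by blast

lemma ranalyticE:
  assumes "ranalytic f p"
  obtains U F where "open U" "cplx p \<in> U" "holo U F" "\<And>z. cplx z \<in> U \<Longrightarrow> F (cplx z) = of_real (f z)"
  using assms unfolding ranalytic_def by blast

lemma open_holo_preimage: "open U \<Longrightarrow> holo U F \<Longrightarrow> open A \<Longrightarrow> open {z \<in> U. F z \<in> A}"
proof -
  assume "open U" "holo U F" "open A"
  then have "open (U \<inter> F -` A)" by (intro continuous_open_preimage holo_continuous)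
  also have "U \<inter> F -` A = {z \<in> U. F z \<in> A}" by auto
  finally show ?thesis .
qed

lemma eventually_cplx_nhds:
  assumes "open U" "cplx p \<in> U" shows "\<forall>\<^sub>F z in nhds p. cplx z \<in> U"
proof -
  have "open (cplx -` U)" using assms(1) continuous_on_cplx by (rule open_vimage)
  then show ?thesis unfolding eventually_nhds using assms(2)
    by (intro exI[of _ "cplx -` U"]) auto
qed

lemma continuous_on_Re_comp: "continuous_on S (\<lambda>z i. Re (z i))"
  by (intro continuous_on_coordinatewise_then_product continuous_on_Re
            continuous_on_subset[OF continuous_on_product_coordinates]) auto

lemma ranalytic_cong:
  assumes f: "ranalytic f p" and eq: "\<forall>\<^sub>F z in nhds p. f z = g z"
  shows "ranalytic g p"
proof -
  from f obtain U F where U: "open U" "cplx p \<in> U" "holo U F" "\<And>z. cplx z \<in> U \<Longrightarrow> F (cplx z) = of_real (f z)"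
    by (rule ranalyticE) blast
  from eq obtain W where W: "open W" "p \<in> W" "\<And>z. z \<in> W \<Longrightarrow> f z = g z"
    unfolding eventually_nhds by blast
  let ?V = "(\<lambda>z i. Re (z i)) -` W"
  have V: "open ?V" using W(1) continuous_on_Re_comp by (rule open_vimage)
  show ?thesis
  proof (rule ranalyticI[of "U \<inter> ?V" _ F])
    show "holo (U \<inter> ?V) F" using U(3) by (rule holo_subset) auto
  qed (use U V W in auto)
qed

text \<open>The filter is \<open>nhds p\<close> rather than \<open>at p\<close>, so that the conclusion also yields that a strict inequality
at \<open>p\<close> persists nearby, as in \<open>ranalytic_pos\<close>.\<close>

lemma ranalytic_tendsto:
  assumes "ranalytic f p" shows "(f \<longlongrightarrow> f p) (nhds p)"
proof -
  from assms obtain U F where U: "open U" "cplx p \<in> U" "holo U F" "\<And>z. cplx z \<in> U \<Longrightarrow> F (cplx z) = of_real (f z)"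
    by (rule ranalyticE) blast
  show ?thesis
  proof (rule topological_tendstoI)
    fix S :: "real set" assume S: "open S" "f p \<in> S"
    have "open (Re -` S)" using S(1) by (rule open_vimage) (intro continuous_intros)
    then have "open {z \<in> U. F z \<in> Re -` S}" by (rule open_holo_preimage[OF U(1,3)])
    then have "\<forall>\<^sub>F z in nhds p. cplx z \<in> {z \<in> U. F z \<in> Re -` S}"
      by (rule eventually_cplx_nhds) (use U S in auto)
    then show "\<forall>\<^sub>F z in nhds p. f z \<in> S" by eventually_elim (use U(4) in auto)
  qed
qed

lemma ranalytic_const [intro]: "ranalytic (\<lambda>z. c) p"
  by (rule ranalyticI[of UNIV _ "\<lambda>z. of_real c"]) (simp_all add: holo_const)

lemma ranalytic_coord [intro]: "ranalytic (\<lambda>z. z i) p"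
  by (rule ranalyticI[of UNIV _ "\<lambda>z. z i"]) (simp_all add: holo_coord)

lemma ranalytic_add [intro]:
  assumes "ranalytic f p" "ranalytic g p" shows "ranalytic (\<lambda>z. f z + g z) p"
proof -
  from assms(1) obtain U F where U: "open U" "cplx p \<in> U" "holo U F" "\<And>z. cplx z \<in> U \<Longrightarrow> F (cplx z) = of_real (f z)"
    by (rule ranalyticE) blast
  from assms(2) obtain V G where V: "open V" "cplx p \<in> V" "holo V G" "\<And>z. cplx z \<in> V \<Longrightarrow> G (cplx z) = of_real (g z)"
    by (rule ranalyticE) blast
  show ?thesis
    by (rule ranalyticI[of "U \<inter> V" _ "\<lambda>z. F z + G z"])
       (use U V in \<open>auto intro!: holo_add holo_subset[OF U(3)] holo_subset[OF V(3)]\<close>)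
qed

lemma ranalytic_mult [intro]:
  assumes "ranalytic f p" "ranalytic g p" shows "ranalytic (\<lambda>z. f z * g z) p"
proof -
  from assms(1) obtain U F where U: "open U" "cplx p \<in> U" "holo U F" "\<And>z. cplx z \<in> U \<Longrightarrow> F (cplx z) = of_real (f z)"
    by (rule ranalyticE) blast
  from assms(2) obtain V G where V: "open V" "cplx p \<in> V" "holo V G" "\<And>z. cplx z \<in> V \<Longrightarrow> G (cplx z) = of_real (g z)"
    by (rule ranalyticE) blast
  show ?thesis
    by (rule ranalyticI[of "U \<inter> V" _ "\<lambda>z. F z * G z"])
       (use U V in \<open>auto intro!: holo_mult holo_subset[OF U(3)] holo_subset[OF V(3)]\<close>)
qed

lemma ranalytic_compose_holomorphic:
  assumes f: "ranalytic f p" and A: "open A" "of_real (f p) \<in> A" and h: "h holomorphic_on A"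
    and eq: "\<And>x. of_real x \<in> A \<Longrightarrow> h (of_real x) = of_real (g x)"
  shows "ranalytic (\<lambda>z. g (f z)) p"
proof -
  from f obtain U F where U: "open U" "cplx p \<in> U" "holo U F" "\<And>z. cplx z \<in> U \<Longrightarrow> F (cplx z) = of_real (f z)"
    by (rule ranalyticE) blast
  show ?thesis
  proof (rule ranalyticI[of "{z \<in> U. F z \<in> A}" _ "\<lambda>z. h (F z)"])
    show "open {z \<in> U. F z \<in> A}" by (rule open_holo_preimage) (use U A in auto)
    show "holo {z \<in> U. F z \<in> A} (\<lambda>z. h (F z))"
      by (rule holo_compose_holomorphic[OF h holo_subset[OF U(3)]]) auto
  qed (use U A eq in auto)
qed

lemma ranalytic_uminus [intro]: "ranalytic f p \<Longrightarrow> ranalytic (\<lambda>z. - f z) p"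
  using ranalytic_mult[OF ranalytic_const[of "-1"], of f p] by simp

lemma ranalytic_diff [intro]: "ranalytic f p \<Longrightarrow> ranalytic g p \<Longrightarrow> ranalytic (\<lambda>z. f z - g z) p"
  using ranalytic_add[of f p "\<lambda>z. - g z"] ranalytic_uminus[of g p] by simp

lemma ranalytic_sum [intro]: "(\<And>k. k \<in> A \<Longrightarrow> ranalytic (f k) p) \<Longrightarrow> ranalytic (\<lambda>z. \<Sum>k\<in>A. f k z) p"
  by (induction A rule: infinite_finite_induct) auto

lemma ranalytic_power [intro]: "ranalytic f p \<Longrightarrow> ranalytic (\<lambda>z. f z ^ n) p"
  by (induction n) auto

lemma ranalytic_inverse [intro]:
  assumes "ranalytic f p" "f p \<noteq> 0" shows "ranalytic (\<lambda>z. inverse (f z)) p"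
  by (rule ranalytic_compose_holomorphic[OF assms(1), of "- {0}" inverse])
     (use assms in \<open>auto intro!: holomorphic_intros\<close>)

lemma ranalytic_divide [intro]:
  "ranalytic f p \<Longrightarrow> ranalytic g p \<Longrightarrow> g p \<noteq> 0 \<Longrightarrow> ranalytic (\<lambda>z. f z / g z) p"
  unfolding divide_inverse by auto

lemma ranalytic_exp [intro]: "ranalytic f p \<Longrightarrow> ranalytic (\<lambda>z. exp (f z)) p"
  by (rule ranalytic_compose_holomorphic[of _ _ UNIV exp]) (auto intro!: holomorphic_intros exp_of_real)

lemma ranalytic_ln [intro]:
  assumes "ranalytic f p" "f p > 0" shows "ranalytic (\<lambda>z. ln (f z)) p"
  by (rule ranalytic_compose_holomorphic[OF assms(1), of "{z. Re z > 0}" Ln])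
     (use assms in \<open>auto intro!: holomorphic_intros simp: open_halfspace_Re_gt Ln_of_real complex_nonpos_Reals_iff\<close>)

lemma ranalytic_sqrt [intro]:
  assumes "ranalytic f p" "f p > 0" shows "ranalytic (\<lambda>z. sqrt (f z)) p"
  by (rule ranalytic_compose_holomorphic[OF assms(1), of "{z. Re z > 0}" csqrt])
     (use assms in \<open>auto intro!: holomorphic_intros simp: open_halfspace_Re_gt csqrt_of_real_nonneg complex_nonpos_Reals_iff\<close>)

lemma ranalytic_pos: "ranalytic f p \<Longrightarrow> f p > a \<Longrightarrow> \<forall>\<^sub>F z in nhds p. f z > a"
  by (rule order_tendstoD(1)[OF ranalytic_tendsto])

lemma ranalytic_common:
  assumes "finite J" "\<And>j. j \<in> J \<Longrightarrow> ranalytic (f j) p"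
  shows "\<exists>U F. open U \<and> cplx p \<in> U \<and> (\<forall>j\<in>J. holo U (F j) \<and> (\<forall>z. cplx z \<in> U \<longrightarrow> F j (cplx z) = of_real (f j z)))"
proof -
  have "\<forall>j\<in>J. \<exists>U F. open U \<and> cplx p \<in> U \<and> holo U F \<and> (\<forall>z. cplx z \<in> U \<longrightarrow> F (cplx z) = of_real (f j z))"
    using assms(2) unfolding ranalytic_def by blast
  then obtain U F where UF: "\<forall>j\<in>J. open (U j) \<and> cplx p \<in> U j \<and> holo (U j) (F j) \<and>
      (\<forall>z. cplx z \<in> U j \<longrightarrow> F j (cplx z) = of_real (f j z))" by metis
  show ?thesis
    by (rule exI[of _ "\<Inter>j\<in>J. U j"], rule exI[of _ F])
       (use UF assms(1) in \<open>auto intro!: open_INT intro: holo_subset\<close>)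
qed

text \<open>Only finitely many coordinates of the inner map may vary: a neighbourhood on which all of them have
extensions is a finite intersection of neighbourhoods.\<close>

lemma ranalytic_compose:
  assumes J: "finite J" and f: "\<And>j. j \<in> J \<Longrightarrow> ranalytic (\<lambda>z. f z j) p"
    and c: "\<And>z j. j \<notin> J \<Longrightarrow> f z j = d j" and g: "ranalytic g (f p)"
  shows "ranalytic (\<lambda>z. g (f z)) p"
proof -
  obtain U F where U: "open U" "cplx p \<in> U" and F: "\<And>j. j \<in> J \<Longrightarrow> holo U (F j)"
     "\<And>j z. j \<in> J \<Longrightarrow> cplx z \<in> U \<Longrightarrow> F j (cplx z) = of_real (f z j)"
    using ranalytic_common[OF J, of "\<lambda>j z. f z j" p] f by blast
  from g obtain V G where V: "open V" "cplx (f p) \<in> V" "holo V G" "\<And>z. cplx z \<in> V \<Longrightarrow> G (cplx z) = of_real (g z)"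
    by (rule ranalyticE) blast
  define \<Phi> where "\<Phi> z j = (if j \<in> J then F j z else of_real (d j))" for z j
  have \<Phi>: "holo U (\<lambda>z. \<Phi> z j)" for j using F(1) by (cases "j \<in> J") (auto simp: \<Phi>_def)
  have \<Phi>c: "\<Phi> (cplx z) = cplx (f z)" if "cplx z \<in> U" for z
    using F(2) c that by (auto simp: \<Phi>_def fun_eq_iff)
  have "continuous_on U \<Phi>"
    by (rule continuous_on_coordinatewise_then_product) (rule holo_continuous[OF \<Phi>])
  then have op: "open (U \<inter> \<Phi> -` V)" using U(1) V(1) by (rule continuous_open_preimage)
  show ?thesis
  proof (rule ranalyticI[OF op, of _ "\<lambda>z. G (\<Phi> z)"])
    show "holo (U \<inter> \<Phi> -` V) (\<lambda>z. G (\<Phi> z))"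
      by (rule holo_compose[OF V(3)]) (auto intro: holo_subset[OF \<Phi>])
  qed (use U V \<Phi>c in auto)
qed

lemma ranalytic_reindex:
  fixes p :: "'i \<Rightarrow> real" and r :: "'j \<Rightarrow> 'i"
  assumes "ranalytic g (\<lambda>j. p (r j))"
  shows "ranalytic (\<lambda>z. g (\<lambda>j. z (r j))) p"
proof -
  from assms obtain V G where V: "open V" "cplx (\<lambda>j. p (r j)) \<in> V" "holo V G" "\<And>z. cplx z \<in> V \<Longrightarrow> G (cplx z) = of_real (g z)"
    by (rule ranalyticE) blast
  let ?r = "\<lambda>z::'i \<Rightarrow> complex. \<lambda>j. z (r j)"
  have "continuous_on UNIV ?r"
    by (rule continuous_on_coordinatewise_then_product) auto
  with V(1) have op: "open (?r -` V)" by (rule open_vimage)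
  have e: "?r (cplx z) = cplx (\<lambda>j. z (r j))" for z by auto
  show ?thesis
    by (rule ranalyticI[OF op, of _ "\<lambda>z. G (?r z)"])
       (use V e in \<open>auto intro!: holo_compose[OF V(3)] simp: vimage_def\<close>)
qed

section \<open>The analytic implicit function theorem\<close>

lemma open_fun_contains_box:
  fixes x0 :: "'j \<Rightarrow> 'a::metric_space"
  assumes "open B" "x0 \<in> B" "finite J"
  shows "\<exists>\<rho>>0. \<forall>x. (\<forall>j\<in>J. dist (x j) (x0 j) < \<rho>) \<longrightarrow> (\<forall>j. j \<notin> J \<longrightarrow> x j = x0 j) \<longrightarrow> x \<in> B"
proof -
  have "openin (product_topology (\<lambda>i. euclidean) UNIV) B" using assms(1) by (simp add: open_fun_def)
  from product_topology_open_contains_basis[OF this assms(2)]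
  obtain X where X: "x0 \<in> PiE UNIV X" "\<And>i. open (X i)" "PiE UNIV X \<subseteq> B" by auto
  have "\<forall>j. \<exists>e>0. ball (x0 j) e \<subseteq> X j" using X(1,2) by (auto simp: open_contains_ball)
  then obtain e where e: "\<And>j. e j > 0" "\<And>j. ball (x0 j) (e j) \<subseteq> X j" by metis
  define \<rho> where "\<rho> = Min (insert 1 (e ` J))"
  have pos: "\<rho> > 0" unfolding \<rho>_def using assms(3) e(1) by simp
  have le: "\<rho> \<le> e j" if "j \<in> J" for j unfolding \<rho>_def using assms(3) that by (intro Min_le) simp_all
  have "x \<in> B" if x: "\<forall>j\<in>J. dist (x j) (x0 j) < \<rho>" "\<forall>j. j \<notin> J \<longrightarrow> x j = x0 j" for x
  proof -
    have "x j \<in> X j" for j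
    proof (cases "j \<in> J")
      case True
      then have "x j \<in> ball (x0 j) (e j)" using x(1) le[OF True] by (simp add: dist_commute) (meson less_le_trans)
      then show ?thesis using e(2)[of j] by blast
    next
      case False
      then have "x j = x0 j" using x(2) by blast
      moreover have "x0 j \<in> X j" using X(1) by (simp add: PiE_iff)
      ultimately show ?thesis by simp
    qed
    then have "x \<in> PiE UNIV X" by (simp add: PiE_iff)
    then show ?thesis using X(3) by blast
  qed
  then show ?thesis using pos by (intro exI[of _ \<rho>] conjI allI impI)
qed

lemma holomorphic_fun_upd: "(\<lambda>t. (w(k := c + t)) i) holomorphic_on A"
proof (cases "i = k")
  case True
  then show ?thesis by simp (intro holomorphic_intros)
qed simp

text \<open>A partial derivative that vanishes at one point is small nearby: by Cauchy's inequality its change is controlled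
by the change of \<open>T\<close> on a small circle, and that is small by compactness of the circle.\<close>

lemma holo_small_partial:
  fixes T :: "('i \<Rightarrow> complex) \<Rightarrow> complex"
  assumes U: "open U" "w0 \<in> U" "holo U T" and e: "e > 0"
    and D0: "((\<lambda>t. T (w0(k := w0 k + t))) has_field_derivative 0) (at 0)"
  shows "\<exists>W. open W \<and> w0 \<in> W \<and> W \<subseteq> U \<and>
    (\<forall>w\<in>W. \<exists>d. ((\<lambda>t. T (w(k := t))) has_field_derivative d) (at (w k)) \<and> norm d \<le> e)"
proof -
  define \<Phi> where "\<Phi> = (\<lambda>(w::'i \<Rightarrow> complex, t). w(k := w k + t))"
  have c: "continuous_on A (\<lambda>p::('i \<Rightarrow> complex) \<times> complex. fst p i)" for A i
    by (rule continuous_on_product_then_coordinatewise) (rule continuous_on_fst[OF continuous_on_id])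
  have \<Phi>c: "continuous_on A \<Phi>" for A
  proof (rule continuous_on_coordinatewise_then_product)
    fix i show "continuous_on A (\<lambda>x. \<Phi> x i)"
      by (cases "i = k") (auto simp: \<Phi>_def split_beta intro!: continuous_intros c)
  qed
  have "open (\<Phi> -` U)" by (rule open_vimage[OF U(1) \<Phi>c])
  moreover have "(w0, 0) \<in> \<Phi> -` U" using U(2) by (simp add: \<Phi>_def)
  ultimately obtain A B where AB: "open A" "open B" "w0 \<in> A" "0 \<in> B" "A \<times> B \<subseteq> \<Phi> -` U"
    by (rule open_prod_elim) auto
  obtain s where s: "s > 0" "cball 0 s \<subseteq> B" using AB(2,4) open_contains_cball by blast
  have in_U: "w(k := w k + t) \<in> U" if "w \<in> A" "t \<in> cball 0 s" for w t
  proof -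
    have "(w, t) \<in> A \<times> B" using s(2) that by blast
    then have "(w, t) \<in> \<Phi> -` U" using AB(5) by blast
    then show ?thesis by (simp add: \<Phi>_def)
  qed
  have fc: "continuous_on (A \<times> cball 0 s) (\<lambda>p. T (\<Phi> p))"
    by (rule continuous_on_compose2[OF holo_continuous[OF U(3)] \<Phi>c]) (use in_U in \<open>auto simp: \<Phi>_def simp del: fun_upd_apply mem_cball\<close>)
  have es: "e * s > 0" using e s(1) by simp
  obtain X0 where X0: "w0 \<in> X0" "open X0"
    "\<forall>x\<in>X0 \<inter> A. \<forall>t \<in> cball 0 s. dist (T (\<Phi> (x, t))) (T (\<Phi> (w0, t))) \<le> e * s"
    by (rule continuous_on_prod_compactE[OF fc compact_cball AB(3) es]) (rule that)
  have hol: "(\<lambda>t. T (w(k := w k + t))) holomorphic_on ball 0 s" if "w \<in> A" for w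
    by (rule holo_disc[OF U(3)]) (use in_U that in \<open>auto intro: holomorphic_fun_upd simp del: fun_upd_apply\<close>)
  have cont: "continuous_on (cball 0 s) (\<lambda>t. T (w(k := w k + t)))" if "w \<in> A" for w
  proof -
    have "continuous_on (cball 0 s) (\<lambda>t. T (\<Phi> (w, t)))"
      by (rule continuous_on_compose2[OF fc]) (use that in \<open>auto intro!: continuous_intros\<close>)
    then show ?thesis by (simp add: \<Phi>_def)
  qed
  have "\<exists>d. ((\<lambda>t. T (w(k := t))) has_field_derivative d) (at (w k)) \<and> norm d \<le> e" if w: "w \<in> X0 \<inter> A" for w
  proof -
    let ?g = "\<lambda>t. T (w(k := w k + t))" and ?h = "\<lambda>t. T (w0(k := w0 k + t))"
    let ?d = "deriv ?g 0"
    have g: "(?g has_field_derivative ?d) (at 0)"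
      by (rule holomorphic_derivI[OF hol open_ball]) (use w s(1) in auto)
    have "((\<lambda>t. ?g t - ?h t) has_field_derivative ?d - 0) (at 0)"
      by (rule DERIV_diff[OF g D0])
    then have d: "deriv (\<lambda>t. ?g t - ?h t) 0 = ?d" by (simp add: DERIV_imp_deriv)
    have "norm ((deriv ^^ 1) (\<lambda>t. ?g t - ?h t) 0) \<le> fact 1 * (e * s) / s ^ 1"
    proof (rule Cauchy_inequality)
      show "(\<lambda>t. ?g t - ?h t) holomorphic_on ball 0 s" using w AB(3) by (intro holomorphic_on_diff hol) auto
      show "continuous_on (cball 0 s) (\<lambda>t. ?g t - ?h t)" using w AB(3) by (intro continuous_on_diff cont) auto
      show "norm (?g t - ?h t) \<le> e * s" if "norm (0 - t) = s" for t
        using X0(3) w that by (auto simp: \<Phi>_def dist_norm)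
    qed (use s in auto)
    then have "norm ?d \<le> e" using s(1) d by simp
    moreover have "((\<lambda>t. T (w(k := t))) has_field_derivative ?d) (at (w k))"
      using g DERIV_shift[of "\<lambda>t. T (w(k := t))" ?d 0 "w k"] by (simp add: add.commute)
    ultimately show ?thesis by blast
  qed
  then show ?thesis
    by (intro exI[of _ "X0 \<inter> A"]) (use X0 AB s in_U[of _ 0] in auto)
qed

text \<open>Picard iteration with parameters. As the partial derivatives of \<open>T\<close> in the unknowns vanish at the base point,
\<open>T\<close> is a contraction near it; the iterates are holomorphic in the parameters and converge uniformly, so the fixed
point is holomorphic as well. The last conclusion is what makes the fixed point of a real map real: the iteration
never leaves the reals. The unknowns outside the finite set \<open>J\<close> are held fixed.\<close>

lemma holo_fixed_point:
  fixes T :: "'j \<Rightarrow> ('i + 'j \<Rightarrow> complex) \<Rightarrow> complex"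
  assumes J: "finite J" and U: "open U" "case_sum z0 x0 \<in> U"
    and T: "\<And>j. j \<in> J \<Longrightarrow> holo U (T j)" and T0: "\<And>j. j \<in> J \<Longrightarrow> T j (case_sum z0 x0) = x0 j"
    and D0: "\<And>j k. j \<in> J \<Longrightarrow> k \<in> J \<Longrightarrow>
       ((\<lambda>t. T j (case_sum z0 (x0(k := x0 k + t)))) has_field_derivative 0) (at 0)"
  defines "near \<equiv> (\<lambda>\<rho> x. (\<forall>j\<in>J. norm (x j - x0 j) < \<rho>) \<and> (\<forall>j. j \<notin> J \<longrightarrow> x j = x0 j))"
  obtains W \<rho> X where "open W" "z0 \<in> W" "\<rho> > 0"
    "\<And>z x. z \<in> W \<Longrightarrow> near \<rho> x \<Longrightarrow> case_sum z x \<in> U"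
    "\<And>j. holo W (\<lambda>z. X z j)" "\<And>z. z \<in> W \<Longrightarrow> near \<rho> (X z)"
    "\<And>z j. z \<in> W \<Longrightarrow> j \<in> J \<Longrightarrow> T j (case_sum z (X z)) = X z j" "X z0 = x0"
    "\<And>z x. z \<in> W \<Longrightarrow> near \<rho> x \<Longrightarrow> \<forall>j\<in>J. T j (case_sum z x) = x j \<Longrightarrow> x = X z"
    "\<And>z. z \<in> W \<Longrightarrow> \<forall>j. x0 j \<in> \<real> \<Longrightarrow>
        \<forall>x. (\<forall>j. x j \<in> \<real>) \<longrightarrow> near \<rho> x \<longrightarrow> (\<forall>j\<in>J. T j (case_sum z x) \<in> \<real>) \<Longrightarrow> \<forall>j. X z j \<in> \<real>"
proof -
  let ?w0 = "case_sum z0 x0"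
  \<comment> \<open>Partial derivatives of modulus at most \<open>\<epsilon>\<close> give the Lipschitz
    constant \<open>card J \<cdot> \<epsilon> \<le> 1/2\<close> for the sum norm.\<close>
  define \<epsilon> where "\<epsilon> = 1 / (2 * (real (card J) + 1))"
  have \<epsilon>: "\<epsilon> > 0" "real (card J) * \<epsilon> \<le> 1/2" by (auto simp: \<epsilon>_def field_simps)
  have upd: "case_sum z (x(k := a)) = (case_sum z x)(Inr k := a)" for z :: "'i \<Rightarrow> complex" and x :: "'j \<Rightarrow> complex" and k a
    by (auto simp: fun_eq_iff split: sum.split)
  have "\<forall>j\<in>J. \<forall>k\<in>J. \<exists>W. open W \<and> ?w0 \<in> W \<and> W \<subseteq> U \<and>
     (\<forall>w\<in>W. \<exists>d. ((\<lambda>t. T j (w(Inr k := t))) has_field_derivative d) (at (w (Inr k))) \<and> norm d \<le> \<epsilon>)"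
  proof (intro ballI)
    fix j k assume jk: "j \<in> J" "k \<in> J"
    show "\<exists>W. open W \<and> ?w0 \<in> W \<and> W \<subseteq> U \<and>
     (\<forall>w\<in>W. \<exists>d. ((\<lambda>t. T j (w(Inr k := t))) has_field_derivative d) (at (w (Inr k))) \<and> norm d \<le> \<epsilon>)"
      by (rule holo_small_partial[OF U T[OF jk(1)] \<epsilon>(1)]) (use D0[OF jk] in \<open>simp add: upd\<close>)
  qed
  then obtain V where V: "\<And>j k. j \<in> J \<Longrightarrow> k \<in> J \<Longrightarrow> open (V j k) \<and> ?w0 \<in> V j k \<and> V j k \<subseteq> U \<and>
     (\<forall>w\<in>V j k. \<exists>d. ((\<lambda>t. T j (w(Inr k := t))) has_field_derivative d) (at (w (Inr k))) \<and> norm d \<le> \<epsilon>)"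
    by metis
  define V0 where "V0 = U \<inter> (\<Inter>j\<in>J. \<Inter>k\<in>J. V j k)"
  have V0: "open V0" "?w0 \<in> V0" "V0 \<subseteq> U" unfolding V0_def
    using U V J by (auto intro!: open_Int open_INT)
  define cs where "cs = (\<lambda>p::('i \<Rightarrow> complex) \<times> ('j \<Rightarrow> complex). case_sum (fst p) (snd p))"
  have csc: "continuous_on UNIV cs"
  proof (rule continuous_on_coordinatewise_then_product)
    fix i :: "'i + 'j" show "continuous_on UNIV (\<lambda>x. cs x i)"
      by (cases i)
         (simp_all add: cs_def, (rule continuous_on_product_then_coordinatewise,
           rule continuous_on_fst[OF continuous_on_id] continuous_on_snd[OF continuous_on_id])+)
  qed
  have "open (cs -` V0)" "(z0, x0) \<in> cs -` V0" using open_vimage[OF V0(1) csc] V0(2) by (auto simp: cs_def)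
  then obtain W1 B where W1: "open W1" "z0 \<in> W1" and B: "open B" "x0 \<in> B" and WB: "W1 \<times> B \<subseteq> cs -` V0"
    by (rule open_prod_elim) auto
  from open_fun_contains_box[OF B J] obtain \<rho> where "\<rho> > 0" and
      "\<forall>x. (\<forall>j\<in>J. dist (x j) (x0 j) < \<rho>) \<longrightarrow> (\<forall>j. j \<notin> J \<longrightarrow> x j = x0 j) \<longrightarrow> x \<in> B"
    by blast
  then have \<rho>: "\<rho> > 0" "\<And>x. near \<rho> x \<Longrightarrow> x \<in> B"
    by (simp_all add: near_def dist_norm)
  have inV: "case_sum z x \<in> V0" if "z \<in> W1" "near \<rho> x" for z x
    using WB that \<rho>(2) by (force simp: cs_def)
  define nd where "nd x y = (\<Sum>j\<in>J. norm (x j - y j))" for x y :: "'j \<Rightarrow> complex"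
  have nd_ge: "norm (x j - y j) \<le> nd x y" if "j \<in> J" for x y j
    unfolding nd_def using J that by (intro member_le_sum) auto
  have nd_tri: "nd x y \<le> nd x u + nd u y" for x y u
    unfolding nd_def sum.distrib[symmetric]
    by (intro sum_mono) (metis dist_norm dist_triangle)
  \<comment> \<open>Changing the coordinates one at a time stays within the box, so only partial derivatives
    matter.\<close>
  have partial: "norm (T j (case_sum z x) - T j (case_sum z y)) \<le> \<epsilon> * (\<Sum>k\<in>K. norm (x k - y k))"
    if "j \<in> J" "z \<in> W1" "finite K" "K \<subseteq> J" "near \<rho> x" "near \<rho> y" "\<forall>k. k \<notin> K \<longrightarrow> x k = y k" for j z K x y
    using that(3,4,5,6,7)
  proof (induction K arbitrary: x y rule: finite_induct)
    case empty
    then have "x = y" by auto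
    then have "case_sum z x = case_sum z y" by (rule arg_cong)
    then show ?case by simp
  next
    case (insert k K)
    let ?y = "y(k := x k)"
    have by': "near \<rho> (y(k := x k))" using insert.prems by (auto simp: near_def)
    have k: "k \<in> J" using insert.prems by auto
    have "norm (T j (case_sum z x) - T j (case_sum z ?y)) \<le> \<epsilon> * (\<Sum>i\<in>K. norm (x i - ?y i))"
    proof (rule insert.IH)
      show "\<forall>i. i \<notin> K \<longrightarrow> x i = ?y i" using insert.prems by auto
    qed (use insert.prems by' in \<open>simp_all del: fun_upd_apply\<close>)
    also have "(\<Sum>i\<in>K. norm (x i - ?y i)) = (\<Sum>i\<in>K. norm (x i - y i))"
      using insert.hyps by (intro sum.cong) auto
    finally have 1: "norm (T j (case_sum z x) - T j (case_sum z ?y)) \<le> \<epsilon> * (\<Sum>i\<in>K. norm (x i - y i))" .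
    let ?g = "\<lambda>t. T j (case_sum z (y(k := t)))"
    have bt: "near \<rho> (y(k := t))" if "t \<in> ball (x0 k) \<rho>" for t
      using insert.prems that k by (auto simp: near_def dist_norm norm_minus_commute)
    have "\<exists>d. (?g has_field_derivative d) (at t) \<and> norm d \<le> \<epsilon>" if "t \<in> ball (x0 k) \<rho>" for t
    proof -
      have "case_sum z (y(k := t)) \<in> V j k" using inV[OF \<open>z \<in> W1\<close> bt[OF that]] \<open>j \<in> J\<close> k by (auto simp: V0_def)
      then show ?thesis using V[OF \<open>j \<in> J\<close> k] by (fastforce simp: upd)
    qed
    then obtain g' where g': "\<And>t. t \<in> ball (x0 k) \<rho> \<Longrightarrow> (?g has_field_derivative g' t) (at t) \<and> norm (g' t) \<le> \<epsilon>"
      by metis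
    have "norm (?g (x k) - ?g (y k)) \<le> \<epsilon> * norm (x k - y k)"
      by (rule field_differentiable_bound[of "ball (x0 k) \<rho>" ?g g'])
         (use g' insert.prems k in \<open>auto simp: near_def dist_norm norm_minus_commute simp del: fun_upd_apply intro: has_field_derivative_at_within\<close>)
    then have 2: "norm (T j (case_sum z ?y) - T j (case_sum z y)) \<le> \<epsilon> * norm (x k - y k)" by simp
    have "norm (T j (case_sum z x) - T j (case_sum z y)) \<le> \<epsilon> * (\<Sum>i\<in>K. norm (x i - y i)) + \<epsilon> * norm (x k - y k)"
      using norm_diff_triangle_le[OF 1 2] .
    then show ?case using insert.hyps by (simp add: algebra_simps)
  qed
  have lip: "nd (\<lambda>j. T j (case_sum z x)) (\<lambda>j. T j (case_sum z y)) \<le> nd x y / 2"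
    if "z \<in> W1" "near \<rho> x" "near \<rho> y" for z x y
  proof -
    have "nd (\<lambda>j. T j (case_sum z x)) (\<lambda>j. T j (case_sum z y)) \<le> (\<Sum>j\<in>J. \<epsilon> * nd x y)"
      unfolding nd_def[of "\<lambda>j. T j (case_sum z x)"]
    proof (rule sum_mono)
      fix j assume "j \<in> J"
      show "norm (T j (case_sum z x) - T j (case_sum z y)) \<le> \<epsilon> * nd x y" unfolding nd_def
        by (rule partial) (use that \<open>j \<in> J\<close> J in \<open>auto simp: near_def\<close>)
    qed
    also have "\<dots> = (real (card J) * \<epsilon>) * nd x y" by simp
    also have "\<dots> \<le> 1/2 * nd x y" by (rule mult_right_mono[OF \<epsilon>(2)]) (auto simp: nd_def intro: sum_nonneg)
    finally show ?thesis by simp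
  qed
  \<comment> \<open>A first step shorter than \<open>\<rho>/4\<close> keeps all the iterates within distance
    \<open>\<rho>/2\<close> of \<open>x0\<close>.\<close>
  define W where "W = {z \<in> W1. (\<Sum>j\<in>J. norm (T j (case_sum z x0) - x0 j)) < \<rho> / 4}"
  have box0: "near \<rho> x0" using \<rho>(1) by (simp add: near_def)
  have contT: "continuous_on W1 (\<lambda>z. T j (case_sum z x0))" if "j \<in> J" for j
  proof (rule continuous_on_compose2[OF holo_continuous[OF T[OF that]]])
    show "continuous_on W1 (\<lambda>z. case_sum z x0)"
    proof (rule continuous_on_coordinatewise_then_product)
      fix i :: "'i + 'j" show "continuous_on W1 (\<lambda>z. case_sum z x0 i)"
        by (cases i) (auto intro: continuous_on_subset[OF continuous_on_product_coordinates])
    qed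
    show "(\<lambda>z. case_sum z x0) ` W1 \<subseteq> U" using inV box0 V0(3) by auto
  qed
  have "open (W1 \<inter> (\<lambda>z. \<Sum>j\<in>J. norm (T j (case_sum z x0) - x0 j)) -` {..<\<rho> / 4})"
    by (rule continuous_open_preimage[OF _ W1(1)]) (auto intro!: continuous_intros contT)
  moreover have "W1 \<inter> (\<lambda>z. \<Sum>j\<in>J. norm (T j (case_sum z x0) - x0 j)) -` {..<\<rho> / 4} = W"
    by (auto simp: W_def)
  ultimately have W: "open W" by simp
  have z0W: "z0 \<in> W" using W1(2) T0 \<rho>(1) by (simp add: W_def)
  have WW1: "z \<in> W1" if "z \<in> W" for z using that by (simp add: W_def)
  define st where "st z x = (\<lambda>j. if j \<in> J then T j (case_sum z x) else x0 j)" for z x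
  define it where "it z n = rec_nat x0 (\<lambda>_. st z) n" for z n
  have it0: "it z 0 = x0" for z by (simp add: it_def)
  have "it z (Suc n) = st z (it z n)" for z n by (simp add: it_def)
  then have itS: "it z (Suc n) = (\<lambda>j. if j \<in> J then T j (case_sum z (it z n)) else x0 j)" for z n
    unfolding st_def .
  have it_bd: "nd (it z n) x0 \<le> \<rho> / 2 * (1 - (1/2)^n) \<and> nd (it z (Suc n)) (it z n) \<le> \<rho> / 4 * (1/2)^n" if "z \<in> W" for z n
  proof -
    have bx: "near \<rho> x" if "nd x x0 \<le> \<rho> / 2 * (1 - (1/2)^m)" "\<forall>j. j \<notin> J \<longrightarrow> x j = x0 j" for x m
    proof -
      have "\<rho> / 2 * (1 - (1/2)^m) \<le> \<rho> / 2 * 1" using \<rho>(1) by (intro mult_left_mono) auto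
      then have "nd x x0 < \<rho>" using that(1) \<rho>(1) by linarith
      then show ?thesis unfolding near_def using that(2) nd_ge[of _ x x0] by (meson le_less_trans)
    qed
    have offJ: "\<forall>j. j \<notin> J \<longrightarrow> it z n j = x0 j" for n by (cases n) (auto simp: it0 itS)
    have nd_if: "nd (it z (Suc n)) (it z (Suc m)) = nd (\<lambda>j. T j (case_sum z (it z n))) (\<lambda>j. T j (case_sum z (it z m)))" for n m
      by (simp add: nd_def itS)
    show ?thesis
    proof (induction n)
      case 0
      have "nd (it z (Suc 0)) (it z 0) = (\<Sum>j\<in>J. norm (T j (case_sum z x0) - x0 j))"
        by (simp add: nd_def it0 itS)
      then show ?case using that by (simp add: nd_def it0 W_def)
    next
      case (Suc n)
      have "nd (it z (Suc n)) x0 \<le> nd (it z (Suc n)) (it z n) + nd (it z n) x0" by (rule nd_tri)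
      also have "\<dots> \<le> \<rho> / 4 * (1/2)^n + \<rho> / 2 * (1 - (1/2)^n)" using Suc by simp
      also have "\<dots> = \<rho> / 2 * (1 - (1/2)^(Suc n))" by (simp add: field_simps)
      finally have a: "nd (it z (Suc n)) x0 \<le> \<rho> / 2 * (1 - (1/2)^(Suc n))" .
      have "nd (it z (Suc (Suc n))) (it z (Suc n)) \<le> nd (it z (Suc n)) (it z n) / 2"
        unfolding nd_if[of "Suc n" n] by (rule lip[OF WW1[OF that] bx[OF a offJ] bx[OF _ offJ]]) (use Suc in blast)
      also have "\<dots> \<le> \<rho> / 4 * (1/2)^(Suc n)" using Suc by simp
      finally show ?case using a by blast
    qed
  qed
  have it_off: "it z n j = x0 j" if "j \<notin> J" for z n j using that by (cases n) (auto simp: it0 itS)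
  have it_box: "near \<rho> (it z n)" if "z \<in> W" for z n
  proof -
    have "\<rho> / 2 * (1 - (1/2)^n) \<le> \<rho> / 2 * 1" using \<rho>(1) by (intro mult_left_mono) auto
    then have "nd (it z n) x0 < \<rho>" using it_bd[OF that, of n] \<rho>(1) by linarith
    then show ?thesis unfolding near_def using it_off nd_ge[of _ "it z n" x0] by (meson le_less_trans)
  qed
  have it_holo: "holo W (\<lambda>z. it z n j)" for n j
  proof (induction n arbitrary: j)
    case 0 show ?case by (simp add: it0 holo_const)
  next
    case (Suc n)
    show ?case
    proof (cases "j \<in> J")
      case True
      have "holo W (\<lambda>z. T j (case_sum z (it z n)))"
      proof (rule holo_compose[OF T[OF True]])
        fix i :: "'i + 'j" show "holo W (\<lambda>z. case_sum z (it z n) i)"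
          by (cases i) (simp_all add: Suc holo_coord)
        show "case_sum z (it z n) \<in> U" if "z \<in> W" for z using inV[OF WW1[OF that] it_box[OF that]] V0(3) by auto
      qed
      then show ?thesis using True by (simp add: itS)
    qed (simp add: itS holo_const)
  qed
  define X where "X z j = x0 j + (\<Sum>n. it z (Suc n) j - it z n j)" for z j
  have step: "norm (it z (Suc n) j - it z n j) \<le> \<rho> / 4 * (1/2)^n" if "z \<in> W" for z n j
  proof (cases "j \<in> J")
    case True
    then show ?thesis using it_bd[OF that, of n] nd_ge[OF True, of "it z (Suc n)" "it z n"] by linarith
  next
    case False
    then show ?thesis using it_off[OF False] \<rho>(1) by simp
  qed
  have sm: "summable (\<lambda>n. \<rho> / 4 * (1/2)^n)" by (intro summable_mult summable_geometric) simp
  have X_holo: "holo W (\<lambda>z. X z j)" for j unfolding X_def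
    by (intro holo_add holo_const holo_suminf[OF _ _ sm] holo_diff it_holo step)
  have X_lim: "(\<lambda>n. it z n j) \<longlonglongrightarrow> X z j" if "z \<in> W" for z j
  proof -
    have "summable (\<lambda>n. it z (Suc n) j - it z n j)"
      by (rule summable_comparison_test'[OF sm]) (use step[OF that] in auto)
    then have "(\<lambda>n. \<Sum>k<n. it z (Suc k) j - it z k j) \<longlonglongrightarrow> (\<Sum>n. it z (Suc n) j - it z n j)"
      by (rule summable_LIMSEQ)
    then have "(\<lambda>n. x0 j + (\<Sum>k<n. it z (Suc k) j - it z k j)) \<longlonglongrightarrow> X z j"
      unfolding X_def by (intro tendsto_intros)
    moreover have "x0 j + (\<Sum>k<n. it z (Suc k) j - it z k j) = it z n j" for n
      by (subst sum_lessThan_telescope) (simp add: it0)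
    ultimately show ?thesis by simp
  qed
  have X_off: "X z j = x0 j" if "j \<notin> J" for z j using it_off[OF that] by (simp add: X_def)
  have X_box: "near \<rho> (X z)" if "z \<in> W" for z
  proof -
    have "norm (X z j - x0 j) \<le> \<rho> / 2" if "j \<in> J" for j
    proof (rule tendsto_upperbound)
      show "(\<lambda>n. norm (it z n j - x0 j)) \<longlonglongrightarrow> norm (X z j - x0 j)"
        by (intro tendsto_intros X_lim \<open>z \<in> W\<close>)
      have "norm (it z n j - x0 j) \<le> \<rho> / 2" for n
      proof -
        have "\<rho> / 2 * (1 - (1/2)^n) \<le> \<rho> / 2 * 1" using \<rho>(1) by (intro mult_left_mono) auto
        then show ?thesis using it_bd[OF \<open>z \<in> W\<close>, of n] nd_ge[OF \<open>j \<in> J\<close>, of "it z n" x0] by linarith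
      qed
      then show "\<forall>\<^sub>F n in sequentially. norm (it z n j - x0 j) \<le> \<rho> / 2" by simp
    qed simp
    then show ?thesis using \<rho>(1) X_off by (fastforce simp: near_def)
  qed
  have fixp: "T j (case_sum z (X z)) = X z j" if "z \<in> W" "j \<in> J" for z j
  proof -
    have "(\<lambda>n. nd (it z n) (X z) / 2) \<longlonglongrightarrow> (\<Sum>j\<in>J. norm (X z j - X z j)) / 2"
      unfolding nd_def by (intro tendsto_intros X_lim that) simp
    then have l0: "(\<lambda>n. nd (it z n) (X z) / 2) \<longlonglongrightarrow> 0" by simp
    have "norm (T j (case_sum z (it z n)) - T j (case_sum z (X z))) \<le> nd (it z n) (X z) / 2" for n
      using lip[OF WW1[OF that(1)] it_box[OF that(1), of n] X_box[OF that(1)]]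
        nd_ge[OF that(2), of "\<lambda>j. T j (case_sum z (it z n))" "\<lambda>j. T j (case_sum z (X z))"] by linarith
    then have "(\<lambda>n. T j (case_sum z (it z n)) - T j (case_sum z (X z))) \<longlonglongrightarrow> 0"
      by (intro Lim_null_comparison[OF always_eventually l0] allI)
    then have "(\<lambda>n. T j (case_sum z (it z n))) \<longlonglongrightarrow> T j (case_sum z (X z))" by (simp add: LIM_zero_iff)
    moreover have "(\<lambda>n. it z (Suc n) j) \<longlonglongrightarrow> X z j" by (rule LIMSEQ_Suc[OF X_lim[OF that(1)]])
    ultimately show ?thesis using that(2) by (auto simp: itS intro: LIMSEQ_unique)
  qed
  have uniq: "x = X z" if z: "z \<in> W" and x: "near \<rho> x" "\<And>j. j \<in> J \<Longrightarrow> T j (case_sum z x) = x j" for z x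
  proof -
    have "nd x (X z) \<le> nd x (X z) / 2"
      using lip[OF WW1[OF z] x(1) X_box[OF z]] x(2) fixp[OF z] by (simp add: nd_def)
    then have "nd x (X z) \<le> 0" by simp
    then have "x j = X z j" if "j \<in> J" for j using nd_ge[OF that, of x "X z"]
      by (metis eq_iff_diff_eq_0 norm_le_zero_iff order_trans)
    moreover have "x j = X z j" if "j \<notin> J" for j using that x(1) X_off by (simp add: near_def)
    ultimately show ?thesis by blast
  qed
  show ?thesis
  proof (rule that[of W \<rho> X])
    show "X z0 = x0" using uniq[OF z0W box0 T0] by simp
    show "\<forall>j. X z j \<in> \<real>" if z: "z \<in> W" and x0: "\<forall>j. x0 j \<in> \<real>"
      and TR: "\<forall>x. (\<forall>j. x j \<in> \<real>) \<longrightarrow> near \<rho> x \<longrightarrow> (\<forall>j\<in>J. T j (case_sum z x) \<in> \<real>)" for z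
    proof
      fix j
      have "\<forall>j. it z n j \<in> \<real>" for n
      proof (induction n)
        case (Suc n)
        then show ?case using TR it_box[OF z, of n] x0 by (auto simp: itS)
      qed (use x0 in \<open>simp add: it0\<close>)
      then show "X z j \<in> \<real>"
        by (intro closed_sequentially[OF closed_complex_Reals _ X_lim[OF z]]) auto
    qed
  qed (use W z0W \<rho> inV V0(3) WW1 X_holo X_box fixp uniq in auto)
qed

text \<open>Lets hypotheses on real derivatives be used for the holomorphic extension.\<close>

lemma complex_derivative_of_real_extension:
  assumes h: "(h has_field_derivative d) (at (of_real x))" and g: "(g has_field_derivative a) (at x)"
    and S: "open S" "x \<in> S" "\<And>t. t \<in> S \<Longrightarrow> h (of_real t) = of_real (g t)"
  shows "d = complex_of_real a"
proof -
  have "((\<lambda>t. h (of_real t)) has_vector_derivative d) (at x)"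
    by (rule has_vector_derivative_real_field[OF h])
  then have "((\<lambda>t. complex_of_real (g t)) has_vector_derivative d) (at x)"
    by (rule has_vector_derivative_transform_within_open[OF _ S])
  moreover have "((\<lambda>t. complex_of_real (g t)) has_vector_derivative of_real a) (at x)"
    by (rule has_vector_derivative_of_real[OF g])
  ultimately show ?thesis by (rule vector_derivative_unique_at)
qed

lemma cplx_case_sum: "cplx (case_sum z x) = case_sum (cplx z) (cplx x)"
  by (auto simp: fun_eq_iff split: sum.split)

lemma continuous_on_fun_upd_add:
  fixes w :: "'i \<Rightarrow> 'a::real_normed_vector"
  shows "continuous_on A (\<lambda>t. w(k := w k + t))"
proof (rule continuous_on_coordinatewise_then_product)
  fix i show "continuous_on A (\<lambda>t. (w(k := w k + t)) i)"
    by (cases "i = k") (auto intro!: continuous_intros)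
qed

text \<open>The equations are solved by the fixed point of \<open>x - B E(z, x)\<close>, where the matrix \<open>B\<close> inverts the Jacobian \<open>A\<close> at
the base point. Both products of \<open>A\<close> and \<open>B\<close> are assumed to be the identity, as the proof uses \<open>B A = 1\<close> to make the
derivative of the iteration vanish and \<open>A B = 1\<close> to return from the fixed point to the equations.\<close>

theorem ranalytic_implicit_function:
  fixes E :: "'j \<Rightarrow> ('i + 'j \<Rightarrow> real) \<Rightarrow> real"
  assumes J: "finite J" and E: "\<And>j. j \<in> J \<Longrightarrow> ranalytic (E j) (case_sum z0 x0)"
    and E0: "\<And>j. j \<in> J \<Longrightarrow> E j (case_sum z0 x0) = 0"
    and A: "\<And>j k. j \<in> J \<Longrightarrow> k \<in> J \<Longrightarrow>
       ((\<lambda>t. E j (case_sum z0 (x0(k := x0 k + t)))) has_field_derivative A j k) (at 0)"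
    and BA: "\<And>j k. j \<in> J \<Longrightarrow> k \<in> J \<Longrightarrow> (\<Sum>l\<in>J. B j l * A l k) = (if j = k then 1 else 0)"
    and AB: "\<And>j k. j \<in> J \<Longrightarrow> k \<in> J \<Longrightarrow> (\<Sum>l\<in>J. A j l * B l k) = (if j = k then 1 else 0)"
  obtains X \<rho> where "\<And>j. ranalytic (\<lambda>z. X z j) z0" "X z0 = x0" "\<And>z j. j \<notin> J \<Longrightarrow> X z j = x0 j"
    "\<forall>\<^sub>F z in nhds z0. \<forall>j\<in>J. E j (case_sum z (X z)) = 0" "\<rho> > 0"
    "\<forall>\<^sub>F z in nhds z0. \<forall>x. (\<forall>j\<in>J. \<bar>x j - x0 j\<bar> < \<rho>) \<longrightarrow> (\<forall>j. j \<notin> J \<longrightarrow> x j = x0 j) \<longrightarrow>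
       (\<forall>j\<in>J. E j (case_sum z x) = 0) \<longrightarrow> x = X z"
proof -
  obtain U F where U: "open U" "cplx (case_sum z0 x0) \<in> U"
    and F: "\<And>j. j \<in> J \<Longrightarrow> holo U (F j)"
      "\<And>j w. j \<in> J \<Longrightarrow> cplx w \<in> U \<Longrightarrow> F j (cplx w) = of_real (E j w)"
    using ranalytic_common[OF J, of E "case_sum z0 x0"] E by blast
  \<comment> \<open>Newton's method with the inverse Jacobian frozen at the base point.\<close>
  define T where "T j w = w (Inr j) - (\<Sum>l\<in>J. of_real (B j l) * F l w)" for j w
  have upd: "case_sum z (x(k := a)) = (case_sum z x)(Inr k := a)" for z :: "'i \<Rightarrow> complex" and x :: "'j \<Rightarrow> complex" and k a
    by (auto simp: fun_eq_iff split: sum.split)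
  have dF: "((\<lambda>t. F l (case_sum (cplx z0) ((cplx x0)(k := cplx x0 k + t)))) has_field_derivative of_real (A l k)) (at 0)"
    if lk: "l \<in> J" "k \<in> J" for l k
  proof -
    let ?w0 = "cplx (case_sum z0 x0)"
    let ?h = "\<lambda>t. F l (?w0(Inr k := ?w0 (Inr k) + t))"
    have "open ((\<lambda>t. ?w0(Inr k := ?w0 (Inr k) + t)) -` U)" (is "open ?S")
      by (rule open_vimage[OF U(1) continuous_on_fun_upd_add])
    moreover have "0 \<in> ?S" using U(2) by (simp del: cplx_apply)
    ultimately obtain s where s: "s > 0" "ball 0 s \<subseteq> ?S" by (rule openE)
    have "?h holomorphic_on ball 0 s"
      by (rule holo_disc[OF F(1)[OF lk(1)]]) (use s in \<open>auto intro: holomorphic_fun_upd simp del: fun_upd_apply cplx_apply\<close>)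
    then have h: "(?h has_field_derivative deriv ?h 0) (at 0)"
      by (rule holomorphic_derivI) (use s in auto)
    have "deriv ?h 0 = of_real (A l k)"
    proof (rule complex_derivative_of_real_extension)
      show "(?h has_field_derivative deriv ?h 0) (at (of_real 0))" using h by simp
      show "((\<lambda>t. E l (case_sum z0 (x0(k := x0 k + t)))) has_field_derivative A l k) (at 0)" by (rule A[OF lk])
      show "?h (of_real t) = of_real (E l (case_sum z0 (x0(k := x0 k + t))))" if "t \<in> ball 0 s" for t
      proof -
        have e: "?w0(Inr k := ?w0 (Inr k) + of_real t) = cplx (case_sum z0 (x0(k := x0 k + t)))"
          by (auto simp: fun_eq_iff split: sum.split)
        have "of_real t \<in> ball (0::complex) s" using that by simp
        then have "?w0(Inr k := ?w0 (Inr k) + of_real t) \<in> U" using s(2) by blast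
        then show ?thesis unfolding e by (rule F(2)[OF lk(1)])
      qed
    qed (use s in auto)
    then show ?thesis using h by (simp add: upd cplx_case_sum)
  qed
  obtain W \<rho> X where W: "open W" "cplx z0 \<in> W" and \<rho>: "\<rho> > 0"
    and inU: "\<And>z x. z \<in> W \<Longrightarrow> (\<forall>j\<in>J. norm (x j - cplx x0 j) < \<rho>) \<and> (\<forall>j. j \<notin> J \<longrightarrow> x j = cplx x0 j) \<Longrightarrow> case_sum z x \<in> U"
    and X: "\<And>j. holo W (\<lambda>z. X z j)"
     "\<And>z. z \<in> W \<Longrightarrow> (\<forall>j\<in>J. norm (X z j - cplx x0 j) < \<rho>) \<and> (\<forall>j. j \<notin> J \<longrightarrow> X z j = cplx x0 j)"
    and fixp: "\<And>z j. z \<in> W \<Longrightarrow> j \<in> J \<Longrightarrow> T j (case_sum z (X z)) = X z j" and X0: "X (cplx z0) = cplx x0"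
    and uniq: "\<And>z x. z \<in> W \<Longrightarrow> (\<forall>j\<in>J. norm (x j - cplx x0 j) < \<rho>) \<and> (\<forall>j. j \<notin> J \<longrightarrow> x j = cplx x0 j) \<Longrightarrow>
        \<forall>j\<in>J. T j (case_sum z x) = x j \<Longrightarrow> x = X z"
    and real: "\<And>z. z \<in> W \<Longrightarrow> \<forall>j. cplx x0 j \<in> \<real> \<Longrightarrow>
        \<forall>x. (\<forall>j. x j \<in> \<real>) \<longrightarrow> (\<forall>j\<in>J. norm (x j - cplx x0 j) < \<rho>) \<and> (\<forall>j. j \<notin> J \<longrightarrow> x j = cplx x0 j) \<longrightarrow>
           (\<forall>j\<in>J. T j (case_sum z x) \<in> \<real>) \<Longrightarrow> \<forall>j. X z j \<in> \<real>"
  proof (rule holo_fixed_point[OF J U(1), of "cplx z0" "cplx x0" T])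
    show "case_sum (cplx z0) (cplx x0) \<in> U" using U(2) by (simp add: cplx_case_sum)
    show "holo U (T j)" if "j \<in> J" for j unfolding T_def
      by (intro holo_diff holo_coord holo_sum holo_mult holo_const F)
    show "T j (case_sum (cplx z0) (cplx x0)) = cplx x0 j" if "j \<in> J" for j
      using U(2) by (simp add: T_def F(2) E0 flip: cplx_case_sum)
    show "((\<lambda>t. T j (case_sum (cplx z0) ((cplx x0)(k := cplx x0 k + t)))) has_field_derivative 0) (at 0)"
      if jk: "j \<in> J" "k \<in> J" for j k
    proof -
      have "((\<lambda>t. (cplx x0 j + (if j = k then t else 0))
          - (\<Sum>l\<in>J. of_real (B j l) * F l (case_sum (cplx z0) ((cplx x0)(k := cplx x0 k + t)))))
        has_field_derivative ((if j = k then 1 else 0) - (\<Sum>l\<in>J. of_real (B j l) * of_real (A l k)))) (at 0)"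
        by (intro DERIV_diff DERIV_sum DERIV_cmult dF jk) (auto intro!: derivative_eq_intros)
      moreover have "(if j = k then 1 else 0) - (\<Sum>l\<in>J. complex_of_real (B j l) * of_real (A l k)) = 0"
        using arg_cong[OF BA[OF jk], of complex_of_real] by simp
      moreover have "(\<lambda>t. T j (case_sum (cplx z0) ((cplx x0)(k := cplx x0 k + t)))) = (\<lambda>t. (cplx x0 j + (if j = k then t else 0))
          - (\<Sum>l\<in>J. of_real (B j l) * F l (case_sum (cplx z0) ((cplx x0)(k := cplx x0 k + t)))))"
        by (simp add: T_def fun_eq_iff)
      ultimately show ?thesis by (simp only:)
    qed
  next
    fix W \<rho> X assume "open W" "cplx z0 \<in> W" "\<rho> > 0"
     "\<And>z x. z \<in> W \<Longrightarrow> (\<forall>j\<in>J. norm (x j - cplx x0 j) < \<rho>) \<and> (\<forall>j. j \<notin> J \<longrightarrow> x j = cplx x0 j) \<Longrightarrow> case_sum z x \<in> U"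
     "\<And>j. holo W (\<lambda>z. X z j)"
     "\<And>z. z \<in> W \<Longrightarrow> (\<forall>j\<in>J. norm (X z j - cplx x0 j) < \<rho>) \<and> (\<forall>j. j \<notin> J \<longrightarrow> X z j = cplx x0 j)"
     "\<And>z j. z \<in> W \<Longrightarrow> j \<in> J \<Longrightarrow> T j (case_sum z (X z)) = X z j" "X (cplx z0) = cplx x0"
     "\<And>z x. z \<in> W \<Longrightarrow> (\<forall>j\<in>J. norm (x j - cplx x0 j) < \<rho>) \<and> (\<forall>j. j \<notin> J \<longrightarrow> x j = cplx x0 j) \<Longrightarrow>
        \<forall>j\<in>J. T j (case_sum z x) = x j \<Longrightarrow> x = X z"
     "\<And>z. z \<in> W \<Longrightarrow> \<forall>j. cplx x0 j \<in> \<real> \<Longrightarrow>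
        \<forall>x. (\<forall>j. x j \<in> \<real>) \<longrightarrow> (\<forall>j\<in>J. norm (x j - cplx x0 j) < \<rho>) \<and> (\<forall>j. j \<notin> J \<longrightarrow> x j = cplx x0 j) \<longrightarrow>
           (\<forall>j\<in>J. T j (case_sum z x) \<in> \<real>) \<Longrightarrow> \<forall>j. X z j \<in> \<real>"
    then show thesis by (rule that)
  qed
  define Y where "Y z j = Re (X (cplx z) j)" for z j
  have XR: "X (cplx z) = cplx (Y z)" if z: "cplx z \<in> W" for z
  proof -
    have "\<forall>j. X (cplx z) j \<in> \<real>"
    proof (rule real[OF z], simp, intro allI impI ballI)
      fix x j assume x: "\<forall>j. x j \<in> \<real>" and b: "(\<forall>j\<in>J. norm (x j - cplx x0 j) < \<rho>) \<and> (\<forall>j. j \<notin> J \<longrightarrow> x j = cplx x0 j)" and j: "j \<in> J"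
      have "x = cplx (\<lambda>j. Re (x j))" using x by (auto simp: fun_eq_iff complex_is_Real_iff complex_eq_iff)
      then have e: "case_sum (cplx z) x = cplx (case_sum z (\<lambda>j. Re (x j)))" by (simp add: cplx_case_sum)
      show "T j (case_sum (cplx z) x) \<in> \<real>"
        using inU[OF z b] x unfolding e T_def by (intro Reals_diff sum_in_Reals Reals_mult) (simp_all add: F(2))
    qed
    then show ?thesis by (auto simp: Y_def fun_eq_iff complex_is_Real_iff complex_eq_iff)
  qed
  have evW: "\<forall>\<^sub>F z in nhds z0. cplx z \<in> W" by (rule eventually_cplx_nhds[OF W])
  have X_off: "Y z j = x0 j" if "j \<notin> J" "cplx z \<in> W" for z j using X(2)[OF that(2)] that(1) by (auto simp: Y_def)
  have inU': "cplx (case_sum z x) \<in> U"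
    if z: "cplx z \<in> W" and x: "\<forall>j\<in>J. \<bar>x j - x0 j\<bar> < \<rho>" "\<forall>j. j \<notin> J \<longrightarrow> x j = x0 j" for z x
    unfolding cplx_case_sum by (rule inU[OF z]) (use x in \<open>simp flip: of_real_diff\<close>)
  have T_real: "T j (cplx (case_sum z x)) = of_real (x j - (\<Sum>l\<in>J. B j l * E l (case_sum z x)))"
    if "cplx (case_sum z x) \<in> U" for j z x
    using that by (simp add: T_def F(2))
  define Y' where "Y' z j = (if j \<in> J then Y z j else x0 j)" for z j
  have Y': "Y' z = Y z" if "cplx z \<in> W" for z using X_off that by (auto simp: Y'_def fun_eq_iff)
  show ?thesis
  proof (rule that[of Y' \<rho>])
    show "ranalytic (\<lambda>z. Y' z j) z0" for j
    proof (cases "j \<in> J")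
      case True
      then show ?thesis using XR by (intro ranalyticI[OF W X(1)[of j]]) (simp add: Y'_def)
    qed (simp add: Y'_def ranalytic_const)
    show "Y' z0 = x0" using X0 XR[OF W(2)] Y'[OF W(2)] by (auto simp: fun_eq_iff)
    show "\<forall>\<^sub>F z in nhds z0. \<forall>j\<in>J. E j (case_sum z (Y' z)) = 0"
      using evW
    proof eventually_elim
      case (elim z)
      have YY: "\<forall>j\<in>J. \<bar>Y z j - x0 j\<bar> < \<rho>" "\<forall>j. j \<notin> J \<longrightarrow> Y z j = x0 j"
        using X(2)[OF elim] unfolding XR[OF elim] by (simp_all flip: of_real_diff)
      have "of_real (Y z j - (\<Sum>l\<in>J. B j l * E l (case_sum z (Y z)))) = complex_of_real (Y z j)" if "j \<in> J" for j
        using T_real[OF inU'[OF elim YY], of j] fixp[OF elim that] unfolding XR[OF elim] by (simp add: cplx_case_sum)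
      then have "Y z j - (\<Sum>l\<in>J. B j l * E l (case_sum z (Y z))) = Y z j" if "j \<in> J" for j
        using that by (simp only: of_real_eq_iff)
      then have BE: "(\<Sum>l\<in>J. B j l * E l (case_sum z (Y z))) = 0" if "j \<in> J" for j using that by fastforce
      show ?case unfolding Y'[OF elim]
      proof
        fix i assume i: "i \<in> J"
        have "0 = (\<Sum>j\<in>J. A i j * (\<Sum>l\<in>J. B j l * E l (case_sum z (Y z))))" using BE by simp
        also have "\<dots> = (\<Sum>j\<in>J. \<Sum>l\<in>J. A i j * B j l * E l (case_sum z (Y z)))"
          by (simp add: sum_distrib_left mult.assoc)
        also have "\<dots> = (\<Sum>l\<in>J. \<Sum>j\<in>J. A i j * B j l * E l (case_sum z (Y z)))" by (rule sum.swap)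
        also have "\<dots> = (\<Sum>l\<in>J. (if i = l then 1 else 0) * E l (case_sum z (Y z)))"
          using AB i by (intro sum.cong refl) (simp flip: sum_distrib_right)
        also have "\<dots> = E i (case_sum z (Y z))" using i J by (simp add: if_distrib[of "\<lambda>c. c * _"] sum.delta cong: if_cong)
        finally show "E i (case_sum z (Y z)) = 0" by simp
      qed
    qed
    show "\<forall>\<^sub>F z in nhds z0. \<forall>x. (\<forall>j\<in>J. \<bar>x j - x0 j\<bar> < \<rho>) \<longrightarrow> (\<forall>j. j \<notin> J \<longrightarrow> x j = x0 j) \<longrightarrow>
       (\<forall>j\<in>J. E j (case_sum z x) = 0) \<longrightarrow> x = Y' z"
      using evW
    proof eventually_elim
      case (elim z)
      show ?case
      proof (intro allI impI)
        fix x assume x: "\<forall>j\<in>J. \<bar>x j - x0 j\<bar> < \<rho>" "\<forall>j. j \<notin> J \<longrightarrow> x j = x0 j" and Ex: "\<forall>j\<in>J. E j (case_sum z x) = 0"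
        have "cplx x = X (cplx z)"
        proof (rule uniq[OF elim])
          show "\<forall>j\<in>J. T j (case_sum (cplx z) (cplx x)) = cplx x j"
            using T_real[OF inU'[OF elim x]] Ex by (simp add: cplx_case_sum)
        qed (use x in \<open>simp flip: of_real_diff\<close>)
        then show "x = Y' z" unfolding XR[OF elim] Y'[OF elim] by (auto simp: fun_eq_iff)
      qed
    qed
  qed (use \<rho> in \<open>auto simp: Y'_def\<close>)
qed

section \<open>Power series expansions\<close>

lemma multi_indices_empty: "multi_indices {} = {\<lambda>_. 0}"
  by (auto simp: multi_indices_def)

lemma bij_betw_multi_indices_insert:
  assumes "j \<notin> I"
  shows "bij_betw (\<lambda>(k, \<alpha>). \<alpha>(j := k)) (UNIV \<times> multi_indices I) (multi_indices (insert j I))"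
proof (rule bij_betw_byWitness[where f' = "\<lambda>\<alpha>. (\<alpha> j, \<alpha>(j := 0))"])
  have 0: "\<alpha> j = 0" if "\<alpha> \<in> multi_indices I" for \<alpha> using that assms by (simp add: multi_indices_def)
  show "\<forall>a\<in>UNIV \<times> multi_indices I. (\<lambda>\<alpha>. (\<alpha> j, \<alpha>(j := 0))) ((\<lambda>(k, \<alpha>). \<alpha>(j := k)) a) = a"
    using 0 by (auto simp: fun_eq_iff)
qed (auto simp: multi_indices_def fun_eq_iff)

lemma prod_fun_upd_index:
  assumes "finite I" "j \<notin> I"
  shows "(\<Prod>i\<in>insert j I. y i ^ (\<alpha>(j := k)) i) = y j ^ k * (\<Prod>i\<in>I. y i ^ \<alpha> i)"
proof -
  have "(\<Prod>i\<in>I. y i ^ (\<alpha>(j := k)) i) = (\<Prod>i\<in>I. y i ^ \<alpha> i)"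
    using assms by (intro prod.cong) auto
  then show ?thesis using assms by simp
qed

text \<open>The multivariate geometric series, the majorant of all power series below.\<close>

lemma summable_on_multi_geometric:
  fixes q :: "'i \<Rightarrow> real"
  assumes "finite I" "\<And>i. i \<in> I \<Longrightarrow> 0 \<le> q i \<and> q i < 1"
  shows "(\<lambda>\<alpha>. \<Prod>i\<in>I. q i ^ \<alpha> i) summable_on multi_indices I"
  using assms
proof (induction I rule: finite_induct)
  case empty
  show ?case by (simp add: multi_indices_empty)
next
  case (insert j I)
  have IH: "(\<lambda>\<alpha>. \<Prod>i\<in>I. q i ^ \<alpha> i) summable_on multi_indices I" using insert by auto
  obtain s where s: "((\<lambda>\<alpha>. \<Prod>i\<in>I. q i ^ \<alpha> i) has_sum s) (multi_indices I)"
    using IH by (auto simp: summable_on_def)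
  have qj: "0 \<le> q j" "q j < 1" using insert.prems by auto
  have "summable (\<lambda>k. norm (q j ^ k * s))"
    using qj summable_mult2[OF summable_geometric[of "q j"], of "\<bar>s\<bar>"] by (simp add: abs_mult power_abs)
  then have g: "(\<lambda>k. q j ^ k * s) summable_on UNIV" by (rule norm_summable_imp_summable_on)
  have "(\<lambda>(k, \<alpha>). q j ^ k * (\<Prod>i\<in>I. q i ^ \<alpha> i)) summable_on UNIV \<times> multi_indices I"
  proof (rule summable_on_SigmaI[OF _ g])
    show "((\<lambda>\<alpha>. case (k, \<alpha>) of (k, \<alpha>) \<Rightarrow> q j ^ k * (\<Prod>i\<in>I. q i ^ \<alpha> i)) has_sum q j ^ k * s) (multi_indices I)" for k
      using has_sum_cmult_right[OF s] by simp
    show "0 \<le> (case (k, \<alpha>) of (k, \<alpha>) \<Rightarrow> q j ^ k * (\<Prod>i\<in>I. q i ^ \<alpha> i))" for k \<alpha>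
      using insert.prems by (auto intro!: mult_nonneg_nonneg prod_nonneg)
  qed
  then have "(\<lambda>x. (\<lambda>\<beta>. \<Prod>i\<in>insert j I. q i ^ \<beta> i) ((\<lambda>(k, \<alpha>). \<alpha>(j := k)) x)) summable_on UNIV \<times> multi_indices I"
    by (simp only: prod_fun_upd_index[OF insert.hyps] case_prod_unfold)
  then show ?case
    using summable_on_reindex_bij_betw[OF bij_betw_multi_indices_insert[OF insert.hyps(2)]] by blast
qed

text \<open>The coordinates outside \<open>I\<close> are frozen at those of the centre.\<close>

definition polydisc :: "('i \<Rightarrow> complex) \<Rightarrow> real \<Rightarrow> 'i set \<Rightarrow> ('i \<Rightarrow> complex) set" where
  "polydisc p r I = {z. (\<forall>i\<in>I. norm (z i - p i) < r) \<and> (\<forall>i. i \<notin> I \<longrightarrow> z i = p i)}"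

text \<open>Osgood's lemma, by induction on the number of variables: expand in the variable \<open>j\<close> by the one-dimensional Taylor
theorem; the coefficients are again holomorphic in the other variables, since the \<open>k\<close>-th one is the
uniform limit of the \<open>k\<close>-th Taylor remainder divided by \<open>\<zeta>\<^sup>k\<close> as \<open>\<zeta>\<close> tends to \<open>0\<close>, and are bounded by \<open>M / r\<^sup>k\<close> by Cauchy's inequality. The Cauchy estimates are part of the induction
because they give the absolute convergence of the double series.\<close>

theorem holo_power_series:
  fixes p :: "'i \<Rightarrow> complex"
  assumes "finite I" and r: "r > 0"
    and "holo (polydisc p r I) F" "\<And>z. z \<in> polydisc p r I \<Longrightarrow> norm (F z) \<le> M"
  shows "\<exists>c. (\<forall>\<alpha>\<in>multi_indices I. norm (c \<alpha>) * r ^ (\<Sum>i\<in>I. \<alpha> i) \<le> M) \<and>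
     (\<forall>z\<in>polydisc p r I. ((\<lambda>\<alpha>. c \<alpha> * (\<Prod>i\<in>I. (z i - p i) ^ \<alpha> i)) has_sum F z) (multi_indices I))"
  using assms(1,3,4)
proof (induction I arbitrary: F M rule: finite_induct)
  case empty
  show ?case
    by (rule exI[of _ "\<lambda>_. F p"])
       (use empty in \<open>auto simp: polydisc_def multi_indices_empty fun_eq_iff[symmetric] intro!: has_sum_finiteI\<close>)
next
  case (insert j I)
  let ?D = "polydisc p r I" and ?D' = "polydisc p r (insert j I)"
  have upd: "w(j := \<zeta>) \<in> ?D'" if "w \<in> ?D" "\<zeta> \<in> ball (p j) r" for w \<zeta>
    using that by (auto simp: polydisc_def dist_norm norm_minus_commute)
  have pM: "p \<in> ?D'" using r by (simp add: polydisc_def)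
  have M: "M \<ge> 0" using insert.prems(2)[OF pM] norm_ge_zero order_trans by blast
  define g where "g w \<zeta> = F (w(j := \<zeta>))" for w \<zeta>
  have ghol: "g w holomorphic_on ball (p j) r" if "w \<in> ?D" for w
    unfolding g_def
  proof (rule holo_disc[OF insert.prems(1) open_ball])
    show "(\<lambda>t. (w(j := t)) i) holomorphic_on ball (p j) r" for i
      using holomorphic_fun_upd[of w j 0 i] by simp
    show "w(j := t) \<in> ?D'" if "t \<in> ball (p j) r" for t by (rule upd[OF \<open>w \<in> ?D\<close> that])
  qed
  \<comment> \<open>The Taylor coefficients in the variable \<open>j\<close>.\<close>
  define a where "a k w = (deriv ^^ k) (g w) (p j) / fact k" for k w
  have gsums: "(\<lambda>k. a k w * (\<zeta> - p j) ^ k) sums g w \<zeta>" if "w \<in> ?D" "\<zeta> \<in> ball (p j) r" for w \<zeta>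
    unfolding a_def by (rule holomorphic_power_series[OF ghol[OF that(1)] that(2)])
  have abound: "norm (a k w) * r ^ k \<le> M" if w: "w \<in> ?D" for k w
  proof -
    have b: "norm (a k w) * \<rho> ^ k \<le> M" if \<rho>: "0 < \<rho>" "\<rho> < r" for \<rho>
    proof -
      have "norm ((deriv ^^ k) (g w) (p j)) \<le> fact k * M / \<rho> ^ k"
      proof (rule Cauchy_inequality)
        have sub: "cball (p j) \<rho> \<subseteq> ball (p j) r" using \<rho> by auto
        show "g w holomorphic_on ball (p j) \<rho>"
          by (rule holomorphic_on_subset[OF ghol[OF w]]) (use \<rho> in auto)
        show "continuous_on (cball (p j) \<rho>) (g w)"
          by (rule continuous_on_subset[OF holomorphic_on_imp_continuous_on[OF ghol[OF w]] sub])
        show "norm (g w x) \<le> M" if "norm (p j - x) = \<rho>" for x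
          unfolding g_def by (rule insert.prems(2)[OF upd[OF w]]) (use that \<rho> in \<open>auto simp: dist_norm\<close>)
      qed (use \<rho> in auto)
      then show ?thesis using \<rho>(1) by (simp add: a_def norm_divide field_simps)
    qed
    have "((\<lambda>\<rho>. norm (a k w) * \<rho> ^ k) \<longlongrightarrow> norm (a k w) * r ^ k) (at_left r)"
      by (intro tendsto_intros)
    moreover have "\<forall>\<^sub>F \<rho> in at_left r. norm (a k w) * \<rho> ^ k \<le> M"
      using eventually_at_left_real[OF r] by eventually_elim (use b in auto)
    ultimately show ?thesis by (rule tendsto_upperbound) simp
  qed
  have aholo: "holo ?D (a k)" for k
  proof (induction k rule: less_induct)
    case (less k)
    define \<zeta> where "\<zeta> n = r / (2 * (real n + 1))" for n
    have \<zeta>: "0 < \<zeta> n" "\<zeta> n \<le> r / 2" for n using r by (auto simp: \<zeta>_def field_simps)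
    define G where "G n w = (g w (p j + \<zeta> n) - (\<Sum>l<k. a l w * of_real (\<zeta> n) ^ l)) * inverse (of_real (\<zeta> n) ^ k)" for n w
    have inb: "p j + \<zeta> n \<in> ball (p j) r" for n using \<zeta>[of n] r by (simp add: dist_norm)
    show ?case
    proof (rule holo_uniform_limit[of ?D G])
      fix n
      have "holo ?D (\<lambda>w. g w (p j + \<zeta> n))" unfolding g_def
      proof (rule holo_compose[OF insert.prems(1)])
        fix i show "holo ?D (\<lambda>w. (w(j := p j + of_real (\<zeta> n))) i)"
          by (cases "i = j") (auto intro: holo_const holo_coord)
      qed (use upd inb in blast)
      then show "holo ?D (G n)" unfolding G_def
        by (intro holo_mult holo_diff holo_sum holo_const less) auto
    next
      have est: "norm (G n w - a k w) \<le> M / r ^ k * (2 * (\<zeta> n / r))" if w: "w \<in> ?D" for n w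
      proof -
        let ?z = "complex_of_real (\<zeta> n)" and ?q = "\<zeta> n / r"
        have z0: "?z \<noteq> 0" using \<zeta>(1)[of n] by simp
        have q: "0 < ?q" "?q \<le> 1/2" using \<zeta>[of n] r by (auto simp: field_simps)
        have "(\<lambda>l. a l w * ?z ^ l) sums g w (p j + \<zeta> n)"
          using gsums[OF w inb, of n] by simp
        then have "(\<lambda>l. a (l + k) w * ?z ^ (l + k)) sums (g w (p j + \<zeta> n) - (\<Sum>l<k. a l w * ?z ^ l))"
          by (subst sums_iff_shift) simp
        then have "(\<lambda>l. a (l + k) w * ?z ^ (l + k) * inverse (?z ^ k)) sums G n w"
          unfolding G_def by (rule sums_mult2)
        moreover have "a (l + k) w * ?z ^ (l + k) * inverse (?z ^ k) = a (l + k) w * ?z ^ l" for l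
          using z0 by (simp add: power_add field_simps)
        ultimately have "(\<lambda>l. a (l + k) w * ?z ^ l) sums G n w" by (simp only:)
        then have "(\<lambda>l. a (Suc l + k) w * ?z ^ Suc l) sums (G n w - a k w)"
          using sums_Suc_iff[of "\<lambda>l. a (l + k) w * ?z ^ l" "G n w - a k w"] by simp
        moreover have "(\<lambda>l. M / r ^ k * (?q * ?q ^ l)) sums (M / r ^ k * (?q * (1 / (1 - ?q))))"
        proof (intro sums_mult geometric_sums)
          show "norm ?q < 1" unfolding real_norm_def using q by linarith
        qed
        moreover have "norm (a (Suc l + k) w * ?z ^ Suc l) \<le> M / r ^ k * (?q * ?q ^ l)" for l
        proof -
          have "norm (a (Suc l + k) w * ?z ^ Suc l) = (norm (a (Suc l + k) w) * r ^ (Suc l + k)) / r ^ k * ?q ^ Suc l"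
            using r \<zeta>(1)[of n] by (simp add: norm_mult norm_power power_add power_divide field_simps)
          also have "\<dots> \<le> M / r ^ k * ?q ^ Suc l"
          proof (rule mult_right_mono)
            show "norm (a (Suc l + k) w) * r ^ (Suc l + k) / r ^ k \<le> M / r ^ k"
              using abound[OF w, of "Suc l + k"] r by (intro divide_right_mono) auto
            show "0 \<le> ?q ^ Suc l" using q(1) by (intro zero_le_power) linarith
          qed
          finally show ?thesis by simp
        qed
        ultimately have "norm (G n w - a k w) \<le> M / r ^ k * (?q * (1 / (1 - ?q)))" by (rule norm_sums_le)
        also have "\<dots> \<le> M / r ^ k * (?q * 2)"
          using M r q by (intro mult_left_mono) (auto simp: field_simps)
        finally show ?thesis by (simp add: mult.commute)
      qed
      have "(\<lambda>n. 1 / (real n + 1)) \<longlonglongrightarrow> 0" using LIMSEQ_inverse_real_of_nat by (simp add: inverse_eq_divide add.commute)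
      then have "(\<lambda>n. M / r ^ k * (1 / (real n + 1))) \<longlonglongrightarrow> M / r ^ k * 0" by (intro tendsto_intros)
      moreover have "M / r ^ k * (2 * (\<zeta> n / r)) = M / r ^ k * (1 / (real n + 1))" for n
        using r by (simp add: \<zeta>_def divide_simps)
      ultimately have lim: "(\<lambda>n. M / r ^ k * (2 * (\<zeta> n / r))) \<longlonglongrightarrow> 0" by simp
      show "uniform_limit ?D G (a k) sequentially"
      proof (rule uniform_limitI)
        fix e :: real assume "e > 0"
        have "\<forall>\<^sub>F n in sequentially. M / r ^ k * (2 * (\<zeta> n / r)) < e"
          by (rule order_tendstoD(2)[OF lim \<open>e > 0\<close>])
        then show "\<forall>\<^sub>F n in sequentially. \<forall>x\<in>?D. dist (G n x) (a k x) < e"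
        proof eventually_elim
          case (elim n)
          show ?case
          proof
            fix w assume "w \<in> ?D"
            from le_less_trans[OF est[OF this, of n] elim] show "dist (G n w) (a k w) < e" by (simp add: dist_norm)
          qed
        qed
      qed
    qed
  qed
  have "\<forall>k. \<exists>c. (\<forall>\<alpha>\<in>multi_indices I. norm (c \<alpha>) * r ^ (\<Sum>i\<in>I. \<alpha> i) \<le> M / r ^ k) \<and>
     (\<forall>z\<in>?D. ((\<lambda>\<alpha>. c \<alpha> * (\<Prod>i\<in>I. (z i - p i) ^ \<alpha> i)) has_sum a k z) (multi_indices I))"
  proof
    fix k
    have "norm (a k z) \<le> M / r ^ k" if "z \<in> ?D" for z using abound[OF that, of k] r by (simp add: field_simps)
    then show "\<exists>c. (\<forall>\<alpha>\<in>multi_indices I. norm (c \<alpha>) * r ^ (\<Sum>i\<in>I. \<alpha> i) \<le> M / r ^ k) \<and>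
     (\<forall>z\<in>?D. ((\<lambda>\<alpha>. c \<alpha> * (\<Prod>i\<in>I. (z i - p i) ^ \<alpha> i)) has_sum a k z) (multi_indices I))"
      by (rule insert.IH[OF aholo])
  qed
  from choice[OF this] obtain C where "\<forall>k. (\<forall>\<alpha>\<in>multi_indices I. norm (C k \<alpha>) * r ^ (\<Sum>i\<in>I. \<alpha> i) \<le> M / r ^ k) \<and>
     (\<forall>z\<in>?D. ((\<lambda>\<alpha>. C k \<alpha> * (\<Prod>i\<in>I. (z i - p i) ^ \<alpha> i)) has_sum a k z) (multi_indices I))" ..
  then have C1: "\<And>k \<alpha>. \<alpha> \<in> multi_indices I \<Longrightarrow> norm (C k \<alpha>) * r ^ (\<Sum>i\<in>I. \<alpha> i) \<le> M / r ^ k"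
    and C2: "\<And>k z. z \<in> ?D \<Longrightarrow> ((\<lambda>\<alpha>. C k \<alpha> * (\<Prod>i\<in>I. (z i - p i) ^ \<alpha> i)) has_sum a k z) (multi_indices I)"
    by blast+
  define c where "c \<alpha> = C (\<alpha> j) (\<alpha>(j := 0))" for \<alpha>
  have c_upd: "c (\<alpha>(j := k)) = C k \<alpha>" if "\<alpha> \<in> multi_indices I" for \<alpha> k
  proof -
    have "\<alpha>(j := 0) = \<alpha>" using that insert.hyps(2) by (auto simp: multi_indices_def)
    then show ?thesis by (simp add: c_def)
  qed
  have bij: "bij_betw (\<lambda>(k, \<alpha>). \<alpha>(j := k)) (UNIV \<times> multi_indices I) (multi_indices (insert j I))"
    by (rule bij_betw_multi_indices_insert[OF insert.hyps(2)])
  show ?case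
  proof (intro exI[of _ c] conjI ballI)
    fix \<beta> assume b: "\<beta> \<in> multi_indices (insert j I)"
    have b0: "\<beta>(j := 0) \<in> multi_indices I" using b by (auto simp: multi_indices_def)
    have s: "(\<Sum>i\<in>I. (\<beta>(j := 0)) i) = (\<Sum>i\<in>I. \<beta> i)" using insert.hyps(2) by (intro sum.cong) auto
    have "norm (c \<beta>) * r ^ (\<Sum>i\<in>I. \<beta> i) \<le> M / r ^ \<beta> j" using C1[OF b0, of "\<beta> j"] unfolding s c_def .
    then show "norm (c \<beta>) * r ^ (\<Sum>i\<in>insert j I. \<beta> i) \<le> M"
      using r insert.hyps by (simp add: power_add field_simps)
  next
    fix z assume z: "z \<in> ?D'"
    define w where "w = z(j := p j)"
    have w: "w \<in> ?D" using z insert.hyps by (auto simp: w_def polydisc_def)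
    have zj: "z j \<in> ball (p j) r" using z by (simp add: polydisc_def dist_norm norm_minus_commute)
    have gz: "g w (z j) = F z" by (simp add: g_def w_def)
    define q where "q i = norm (z i - p i) / r" for i
    have q: "0 \<le> q i \<and> q i < 1" if "i \<in> insert j I" for i using z r that by (auto simp: q_def polydisc_def)
    have wz: "w i = z i" if "i \<in> I" for i using that insert.hyps by (auto simp: w_def)
    define f where "f = (\<lambda>(k, \<alpha>). C k \<alpha> * (\<Prod>i\<in>I. (w i - p i) ^ \<alpha> i) * (z j - p j) ^ k)"
    have "(f has_sum F z) (UNIV \<times> multi_indices I)"
    proof (rule has_sum_SigmaI)
      show "((\<lambda>\<alpha>. f (k, \<alpha>)) has_sum a k w * (z j - p j) ^ k) (multi_indices I)" for k
        unfolding f_def using has_sum_cmult_left[OF C2[OF w]] by simp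
      have bd: "norm (a k w * (z j - p j) ^ k) \<le> M * q j ^ k" for k
      proof -
        have "norm (a k w * (z j - p j) ^ k) = (norm (a k w) * r ^ k) * q j ^ k"
          using r by (simp add: q_def norm_mult norm_power power_divide)
        also have "\<dots> \<le> M * q j ^ k" using abound[OF w] q by (intro mult_right_mono) auto
        finally show ?thesis .
      qed
      have sm: "summable (\<lambda>k. M * q j ^ k)" using q[of j] by (intro summable_mult summable_geometric) simp
      have "summable (\<lambda>k. norm (a k w * (z j - p j) ^ k))"
        by (rule summable_comparison_test'[OF sm, of 0]) (simp only: real_norm_def abs_norm_cancel bd)
      then show "((\<lambda>k. a k w * (z j - p j) ^ k) has_sum F z) UNIV"
        using gsums[OF w zj] unfolding gz by (rule norm_summable_imp_has_sum)
      have "(\<lambda>\<alpha>. \<Prod>i\<in>insert j I. q i ^ \<alpha> i) summable_on multi_indices (insert j I)"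
        by (rule summable_on_multi_geometric) (use insert.hyps q in auto)
      then have "(\<lambda>x. \<Prod>i\<in>insert j I. q i ^ ((\<lambda>(k, \<alpha>). \<alpha>(j := k)) x) i) summable_on UNIV \<times> multi_indices I"
        by (simp only: summable_on_reindex_bij_betw[OF bij, of "\<lambda>\<alpha>. \<Prod>i\<in>insert j I. q i ^ \<alpha> i"])
      then have sq: "(\<lambda>x. M * (\<Prod>i\<in>insert j I. q i ^ ((\<lambda>(k, \<alpha>). \<alpha>(j := k)) x) i)) summable_on UNIV \<times> multi_indices I"
        by (rule summable_on_cmult_right)
      have "(\<lambda>x. norm (f x)) summable_on UNIV \<times> multi_indices I"
      proof (rule Infinite_Sum.abs_summable_on_comparison_test'[OF sq])
        fix x :: "nat \<times> ('i \<Rightarrow> nat)" assume "x \<in> UNIV \<times> multi_indices I"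
        then obtain k \<alpha> where x: "x = (k, \<alpha>)" and \<alpha>: "\<alpha> \<in> multi_indices I" by auto
        have "norm (f x) = norm (C k \<alpha>) * (\<Prod>i\<in>I. norm (z i - p i) ^ \<alpha> i) * norm (z j - p j) ^ k"
          using wz by (simp add: f_def x norm_mult norm_power prod_norm[symmetric])
        also have "(\<Prod>i\<in>I. norm (z i - p i) ^ \<alpha> i) = (\<Prod>i\<in>I. q i ^ \<alpha> i) * r ^ (\<Sum>i\<in>I. \<alpha> i)"
          unfolding q_def power_sum prod.distrib[symmetric] using r by (intro prod.cong) (auto simp: power_divide)
        also have "norm (C k \<alpha>) * ((\<Prod>i\<in>I. q i ^ \<alpha> i) * r ^ (\<Sum>i\<in>I. \<alpha> i)) * norm (z j - p j) ^ k
           = (norm (C k \<alpha>) * r ^ (\<Sum>i\<in>I. \<alpha> i)) * r ^ k * (q j ^ k * (\<Prod>i\<in>I. q i ^ \<alpha> i))"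
          using r by (simp add: q_def power_divide)
        also have "\<dots> \<le> M * (q j ^ k * (\<Prod>i\<in>I. q i ^ \<alpha> i))"
        proof (rule mult_right_mono)
          show "norm (C k \<alpha>) * r ^ (\<Sum>i\<in>I. \<alpha> i) * r ^ k \<le> M"
            using C1[OF \<alpha>, of k] r by (simp add: field_simps)
          show "0 \<le> q j ^ k * (\<Prod>i\<in>I. q i ^ \<alpha> i)" using q by (intro mult_nonneg_nonneg prod_nonneg) auto
        qed
        finally show "norm (f x) \<le> M * (\<Prod>i\<in>insert j I. q i ^ ((\<lambda>(k, \<alpha>). \<alpha>(j := k)) x) i)"
          unfolding x prod.case prod_fun_upd_index[OF insert.hyps] .
      qed
      then show "f summable_on UNIV \<times> multi_indices I" by (rule Infinite_Sum.abs_summable_summable)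
    qed
    also have "(f has_sum F z) (UNIV \<times> multi_indices I) \<longleftrightarrow>
      ((\<lambda>x. (\<lambda>\<beta>. c \<beta> * (\<Prod>i\<in>insert j I. (z i - p i) ^ \<beta> i)) ((\<lambda>(k, \<alpha>). \<alpha>(j := k)) x)) has_sum F z) (UNIV \<times> multi_indices I)"
    proof (rule has_sum_cong)
      fix x :: "nat \<times> ('i \<Rightarrow> nat)" assume "x \<in> UNIV \<times> multi_indices I"
      then obtain k \<alpha> where x: "x = (k, \<alpha>)" and \<alpha>: "\<alpha> \<in> multi_indices I" by auto
      have "(\<Prod>i\<in>I. (w i - p i) ^ \<alpha> i) = (\<Prod>i\<in>I. (z i - p i) ^ \<alpha> i)" using wz by (intro prod.cong) auto
      then show "f x = (\<lambda>\<beta>. c \<beta> * (\<Prod>i\<in>insert j I. (z i - p i) ^ \<beta> i)) ((\<lambda>(k, \<alpha>). \<alpha>(j := k)) x)"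
        unfolding x prod.case prod_fun_upd_index[OF insert.hyps] c_upd[OF \<alpha>] f_def by simp
    qed
    also have "\<dots> \<longleftrightarrow> ((\<lambda>\<beta>. c \<beta> * (\<Prod>i\<in>insert j I. (z i - p i) ^ \<beta> i)) has_sum F z) (multi_indices (insert j I))"
      by (rule has_sum_reindex_bij_betw[OF bij])
    finally show "((\<lambda>\<beta>. c \<beta> * (\<Prod>i\<in>insert j I. (z i - p i) ^ \<beta> i)) has_sum F z) (multi_indices (insert j I))" .
  qed
qed

lemma coords_outside:
  "z \<in> Rn m \<times> Rn m \<Longrightarrow> i \<notin> {1..m} <+> {1..m} \<Longrightarrow> coords z i = 0"
  by (cases i) (auto simp: coords_def Rn_def InlI InrI)

text \<open>Bridge to the notion of real analyticity by power series. The coefficients of the complex expansion may be replaced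
by their real parts since the sum is real at real points.\<close>

theorem real_analytic_funI:
  assumes S: "S \<subseteq> Rn m \<times> Rn m"
    and f: "\<And>p. p \<in> S \<Longrightarrow> \<exists>g. ranalytic g (coords p) \<and> (\<forall>\<^sub>F w in nhds (coords p). \<forall>z\<in>S. coords z = w \<longrightarrow> f z = g w)"
  shows "real_analytic_fun m S f"
  unfolding real_analytic_fun_def Let_def
proof
  let ?I = "{1..m} <+> {1..m}"
  fix p assume p: "p \<in> S"
  obtain g where g: "ranalytic g (coords p)" and fg: "\<forall>\<^sub>F w in nhds (coords p). \<forall>z\<in>S. coords z = w \<longrightarrow> f z = g w"
    using f[OF p] by blast
  from g obtain U G where U: "open U" "cplx (coords p) \<in> U" "holo U G" "\<And>z. cplx z \<in> U \<Longrightarrow> G (cplx z) = of_real (g z)"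
    by (rule ranalyticE) blast
  from fg obtain W where W: "open W" "coords p \<in> W" "\<And>w z. w \<in> W \<Longrightarrow> z \<in> S \<Longrightarrow> coords z = w \<Longrightarrow> f z = g w"
    unfolding eventually_nhds by blast
  let ?P = "cplx (coords p)" and ?V = "{z \<in> U. G z \<in> ball (G (cplx (coords p))) 1}"
  have fin: "finite ?I" by simp
  have "open ?V" by (rule open_holo_preimage[OF U(1,3)]) simp
  then obtain r1 where r1: "r1 > 0" "\<And>x. (\<forall>j\<in>?I. dist (x j) (?P j) < r1) \<Longrightarrow> (\<forall>j. j \<notin> ?I \<longrightarrow> x j = ?P j) \<Longrightarrow> x \<in> ?V"
    using open_fun_contains_box[OF _ _ fin, of ?V ?P] U(2) by auto
  obtain r2 where r2: "r2 > 0" "\<And>x. (\<forall>j\<in>?I. dist (x j) (coords p j) < r2) \<Longrightarrow> (\<forall>j. j \<notin> ?I \<longrightarrow> x j = coords p j) \<Longrightarrow> x \<in> W"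
    using open_fun_contains_box[OF W(1,2) fin] by auto
  define r where "r = min r1 r2"
  have r: "r > 0" "r \<le> r1" "r \<le> r2" using r1 r2 by (auto simp: r_def)
  have sub: "polydisc ?P r ?I \<subseteq> ?V"
  proof
    fix z assume "z \<in> polydisc ?P r ?I"
    then show "z \<in> ?V" using r(2) by (intro r1(2)) (force simp: polydisc_def dist_norm)+
  qed
  have bound: "norm (G z) \<le> norm (G ?P) + 1" if "z \<in> polydisc ?P r ?I" for z
  proof -
    have "norm (G z - G ?P) < 1" using sub that by (auto simp: dist_norm norm_minus_commute)
    then show ?thesis using norm_triangle_ineq2[of "G z" "G ?P"] by linarith
  qed
  have hG: "holo (polydisc ?P r ?I) G" by (rule holo_subset[OF U(3)]) (use sub in blast)
  from holo_power_series[OF fin r(1) hG bound] obtain c where "\<forall>z\<in>polydisc ?P r ?I.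
      ((\<lambda>\<alpha>. c \<alpha> * (\<Prod>i\<in>?I. (z i - ?P i) ^ \<alpha> i)) has_sum G z) (multi_indices ?I)"
    by blast
  then have c: "\<And>z. z \<in> polydisc ?P r ?I \<Longrightarrow>
      ((\<lambda>\<alpha>. c \<alpha> * (\<Prod>i\<in>?I. (z i - ?P i) ^ \<alpha> i)) has_sum G z) (multi_indices ?I)" by blast
  have main: "((\<lambda>\<alpha>. Re (c \<alpha>) * (\<Prod>i\<in>?I. (coords z i - coords p i) ^ \<alpha> i)) has_sum g (coords z)) (multi_indices ?I)
      \<and> (z \<in> S \<longrightarrow> f z = g (coords z))"
    if z: "z \<in> Rn m \<times> Rn m" and zr: "\<forall>i\<in>?I. \<bar>coords z i - coords p i\<bar> < r" for z
  proof -
    have out: "coords z i = coords p i" if "i \<notin> ?I" for i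
      using coords_outside[OF z that] coords_outside[of p m i] that S p by auto
    have "cplx (coords z) \<in> polydisc ?P r ?I" using zr out by (auto simp: polydisc_def simp flip: of_real_diff)
    then have "((\<lambda>\<alpha>. c \<alpha> * of_real (\<Prod>i\<in>?I. (coords z i - coords p i) ^ \<alpha> i)) has_sum of_real (g (coords z))) (multi_indices ?I)"
      using c[of "cplx (coords z)"] U(4)[of "coords z"] subsetD[OF sub, of "cplx (coords z)"] by simp
    from has_sum_Re[OF this] have 1: "((\<lambda>\<alpha>. Re (c \<alpha>) * (\<Prod>i\<in>?I. (coords z i - coords p i) ^ \<alpha> i)) has_sum g (coords z)) (multi_indices ?I)"
      by (simp del: of_real_prod of_real_power of_real_diff)
    have "coords z \<in> W" using zr out r(3) by (intro r2(2)) (force simp: dist_real_def)+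
    then show ?thesis using 1 W(3) by auto
  qed
  show "\<exists>r>0. \<exists>c :: (nat + nat \<Rightarrow> nat) \<Rightarrow> real. \<forall>z\<in>Rn m \<times> Rn m. (\<forall>i\<in>?I. \<bar>coords z i - coords p i\<bar> < r) \<longrightarrow>
          (\<lambda>\<alpha>. c \<alpha> * (\<Prod>i\<in>?I. (coords z i - coords p i) ^ \<alpha> i)) summable_on multi_indices ?I \<and>
          (z \<in> S \<longrightarrow> f z = (\<Sum>\<^sub>\<infinity>\<alpha>\<in>multi_indices ?I. c \<alpha> * (\<Prod>i\<in>?I. (coords z i - coords p i) ^ \<alpha> i)))"
  proof (intro exI[of _ r] conjI r(1) exI[of _ "\<lambda>\<alpha>. Re (c \<alpha>)"] ballI impI)
    fix z assume z: "z \<in> Rn m \<times> Rn m" "\<forall>i\<in>?I. \<bar>coords z i - coords p i\<bar> < r"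
    show "(\<lambda>\<alpha>. Re (c \<alpha>) * (\<Prod>i\<in>?I. (coords z i - coords p i) ^ \<alpha> i)) summable_on multi_indices ?I"
      using conjunct1[OF main[OF z]] by (rule has_sum_imp_summable)
    show "f z = (\<Sum>\<^sub>\<infinity>\<alpha>\<in>multi_indices ?I. Re (c \<alpha>) * (\<Prod>i\<in>?I. (coords z i - coords p i) ^ \<alpha> i))" if "z \<in> S"
      using conjunct2[OF main[OF z]] that infsumI[OF conjunct1[OF main[OF z]]] by simp
  qed
qed

section \<open>Families of polynomials with analytic coefficients\<close>

lemma ranalytic_parameter:
  "ranalytic g z0 \<Longrightarrow> ranalytic (\<lambda>w. g (\<lambda>i. w (Inl i))) (case_sum z0 x0)"
  using ranalytic_reindex[of g "case_sum z0 x0" Inl] by simp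

theorem ranalytic_implicit_function_1:
  fixes f :: "('i \<Rightarrow> real) \<Rightarrow> real \<Rightarrow> real"
  assumes f: "ranalytic (\<lambda>w. f (\<lambda>i. w (Inl i)) (w (Inr ()))) (case_sum z0 (\<lambda>_. x0))"
    and f0: "f z0 x0 = 0" and d: "(f z0 has_field_derivative a) (at x0)" and a: "a \<noteq> 0"
  obtains X \<rho> where "ranalytic X z0" "X z0 = x0" "\<forall>\<^sub>F z in nhds z0. f z (X z) = 0" "\<rho> > 0"
    "\<forall>\<^sub>F z in nhds z0. \<forall>x. \<bar>x - x0\<bar> < \<rho> \<longrightarrow> f z x = 0 \<longrightarrow> x = X z"
proof -
  let ?E = "\<lambda>(_::unit) w. f (\<lambda>i. w (Inl i)) (w (Inr ()))"
  have d': "((\<lambda>t. f z0 (x0 + t)) has_field_derivative a) (at 0)"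
    using d DERIV_shift[of "f z0" a 0 x0] by (simp add: add.commute)
  obtain X \<rho> where X: "\<And>j. ranalytic (\<lambda>z. X z j) z0" "X z0 = (\<lambda>_. x0)"
    "\<forall>\<^sub>F z in nhds z0. \<forall>j\<in>UNIV. ?E j (case_sum z (X z)) = 0" "\<rho> > 0"
    "\<forall>\<^sub>F z in nhds z0. \<forall>x. (\<forall>j\<in>UNIV. \<bar>x j - x0\<bar> < \<rho>) \<longrightarrow> (\<forall>j. j \<notin> UNIV \<longrightarrow> x j = x0) \<longrightarrow>
       (\<forall>j\<in>UNIV. ?E j (case_sum z x) = 0) \<longrightarrow> x = X z"
  proof (rule ranalytic_implicit_function[of UNIV ?E z0 "\<lambda>_. x0" "\<lambda>_ _. a" "\<lambda>_ _. 1 / a"])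
    fix j k :: unit
    show "((\<lambda>t. ?E j (case_sum z0 ((\<lambda>_. x0)(k := x0 + t)))) has_field_derivative a) (at 0)" using d' by simp
    show "(\<Sum>l\<in>(UNIV::unit set). (1 / a) * a) = (if j = k then 1 else 0)" using a by simp
    show "(\<Sum>l\<in>(UNIV::unit set). a * (1 / a)) = (if j = k then 1 else 0)" using a by simp
  next
    fix X \<rho> assume "\<And>j. ranalytic (\<lambda>z. X z j) z0" "X z0 = (\<lambda>_. x0)"
    "\<forall>\<^sub>F z in nhds z0. \<forall>j\<in>UNIV. ?E j (case_sum z (X z)) = 0" "\<rho> > 0"
    "\<forall>\<^sub>F z in nhds z0. \<forall>x. (\<forall>j\<in>UNIV. \<bar>x j - x0\<bar> < \<rho>) \<longrightarrow> (\<forall>j. j \<notin> UNIV \<longrightarrow> x j = x0) \<longrightarrow>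
       (\<forall>j\<in>UNIV. ?E j (case_sum z x) = 0) \<longrightarrow> x = X z"
    then show thesis by (rule that)
  qed (use f f0 in simp_all)
  show ?thesis
  proof (rule that[of "\<lambda>z. X z ()" \<rho>])
    show "\<forall>\<^sub>F z in nhds z0. f z (X z ()) = 0" using X(3) by eventually_elim simp
    show "\<forall>\<^sub>F z in nhds z0. \<forall>x. \<bar>x - x0\<bar> < \<rho> \<longrightarrow> f z x = 0 \<longrightarrow> x = X z ()"
      using X(5)
    proof eventually_elim
      case (elim z)
      show ?case
      proof (intro allI impI)
        fix x assume "\<bar>x - x0\<bar> < \<rho>" "f z x = 0"
        then have "(\<lambda>_. x) = X z" using elim[rule_format, of "\<lambda>_. x"] by simp
        then show "x = X z ()" by metis
      qed
    qed
  qed (use X(1,2,4) in simp_all)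
qed

text \<open>The uniform bound on the degrees makes evaluation and products finite sums of coefficient functions.\<close>

definition ranalytic_poly :: "(('i \<Rightarrow> real) \<Rightarrow> real poly) \<Rightarrow> ('i \<Rightarrow> real) \<Rightarrow> bool" where
  "ranalytic_poly p z0 \<longleftrightarrow> (\<exists>d. \<forall>z. degree (p z) \<le> d) \<and> (\<forall>k. ranalytic (\<lambda>z. coeff (p z) k) z0)"

lemma ranalytic_polyD: "ranalytic_poly p z0 \<Longrightarrow> ranalytic (\<lambda>z. coeff (p z) k) z0"
  by (simp add: ranalytic_poly_def)

definition deg_bound :: "('z \<Rightarrow> real poly) \<Rightarrow> nat" where
  "deg_bound p = (SOME d. \<forall>z. degree (p z) \<le> d)"

lemma deg_bound: "ranalytic_poly p z0 \<Longrightarrow> degree (p z) \<le> deg_bound p"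
  using someI_ex[of "\<lambda>d. \<forall>z. degree (p z) \<le> d"] unfolding deg_bound_def ranalytic_poly_def by blast

lemma ranalytic_polyI:
  "(\<And>z. degree (p z) \<le> d) \<Longrightarrow> (\<And>k. ranalytic (\<lambda>z. coeff (p z) k) z0) \<Longrightarrow> ranalytic_poly p z0"
  unfolding ranalytic_poly_def by blast

lemma ranalytic_poly_const: "ranalytic_poly (\<lambda>z. p) z0"
  by (rule ranalytic_polyI[where d = "degree p"]) (rule order_refl ranalytic_const)+

lemma ranalytic_poly_add:
  "ranalytic_poly p z0 \<Longrightarrow> ranalytic_poly q z0 \<Longrightarrow> ranalytic_poly (\<lambda>z. p z + q z) z0"
proof (rule ranalytic_polyI)
  assume p: "ranalytic_poly p z0" and q: "ranalytic_poly q z0"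
  show "degree (p z + q z) \<le> deg_bound p + deg_bound q" for z
    using deg_bound[OF p, of z] deg_bound[OF q, of z] by (intro degree_add_le) simp_all
  show "ranalytic (\<lambda>z. coeff (p z + q z) k) z0" for k
    unfolding coeff_add by (intro ranalytic_add ranalytic_polyD p q)
qed

lemma ranalytic_poly_smult:
  "ranalytic c z0 \<Longrightarrow> ranalytic_poly p z0 \<Longrightarrow> ranalytic_poly (\<lambda>z. smult (c z) (p z)) z0"
  by (rule ranalytic_polyI[where d = "deg_bound p"])
     (auto intro!: ranalytic_mult ranalytic_polyD intro: order_trans[OF degree_smult_le] deg_bound)

lemma ranalytic_poly_diff:
  "ranalytic_poly p z0 \<Longrightarrow> ranalytic_poly q z0 \<Longrightarrow> ranalytic_poly (\<lambda>z. p z - q z) z0"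
  using ranalytic_poly_add[of p z0 "\<lambda>z. smult (-1) (q z)"] ranalytic_poly_smult[OF ranalytic_const, of q z0 "-1"] by simp

lemma ranalytic_poly_mult:
  assumes "ranalytic_poly p z0" "ranalytic_poly q z0" shows "ranalytic_poly (\<lambda>z. p z * q z) z0"
proof -
  show ?thesis
  proof (rule ranalytic_polyI)
    show "degree (p z * q z) \<le> deg_bound p + deg_bound q" for z
      by (rule order_trans[OF degree_mult_le add_mono]) (rule deg_bound[OF assms(1)] deg_bound[OF assms(2)])+
    show "ranalytic (\<lambda>z. coeff (p z * q z) k) z0" for k
      unfolding coeff_mult by (intro ranalytic_sum ranalytic_mult ranalytic_polyD assms)
  qed
qed

lemma ranalytic_poly_pCons:
  assumes "ranalytic c z0" "ranalytic_poly p z0" shows "ranalytic_poly (\<lambda>z. pCons (c z) (p z)) z0"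
proof -
  show ?thesis
  proof (rule ranalytic_polyI)
    show "degree (pCons (c z) (p z)) \<le> Suc (deg_bound p)" for z
      by (rule order_trans[OF degree_pCons_le]) (simp add: deg_bound[OF assms(2)])
    show "ranalytic (\<lambda>z. coeff (pCons (c z) (p z)) k) z0" for k
      by (cases k) (simp_all add: assms(1) ranalytic_polyD[OF assms(2)])
  qed
qed

lemma ranalytic_poly_sum:
  "(\<And>k. k \<in> A \<Longrightarrow> ranalytic_poly (p k) z0) \<Longrightarrow> ranalytic_poly (\<lambda>z. \<Sum>k\<in>A. p k z) z0"
  by (induction A rule: infinite_finite_induct) (auto intro: ranalytic_poly_add ranalytic_poly_const)

lemma ranalytic_poly_prod:
  "(\<And>k. k \<in> A \<Longrightarrow> ranalytic_poly (p k) z0) \<Longrightarrow> ranalytic_poly (\<lambda>z. \<Prod>k\<in>A. p k z) z0"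
  by (induction A rule: infinite_finite_induct) (auto intro: ranalytic_poly_mult ranalytic_poly_const)

lemma ranalytic_poly_pderiv:
  assumes "ranalytic_poly p z0" shows "ranalytic_poly (\<lambda>z. pderiv (p z)) z0"
proof -
  show ?thesis
  proof (rule ranalytic_polyI)
    show "degree (pderiv (p z)) \<le> deg_bound p" for z
      using deg_bound[OF assms, of z] by (simp add: degree_pderiv)
    show "ranalytic (\<lambda>z. coeff (pderiv (p z)) k) z0" for k
      unfolding coeff_pderiv by (intro ranalytic_mult ranalytic_const ranalytic_polyD assms)
  qed
qed

lemma poly_eq_sum_coeff: "degree (p :: real poly) \<le> d \<Longrightarrow> poly p x = (\<Sum>k\<le>d. coeff p k * x ^ k)"
  unfolding poly_altdef by (intro sum.mono_neutral_left) (auto simp: coeff_eq_0)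

lemma ranalytic_poly_eval:
  assumes "ranalytic_poly p z0" "ranalytic x z0" shows "ranalytic (\<lambda>z. poly (p z) (x z)) z0"
proof -
  have "(\<lambda>z. poly (p z) (x z)) = (\<lambda>z. \<Sum>k\<le>deg_bound p. coeff (p z) k * x z ^ k)"
    by (intro ext poly_eq_sum_coeff deg_bound[OF assms(1)])
  moreover have "ranalytic (\<lambda>z. \<Sum>k\<le>deg_bound p. coeff (p z) k * x z ^ k) z0"
    by (intro ranalytic_sum ranalytic_mult ranalytic_power ranalytic_polyD[OF assms(1)] assms(2))
  ultimately show ?thesis by simp
qed

lemma ranalytic_poly_parameter:
  "ranalytic_poly p z0 \<Longrightarrow> ranalytic_poly (\<lambda>w. p (\<lambda>i. w (Inl i))) (case_sum z0 x0)"
  by (rule ranalytic_polyI[OF deg_bound ranalytic_parameter[OF ranalytic_polyD]])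

text \<open>The derivative at a simple root does not vanish, so the implicit function theorem applies to \<open>(z, x) \<mapsto> p\<^sub>z(x)\<close>.\<close>

theorem ranalytic_simple_root:
  assumes p: "ranalytic_poly p z0" and root: "poly (p z0) x0 = 0" and simple: "poly (pderiv (p z0)) x0 \<noteq> 0"
  obtains X where "ranalytic X z0" "X z0 = x0" "\<forall>\<^sub>F z in nhds z0. poly (p z) (X z) = 0"
proof (rule ranalytic_implicit_function_1[of "\<lambda>z. poly (p z)" z0 x0 "poly (pderiv (p z0)) x0"])
  show "ranalytic (\<lambda>w. poly (p (\<lambda>i. w (Inl i))) (w (Inr ()))) (case_sum z0 (\<lambda>_. x0))"
    by (rule ranalytic_poly_eval[OF ranalytic_poly_parameter[OF p] ranalytic_coord])
  show "(poly (p z0) has_field_derivative poly (pderiv (p z0)) x0) (at x0)" by (rule poly_DERIV)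
qed (use root simple that in blast)+

section \<open>Polynomials with simple real roots\<close>

definition real_rooted :: "real poly \<Rightarrow> bool" where
  "real_rooted p \<longleftrightarrow> p \<noteq> 0 \<and> card {x. poly p x = 0} = degree p"

text \<open>The roots are numbered from \<open>1\<close> in increasing order, multiplicities being ignored.\<close>

definition rt :: "real poly \<Rightarrow> nat \<Rightarrow> real" where
  "rt p n = sorted_list_of_set {x. poly p x = 0} ! (n - 1)"

lemma rt_image:
  assumes "real_rooted p" shows "{x. poly p x = 0} = rt p ` {1..degree p}"
proof -
  let ?R = "{x. poly p x = 0}" and ?L = "sorted_list_of_set {x. poly p x = 0}"
  have fin: "finite ?R" using assms poly_roots_finite by (auto simp: real_rooted_def)
  have len: "length ?L = degree p" using assms by (simp add: real_rooted_def)
  have "?R = set ?L" using fin by simp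
  also have "\<dots> = (!) ?L ` {0..<degree p}" using len by (simp add: set_conv_nth image_def)
      (metis atLeast0LessThan lessThan_iff)
  also have "\<dots> = rt p ` {1..degree p}"
  proof -
    have "{1..degree p} = Suc ` {0..<degree p}"
      by (simp add: image_Suc_atLeastLessThan atLeastLessThanSuc_atLeastAtMost)
    then show ?thesis unfolding rt_def by (simp only: image_image) simp
  qed
  finally show ?thesis .
qed

lemma rt_root: "real_rooted p \<Longrightarrow> n \<in> {1..degree p} \<Longrightarrow> poly p (rt p n) = 0"
  using rt_image by blast

lemma rt_less:
  assumes "real_rooted p" "1 \<le> i" "i < j" "j \<le> degree p" shows "rt p i < rt p j"
proof -
  let ?L = "sorted_list_of_set {x. poly p x = 0}"
  have "length ?L = degree p" using assms by (simp add: real_rooted_def)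
  moreover have "sorted_wrt (<) ?L" by simp
  ultimately show ?thesis unfolding rt_def using assms
    by (intro sorted_wrt_nth_less[of "(<)" ?L]) auto
qed

lemma rt_le: "real_rooted p \<Longrightarrow> 1 \<le> i \<Longrightarrow> i \<le> j \<Longrightarrow> j \<le> degree p \<Longrightarrow> rt p i \<le> rt p j"
  using rt_less[of p i j] by (cases "i = j") auto

lemma inj_on_increasing: "(\<And>i j. i \<in> A \<Longrightarrow> j \<in> A \<Longrightarrow> i < j \<Longrightarrow> z i < (z j :: real)) \<Longrightarrow> inj_on z (A :: nat set)"
  by (rule linorder_inj_onI) (auto simp: order.strict_iff_order)

text \<open>As many increasing roots as the degree are all the roots.\<close>

lemma real_rootedI:
  assumes p: "p \<noteq> 0" "degree p = k" and root: "\<And>i. i \<in> {1..k} \<Longrightarrow> poly p (z i) = 0"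
    and less: "\<And>i j. 1 \<le> i \<Longrightarrow> i < j \<Longrightarrow> j \<le> k \<Longrightarrow> z i < z j"
  shows "real_rooted p" "\<And>i. i \<in> {1..k} \<Longrightarrow> rt p i = z i"
proof -
  have fin: "finite {x. poly p x = 0}" by (rule poly_roots_finite[OF p(1)])
  have inj: "inj_on z {1..k}" by (rule inj_on_increasing) (use less in auto)
  have sub: "z ` {1..k} \<subseteq> {x. poly p x = 0}" using root by auto
  have "card {x. poly p x = 0} \<le> k" using card_poly_roots_bound[OF p(1)] p(2) by simp
  moreover have "card (z ` {1..k}) = k" using inj by (simp add: card_image)
  ultimately have eq: "z ` {1..k} = {x. poly p x = 0}" using card_seteq[OF fin sub] by simp
  then show rr: "real_rooted p" using p \<open>card (z ` {1..k}) = k\<close> by (simp add: real_rooted_def)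
  have "sorted_list_of_set {x. poly p x = 0} = map z [1..<Suc k]"
  proof -
    have "sorted_wrt (<) (map z [1..<Suc k])"
      by (auto simp: sorted_wrt_iff_nth_less less simp del: upt_Suc)
    then have "sorted_wrt (<) (map z [1..<Suc k]) \<and> set (map z [1..<Suc k]) = {x. poly p x = 0} \<and>
        length (map z [1..<Suc k]) = card {x. poly p x = 0}"
      using eq \<open>card (z ` {1..k}) = k\<close> by (auto simp: atLeastLessThanSuc_atLeastAtMost simp del: upt_Suc)
    then show ?thesis using sorted_list_of_set_unique[OF fin] by blast
  qed
  then show "rt p i = z i" if "i \<in> {1..k}" for i
    using that by (cases i) (auto simp: rt_def simp del: upt_Suc)
qed

lemma real_rooted_factor:
  assumes "real_rooted p"
  shows "p = smult (lead_coeff p) (\<Prod>i\<in>{1..degree p}. [:- rt p i, 1:])"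
proof -
  let ?k = "degree p" and ?q = "\<Prod>i\<in>{1..degree p}. [:- rt p i, 1:]"
  have p0: "p \<noteq> 0" using assms by (simp add: real_rooted_def)
  have dq: "degree ?q = ?k" by (subst degree_prod_eq_sum_degree) auto
  have lq: "lead_coeff ?q = 1" by (subst lead_coeff_prod) simp
  show ?thesis
  proof (rule poly_eqI_degree_lead_coeff[where n = ?k and A = "rt p ` {1..?k}"])
    show "?k \<le> card (rt p ` {1..?k})"
      using inj_on_increasing[of "{1..?k}" "rt p"] rt_less[OF assms] by (auto simp: card_image)
    show "coeff p ?k = coeff (smult (lead_coeff p) ?q) ?k" using dq lq by simp
    show "poly p x = poly (smult (lead_coeff p) ?q) x" if "x \<in> rt p ` {1..?k}" for x
    proof -
      obtain i where i: "i \<in> {1..?k}" "x = rt p i" using \<open>x \<in> _\<close> by blast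
      then have "poly ?q x = 0" unfolding poly_prod by (intro prod_zero) auto
      then show ?thesis using rt_root[OF assms i(1)] i(2) by simp
    qed
  qed (use dq in \<open>auto intro: order_trans[OF degree_smult_le]\<close>)
qed

lemma sign_prod_roots:
  fixes z :: "nat \<Rightarrow> real"
  assumes "n \<le> k" "\<And>i. i \<in> {1..n} \<Longrightarrow> z i < x" "\<And>i. i \<in> {n+1..k} \<Longrightarrow> x < z i"
  shows "(-1) ^ (k - n) * (\<Prod>i\<in>{1..k}. x - z i) > 0"
proof -
  have "(\<Prod>i\<in>{1..k}. x - z i) = (\<Prod>i\<in>{1..n}. x - z i) * (\<Prod>i\<in>{n+1..k}. x - z i)"
    using assms(1) by (subst prod.union_disjoint[symmetric]) (auto intro!: prod.cong)
  also have "(\<Prod>i\<in>{n+1..k}. x - z i) = (-1) ^ (k - n) * (\<Prod>i\<in>{n+1..k}. z i - x)"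
    using prod_uminus[of "\<lambda>i. z i - x" "{n+1..k}"] by simp
  finally have "(-1) ^ (k - n) * (\<Prod>i\<in>{1..k}. x - z i) = (\<Prod>i\<in>{1..n}. x - z i) * (\<Prod>i\<in>{n+1..k}. z i - x)"
    by (simp add: ac_simps flip: power_mult_distrib)
  also have "\<dots> > 0" using assms by (intro mult_pos_pos prod_pos) auto
  finally show ?thesis .
qed

text \<open>Each root to the right of \<open>x\<close> contributes one factor \<open>-1\<close>.\<close>

lemma real_rooted_sign:
  assumes rr: "real_rooted p" and lc: "lead_coeff p > 0" and n: "n \<le> degree p"
    and below: "n \<ge> 1 \<Longrightarrow> rt p n < x" and above: "n < degree p \<Longrightarrow> x < rt p (n + 1)"
  shows "(-1) ^ (degree p - n) * poly p x > 0"
proof -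
  have "(-1) ^ (degree p - n) * (\<Prod>i\<in>{1..degree p}. x - rt p i) > 0"
  proof (rule sign_prod_roots[OF n])
    show "rt p i < x" if "i \<in> {1..n}" for i using that below rt_le[OF rr, of i n] n by auto
    show "x < rt p i" if "i \<in> {n+1..degree p}" for i using that above rt_le[OF rr, of "n+1" i] n by auto
  qed
  moreover have "poly p x = lead_coeff p * (\<Prod>i\<in>{1..degree p}. x - rt p i)"
    by (subst real_rooted_factor[OF rr]) (simp add: poly_prod)
  ultimately show ?thesis using lc by (simp add: mult.left_commute zero_less_mult_iff)
qed

lemma poly_sign_at_bot:
  fixes p :: "real poly"
  assumes "lead_coeff p > 0" "degree p = N"
  shows "\<exists>a<b. (-1) ^ N * poly p a > 0"
proof -
  let ?q = "smult ((-1) ^ N) (pcompose p [:0, -1:])"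
  have "lead_coeff (pcompose p [:0, -1:]) = lead_coeff p * (-1) ^ N" using assms(2)
    by (subst lead_coeff_comp) auto
  then have l: "lead_coeff ?q = lead_coeff p" by (simp flip: power_mult_distrib)
  obtain m where "\<forall>x\<ge>m. poly ?q x \<ge> lead_coeff ?q"
    using poly_pinfty_gt_lc[of ?q] assms(1) l by auto
  then have "poly ?q (max m (\<bar>b\<bar> + 1)) > 0" using assms(1) l by (metis less_le_trans max.cobounded1)
  then show ?thesis by (intro exI[of _ "- max m (\<bar>b\<bar> + 1)"]) (auto simp: poly_pcompose)
qed

lemma poly_sign_at_top:
  fixes p :: "real poly"
  assumes "lead_coeff p > 0"
  shows "\<exists>a>b. poly p a > 0"
proof -
  obtain m where "\<forall>x\<ge>m. poly p x \<ge> lead_coeff p" using poly_pinfty_gt_lc[OF assms] by auto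
  then have "poly p (max m (\<bar>b\<bar> + 1)) > 0" using assms by (metis less_le_trans max.cobounded1)
  then show ?thesis by (intro exI[of _ "max m (\<bar>b\<bar> + 1)"]) auto
qed

text \<open>Signs that alternate at \<open>N - 1\<close> points, together with the signs at \<open>\<plusminus>\<infinity>\<close>, produce \<open>N\<close> roots by the intermediate
value theorem.\<close>

theorem alternating_real_rooted:
  fixes p :: "real poly"
  assumes deg: "degree p = N" "N \<ge> 1" and lc: "lead_coeff p > 0"
    and less: "\<And>i j. 1 \<le> i \<Longrightarrow> i < j \<Longrightarrow> j \<le> N - 1 \<Longrightarrow> y i < y j"
    and alt: "\<And>n. n \<in> {1..N-1} \<Longrightarrow> (-1) ^ (N - n) * poly p (y n) > 0"
  shows "real_rooted p" "\<And>n. n \<in> {1..N-1} \<Longrightarrow> rt p n < y n \<and> y n < rt p (n + 1)"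
proof -
  obtain lo where lo: "lo < y 1" "(-1) ^ N * poly p lo > 0" using poly_sign_at_bot[OF lc deg(1)] by blast
  obtain hi where hi: "hi > max lo (y (N - 1))" "poly p hi > 0" using poly_sign_at_top[OF lc] by blast
  define Y where "Y n = (if n = 0 then lo else if n = N then hi else y n)" for n
  have Yalt: "(-1) ^ (N - n) * poly p (Y n) > 0" if "n \<le> N" for n
    using that alt[of n] lo hi by (auto simp: Y_def)
  have Ystep: "Y n < Y (Suc n)" if "n < N" for n
    using that less[of n "Suc n"] lo hi deg(2) by (cases "Suc n = N"; cases "n = 0") (auto simp: Y_def)
  have "\<exists>x. Y (i - 1) < x \<and> x < Y i \<and> poly p x = 0" if "i \<in> {1..N}" for i
  proof -
    have n: "i = Suc (i - 1)" "i - 1 < N" using that by auto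
    define n where "n = i - 1"
    then have n: "i = Suc n" "n < N" using n by auto
    have "N - n = Suc (N - Suc n)" using n by simp
    then have "(-1 :: real) ^ (N - n) * (-1) ^ (N - Suc n) = -1" by (simp flip: power_mult_distrib)
    then have e: "((-1) ^ (N - n) * poly p (Y n)) * ((-1) ^ (N - Suc n) * poly p (Y (Suc n))) = - (poly p (Y n) * poly p (Y (Suc n)))"
      by (metis (no_types, lifting) mult.assoc mult.left_commute mult_minus1)
    have "0 < ((-1) ^ (N - n) * poly p (Y n)) * ((-1) ^ (N - Suc n) * poly p (Y (Suc n)))"
      using n by (intro mult_pos_pos Yalt) auto
    then have "poly p (Y n) * poly p (Y (Suc n)) < 0" unfolding e by linarith
    from poly_IVT[OF Ystep[OF n(2)] this] show ?thesis using n by auto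
  qed
  then obtain z where z: "\<And>i. i \<in> {1..N} \<Longrightarrow> Y (i - 1) < z i \<and> z i < Y i \<and> poly p (z i) = 0" by metis
  have Yle: "Y i \<le> Y j" if "i \<le> j" "j \<le> N" for i j using that
  proof (induction rule: dec_induct)
    case (step n) then show ?case using Ystep[of n] by auto
  qed simp
  have zless: "z i < z j" if "1 \<le> i" "i < j" "j \<le> N" for i j
  proof -
    have "Y i \<le> Y (j - 1)" by (rule Yle) (use that in auto)
    moreover have "z i < Y i" "Y (j - 1) < z j" using z[of i] z[of j] that by auto
    ultimately show ?thesis by linarith
  qed
  have p0: "p \<noteq> 0" using lc by auto
  show "real_rooted p" by (rule real_rootedI(1)[OF p0 deg(1), of z]) (use z zless in auto)
  have rt: "rt p i = z i" if "i \<in> {1..N}" for i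
    by (rule real_rootedI(2)[OF p0 deg(1), of z]) (use z zless that in auto)
  show "rt p n < y n \<and> y n < rt p (n + 1)" if n: "n \<in> {1..N-1}" for n
  proof -
    have i: "n \<in> {1..N}" "n + 1 \<in> {1..N}" using n by auto
    have "Y n = y n" using n by (auto simp: Y_def)
    then show ?thesis using z[OF i(1)] z[OF i(2)] rt[OF i(1)] rt[OF i(2)] by simp
  qed
qed

text \<open>Rolle's theorem.\<close>

theorem real_rooted_pderiv:
  fixes p :: "real poly"
  assumes rr: "real_rooted p" and deg: "degree p = N" "N \<ge> 1"
  shows "real_rooted (pderiv p)"
    "\<And>n. n \<in> {1..N-1} \<Longrightarrow> rt p n < rt (pderiv p) n \<and> rt (pderiv p) n < rt p (n + 1)"
proof -
  have "\<exists>x. rt p i < x \<and> x < rt p (i + 1) \<and> poly (pderiv p) x = 0" if "i \<in> {1..N-1}" for i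
  proof -
    have l: "rt p i < rt p (i + 1)" by (rule rt_less[OF rr]) (use that deg in auto)
    have "poly p (rt p i) = 0" "poly p (rt p (i + 1)) = 0" using that deg by (auto intro!: rt_root[OF rr])
    with poly_MVT[OF l, of p] l show ?thesis by auto
  qed
  then obtain z where z: "\<And>i. i \<in> {1..N-1} \<Longrightarrow> rt p i < z i \<and> z i < rt p (i + 1) \<and> poly (pderiv p) (z i) = 0" by metis
  have d: "degree (pderiv p) = N - 1" using deg by (simp add: degree_pderiv)
  have nz: "pderiv p \<noteq> 0" using deg by (auto simp: pderiv_eq_0_iff)
  have zless: "z i < z j" if "1 \<le> i" "i < j" "j \<le> N - 1" for i j
  proof -
    have "rt p (i + 1) \<le> rt p j" by (rule rt_le[OF rr]) (use that deg in auto)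
    moreover have "z i < rt p (i + 1)" "rt p j < z j" using z[of i] z[of j] that by auto
    ultimately show ?thesis by linarith
  qed
  show "real_rooted (pderiv p)" by (rule real_rootedI(1)[OF nz d, of z]) (use z zless in auto)
  have rt: "rt (pderiv p) i = z i" if "i \<in> {1..N-1}" for i
    by (rule real_rootedI(2)[OF nz d, of z]) (use z zless that in auto)
  show "rt p n < rt (pderiv p) n \<and> rt (pderiv p) n < rt p (n + 1)" if n: "n \<in> {1..N-1}" for n
    using z[OF n] rt[OF n] by simp
qed

text \<open>Between two consecutive roots the derivative has exactly one zero, at which its sign changes.\<close>

lemma rt_unimodal:
  fixes p :: "real poly"
  assumes rr: "real_rooted p" and deg: "degree p = N" and lc: "lead_coeff p > 0" and n: "n \<in> {1..N-1}"
  defines "s \<equiv> (-1 :: real) ^ (N - n)" and "l \<equiv> rt (pderiv p) n"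
  shows "\<And>x. rt p n < x \<Longrightarrow> x < rt p (n + 1) \<Longrightarrow> s * poly p x > 0"
    "\<And>x y. rt p n \<le> x \<Longrightarrow> x < y \<Longrightarrow> y \<le> l \<Longrightarrow> s * poly p x < s * poly p y"
    "\<And>x y. l \<le> x \<Longrightarrow> x < y \<Longrightarrow> y \<le> rt p (n + 1) \<Longrightarrow> s * poly p x > s * poly p y"
    "\<And>x. rt p n \<le> x \<Longrightarrow> x < l \<Longrightarrow> s * poly (pderiv p) x > 0"
    "\<And>x. l < x \<Longrightarrow> x \<le> rt p (n + 1) \<Longrightarrow> s * poly (pderiv p) x < 0"
proof -
  have N: "N \<ge> 1" using n by auto
  note D = real_rooted_pderiv[OF rr deg N]
  have dD: "degree (pderiv p) = N - 1" using deg by (simp add: degree_pderiv)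
  have lD: "lead_coeff (pderiv p) > 0" using lc N deg dD by (simp add: coeff_pderiv)
  show "s * poly p x > 0" if "rt p n < x" "x < rt p (n + 1)" for x
    using real_rooted_sign[OF rr lc, of n x] that n deg by (auto simp: s_def)
  show up: "s * poly (pderiv p) x > 0" if "rt p n \<le> x" "x < l" for x
  proof -
    have "(-1) ^ (degree (pderiv p) - (n - 1)) * poly (pderiv p) x > 0"
    proof (rule real_rooted_sign[OF D(1) lD])
      show "rt (pderiv p) (n - 1) < x" if "n - 1 \<ge> 1"
      proof -
        have "n - 1 \<in> {1..N-1}" using that n by auto
        from D(2)[OF this] show ?thesis using n that \<open>rt p n \<le> x\<close> by simp
      qed
    qed (use n dD that in \<open>auto simp: l_def\<close>)
    moreover have "degree (pderiv p) - (n - 1) = N - n" using n dD by auto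
    ultimately show ?thesis by (simp add: s_def)
  qed
  show down: "s * poly (pderiv p) x < 0" if "l < x" "x \<le> rt p (n + 1)" for x
  proof -
    have "(-1) ^ (degree (pderiv p) - n) * poly (pderiv p) x > 0"
    proof (rule real_rooted_sign[OF D(1) lD])
      show "x < rt (pderiv p) (n + 1)" if "n < degree (pderiv p)"
      proof -
        have "n + 1 \<in> {1..N-1}" using that n dD by auto
        from D(2)[OF this] show ?thesis using \<open>x \<le> rt p (n + 1)\<close> by simp
      qed
    qed (use n dD that in \<open>auto simp: l_def\<close>)
    moreover have "N - n = Suc (degree (pderiv p) - n)" using n dD by auto
    ultimately show ?thesis by (simp add: s_def)
  qed
  have mvt: "\<exists>u. x < u \<and> u < y \<and> s * poly p y - s * poly p x = (y - x) * (s * poly (pderiv p) u)" if "x < y" for x y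
    using poly_MVT[OF that, of p] by (metis (no_types, opaque_lifting) mult.left_commute right_diff_distrib)
  have ln: "rt p n < l" "l < rt p (n + 1)" using D(2)[OF n] by (auto simp: l_def)
  show "s * poly p x < s * poly p y" if "rt p n \<le> x" "x < y" "y \<le> l" for x y
  proof -
    obtain u where u: "x < u" "u < y" "s * poly p y - s * poly p x = (y - x) * (s * poly (pderiv p) u)"
      using mvt[OF \<open>x < y\<close>] by blast
    have "(y - x) * (s * poly (pderiv p) u) > 0" by (rule mult_pos_pos) (use u that up[of u] in auto)
    then show ?thesis using u(3) by linarith
  qed
  show "s * poly p x > s * poly p y" if "l \<le> x" "x < y" "y \<le> rt p (n + 1)" for x y
  proof -
    obtain u where u: "x < u" "u < y" "s * poly p y - s * poly p x = (y - x) * (s * poly (pderiv p) u)"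
      using mvt[OF \<open>x < y\<close>] by blast
    have "(y - x) * (s * poly (pderiv p) u) < 0" by (rule mult_pos_neg) (use u that down[of u] in auto)
    then show ?thesis using u(3) by linarith
  qed
qed

section \<open>Jacobi matrices and the periodic recurrence\<close>

definition lagrange_basis :: "(nat \<Rightarrow> real) \<Rightarrow> nat set \<Rightarrow> nat \<Rightarrow> real poly" where
  "lagrange_basis y I i = (\<Prod>j\<in>I - {i}. smult (1 / (y i - y j)) [:- y j, 1:])"

lemma poly_lagrange_basis:
  assumes "finite I" "inj_on y I" "i \<in> I" "j \<in> I"
  shows "poly (lagrange_basis y I i) (y j) = (if i = j then 1 else 0)"
proof (cases "i = j")
  case True
  have "poly (smult (1 / (y i - y k)) [:- y k, 1:]) (y j) = 1" if "k \<in> I - {i}" for k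
  proof -
    have "y i \<noteq> y k" using assms that by (auto dest: inj_onD)
    then show ?thesis using True by (simp add: divide_simps)
  qed
  then show ?thesis using True by (simp add: lagrange_basis_def poly_prod del: poly_smult)
next
  case False
  then have "j \<in> I - {i}" using assms by auto
  then have "poly (lagrange_basis y I i) (y j) = 0"
    unfolding lagrange_basis_def poly_prod using assms(1) by (intro prod_zero) auto
  then show ?thesis using False by simp
qed

lemma degree_lagrange_basis:
  assumes "finite I" "i \<in> I" shows "degree (lagrange_basis y I i) \<le> card I - 1"
proof -
  have "degree (lagrange_basis y I i) \<le> (\<Sum>j\<in>I - {i}. degree (smult (1 / (y i - y j)) [:- y j, 1:]))"
    unfolding lagrange_basis_def using degree_prod_sum_le[of "I - {i}" "\<lambda>j. smult (1 / (y i - y j)) [:- y j, 1:]"] assms by (simp add: o_def)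
  also have "\<dots> \<le> (\<Sum>j\<in>I - {i}. 1)" by (intro sum_mono) simp
  finally show ?thesis using assms by simp
qed

lemma coeff_lagrange_basis:
  assumes "finite I" "i \<in> I"
  shows "coeff (lagrange_basis y I i) (card I - 1) = (\<Prod>j\<in>I - {i}. 1 / (y i - y j))"
proof -
  have "coeff (\<Prod>j\<in>K. smult (c j) [:- y j, 1:]) (card K) = (\<Prod>j\<in>K. c j)" if "finite K" for K and c :: "nat \<Rightarrow> real"
  proof -
    have e: "(\<Prod>j\<in>K. smult (c j) [:- y j, 1:]) = smult (\<Prod>j\<in>K. c j) (\<Prod>j\<in>K. [:- y j, 1:])"
      by (rule prod_smult)
    have "degree (\<Prod>j\<in>K. [:- y j, 1:]) = card K" by (subst degree_prod_eq_sum_degree) auto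
    moreover have "lead_coeff (\<Prod>j\<in>K. [:- y j, 1:]) = 1" by (subst lead_coeff_prod) simp
    ultimately show ?thesis unfolding e by simp
  qed
  from this[of "I - {i}" "\<lambda>j. 1 / (y i - y j)"] show ?thesis using assms
    unfolding lagrange_basis_def by (simp only: finite_Diff card_Diff_singleton)
qed

lemma lagrange_interpolation:
  assumes I: "finite I" "inj_on y I" and p: "degree p < card I"
  shows "p = (\<Sum>i\<in>I. smult (poly p (y i)) (lagrange_basis y I i))"
proof (rule poly_eqI_degree)
  let ?q = "\<Sum>i\<in>I. smult (poly p (y i)) (lagrange_basis y I i)"
  have c: "card (y ` I) = card I" using I(2) by (rule card_image)
  show "card (y ` I) > degree p" using p c by simp
  have "degree ?q \<le> card I - 1"
    by (intro degree_sum_le order_trans[OF degree_smult_le] degree_lagrange_basis I(1))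
  then show "card (y ` I) > degree ?q" using p c by linarith
  fix x assume "x \<in> y ` I"
  then obtain j where j: "j \<in> I" "x = y j" by blast
  have "poly ?q x = (\<Sum>i\<in>I. poly p (y i) * (if i = j then 1 else 0))"
    unfolding poly_sum j(2) by (intro sum.cong refl) (simp add: poly_lagrange_basis[OF I _ j(1)])
  also have "\<dots> = (\<Sum>i\<in>I. if i = j then poly p (y i) else 0)" by (intro sum.cong) auto
  also have "\<dots> = poly p x" using j I(1) by (simp add: sum.delta)
  finally show "poly p x = poly ?q x" by simp
qed

text \<open>In the Lagrange formula for the leading coefficient, \<open>\<Sum>\<^sub>i p(y\<^sub>i) / \<Prod>\<^sub>j\<^sub>\<noteq>\<^sub>i (y\<^sub>i - y\<^sub>j)\<close>, numerators and denominators alternate in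
the same way, so all the summands are positive.\<close>

lemma alternating_lead_coeff_pos:
  assumes "k \<ge> 1" and less: "\<And>i j. 1 \<le> i \<Longrightarrow> i < j \<Longrightarrow> j \<le> k \<Longrightarrow> y i < y j"
    and deg: "degree p < k" and alt: "\<And>i. i \<in> {1..k} \<Longrightarrow> (-1) ^ (k - i) * poly p (y i) > (0::real)"
  shows "coeff p (k - 1) > 0"
proof -
  have inj: "inj_on y {1..k}" by (rule inj_on_increasing) (use less in auto)
  have "coeff p (k - 1) = (\<Sum>i\<in>{1..k}. poly p (y i) * coeff (lagrange_basis y {1..k} i) (k - 1))"
    by (subst lagrange_interpolation[OF _ inj, of p]) (use deg in \<open>simp_all add: coeff_sum\<close>)
  also have "\<dots> > 0"
  proof (rule sum_pos)
    fix i assume i: "i \<in> {1..k}"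
    have "coeff (lagrange_basis y {1..k} i) (k - 1) = (\<Prod>j\<in>{1..k} - {i}. 1 / (y i - y j))"
      using coeff_lagrange_basis[of "{1..k}" i y] i by simp
    also have "{1..k} - {i} = {1..<i} \<union> {i+1..k}" using i by auto
    also have "(\<Prod>j\<in>{1..<i} \<union> {i+1..k}. 1 / (y i - y j)) = (\<Prod>j\<in>{1..<i}. 1 / (y i - y j)) * (\<Prod>j\<in>{i+1..k}. - (1 / (y j - y i)))"
      by (subst prod.union_disjoint) (auto simp: minus_divide_right)
    also have "(\<Prod>j\<in>{i+1..k}. - (1 / (y j - y i))) = (-1) ^ (k - i) * (\<Prod>j\<in>{i+1..k}. 1 / (y j - y i))"
      using prod_uminus[of "\<lambda>j. 1 / (y j - y i)" "{i+1..k}"] by simp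
    finally have e: "poly p (y i) * coeff (lagrange_basis y {1..k} i) (k - 1) =
       ((-1) ^ (k - i) * poly p (y i)) * ((\<Prod>j\<in>{1..<i}. 1 / (y i - y j)) * (\<Prod>j\<in>{i+1..k}. 1 / (y j - y i)))"
      by simp
    have "(\<Prod>j\<in>{1..<i}. 1 / (y i - y j)) > 0" using less i by (intro prod_pos) auto
    moreover have "(\<Prod>j\<in>{i+1..k}. 1 / (y j - y i)) > 0" using less i by (intro prod_pos) auto
    ultimately show "poly p (y i) * coeff (lagrange_basis y {1..k} i) (k - 1) > 0"
      unfolding e using alt[OF i] by simp
  qed (use assms(1) in auto)
  finally show ?thesis .
qed

text \<open>The monic polynomials of a Jacobi matrix with squared off-diagonal entries \<open>al\<close> and diagonal entries \<open>be\<close>. The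
index is shifted so as to agree with that of \<open>\<phi>\<^sub>n\<close>: the degree is one less than the index.\<close>

fun jmonic :: "(nat \<Rightarrow> real) \<Rightarrow> (nat \<Rightarrow> real) \<Rightarrow> nat \<Rightarrow> real poly" where
  "jmonic al be 0 = 0"
| "jmonic al be (Suc 0) = 1"
| "jmonic al be (Suc (Suc n)) = [:- be (Suc n), 1:] * jmonic al be (Suc n) - smult (al n) (jmonic al be n)"

lemma jmonic_coeffs:
  "degree (jmonic al be (Suc n)) \<le> n \<and> coeff (jmonic al be (Suc n)) n = 1 \<and>
   (n \<ge> 1 \<longrightarrow> coeff (jmonic al be (Suc n)) (n - 1) = - (\<Sum>i=1..n. be i))"
proof (induction n rule: less_induct)
  case (less n)
  show ?case
  proof (cases n)
    case 0 then show ?thesis by simp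
  next
    case (Suc m)
    have IH: "degree (jmonic al be (Suc m)) \<le> m" "coeff (jmonic al be (Suc m)) m = 1"
      "m \<ge> 1 \<longrightarrow> coeff (jmonic al be (Suc m)) (m - 1) = - (\<Sum>i=1..m. be i)" using less[of m] Suc by auto
    have d: "degree (jmonic al be m) \<le> m - 1" "m \<ge> 1 \<Longrightarrow> degree (jmonic al be m) < m"
      using less[of "m - 1"] Suc by (cases m; force)+
    have c0: "coeff (jmonic al be (Suc m)) k = 0" if "k > m" for k using IH(1) that by (simp add: coeff_eq_0)
    have c1: "coeff (jmonic al be m) k = 0" if "k \<ge> m" for k
      using d(2) that by (cases "m = 0") (auto simp: coeff_eq_0)
    have "degree (jmonic al be (Suc n)) \<le> n"
    proof (rule degree_le, intro allI impI)
      fix i assume "n < i"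
      then show "coeff (jmonic al be (Suc n)) i = 0"
        using Suc c0[of i] c0[of "i - 1"] c1[of i] by (cases i) simp_all
    qed
    moreover have "coeff (jmonic al be (Suc n)) n = 1" using Suc c0[of n] c1[of n] IH(2) by simp
    moreover have "coeff (jmonic al be (Suc n)) m = - (\<Sum>i=1..n. be i)"
      using Suc c1[of m] IH by (cases m) simp_all
    ultimately show ?thesis using Suc by simp
  qed
qed

lemma degree_jmonic: "degree (jmonic al be (Suc n)) = n"
  using jmonic_coeffs[of al be n] le_degree[of "jmonic al be (Suc n)" n] by fastforce

lemma lead_coeff_jmonic: "coeff (jmonic al be (Suc n)) n = 1"
  using jmonic_coeffs[of al be n] by simp

lemma jmonic_cong:
  "(\<And>i. 1 \<le> i \<Longrightarrow> i + 1 < n \<Longrightarrow> al i = al' i) \<Longrightarrow> (\<And>i. 1 \<le> i \<Longrightarrow> i < n \<Longrightarrow> be i = be' i) \<Longrightarrow>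
   jmonic al be n = jmonic al' be' n"
proof (induction n rule: less_induct)
  case (less n)
  consider "n = 0" | "n = Suc 0" | m where "n = Suc (Suc m)" by (metis not0_implies_Suc)
  then show ?case
  proof cases
    case 3
    have "jmonic al be (Suc m) = jmonic al' be' (Suc m)" "jmonic al be m = jmonic al' be' m"
      using 3 by (intro less; simp add: less.prems)+
    moreover have "smult (al m) (jmonic al' be' m) = smult (al' m) (jmonic al' be' m)"
      using less.prems(1)[of m] 3 by (cases m) auto
    ultimately show ?thesis using 3 less.prems(2)[of "Suc m"] by simp
  qed auto
qed

declare jmonic.simps(3) [simp del]

text \<open>The sign condition is equivalent to the interlacing of the roots of \<open>A\<close> and \<open>B\<close>, but is open and easy to verify.\<close>

definition interlaced :: "nat \<Rightarrow> real poly \<Rightarrow> real poly \<Rightarrow> bool" where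
  "interlaced k A B \<longleftrightarrow> degree A = Suc k \<and> coeff A (Suc k) = 1 \<and> degree B = k \<and> coeff B k = 1 \<and>
     real_rooted B \<and> (\<forall>i\<in>{1..k}. (-1) ^ (Suc k - i) * poly A (rt B i) > 0)"

lemma interlaced_jmonic:
  assumes "\<And>i. 1 \<le> i \<Longrightarrow> i \<le> k \<Longrightarrow> al i > 0"
  shows "interlaced k (jmonic al be (Suc (Suc k))) (jmonic al be (Suc k))"
  using assms
proof (induction k)
  case 0
  show ?case unfolding interlaced_def
    using degree_jmonic[of al be 1] lead_coeff_jmonic[of al be 1] by (simp add: real_rooted_def)
next
  case (Suc k)
  let ?A = "jmonic al be (Suc (Suc k))" and ?B = "jmonic al be (Suc k)" and ?A' = "jmonic al be (Suc (Suc (Suc k)))"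
  have IH: "interlaced k ?A ?B" using Suc by auto
  have B: "degree ?B = k" "lead_coeff ?B > 0" "real_rooted ?B" using IH by (auto simp: interlaced_def)
  have A: "degree ?A = Suc k" "lead_coeff ?A > 0" using IH by (auto simp: interlaced_def)
  note AR = alternating_real_rooted[OF A(1) _ A(2), of "rt ?B"]
  have rA: "real_rooted ?A"
    by (rule AR(1)) (use rt_less[OF B(3)] B(1) IH in \<open>auto simp: interlaced_def\<close>)
  have int: "rt ?A n < rt ?B n \<and> rt ?B n < rt ?A (n + 1)" if "n \<in> {1..k}" for n
    by (rule AR(2)) (use rt_less[OF B(3)] B(1) IH that in \<open>auto simp: interlaced_def\<close>)
  have sgn: "(-1) ^ (Suc (Suc k) - j) * poly ?A' (rt ?A j) > 0" if j: "j \<in> {1..Suc k}" for j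
  proof -
    have "(-1) ^ (degree ?B - (j - 1)) * poly ?B (rt ?A j) > 0"
    proof (rule real_rooted_sign[OF B(3,2)])
      show "j - 1 \<le> degree ?B" using j B(1) by auto
      show "rt ?B (j - 1) < rt ?A j" if "1 \<le> j - 1" using int[of "j - 1"] j that by auto
      show "rt ?A j < rt ?B (j - 1 + 1)" if "j - 1 < degree ?B" using int[of j] j that B(1) by auto
    qed
    moreover have "degree ?B - (j - 1) = Suc k - j" using j B(1) by auto
    ultimately have p: "(-1) ^ (Suc k - j) * poly ?B (rt ?A j) > 0" by simp
    have "poly ?A (rt ?A j) = 0" using rt_root[OF rA] A(1) j by auto
    then have "poly ?A' (rt ?A j) = - al (Suc k) * poly ?B (rt ?A j)" by (simp add: jmonic.simps(3)[of al be "Suc k"])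
    moreover have "Suc (Suc k) - j = Suc (Suc k - j)" using j by auto
    ultimately have "(-1) ^ (Suc (Suc k) - j) * poly ?A' (rt ?A j) = al (Suc k) * ((-1) ^ (Suc k - j) * poly ?B (rt ?A j))"
      by simp
    also have "\<dots> > 0" by (rule mult_pos_pos) (use Suc.prems[of "Suc k"] p in auto)
    finally show ?thesis .
  qed
  show ?case unfolding interlaced_def
    using degree_jmonic[of al be "Suc (Suc k)"] lead_coeff_jmonic[of al be "Suc (Suc k)"]
      degree_jmonic[of al be "Suc k"] lead_coeff_jmonic[of al be "Suc k"] rA sgn by (simp)
qed

text \<open>One step of the inverse problem. In \<open>A = (\<lambda> - \<beta>) B - \<alpha> C\<close> with monic \<open>A\<close>, \<open>B\<close>, \<open>C\<close> of degrees \<open>k + 1\<close>, \<open>k\<close>, \<open>k - 1\<close>, comparing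
coefficients of degree \<open>k\<close> gives \<open>\<beta>\<close>; then \<open>\<alpha>\<close> is the leading coefficient of the remainder and \<open>C\<close> the normalized
remainder. All of these are rational in the coefficients of \<open>A\<close> and \<open>B\<close>.\<close>

definition jstep_b :: "nat \<Rightarrow> real poly \<Rightarrow> real poly \<Rightarrow> real" where
  "jstep_b k A B = coeff B (k - 1) - coeff A k"

definition jstep_rem :: "nat \<Rightarrow> real poly \<Rightarrow> real poly \<Rightarrow> real poly" where
  "jstep_rem k A B = [:- jstep_b k A B, 1:] * B - A"

definition jstep_a :: "nat \<Rightarrow> real poly \<Rightarrow> real poly \<Rightarrow> real" where
  "jstep_a k A B = coeff (jstep_rem k A B) (k - 1)"

definition jstep_poly :: "nat \<Rightarrow> real poly \<Rightarrow> real poly \<Rightarrow> real poly" where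
  "jstep_poly k A B = smult (1 / jstep_a k A B) (jstep_rem k A B)"

text \<open>Iterating the step recovers the entries of the Jacobi matrix from the bottom right corner upwards.\<close>

fun jal :: "nat \<Rightarrow> real poly \<Rightarrow> real poly \<Rightarrow> nat \<Rightarrow> real" where
  "jal 0 A B i = 0"
| "jal (Suc k) A B i = (if i = Suc k then jstep_a (Suc k) A B else jal k B (jstep_poly (Suc k) A B) i)"

fun jbe :: "nat \<Rightarrow> real poly \<Rightarrow> real poly \<Rightarrow> nat \<Rightarrow> real" where
  "jbe 0 A B i = - coeff A 0"
| "jbe (Suc k) A B i = (if i = Suc (Suc k) then jstep_b (Suc k) A B else jbe k B (jstep_poly (Suc k) A B) i)"

text \<open>At the roots of \<open>B\<close> the remainder equals \<open>-A\<close>, whose signs alternate; so its leading coefficient is positive, which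
makes the division possible, and it interlaces with \<open>B\<close> again, which lets the step be repeated.\<close>

lemma interlaced_step:
  assumes I: "interlaced (Suc k) A B"
  shows "jstep_a (Suc k) A B > 0" "interlaced k B (jstep_poly (Suc k) A B)"
    "A = [:- jstep_b (Suc k) A B, 1:] * B - smult (jstep_a (Suc k) A B) (jstep_poly (Suc k) A B)"
proof -
  let ?b = "jstep_b (Suc k) A B" and ?R = "jstep_rem (Suc k) A B" and ?a = "jstep_a (Suc k) A B" and ?C = "jstep_poly (Suc k) A B"
  have A: "degree A = Suc (Suc k)" "coeff A (Suc (Suc k)) = 1" and B: "degree B = Suc k" "coeff B (Suc k) = 1" "real_rooted B"
    and alt: "\<And>i. i \<in> {1..Suc k} \<Longrightarrow> (-1) ^ (Suc (Suc k) - i) * poly A (rt B i) > 0"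
    using I by (auto simp: interlaced_def)
  have degR: "degree ?R \<le> k"
  proof (rule degree_le, intro allI impI)
    fix i assume "k < i"
    then consider "i = Suc k" | "i = Suc (Suc k)" | j where "i = Suc j" "j > Suc k" by (metis Suc_lessI gr0_implies_Suc not_less_eq zero_less_Suc less_trans_Suc less_imp_Suc_add Suc_lessE)
    then show "coeff ?R i = 0"
    proof cases
      case 1 then show ?thesis using B by (simp add: jstep_rem_def jstep_b_def)
    next
      case 2 then show ?thesis using A B by (simp add: jstep_rem_def coeff_eq_0)
    next
      case 3 then show ?thesis using A B by (simp add: jstep_rem_def coeff_eq_0)
    qed
  qed
  have Rrt: "poly ?R (rt B i) = - poly A (rt B i)" if "i \<in> {1..Suc k}" for i
    using rt_root[OF B(3), of i] that B(1) by (simp add: jstep_rem_def)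
  have altR: "(-1) ^ (Suc k - i) * poly ?R (rt B i) > 0" if "i \<in> {1..Suc k}" for i
  proof -
    have "Suc (Suc k) - i = Suc (Suc k - i)" using that by auto
    then show ?thesis using alt[OF that] Rrt[OF that] by simp
  qed
  have Bless: "\<And>i j. 1 \<le> i \<Longrightarrow> i < j \<Longrightarrow> j \<le> Suc k \<Longrightarrow> rt B i < rt B j" using rt_less[OF B(3)] B(1) by simp
  have "coeff ?R (Suc k - 1) > 0"
    by (rule alternating_lead_coeff_pos[where y = "rt B"]) (use Bless altR degR in auto)
  then show a: "?a > 0" by (simp add: jstep_a_def)
  have ac: "coeff ?R k = ?a" by (simp add: jstep_a_def)
  have RC: "?R = smult ?a ?C" using a by (simp add: jstep_poly_def)
  have "degree ?R = k" using degR ac a le_degree[of ?R k] by force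
  then have C: "degree ?C = k" "coeff ?C k = 1" using a ac by (auto simp: jstep_poly_def)
  have "\<exists>x. rt B i < x \<and> x < rt B (i + 1) \<and> poly ?C x = 0" if "i \<in> {1..k}" for i
  proof -
    have p: "(-1) ^ (Suc k - i) * poly ?R (rt B i) > 0" "(-1) ^ (Suc k - Suc i) * poly ?R (rt B (Suc i)) > 0"
      using altR[of i] altR[of "Suc i"] that by auto
    have "Suc k - i = Suc (Suc k - Suc i)" using that by auto
    then have "poly ?R (rt B i) * poly ?R (rt B (Suc i)) < 0"
      using p by (cases "even (Suc k - Suc i)") (auto simp: mult_neg_pos mult_pos_neg)
    then show ?thesis using poly_IVT[OF Bless[of i "Suc i"], of ?R] that a by (auto simp: jstep_poly_def)
  qed
  then obtain w where w: "\<And>i. i \<in> {1..k} \<Longrightarrow> rt B i < w i \<and> w i < rt B (i + 1) \<and> poly ?C (w i) = 0" by metis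
  have wless: "w i < w j" if "1 \<le> i" "i < j" "j \<le> k" for i j
  proof -
    have "rt B (i + 1) \<le> rt B j" by (rule rt_le[OF B(3)]) (use that B in auto)
    moreover have "w i < rt B (i + 1)" "rt B j < w j" using w[of i] w[of j] that by auto
    ultimately show ?thesis by linarith
  qed
  have C0: "?C \<noteq> 0" using C by auto
  have rC: "real_rooted ?C" by (rule real_rootedI(1)[OF C0 C(1), of w]) (use w wless in auto)
  have rtC: "rt ?C i = w i" if "i \<in> {1..k}" for i
    by (rule real_rootedI(2)[OF C0 C(1), of w]) (use w wless that in auto)
  have "(-1) ^ (Suc k - i) * poly B (rt ?C i) > 0" if "i \<in> {1..k}" for i
  proof -
    have "(-1) ^ (degree B - i) * poly B (w i) > 0"
      by (rule real_rooted_sign[OF B(3)]) (use w[OF that] B that in auto)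
    then show ?thesis using rtC[OF that] B(1) by simp
  qed
  then show "interlaced k B ?C" using B C rC by (simp add: interlaced_def)
  show "A = [:- ?b, 1:] * B - smult ?a ?C" unfolding RC[symmetric] by (simp add: jstep_rem_def)
qed

lemma jmonic_inverse:
  assumes "interlaced k A B"
  shows "(\<forall>i\<in>{1..k}. jal k A B i > 0) \<and> jmonic (jal k A B) (jbe k A B) (Suc (Suc k)) = A \<and>
         jmonic (jal k A B) (jbe k A B) (Suc k) = B"
  using assms
proof (induction k arbitrary: A B)
  case 0
  then have A: "degree A = 1" "coeff A (Suc 0) = 1" and B: "degree B = 0" "coeff B 0 = 1" by (auto simp: interlaced_def)
  have "B = 1" using B by (metis degree_eq_zeroE coeff_pCons_0 one_pCons)
  moreover have "A = [:coeff A 0, 1:]"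
    by (rule poly_eqI) (use A in \<open>auto simp: coeff_pCons coeff_eq_0 split: nat.splits\<close>)
  ultimately show ?case by (simp add: jmonic.simps(3))
next
  case (Suc k)
  let ?C = "jstep_poly (Suc k) A B"
  note st = interlaced_step[OF Suc.prems]
  have IH: "\<forall>i\<in>{1..k}. jal k B ?C i > 0" "jmonic (jal k B ?C) (jbe k B ?C) (Suc (Suc k)) = B"
     "jmonic (jal k B ?C) (jbe k B ?C) (Suc k) = ?C" using Suc.IH[OF st(2)] by auto
  have e: "jmonic (jal (Suc k) A B) (jbe (Suc k) A B) n = jmonic (jal k B ?C) (jbe k B ?C) n" if "n \<le> Suc (Suc k)" for n
    by (rule jmonic_cong) (use that in auto)
  have "jmonic (jal (Suc k) A B) (jbe (Suc k) A B) (Suc (Suc (Suc k))) = A"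
    unfolding jmonic.simps(3)[of _ _ "Suc k"] e[OF order_refl] e[of "Suc k", simplified] IH
    by (simp only: jal.simps jbe.simps if_True simp_thms st(3)[symmetric])
  moreover have "jmonic (jal (Suc k) A B) (jbe (Suc k) A B) (Suc (Suc k)) = B" using e[OF order_refl] IH(2) by simp
  moreover have "\<forall>i\<in>{1..Suc k}. jal (Suc k) A B i > 0" using IH(1) st(1) by auto
  ultimately show ?case by (intro conjI)
qed

lemma jmonic_unique:
  assumes "\<And>i. 1 \<le> i \<Longrightarrow> i \<le> k \<Longrightarrow> al i \<noteq> 0"
  shows "(\<forall>i\<in>{1..k}. jal k (jmonic al be (Suc (Suc k))) (jmonic al be (Suc k)) i = al i) \<and>
     (\<forall>i\<in>{1..Suc k}. jbe k (jmonic al be (Suc (Suc k))) (jmonic al be (Suc k)) i = be i)"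
  using assms
proof (induction k)
  case 0 then show ?case by (simp add: jmonic.simps(3))
next
  case (Suc k)
  let ?A = "jmonic al be (Suc (Suc (Suc k)))" and ?B = "jmonic al be (Suc (Suc k))"
  have "coeff ?A (Suc k) = - (\<Sum>i=1..Suc (Suc k). be i)" using jmonic_coeffs[of al be "Suc (Suc k)"] by (simp)
  moreover have "coeff ?B k = - (\<Sum>i=1..Suc k. be i)" using jmonic_coeffs[of al be "Suc k"] by (simp)
  ultimately have b: "jstep_b (Suc k) ?A ?B = be (Suc (Suc k))" by (simp add: jstep_b_def)
  have R: "jstep_rem (Suc k) ?A ?B = smult (al (Suc k)) (jmonic al be (Suc k))"
    unfolding jstep_rem_def b by (simp add: jmonic.simps(3)[of al be "Suc k"])
  have a: "jstep_a (Suc k) ?A ?B = al (Suc k)" unfolding jstep_a_def R using lead_coeff_jmonic[of al be k] by simp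
  have C: "jstep_poly (Suc k) ?A ?B = jmonic al be (Suc k)" unfolding jstep_poly_def R a using Suc.prems[of "Suc k"] by simp
  have IH: "(\<forall>i\<in>{1..k}. jal k ?B (jmonic al be (Suc k)) i = al i) \<and> (\<forall>i\<in>{1..Suc k}. jbe k ?B (jmonic al be (Suc k)) i = be i)"
    using Suc by auto
  show ?case using IH a b C by (auto simp: le_Suc_eq)
qed

lemma ranalytic_jacobi_inverse:
  assumes "interlaced k (A z0) (B z0)" "ranalytic_poly A z0" "ranalytic_poly B z0"
  shows "ranalytic (\<lambda>z. jal k (A z) (B z) i) z0 \<and> ranalytic (\<lambda>z. jbe k (A z) (B z) i) z0"
  using assms
proof (induction k arbitrary: A B)
  case 0
  then show ?case by (auto intro!: ranalytic_const ranalytic_uminus ranalytic_polyD)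
next
  case (Suc k)
  have b: "ranalytic (\<lambda>z. jstep_b (Suc k) (A z) (B z)) z0"
    unfolding jstep_b_def by (intro ranalytic_diff ranalytic_polyD Suc.prems)
  have R: "ranalytic_poly (\<lambda>z. jstep_rem (Suc k) (A z) (B z)) z0" unfolding jstep_rem_def
    by (intro ranalytic_poly_diff ranalytic_poly_mult ranalytic_poly_pCons ranalytic_uminus ranalytic_poly_const b Suc.prems)
  have a: "ranalytic (\<lambda>z. jstep_a (Suc k) (A z) (B z)) z0" unfolding jstep_a_def by (rule ranalytic_polyD[OF R])
  note st = interlaced_step[OF Suc.prems(1)]
  have C: "ranalytic_poly (\<lambda>z. jstep_poly (Suc k) (A z) (B z)) z0" unfolding jstep_poly_def
    by (intro ranalytic_poly_smult ranalytic_divide ranalytic_const a R) (use st(1) in simp)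
  note IH = Suc.IH[OF st(2) Suc.prems(3) C]
  show ?case using a b IH by (cases "i = Suc k"; cases "i = Suc (Suc k)") simp_all
qed

lemma acoeff_nat: "1 \<le> n \<Longrightarrow> n \<le> N \<Longrightarrow> acoeff N x (int n) = exp (x n)"
  by (simp add: acoeff_def periodic_def nat_diff_distrib' mod_pos_pos_trivial)

lemma bcoeff_nat: "1 \<le> n \<Longrightarrow> n \<le> N \<Longrightarrow> bcoeff N b (int n) = b n"
  by (simp add: bcoeff_def periodic_def nat_diff_distrib' mod_pos_pos_trivial)

lemma acoeff_pos: "acoeff N x n > 0"
  by (simp add: acoeff_def periodic_def)

lemma acoeff_period: "acoeff N x (int N) = acoeff N x 0"
  by (cases "N = 0") (simp_all add: acoeff_def periodic_def zmod_minus1)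

text \<open>Clearing the denominators \<open>a\<^sub>1 \<dots> a\<^sub>n\<^sub>-\<^sub>1\<close> turns the recurrence for \<open>\<phi>\<close> into that of the monic polynomials.\<close>

lemma phi_eq_jmonic:
  assumes "n \<le> N + 1"
  shows "smult (\<Prod>i=1..<n. exp (x i)) (phi N (x, b) n) = jmonic (\<lambda>i. exp (2 * x i)) b n"
  using assms
proof (induction n rule: induct_nat_012)
  case 0 then show ?case by (simp add: phi_def)
next
  case 1 then show ?case by (simp add: phi_def)
next
  case (ge2 n)
  let ?a = "acoeff N x" and ?p = "phi N (x, b)"
  have a1: "?a (1 + int n) = exp (x (Suc n))" and b1: "bcoeff N b (1 + int n) = b (Suc n)"
    using acoeff_nat[of "Suc n" N x] bcoeff_nat[of "Suc n" N b] ge2.prems by simp_all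
  have rec: "?p (Suc (Suc n)) = smult (1 / exp (x (Suc n))) ([:- b (Suc n), 1:] * ?p (Suc n) - smult (?a (int n)) (?p n))"
    by (simp add: phi_def a1 b1 add.commute)
  have P: "(\<Prod>i=1..<Suc (Suc n). exp (x i)) = (\<Prod>i=1..<Suc n. exp (x i)) * exp (x (Suc n))"
    by simp
  have n0: "smult ((\<Prod>i=1..<Suc n. exp (x i)) * ?a (int n)) (?p n) = smult (exp (2 * x n)) (jmonic (\<lambda>i. exp (2 * x i)) b n)"
  proof (cases "n = 0")
    case True then show ?thesis by (simp add: phi_def)
  next
    case False
    then have a: "?a (int n) = exp (x n)" using ge2.prems by (intro acoeff_nat) auto
    have "(\<Prod>i=1..<Suc n. exp (x i)) = (\<Prod>i=1..<n. exp (x i)) * exp (x n)" using False by simp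
    then have "smult ((\<Prod>i=1..<Suc n. exp (x i)) * ?a (int n)) (?p n) = smult (exp (x n) * exp (x n)) (smult (\<Prod>i=1..<n. exp (x i)) (?p n))"
      unfolding a by (simp add: ac_simps)
    also have "exp (x n) * exp (x n) = exp (2 * x n)" by (simp flip: exp_add)
    finally have e: "smult ((\<Prod>i=1..<Suc n. exp (x i)) * ?a (int n)) (?p n) = smult (exp (2 * x n)) (smult (\<Prod>i=1..<n. exp (x i)) (?p n))" .
    have "smult (\<Prod>i=1..<n. exp (x i)) (?p n) = jmonic (\<lambda>i. exp (2 * x i)) b n"
      by (rule ge2.IH(1)) (use ge2.prems in simp)
    then show ?thesis unfolding e by (rule arg_cong)
  qed
  have "smult (\<Prod>i=1..<Suc (Suc n). exp (x i)) (?p (Suc (Suc n))) =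
      smult (\<Prod>i=1..<Suc n. exp (x i)) ([:- b (Suc n), 1:] * ?p (Suc n) - smult (?a (int n)) (?p n))"
    unfolding rec P by simp
  also have "\<dots> = [:- b (Suc n), 1:] * smult (\<Prod>i=1..<Suc n. exp (x i)) (?p (Suc n)) - smult ((\<Prod>i=1..<Suc n. exp (x i)) * ?a (int n)) (?p n)"
    by (simp add: smult_diff_right)
  also have "\<dots> = jmonic (\<lambda>i. exp (2 * x i)) b (Suc (Suc n))"
    unfolding n0 using ge2 by (simp add: jmonic.simps(3))
  finally show ?case .
qed

text \<open>The Wronskian of two solutions is constant up to the factor \<open>a\<^sub>n\<close>.\<close>

lemma wronskian:
  assumes "\<And>n. a n \<noteq> 0"
  shows "smult (a (int n)) (jacobi_poly a b 0 1 (Suc n) * jacobi_poly a b 1 0 n - jacobi_poly a b 0 1 n * jacobi_poly a b 1 0 (Suc n)) = [:a 0:]"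
proof (induction n)
  case 0 then show ?case by simp
next
  case (Suc n)
  let ?p = "jacobi_poly a b 0 1" and ?t = "jacobi_poly a b 1 0"
  have rec: "smult (a (int (Suc n))) (?p (Suc (Suc n))) = [:- b (int n + 1), 1:] * ?p (Suc n) - smult (a (int n)) (?p n)"
    "smult (a (int (Suc n))) (?t (Suc (Suc n))) = [:- b (int n + 1), 1:] * ?t (Suc n) - smult (a (int n)) (?t n)"
    using assms[of "int n + 1"] by (simp_all add: add.commute)
  have "smult (a (int (Suc n))) (?p (Suc (Suc n)) * ?t (Suc n) - ?p (Suc n) * ?t (Suc (Suc n)))
      = smult (a (int (Suc n))) (?p (Suc (Suc n))) * ?t (Suc n) - ?p (Suc n) * smult (a (int (Suc n))) (?t (Suc (Suc n)))"
    by (simp add: smult_diff_right del: jacobi_poly.simps)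
  also have "\<dots> = smult (a (int n)) (?p (Suc n) * ?t n - ?p n * ?t (Suc n))"
    unfolding rec by (simp add: algebra_simps smult_diff_right del: jacobi_poly.simps)
  finally show ?case using Suc by simp
qed

lemma degree_jacobi_poly_theta: "degree (jacobi_poly a b 1 0 (Suc (Suc n))) \<le> n"
proof (induction n rule: less_induct)
  case (less n)
  let ?t = "jacobi_poly a b 1 0"
  have d: "degree ([:- b (int m + 1), 1:] * ?t (Suc m)) \<le> m" if "m \<le> n" for m
  proof (cases m)
    case (Suc k)
    have "degree ([:- b (int m + 1), 1:] * ?t (Suc m)) \<le> 1 + degree (?t (Suc m))"
      using degree_mult_le[of "[:- b (int m + 1), 1:]" "?t (Suc m)"] by (simp del: jacobi_poly.simps)
    then show ?thesis using less[of k] Suc that by (simp del: jacobi_poly.simps)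
  qed simp
  have "degree (?t n) \<le> n"
  proof -
    consider "n = 0" | "n = Suc 0" | m where "n = Suc (Suc m)" by (metis not0_implies_Suc)
    then show ?thesis using less[of "n - 2"] by cases (simp_all del: jacobi_poly.simps(3))
  qed
  then have "degree ([:- b (int n + 1), 1:] * ?t (Suc n) - smult (a (int n)) (?t n)) \<le> n"
    using d[of n] by (intro degree_diff_le order_trans[OF degree_smult_le]) (simp_all del: jacobi_poly.simps)
  then show ?case by (simp del: mult_pCons_left)
qed

lemma ranalytic_jacobi_poly:
  assumes a: "\<And>n. ranalytic (\<lambda>z. a z n) z0" "\<And>n. a z0 n \<noteq> 0" and b: "\<And>n. ranalytic (\<lambda>z. b z n) z0"
  shows "ranalytic_poly (\<lambda>z. jacobi_poly (a z) (b z) u v n) z0"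
proof (induction n rule: induct_nat_012)
  case (ge2 n)
  show ?case unfolding jacobi_poly.simps
    by (intro ranalytic_poly_smult ranalytic_poly_diff ranalytic_poly_mult ranalytic_poly_pCons
          ranalytic_divide ranalytic_const ranalytic_uminus ranalytic_poly_const a b ge2)
qed (simp_all only: jacobi_poly.simps ranalytic_poly_const)

lemma exp_sum_prod: "finite A \<Longrightarrow> (\<Prod>i\<in>A. exp (f i)) = exp (\<Sum>i\<in>A. f i :: real)"
  by (simp add: exp_sum)

text \<open>The last part is where periodicity enters: as \<open>a\<^sub>N = a\<^sub>0\<close>, the Wronskian reads \<open>\<phi>\<^sub>N\<^sub>+\<^sub>1 \<vartheta>\<^sub>N = 1\<close> wherever \<open>\<phi>\<^sub>N\<close> vanishes.\<close>

lemma periodic_data: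
  assumes x: "x \<in> Hspace N" and b: "b \<in> Hspace N" and N: "N \<ge> 2"
  defines "A \<equiv> phi N (x, b) (N + 1)" and "B \<equiv> jmonic (\<lambda>i. exp (2 * x i)) b N" and "D \<equiv> Lyapunov N (x, b)"
  shows "A = jmonic (\<lambda>i. exp (2 * x i)) b (N + 1)" "interlaced (N - 1) A B" "coeff A (N - 1) = 0"
    "\<exists>c\<noteq>0. phi N (x, b) N = smult c B"
    "degree D = N" "coeff D N = 1/2" "coeff D (N - 1) = 0"
    "\<And>t. poly B t = 0 \<Longrightarrow> poly A t \<noteq> 0 \<and> poly D t = (poly A t + 1 / poly A t) / 2"
proof -
  obtain k where k: "N = Suc (Suc k)" using N by (metis add_2_eq_Suc le_Suc_ex)
  have sx: "(\<Sum>i=1..N. x i) = 0" and sb: "(\<Sum>i=1..N. b i) = 0" using x b by (auto simp: Hspace_def)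
  have "(\<Prod>i=1..<N+1. exp (x i)) = 1"
    using sx by (simp add: exp_sum_prod atLeastLessThanSuc_atLeastAtMost)
  then show A: "A = jmonic (\<lambda>i. exp (2 * x i)) b (N + 1)"
    using phi_eq_jmonic[of "N + 1" N x b] by (simp add: A_def)
  show "interlaced (N - 1) A B" unfolding A B_def using interlaced_jmonic[of "N - 1"  "\<lambda>i. exp (2 * x i)" b] k by simp
  show cA: "coeff A (N - 1) = 0" unfolding A using jmonic_coeffs[of "\<lambda>i. exp (2 * x i)" b N] sb k by simp
  let ?P = "\<Prod>i=1..<N. exp (x i)"
  have "?P \<noteq> 0" by simp
  moreover have pB: "smult ?P (phi N (x, b) N) = B" unfolding B_def by (rule phi_eq_jmonic) simp
  ultimately have ph: "phi N (x, b) N = smult (1 / ?P) B" by (metis (no_types, lifting) nonzero_eq_divide_eq smult_1_left smult_smult)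
  then show "\<exists>c\<noteq>0. phi N (x, b) N = smult c B" by (intro exI[of _ "1 / ?P"]) simp
  have dA: "degree A = N" "coeff A N = 1" unfolding A using degree_jmonic[of _ b N] lead_coeff_jmonic[of _ b N] by simp_all
  have dt: "degree (theta N (x, b) N) \<le> k" unfolding theta_def k using degree_jacobi_poly_theta by simp
  then have t0: "coeff (theta N (x, b) N) N = 0" "coeff (theta N (x, b) N) (N - 1) = 0" using k by (auto simp: coeff_eq_0)
  have D: "D = smult (1/2) (A + theta N (x, b) N)" by (simp add: D_def Lyapunov_def A_def)
  show cD: "coeff D N = 1/2" "coeff D (N - 1) = 0" using t0 dA cA by (simp_all add: D)
  have "degree (A + theta N (x, b) N) \<le> N" using dA dt k by (intro degree_add_le) auto
  then have "degree D \<le> N" unfolding D by (rule order_trans[OF degree_smult_le])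
  then show "degree D = N" using cD(1) le_degree[of D N] by simp
  fix t assume t: "poly B t = 0"
  have an: "acoeff N x n \<noteq> 0" for n using acoeff_pos[of N x n] by simp
  have w: "smult (acoeff N x (int N)) (A * theta N (x, b) N - phi N (x, b) N * theta N (x, b) (N + 1)) = [:acoeff N x 0:]"
    using wronskian[of "acoeff N x" N "bcoeff N b"] an by (simp add: A_def phi_def theta_def)
  have "acoeff N x (int N) * (poly A t * poly (theta N (x, b) N) t) = acoeff N x 0"
    using arg_cong[OF w, of "\<lambda>p. poly p t"] t by (simp add: ph)
  then have e: "poly A t * poly (theta N (x, b) N) t = 1" using an[of 0] by (simp add: acoeff_period)
  then have nz: "poly A t \<noteq> 0" by auto
  then have "poly (theta N (x, b) N) t = 1 / poly A t" using e by (simp add: field_simps)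
  then show "poly A t \<noteq> 0 \<and> poly D t = (poly A t + 1 / poly A t) / 2" using nz by (simp add: D)
qed

text \<open>The Jacobi matrix of \<open>A\<close> and \<open>B\<close> contains \<open>x\<^sub>1, \<dots>, x\<^sub>N\<^sub>-\<^sub>1\<close>; the remaining \<open>x\<^sub>N\<close> is fixed by the zero sum. The zero sum of
\<open>b\<close> is the vanishing of the coefficient of \<open>A\<close> of degree \<open>N - 1\<close>.\<close>

lemma periodic_data_inverse:
  assumes I: "interlaced (N - 1) A B" and c: "coeff A (N - 1) = 0" and N: "N \<ge> 2"
  defines "x \<equiv> (\<lambda>i. if i \<in> {1..N-1} then ln (jal (N - 1) A B i) / 2
      else if i = N then - (\<Sum>j=1..N-1. ln (jal (N - 1) A B j) / 2) else 0)"
    and "b \<equiv> (\<lambda>i. if i \<in> {1..N} then jbe (N - 1) A B i else 0)"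
  shows "x \<in> Hspace N" "b \<in> Hspace N" "phi N (x, b) (N + 1) = A" "jmonic (\<lambda>i. exp (2 * x i)) b N = B"
proof -
  let ?al = "jal (N - 1) A B" and ?be = "jbe (N - 1) A B"
  have J: "\<And>i. i \<in> {1..N-1} \<Longrightarrow> ?al i > 0" "jmonic ?al ?be (N + 1) = A" "jmonic ?al ?be N = B"
    using jmonic_inverse[OF I] N by (auto simp: numeral_2_eq_2)
  obtain m where m: "N = Suc m" "m \<ge> 1" using N by (cases N) auto
  have "(\<Sum>i=1..N. x i) = (\<Sum>i=1..m. x i) + x N" using m by simp
  also have "(\<Sum>i=1..m. x i) = (\<Sum>i=1..m. ln (?al i) / 2)" using m by (intro sum.cong) (auto simp: x_def)
  finally have sx: "(\<Sum>i=1..N. x i) = 0" using m by (simp add: x_def)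
  show xH: "x \<in> Hspace N" using sx N by (auto simp: Hspace_def Rn_def x_def)
  have e2: "exp (2 * x i) = ?al i" if "1 \<le> i" "i \<le> N - 1" for i using that J(1)[of i] by (simp add: x_def)
  have j: "jmonic (\<lambda>i. exp (2 * x i)) b n = jmonic ?al ?be n" if "n \<le> N + 1" for n
    by (rule jmonic_cong) (use that e2 in \<open>auto simp: b_def\<close>)
  have jA: "jmonic (\<lambda>i. exp (2 * x i)) b (N + 1) = A" using j[of "N + 1"] J(2) by simp
  show "jmonic (\<lambda>i. exp (2 * x i)) b N = B" using j[of N] J(3) by simp
  have "coeff A (N - 1) = - (\<Sum>i=1..N. b i)"
    using jmonic_coeffs[of "\<lambda>i. exp (2 * x i)" b N] jA N by simp
  then show "b \<in> Hspace N" using c by (auto simp: Hspace_def Rn_def b_def)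
  have "(\<Prod>i=1..<N+1. exp (x i)) = 1"
    using sx by (simp add: exp_sum_prod atLeastLessThanSuc_atLeastAtMost)
  then show "phi N (x, b) (N + 1) = A" using phi_eq_jmonic[of "N + 1" N x b] jA by simp
qed

lemma periodic_data_inj:
  assumes H: "x \<in> Hspace N" "b \<in> Hspace N" "x' \<in> Hspace N" "b' \<in> Hspace N" and N: "N \<ge> 2"
    and A: "phi N (x, b) (N + 1) = phi N (x', b') (N + 1)"
    and B: "jmonic (\<lambda>i. exp (2 * x i)) b N = jmonic (\<lambda>i. exp (2 * x' i)) b' N"
  shows "(x, b) = (x', b')"
proof -
  have e: "(\<forall>i\<in>{1..N-1}. jal (N-1) (phi N (u, v) (N + 1)) (jmonic (\<lambda>i. exp (2 * u i)) v N) i = exp (2 * u i)) \<and>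
     (\<forall>i\<in>{1..N}. jbe (N-1) (phi N (u, v) (N + 1)) (jmonic (\<lambda>i. exp (2 * u i)) v N) i = v i)"
    if "u \<in> Hspace N" "v \<in> Hspace N" for u v
    using jmonic_unique[of "N - 1" "\<lambda>i. exp (2 * u i)" v] periodic_data(1)[OF that N] N by (simp add: numeral_2_eq_2 Suc_diff_Suc)
  have bb: "b i = b' i" if "i \<in> {1..N}" for i
    using e[OF H(1,2)] e[OF H(3,4)] that unfolding A B by metis
  have xx: "x i = x' i" if "i \<in> {1..N-1}" for i
  proof -
    have "exp (2 * x i) = exp (2 * x' i)" using e[OF H(1,2)] e[OF H(3,4)] that unfolding A B by metis
    then show ?thesis by simp
  qed
  obtain m where m: "N = Suc m" using N by (cases N) auto
  have "(\<Sum>i=1..m. x i) + x N = 0" "(\<Sum>i=1..m. x' i) + x' N = 0" using H m by (auto simp: Hspace_def)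
  moreover have "(\<Sum>i=1..m. x i) = (\<Sum>i=1..m. x' i)" using xx m by (intro sum.cong) auto
  ultimately have xN: "x N = x' N" by linarith
  have "x i = x' i" for i
  proof -
    consider "i \<in> {1..N-1}" | "i = N" | "i \<notin> {1..N}" by fastforce
    then show ?thesis using xx xN H by cases (auto simp: Hspace_def Rn_def)
  qed
  moreover have "b i = b' i" for i using bb[of i] H by (cases "i \<in> {1..N}") (auto simp: Hspace_def Rn_def)
  ultimately show ?thesis by (simp add: fun_eq_iff)
qed

section \<open>Band edges and the components of the Marchenko-Ostrovsky mapping\<close>

lemma degree_diff_const:
  fixes p :: "real poly"
  assumes "degree p \<ge> 1"
  shows "degree (p - [:c:]) = degree p" "lead_coeff (p - [:c:]) = lead_coeff p"
proof -
  show d: "degree (p - [:c:]) = degree p"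
    using degree_add_eq_left[of "[:- c:]" p] assms by (simp add: diff_conv_add_uminus del: add_uminus_conv_diff)
  show "lead_coeff (p - [:c:]) = lead_coeff p"
    unfolding d using assms by (cases "degree p") auto
qed

lemma IVT_poly_value:
  fixes p :: "real poly"
  assumes "a \<le> b" "poly p a \<le> y" "y \<le> poly p b" shows "\<exists>x. a \<le> x \<and> x \<le> b \<and> poly p x = y"
  using IVT[of "poly p" a y b] assms by auto

text \<open>Recognizes the sorted list of roots with multiplicities. No three terms of the candidate list \<open>e\<close> coincide, and a
repeated term is a multiple root; hence the candidates form a sub-multiset of the roots, and there are at least
as many of them as the degree.\<close>

lemma sorted_list_of_multiset_proots:
  fixes p :: "real poly" and e :: "nat \<Rightarrow> real"
  assumes p: "p \<noteq> 0" "degree p \<le> M"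
    and step: "\<And>k. Suc k < M \<Longrightarrow> e k \<le> e (Suc k)" "\<And>k. Suc k < M \<Longrightarrow> even k \<Longrightarrow> e k < e (Suc k)"
    and root: "\<And>k. k < M \<Longrightarrow> poly p (e k) = 0"
    and double: "\<And>k. Suc k < M \<Longrightarrow> e k = e (Suc k) \<Longrightarrow> poly (pderiv p) (e k) = 0"
  shows "sorted_list_of_multiset (proots p) = map e [0..<M]"
proof -
  have mono: "e i \<le> e j" if "i \<le> j" "j < M" for i j using that
  proof (induction rule: dec_induct)
    case (step n) then show ?case using assms(3)[of n] by auto
  qed simp
  have strict: "e i < e j" if "i + 2 \<le> j" "j < M" for i j
  proof -
    have "e i \<le> e (Suc i)" "e (Suc i) \<le> e (Suc (Suc i))" "e (Suc (Suc i)) \<le> e j"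
      using step(1)[of i] step(1)[of "Suc i"] mono[of "Suc (Suc i)" j] that by auto
    moreover have "e i < e (Suc i) \<or> e (Suc i) < e (Suc (Suc i))"
      using step(2)[of i] step(2)[of "Suc i"] that by auto
    ultimately show ?thesis by linarith
  qed
  have cnt: "card {k. k < M \<and> e k = r} \<le> order r p" for r
  proof (cases "{k. k < M \<and> e k = r} = {}")
    case True then show ?thesis by (simp only: card.empty)
  next
    case False
    define i where "i = (LEAST k. k < M \<and> e k = r)"
    have i: "i < M" "e i = r" using False LeastI_ex[of "\<lambda>k. k < M \<and> e k = r"] by (auto simp: i_def)
    have imin: "i \<le> k" if "k < M" "e k = r" for k unfolding i_def using that by (intro Least_le) auto
    have sub: "{k. k < M \<and> e k = r} \<subseteq> {i, Suc i}"
    proof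
      fix k assume "k \<in> {k. k < M \<and> e k = r}"
      then have k: "k < M" "e k = r" by auto
      have "\<not> i + 2 \<le> k" using strict[of i k] k i by auto
      then show "k \<in> {i, Suc i}" using imin[OF k] by auto
    qed
    have o1: "order r p \<ge> 1" using root[OF i(1)] i(2) p(1) by (simp add: order_root Suc_le_eq)
    show ?thesis
    proof (cases "Suc i < M \<and> e (Suc i) = r")
      case True
      have d: "poly (pderiv p) r = 0" using double[of i] True i by simp
      have "pderiv p \<noteq> 0"
      proof
        assume "pderiv p = 0"
        then obtain c where "p = [:c:]" by (auto simp: pderiv_eq_0_iff elim: degree_eq_zeroE)
        then show False using root[OF i(1)] p(1) by simp
      qed
      then have "order r p = Suc (order r (pderiv p))" "order r (pderiv p) \<ge> 1"
        using order_pderiv[of p r] o1 d p(1) by (auto simp: order_root Suc_le_eq)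
      moreover have "card {k. k < M \<and> e k = r} \<le> card {i, Suc i}" using sub by (intro card_mono) auto
      ultimately show ?thesis by simp
    next
      case F: False
      have "{k. k < M \<and> e k = r} \<subseteq> {i}" using sub F by auto
      then have "card {k. k < M \<and> e k = r} \<le> card {i}" by (intro card_mono) auto
      then show ?thesis using o1 by simp
    qed
  qed
  have "mset (map e [0..<M]) \<subseteq># proots p"
  proof (rule mset_subset_eqI)
    fix r
    have "count (mset (map e [0..<m])) r = card {k. k < m \<and> e k = r}" for m
    proof (induction m)
      case (Suc m)
      have "{k. k < Suc m \<and> e k = r} = (if e m = r then insert m {k. k < m \<and> e k = r} else {k. k < m \<and> e k = r})"
        by (auto simp: less_Suc_eq)
      then show ?case using Suc by simp
    qed simp
    then show "count (mset (map e [0..<M])) r \<le> count (proots p) r" using cnt[of r] p(1) by simp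
  qed
  moreover have "size (proots p) \<le> M" using size_proots_le[of p] p(2) by linarith
  ultimately have "mset (map e [0..<M]) = proots p"
    using mset_subset_size[of "mset (map e [0..<M])" "proots p"] by (fastforce simp: subset_mset.le_less)
  then have "sorted_list_of_multiset (proots p) = sort (map e [0..<M])"
    by (metis sorted_list_of_multiset_mset)
  also have "sorted (map e [0..<M])" by (auto simp: sorted_iff_nth_mono intro!: mono)
  then have "sort (map e [0..<M]) = map e [0..<M]" by (rule sorted_sort_id)
  finally show ?thesis .
qed

text \<open>At \<open>\<lambda>\<^sub>n\<close> the function \<open>s\<^sub>n \<Delta>\<close> is at least \<open>1\<close>, so it takes the value \<open>1\<close> once on the way
up from the root before \<open>\<lambda>\<^sub>n\<close> and once on the way down to the next one. Together with the two outermost edges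
these are \<open>2N\<close> roots of \<open>\<Delta>\<^sup>2 - 1\<close>, hence all of them.\<close>

lemma band_edges:
  fixes D :: "real poly"
  assumes rr: "real_rooted D" and deg: "degree D = N" "N \<ge> 1" and lc: "lead_coeff D > 0"
    and crit: "\<And>n. n \<in> {1..N-1} \<Longrightarrow> (-1) ^ (N - n) * poly D (rt (pderiv D) n) \<ge> 1"
  defines "E \<equiv> sorted_list_of_multiset (proots (D\<^sup>2 - 1))"
  assumes n: "n \<in> {1..N-1}"
  shows "rt D n < E ! (2 * n - 1)" "E ! (2 * n - 1) \<le> rt (pderiv D) n" "rt (pderiv D) n \<le> E ! (2 * n)"
    "E ! (2 * n) < rt D (n + 1)"
    "(-1) ^ (N - n) * poly D (E ! (2 * n - 1)) = 1" "(-1) ^ (N - n) * poly D (E ! (2 * n)) = 1"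
proof -
  let ?l = "rt (pderiv D)"
  note PD = real_rooted_pderiv[OF rr deg]
  have z: "poly D (rt D i) = 0" if "i \<in> {1..N}" for i using rt_root[OF rr] that deg by simp
  have em_ex: "\<exists>x. rt D i < x \<and> (i < N \<longrightarrow> x \<le> ?l i) \<and> (-1) ^ (N - i) * poly D x = 1" if i: "i \<in> {1..N}" for i
  proof (cases "i = N")
    case False
    then have i': "i \<in> {1..N-1}" using i by auto
    have "\<exists>x\<ge>rt D i. x \<le> ?l i \<and> poly (smult ((-1) ^ (N - i)) D) x = 1"
      using IVT_poly_value[of "rt D i" "?l i" "smult ((-1) ^ (N - i)) D" 1] PD(2)[OF i'] crit[OF i'] z[OF i] by auto
    then obtain x where x: "rt D i \<le> x" "x \<le> ?l i" "(-1) ^ (N - i) * poly D x = 1" by auto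
    have "x \<noteq> rt D i" using x(3) z[OF i] by auto
    then show ?thesis using x False by (intro exI[of _ x]) auto
  next
    case True
    have l: "lead_coeff (D - 1) = lead_coeff D"
      using degree_diff_const(2)[of D 1] deg by (simp add: one_pCons)
    obtain a where a: "a > rt D N" "poly (D - 1) a > 0" using poly_sign_at_top[of "D - 1"] l lc by auto
    have "\<exists>x\<ge>rt D N. x \<le> a \<and> poly D x = 1"
      by (rule IVT_poly_value) (use a z[of N] deg in auto)
    then obtain x where x: "rt D N \<le> x" "poly D x = 1" by blast
    have "x \<noteq> rt D N" using x z[of N] deg by auto
    then show ?thesis using x True by (intro exI[of _ x]) auto
  qed
  have ep_ex: "\<exists>x. x < rt D (i + 1) \<and> (0 < i \<longrightarrow> ?l i \<le> x) \<and> (-1) ^ (N - i) * poly D x = 1" if i: "i < N" for i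
  proof (cases "i = 0")
    case False
    then have i': "i \<in> {1..N-1}" using i by auto
    have "\<exists>x\<ge>?l i. x \<le> rt D (i + 1) \<and> poly (smult (- ((-1) ^ (N - i))) D) x = -1"
      using IVT_poly_value[of "?l i" "rt D (i + 1)" "smult (- ((-1) ^ (N - i))) D" "-1"] PD(2)[OF i'] crit[OF i'] z[of "i + 1"] i by auto
    then obtain x where x: "?l i \<le> x" "x \<le> rt D (i + 1)" "(-1) ^ (N - i) * poly D x = 1" by auto
    have "x \<noteq> rt D (i + 1)" using x(3) z[of "i + 1"] i by auto
    then show ?thesis using x False by (intro exI[of _ x]) auto
  next
    case True
    let ?c = "(-1 :: real) ^ N"
    have d: "degree (D - [:?c:]) = N" and l: "lead_coeff (D - [:?c:]) = lead_coeff D"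
      using degree_diff_const[of D ?c] deg by simp_all
    obtain a where a: "a < rt D 1" "?c * poly (D - [:?c:]) a > 0" using poly_sign_at_bot[of "D - [:?c:]" N] l lc d by auto
    have cc: "?c * ?c = 1" by (simp flip: power_mult_distrib)
    have a1: "?c * poly D a > 1" using a(2) cc by (simp add: right_diff_distrib)
    have "\<exists>x\<ge>a. x \<le> rt D 1 \<and> poly (smult (- ?c) D) x = -1"
      by (rule IVT_poly_value) (use a(1) a1 z[of 1] deg in auto)
    then obtain x where x: "x \<le> rt D 1" "?c * poly D x = 1" by auto
    have "x \<noteq> rt D 1" using x z[of 1] deg by auto
    then show ?thesis using x True by (intro exI[of _ x]) auto
  qed
  from em_ex obtain em where em: "\<And>i. i \<in> {1..N} \<Longrightarrow> rt D i < em i \<and> (i < N \<longrightarrow> em i \<le> ?l i) \<and> (-1) ^ (N - i) * poly D (em i) = 1" by metis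
  from ep_ex obtain ep where ep: "\<And>i. i < N \<Longrightarrow> ep i < rt D (i + 1) \<and> (0 < i \<longrightarrow> ?l i \<le> ep i) \<and> (-1) ^ (N - i) * poly D (ep i) = 1" by metis
  \<comment> \<open>The edges in the order \<open>\<lambda>\<^sub>0\<^sup>+, \<lambda>\<^sub>1\<^sup>-,
    \<lambda>\<^sub>1\<^sup>+, \<dots>, \<lambda>\<^sub>N\<^sup>-\<close>, numbered from
    \<open>0\<close>.\<close>
  define e where "e k = (if even k then ep (k div 2) else em ((k + 1) div 2))" for k
  have val: "poly D (e k) * poly D (e k) = 1" if k: "k < 2 * N" for k
  proof -
    have "\<exists>i. (-1) ^ (N - i) * poly D (e k) = 1"
    proof (cases "even k")
      case True
      then have "k div 2 < N" "e k = ep (k div 2)" using k by (auto simp: e_def)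
      then show ?thesis using ep[of "k div 2"] by auto
    next
      case False
      then have "(k + 1) div 2 \<in> {1..N}" "e k = em ((k + 1) div 2)" using k by (auto simp: e_def elim!: oddE)
      then show ?thesis using em[of "(k + 1) div 2"] by auto
    qed
    then obtain i where i: "(-1) ^ (N - i) * poly D (e k) = 1" by blast
    show ?thesis
    proof (cases "even (N - i)")
      case True then show ?thesis using i by simp
    next
      case False
      then have "poly D (e k) = -1" using i by (simp add: minus_equation_iff)
      then show ?thesis by simp
    qed
  qed
  have str: "e k < e (Suc k)" if "Suc k < 2 * N" "even k" for k
  proof -
    obtain i where i: "k = 2 * i" using \<open>even k\<close> by blast
    have "i < N" using that i by auto
    then have "ep i < rt D (i + 1)" "rt D (i + 1) < em (i + 1)" using ep[of i] em[of "i + 1"] by auto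
    then show ?thesis by (simp add: e_def i)
  qed
  have wk: "em i \<le> ep i \<and> em i \<le> ?l i \<and> ?l i \<le> ep i" if "i \<in> {1..N-1}" for i
  proof -
    have "i \<in> {1..N}" "i < N" "0 < i" using that by auto
    then have "em i \<le> ?l i" "?l i \<le> ep i" using em[of i] ep[of i] by auto
    then show ?thesis by linarith
  qed
  have odd: "\<exists>i. k = 2 * i - 1 \<and> i \<in> {1..N-1} \<and> e k = em i \<and> e (Suc k) = ep i" if "Suc k < 2 * N" "odd k" for k
  proof -
    obtain i where i: "k = 2 * i + 1" using \<open>odd k\<close> oddE by blast
    show ?thesis using that by (intro exI[of _ "Suc i"]) (auto simp: e_def i)
  qed
  have D2: "degree (D\<^sup>2) = 2 * N"
    using deg rr by (simp add: power2_eq_square degree_mult_eq real_rooted_def)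
  then have dp: "degree (D\<^sup>2 - 1) = 2 * N" using degree_diff_const(1)[of "D\<^sup>2" 1] deg by (simp add: one_pCons)
  have E: "E = map e [0..<2 * N]" unfolding E_def
  proof (rule sorted_list_of_multiset_proots)
    show "D\<^sup>2 - 1 \<noteq> 0" using dp deg by auto
    show "degree (D\<^sup>2 - 1) \<le> 2 * N" using dp by simp
    show "poly (D\<^sup>2 - 1) (e k) = 0" if "k < 2 * N" for k using val[OF that] by (simp add: power2_eq_square)
    show "e k \<le> e (Suc k)" if "Suc k < 2 * N" for k
    proof (cases "even k")
      case True then show ?thesis using str[OF that] by simp
    next
      case False then show ?thesis using odd[OF that False] wk by auto
    qed
    show "e k < e (Suc k)" if "Suc k < 2 * N" "even k" for k by (rule str[OF that])
    show "poly (pderiv (D\<^sup>2 - 1)) (e k) = 0" if k: "Suc k < 2 * N" and eq: "e k = e (Suc k)" for k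
    proof -
      have "odd k" using str[OF k] eq by auto
      then obtain i where i: "i \<in> {1..N-1}" "e k = em i" "e (Suc k) = ep i" using odd[OF k] by blast
      \<comment> \<open>A closed gap consists of the critical point alone.\<close>
      then have "e k = ?l i" using wk[OF i(1)] eq by auto
      moreover have "poly (pderiv D) (?l i) = 0" using rt_root[OF PD(1), of i] i(1) deg by (simp add: degree_pderiv)
      ultimately show ?thesis by (simp add: pderiv_diff pderiv_mult power2_eq_square)
    qed
  qed
  have n2: "2 * n < 2 * N" "2 * n - 1 < 2 * N" "odd (2 * n - 1)" "(2 * n - 1 + 1) div 2 = n" using n by auto
  have "E ! (2 * n) = ep n" "E ! (2 * n - 1) = em n" using n2 by (simp_all add: E e_def)
  moreover have "n \<in> {1..N}" "n < N" "0 < n" using n by auto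
  ultimately show "rt D n < E ! (2 * n - 1)" "E ! (2 * n - 1) \<le> ?l n" "?l n \<le> E ! (2 * n)"
    "E ! (2 * n) < rt D (n + 1)"
    "(-1) ^ (N - n) * poly D (E ! (2 * n - 1)) = 1" "(-1) ^ (N - n) * poly D (E ! (2 * n)) = 1"
    using em[of n] ep[of n] by auto
qed

lemma cosh_ln: "u > 0 \<Longrightarrow> cosh (ln u) = (u + 1 / u) / (2::real)"
  by (simp add: cosh_def exp_minus inverse_eq_divide)

lemma cosh_le_iff_square: "cosh x \<le> cosh y \<longleftrightarrow> x\<^sup>2 \<le> (y::real)\<^sup>2"
proof -
  have "cosh x \<le> cosh y \<longleftrightarrow> cosh \<bar>x\<bar> \<le> cosh \<bar>y\<bar>" by simp
  also have "\<dots> \<longleftrightarrow> \<bar>x\<bar> \<le> \<bar>y\<bar>" by (rule cosh_real_nonneg_le_iff) auto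
  also have "\<dots> \<longleftrightarrow> x\<^sup>2 \<le> y\<^sup>2" by (rule abs_le_square_iff)
  finally show ?thesis .
qed

text \<open>All that the rest of the proof needs to know about the mapping. It replaces the definite descriptions of \<open>\<lambda>\<^sub>n\<close>, \<open>\<nu>\<^sub>n\<close>
and \<open>|\<psi>\<^sub>n|\<close> between the band edges by roots numbered in increasing order, which are available for every polynomial with
simple real roots. The values of \<open>\<Delta>\<close> at the \<open>\<nu>\<^sub>n\<close> alternate in sign and have modulus at least \<open>1\<close>, which
gives the real roots of \<open>\<Delta>\<close> and locates the \<open>\<nu>\<^sub>n\<close> between them.\<close>

theorem psi_characterization:
  assumes x: "x \<in> Hspace N" and b: "b \<in> Hspace N" and N: "N \<ge> 2" and n: "n \<in> {1..N-1}"
  defines "A \<equiv> phi N (x, b) (N + 1)" and "B \<equiv> jmonic (\<lambda>i. exp (2 * x i)) b N" and "D \<equiv> Lyapunov N (x, b)"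
  defines "\<nu> \<equiv> rt B n" and "\<kappa> \<equiv> rt (pderiv D) n" and "s \<equiv> (-1 :: real) ^ (N - n)"
  shows "real_rooted D" "rt D n < \<nu>" "\<nu> < rt D (n + 1)" "s * poly A \<nu> > 0"
    "psi1 N (x, b) n = ln (s * poly A \<nu>)" "cosh (psi1 N (x, b) n) = s * poly D \<nu>"
    "cosh (psi_abs N (x, b) n) = s * poly D \<kappa>" "psi_abs N (x, b) n \<ge> 0"
    "(psi_abs N (x, b) n)\<^sup>2 = (psi1 N (x, b) n)\<^sup>2 + (psi2 N (x, b) n)\<^sup>2"
    "sgn (psi2 N (x, b) n) = sgn (\<kappa> - \<nu>)"
proof -
  note data = periodic_data[OF x b N, folded A_def B_def D_def]
  have I: "interlaced (N - 1) A B" by (rule data(2))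
  have rB: "real_rooted B" and dB: "degree B = N - 1" using I by (auto simp: interlaced_def)
  have ss: "s * s = 1" by (simp add: s_def flip: power_mult_distrib)
  have sA: "(-1) ^ (N - i) * poly A (rt B i) > 0" if "i \<in> {1..N-1}" for i
    using I that N by (auto simp: interlaced_def Suc_diff_Suc)
  have DB: "poly A (rt B i) \<noteq> 0 \<and> poly D (rt B i) = (poly A (rt B i) + 1 / poly A (rt B i)) / 2" if "i \<in> {1..N-1}" for i
    by (rule data(8)) (use rt_root[OF rB] dB that in auto)
  have sD: "cosh (ln ((-1) ^ (N - i) * poly A (rt B i))) = (-1) ^ (N - i) * poly D (rt B i)" if "i \<in> {1..N-1}" for i
  proof -
    have "1 / ((-1) ^ (N - i) * poly A (rt B i)) = (-1) ^ (N - i) * (1 / poly A (rt B i))"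
      by (cases "even (N - i)") auto
    then show ?thesis unfolding cosh_ln[OF sA[OF that]] using DB[OF that] by (simp add: algebra_simps add_divide_distrib)
  qed
  have D1: "(-1) ^ (N - i) * poly D (rt B i) \<ge> 1" if "i \<in> {1..N-1}" for i
    using cosh_real_ge_1[of "ln ((-1) ^ (N - i) * poly A (rt B i))"] unfolding sD[OF that] .
  have degD: "degree D = N" and lcD: "lead_coeff D > 0" using data(5,6) by auto
  have Dpos: "(-1) ^ (N - i) * poly D (rt B i) > 0" if "i \<in> {1..N-1}" for i using D1[OF that] by linarith
  have Bless: "\<And>i j. 1 \<le> i \<Longrightarrow> i < j \<Longrightarrow> j \<le> N - 1 \<Longrightarrow> rt B i < rt B j" using rt_less[OF rB] dB by auto
  have N1: "N \<ge> 1" using N by simp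
  show rD: "real_rooted D" by (rule alternating_real_rooted(1)[OF degD N1 lcD Bless Dpos])
  have loc: "rt D i < rt B i \<and> rt B i < rt D (i + 1)" if "i \<in> {1..N-1}" for i
    by (rule alternating_real_rooted(2)[OF degD N1 lcD Bless Dpos that])
  show l1: "rt D n < \<nu>" and l2: "\<nu> < rt D (n + 1)" using loc[OF n] by (auto simp: \<nu>_def)
  note PD = real_rooted_pderiv[OF rD degD N1]
  have peak: "(-1) ^ (N - i) * poly D u \<le> (-1) ^ (N - i) * poly D (rt (pderiv D) i)"
    if "i \<in> {1..N-1}" "rt D i < u" "u < rt D (i + 1)" for i u
    using rt_unimodal(2)[OF rD degD lcD that(1), of u "rt (pderiv D) i"]
      rt_unimodal(3)[OF rD degD lcD that(1), of "rt (pderiv D) i" u] that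
    by (cases u "rt (pderiv D) i" rule: linorder_cases) auto
  have crit1: "(-1) ^ (N - i) * poly D (rt (pderiv D) i) \<ge> 1" if "i \<in> {1..N-1}" for i
    using peak[OF that, of "rt B i"] loc[OF that] D1[OF that] by linarith
  let ?em = "edge_minus N (x, b) n" and ?ep = "edge_plus N (x, b) n"
  have ed: "rt D n < ?em" "?em \<le> \<kappa>" "\<kappa> \<le> ?ep" "?ep < rt D (n + 1)" "s * poly D ?em = 1" "s * poly D ?ep = 1"
    using band_edges[OF rD degD N1 lcD crit1 n] by (simp_all add: edge_minus_def edge_plus_def edges_def \<kappa>_def s_def flip: D_def)
  have lroot: "poly (pderiv D) \<kappa> = 0" using rt_root[OF PD(1), of n] n degD by (simp add: degree_pderiv \<kappa>_def)
  have cr: "crit N (x, b) n = \<kappa>" unfolding crit_def D_def[symmetric]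
  proof (rule the_equality)
    show "t = \<kappa>" if "t \<in> {?em..?ep} \<and> poly (pderiv D) t = 0" for t
      using rt_unimodal(4,5)[OF rD degD lcD n, of t] that ed
      by (cases t \<kappa> rule: linorder_cases) (auto simp: \<kappa>_def)
  qed (use ed lroot in auto)
  have nin: "?em \<le> \<nu>" "\<nu> \<le> ?ep"
  proof -
    have "s * poly D \<nu> \<ge> 1" using D1[OF n] by (simp add: s_def \<nu>_def)
    then show "?em \<le> \<nu>" using rt_unimodal(2)[OF rD degD lcD n, of \<nu> ?em] ed l1 by (fastforce simp: \<kappa>_def s_def)
    show "\<nu> \<le> ?ep" using rt_unimodal(3)[OF rD degD lcD n, of ?ep \<nu>] ed l2 \<open>s * poly D \<nu> \<ge> 1\<close> by (fastforce simp: \<kappa>_def s_def)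
  qed
  obtain c where c: "c \<noteq> 0" "phi N (x, b) N = smult c B" using data(4) by blast
  have di: "dirichlet N (x, b) n = \<nu>" unfolding dirichlet_def
  proof (rule the_equality)
    show "\<nu> \<in> {?em..?ep} \<and> poly (phi N (x, b) N) \<nu> = 0"
      using nin rt_root[OF rB, of n] dB n by (simp add: c(2) \<nu>_def)
    fix t assume t: "t \<in> {?em..?ep} \<and> poly (phi N (x, b) N) t = 0"
    then have "poly B t = 0" using c by simp
    then have "t \<in> {u. poly B u = 0}" by simp
    then obtain j where j: "j \<in> {1..N-1}" "t = rt B j" unfolding rt_image[OF rB] dB by blast
    have tl: "rt D n < t" "t < rt D (n + 1)" using t ed by auto
    have "\<not> j < n"
    proof
      assume "j < n"
      then have "rt D (j + 1) \<le> rt D n" using n degD by (intro rt_le[OF rD]) auto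
      then show False using loc[OF j(1)] j(2) tl by linarith
    qed
    moreover have "\<not> n < j"
    proof
      assume "n < j"
      then have "rt D (n + 1) \<le> rt D j" using j degD by (intro rt_le[OF rD]) auto
      then show False using loc[OF j(1)] j(2) tl by linarith
    qed
    ultimately show "t = \<nu>" using j by (simp add: \<nu>_def)
  qed
  show sAn: "s * poly A \<nu> > 0" using sA[OF n] by (simp add: s_def \<nu>_def)
  show p1: "psi1 N (x, b) n = ln (s * poly A \<nu>)" by (simp add: psi1_def di A_def s_def)
  show c1: "cosh (psi1 N (x, b) n) = s * poly D \<nu>" unfolding p1 using sD[OF n] by (simp add: s_def \<nu>_def)
  have cl: "s * poly D \<kappa> \<ge> 1" using crit1[OF n] by (simp add: s_def \<kappa>_def)
  have "psi_abs N (x, b) n = arcosh (s * poly D \<kappa>)" unfolding psi_abs_def cr D_def[symmetric] s_def[symmetric]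
  proof (rule the_equality)
    show "0 \<le> arcosh (s * poly D \<kappa>) \<and> cosh (arcosh (s * poly D \<kappa>)) = s * poly D \<kappa>"
      using cl by (simp add: arcosh_nonneg_real)
    show "r = arcosh (s * poly D \<kappa>)" if "0 \<le> r \<and> cosh r = s * poly D \<kappa>" for r
      using that arcosh_cosh_real[of r] by auto
  qed
  then show c2: "cosh (psi_abs N (x, b) n) = s * poly D \<kappa>" and "psi_abs N (x, b) n \<ge> 0"
    using cl by (simp_all add: arcosh_nonneg_real)
  have le: "s * poly D \<nu> \<le> s * poly D \<kappa>" using peak[OF n l1 l2] by (simp add: s_def \<kappa>_def)
  have ge: "(psi1 N (x, b) n)\<^sup>2 \<le> (psi_abs N (x, b) n)\<^sup>2"
    using le c1 c2 by (simp flip: cosh_le_iff_square)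
  have p2: "psi2 N (x, b) n = sqrt ((psi_abs N (x, b) n)\<^sup>2 - (psi1 N (x, b) n)\<^sup>2) * sgn (\<kappa> - \<nu>)"
    by (simp add: psi2_def cr di)
  have eqcase: "(psi_abs N (x, b) n)\<^sup>2 = (psi1 N (x, b) n)\<^sup>2 \<longleftrightarrow> \<kappa> = \<nu>"
  proof
    assume "\<kappa> = \<nu>"
    then have "cosh (psi_abs N (x, b) n) = cosh (psi1 N (x, b) n)" using c1 c2 by simp
    then show "(psi_abs N (x, b) n)\<^sup>2 = (psi1 N (x, b) n)\<^sup>2" by (metis cosh_le_iff_square order_antisym order_refl)
  next
    assume "(psi_abs N (x, b) n)\<^sup>2 = (psi1 N (x, b) n)\<^sup>2"
    then have "s * poly D \<nu> = s * poly D \<kappa>" using c1 c2 by (metis cosh_le_iff_square order_antisym order_refl)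
    then show "\<kappa> = \<nu>"
      using rt_unimodal(2)[OF rD degD lcD n, of \<nu> \<kappa>] rt_unimodal(3)[OF rD degD lcD n, of \<kappa> \<nu>] l1 l2
      by (cases \<nu> \<kappa> rule: linorder_cases) (auto simp: \<kappa>_def s_def)
  qed
  show "(psi_abs N (x, b) n)\<^sup>2 = (psi1 N (x, b) n)\<^sup>2 + (psi2 N (x, b) n)\<^sup>2"
    using ge eqcase by (cases "\<kappa> = \<nu>") (auto simp: p2 power_mult_distrib sgn_real_def)
  show "sgn (psi2 N (x, b) n) = sgn (\<kappa> - \<nu>)"
    using ge eqcase by (cases "\<kappa> = \<nu>") (auto simp: p2 sgn_mult)
qed

section \<open>Critical values as local coordinates\<close>

lemma rt_simple:
  assumes rr: "real_rooted p" and n: "n \<in> {1..degree p}"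
  shows "poly (pderiv p) (rt p n) \<noteq> 0"
proof
  assume d0: "poly (pderiv p) (rt p n) = 0"
  let ?k = "degree p"
  have p0: "p \<noteq> 0" using rr by (simp add: real_rooted_def)
  have pr: "poly p (rt p n) = 0" by (rule rt_root[OF rr n])
  from real_rooted_factor[OF rr] have "p = smult (lead_coeff p) ([:- rt p n, 1:] * (\<Prod>i\<in>{1..?k} - {n}. [:- rt p i, 1:]))"
    using n by (subst (asm) prod.remove[of _ n]) auto
  then have "poly (pderiv p) (rt p n) = poly (pderiv (smult (lead_coeff p) ([:- rt p n, 1:] * (\<Prod>i\<in>{1..?k} - {n}. [:- rt p i, 1:])))) (rt p n)"
    by (rule arg_cong)
  also have "\<dots> = lead_coeff p * (\<Prod>i\<in>{1..?k} - {n}. rt p n - rt p i)"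
    by (simp only: pderiv_smult pderiv_mult) (simp add: pderiv_pCons poly_prod)
  also have "\<dots> \<noteq> 0"
  proof -
    have "rt p n \<noteq> rt p i" if "i \<in> {1..?k} - {n}" for i
      using rt_less[OF rr, of i n] rt_less[OF rr, of n i] that n by (cases i n rule: linorder_cases) auto
    then show ?thesis using p0 by simp
  qed
  finally show False using d0 by simp
qed

text \<open>The critical points are simple roots of \<open>D'\<close>, and \<open>s\<^sub>n D\<close> has a maximum at the \<open>n\<close>-th one.\<close>

lemma rt_second_deriv:
  assumes rr: "real_rooted D" and deg: "degree D = N" and lc: "lead_coeff D > 0" and n: "n \<in> {1..N-1}"
  shows "(-1) ^ (N - n) * poly (pderiv (pderiv D)) (rt (pderiv D) n) < 0"
proof -
  let ?l = "rt (pderiv D) n" and ?s = "(-1 :: real) ^ (N - n)"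
  have N: "N \<ge> 1" using n by auto
  note PD = real_rooted_pderiv[OF rr deg N]
  have dD: "degree (pderiv D) = N - 1" using deg by (simp add: degree_pderiv)
  have nz: "poly (pderiv (pderiv D)) ?l \<noteq> 0" by (rule rt_simple[OF PD(1)]) (use n dD in auto)
  have l0: "poly (pderiv D) ?l = 0" by (rule rt_root[OF PD(1)]) (use n dD in auto)
  have lt: "?l < rt D (n + 1)" using PD(2)[OF n] by auto
  have "\<not> ?s * poly (pderiv (pderiv D)) ?l > 0"
  proof
    assume pos: "?s * poly (pderiv (pderiv D)) ?l > 0"
    have "((\<lambda>x. ?s * poly (pderiv D) x) has_real_derivative ?s * poly (pderiv (pderiv D)) ?l) (at ?l)"
      by (intro DERIV_cmult poly_DERIV)
    from DERIV_pos_inc_right[OF this pos] obtain d where d: "d > 0" "\<And>h. 0 < h \<Longrightarrow> h < d \<Longrightarrow> ?s * poly (pderiv D) ?l < ?s * poly (pderiv D) (?l + h)"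
      by auto
    define h where "h = min (d / 2) (rt D (n + 1) - ?l)"
    have h: "0 < h" "h < d" "?l + h \<le> rt D (n + 1)" using d(1) lt by (auto simp: h_def)
    have "?s * poly (pderiv D) (?l + h) > 0" using d(2)[OF h(1,2)] l0 by simp
    moreover have "?s * poly (pderiv D) (?l + h) < 0"
      using rt_unimodal(5)[OF rr deg lc n, of "?l + h"] h by simp
    ultimately show False by linarith
  qed
  moreover have "?s * poly (pderiv (pderiv D)) ?l \<noteq> 0" using nz by simp
  ultimately show ?thesis by linarith
qed

text \<open>The simple roots at the base point continue analytically and stay ordered; being \<open>d\<close> in number, they are all the
roots nearby.\<close>

theorem ranalytic_rt:
  assumes p: "ranalytic_poly p z0" and deg: "\<And>z. degree (p z) \<le> d" "degree (p z0) = d" and rr: "real_rooted (p z0)"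
  shows "\<And>n. n \<in> {1..d} \<Longrightarrow> ranalytic (\<lambda>z. rt (p z) n) z0"
    "\<forall>\<^sub>F z in nhds z0. real_rooted (p z) \<and> degree (p z) = d"
proof -
  have "\<forall>n\<in>{1..d}. \<exists>X. ranalytic X z0 \<and> X z0 = rt (p z0) n \<and> (\<forall>\<^sub>F z in nhds z0. poly (p z) (X z) = 0)"
  proof
    fix n assume n: "n \<in> {1..d}"
    have "poly (p z0) (rt (p z0) n) = 0" "poly (pderiv (p z0)) (rt (p z0) n) \<noteq> 0"
      using rt_root[OF rr] rt_simple[OF rr] n deg(2) by auto
    from ranalytic_simple_root[OF p this] show "\<exists>X. ranalytic X z0 \<and> X z0 = rt (p z0) n \<and> (\<forall>\<^sub>F z in nhds z0. poly (p z) (X z) = 0)"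
      by metis
  qed
  then obtain X where X: "\<And>n. n \<in> {1..d} \<Longrightarrow> ranalytic (X n) z0" "\<And>n. n \<in> {1..d} \<Longrightarrow> X n z0 = rt (p z0) n"
    "\<And>n. n \<in> {1..d} \<Longrightarrow> \<forall>\<^sub>F z in nhds z0. poly (p z) (X n z) = 0" by metis
  have e1: "\<forall>\<^sub>F z in nhds z0. \<forall>n\<in>{1..d}. poly (p z) (X n z) = 0"
    by (rule eventually_ball_finite) (use X(3) in auto)
  have e2: "\<forall>\<^sub>F z in nhds z0. \<forall>i\<in>{1..d}. \<forall>j\<in>{1..d}. i < j \<longrightarrow> X i z < X j z"
  proof (intro eventually_ball_finite ballI finite_atLeastAtMost)
    fix i j assume ij: "i \<in> {1..d}" "j \<in> {1..d}"
    show "\<forall>\<^sub>F z in nhds z0. i < j \<longrightarrow> X i z < X j z"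
    proof (cases "i < j")
      case True
      have "X i z0 < X j z0" using X(2) ij rt_less[OF rr, of i j] True deg(2) by auto
      then have "\<forall>\<^sub>F z in nhds z0. X j z - X i z > 0"
        by (intro ranalytic_pos[OF ranalytic_diff[OF X(1)[OF ij(2)] X(1)[OF ij(1)]]]) simp
      then show ?thesis by eventually_elim simp
    qed simp
  qed
  have "coeff (p z0) d \<noteq> 0" using rr deg(2) by (auto simp: real_rooted_def)
  then have "coeff (p z0) d * coeff (p z0) d > 0" using not_real_square_gt_zero by blast
  then have e3: "\<forall>\<^sub>F z in nhds z0. coeff (p z) d * coeff (p z) d > 0"
    by (rule ranalytic_pos[OF ranalytic_mult[OF ranalytic_polyD[OF p] ranalytic_polyD[OF p]]])
  have main: "\<forall>\<^sub>F z in nhds z0. (real_rooted (p z) \<and> degree (p z) = d) \<and> (\<forall>n\<in>{1..d}. X n z = rt (p z) n)"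
    using e1 e2 e3
  proof eventually_elim
    case (elim z)
    have c: "coeff (p z) d \<noteq> 0" using elim(3) by auto
    have pz: "p z \<noteq> 0" "degree (p z) = d" using c deg(1)[of z] le_degree[OF c] by auto
    have l: "X i z < X j z" if "1 \<le> i" "i < j" "j \<le> d" for i j using elim(2) that by auto
    have r: "poly (p z) (X i z) = 0" if "i \<in> {1..d}" for i using elim(1) that by auto
    have "real_rooted (p z)" by (rule real_rootedI(1)[OF pz, of "\<lambda>i. X i z"]) (use l r in auto)
    moreover have "rt (p z) i = X i z" if "i \<in> {1..d}" for i
      by (rule real_rootedI(2)[OF pz, of "\<lambda>i. X i z"]) (use l r that in auto)
    ultimately show ?case using pz(2) by simp
  qed
  show "\<forall>\<^sub>F z in nhds z0. real_rooted (p z) \<and> degree (p z) = d"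
    using main by eventually_elim blast
  show "ranalytic (\<lambda>z. rt (p z) n) z0" if n: "n \<in> {1..d}" for n
  proof (rule ranalytic_cong[OF X(1)[OF n]])
    show "\<forall>\<^sub>F z in nhds z0. X n z = rt (p z) n" using main by eventually_elim (use n in blast)
  qed
qed

lemma ranalytic_partial_derivative:
  assumes "ranalytic f p"
  shows "\<exists>d. ((\<lambda>t. f (p(k := p k + t))) has_field_derivative d) (at 0)"
proof -
  from assms obtain U F where U: "open U" "cplx p \<in> U" "holo U F" "\<And>z. cplx z \<in> U \<Longrightarrow> F (cplx z) = of_real (f z)"
    by (rule ranalyticE) blast
  let ?h = "\<lambda>t. F ((cplx p)(k := cplx p k + t))"
  have "open ((\<lambda>t. (cplx p)(k := cplx p k + t)) -` U)" (is "open ?S")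
    by (rule open_vimage[OF U(1) continuous_on_fun_upd_add])
  moreover have "0 \<in> ?S" using U(2) by (simp del: cplx_apply)
  ultimately obtain s where s: "s > 0" "ball 0 s \<subseteq> ?S" by (rule openE)
  have "?h holomorphic_on ball 0 s"
    by (rule holo_disc[OF U(3)]) (use s in \<open>auto intro: holomorphic_fun_upd simp del: fun_upd_apply cplx_apply\<close>)
  then have h: "(?h has_field_derivative deriv ?h 0) (at (of_real 0))"
    using s by (simp add: holomorphic_derivI)
  have "((\<lambda>t. ?h (of_real t)) has_vector_derivative deriv ?h 0) (at 0)"
    by (rule has_vector_derivative_real_field[OF h])
  then have "((\<lambda>t. Re (?h (of_real t))) has_vector_derivative Re (deriv ?h 0)) (at 0)"
    by (rule bounded_linear.has_vector_derivative[OF bounded_linear_Re])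
  then have "((\<lambda>t. f (p(k := p k + t))) has_vector_derivative Re (deriv ?h 0)) (at 0)"
  proof (rule has_vector_derivative_transform_within_open[of _ _ _ "ball 0 s"])
    fix t :: real assume t: "t \<in> ball 0 s"
    have e: "(cplx p)(k := cplx p k + of_real t) = cplx (p(k := p k + t))" by (auto simp: fun_eq_iff)
    have "of_real t \<in> ball (0::complex) s" using t by simp
    then have "(cplx p)(k := cplx p k + of_real t) \<in> U" using s(2) by blast
    then show "Re (?h (of_real t)) = f (p(k := p k + t))" unfolding e by (simp add: U(4))
  qed (use s in auto)
  then show ?thesis by (auto simp: has_real_derivative_iff_has_vector_derivative)
qed

text \<open>Continuity of a map all but finitely many of whose coordinates are constant.\<close>

lemma eventually_ranalytic_map:
  assumes J: "finite J" and X: "\<And>j. j \<in> J \<Longrightarrow> ranalytic (\<lambda>z. X z j) z0" "\<And>z j. j \<notin> J \<Longrightarrow> X z j = X z0 j"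
    and Q: "eventually Q (nhds (X z0))"
  shows "\<forall>\<^sub>F z in nhds z0. Q (X z)"
proof -
  obtain S where S: "open S" "X z0 \<in> S" "\<And>x. x \<in> S \<Longrightarrow> Q x" using Q unfolding eventually_nhds by blast
  obtain \<rho> where \<rho>: "\<rho> > 0" "\<forall>x. (\<forall>j\<in>J. dist (x j) (X z0 j) < \<rho>) \<longrightarrow> (\<forall>j. j \<notin> J \<longrightarrow> x j = X z0 j) \<longrightarrow> x \<in> S"
    using open_fun_contains_box[OF S(1,2) J] by blast
  have "\<forall>\<^sub>F z in nhds z0. \<forall>j\<in>J. dist (X z j) (X z0 j) < \<rho>"
    by (intro eventually_ball_finite J ballI tendstoD[OF ranalytic_tendsto[OF X(1)]] \<rho>(1))
  then show ?thesis
  proof eventually_elim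
    case (elim z)
    have "X z \<in> S" using \<rho>(2) elim X(2) by blast
    then show ?case by (rule S(3))
  qed
qed

text \<open>The shape of the Lyapunov functions of operators with \<open>x\<close> and \<open>b\<close> of zero sum.\<close>

definition normal_poly :: "nat \<Rightarrow> real poly \<Rightarrow> bool" where
  "normal_poly N D \<longleftrightarrow> degree D = N \<and> coeff D N = 1/2 \<and> coeff D (N - 1) = 0"

text \<open>The free coefficients of a normalized polynomial as coordinates.\<close>

definition npoly :: "nat \<Rightarrow> (nat \<Rightarrow> real) \<Rightarrow> real poly" where
  "npoly N p = monom (1/2) N + (\<Sum>k<N-1. monom (p k) k)"

definition critval :: "real poly \<Rightarrow> nat \<Rightarrow> real" where
  "critval D n = poly D (rt (pderiv D) n)"

lemma coeff_npoly:
  assumes "N \<ge> 2"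
  shows "coeff (npoly N p) k = (if k = N then 1/2 else if k < N - 1 then p k else 0)"
proof -
  have "(\<Sum>j<N-1. if j = k then p j else 0) = (if k < N - 1 then p k else 0)" by simp
  then show ?thesis using assms by (auto simp: npoly_def coeff_sum)
qed

lemma normal_npoly: "N \<ge> 2 \<Longrightarrow> normal_poly N (npoly N p)"
proof -
  assume N: "N \<ge> 2"
  have "degree (npoly N p) \<le> N" by (rule degree_le) (use N in \<open>auto simp: coeff_npoly\<close>)
  moreover have "degree (npoly N p) \<ge> N" by (rule le_degree) (use N in \<open>simp add: coeff_npoly\<close>)
  ultimately show ?thesis using N by (simp add: normal_poly_def coeff_npoly)
qed

lemma npoly_coeff:
  assumes N: "N \<ge> 2" and D: "normal_poly N D" and p: "\<And>k. k < N - 1 \<Longrightarrow> p k = coeff D k"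
  shows "npoly N p = D"
proof (rule poly_eqI)
  fix k
  consider "k = N" | "k < N - 1" | "k = N - 1" | "k > N" using N by linarith
  then show "coeff (npoly N p) k = coeff D k"
    using D p N by cases (auto simp: coeff_npoly normal_poly_def coeff_eq_0)
qed

lemma npoly_eqD: "N \<ge> 2 \<Longrightarrow> npoly N p = npoly N p' \<Longrightarrow> k < N - 1 \<Longrightarrow> p k = p' k"
  by (metis coeff_npoly less_irrefl_nat less_le_trans nat_less_le diff_le_self)

lemma npoly_upd: "k < N - 1 \<Longrightarrow> npoly N (p(k := p k + t)) = npoly N p + monom t k"
proof -
  assume k: "k < N - 1"
  have "(\<Sum>j<N-1. monom ((p(k := p k + t)) j) j) = (\<Sum>j<N-1. monom (p j) j + (if j = k then monom t k else 0))"
    by (intro sum.cong) (auto simp: add_monom)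
  then show ?thesis using k by (simp add: npoly_def sum.distrib add.assoc)
qed

lemma ranalytic_poly_npoly:
  assumes "N \<ge> 2" "\<And>k. k < N - 1 \<Longrightarrow> ranalytic (\<lambda>z. p z k) z0"
  shows "ranalytic_poly (\<lambda>z. npoly N (p z)) z0"
proof (rule ranalytic_polyI)
  show "degree (npoly N (p z)) \<le> N" for z using normal_npoly[OF assms(1)] by (simp add: normal_poly_def)
  show "ranalytic (\<lambda>z. coeff (npoly N (p z)) k) z0" for k
    by (cases "k = N"; cases "k < N - 1") (simp_all add: assms coeff_npoly[OF assms(1)] ranalytic_const)
qed

lemma normal_lead: "normal_poly N D \<Longrightarrow> lead_coeff D > 0"
  by (auto simp: normal_poly_def)

lemma critval_sign:
  assumes "normal_poly N D" "real_rooted D" "n \<in> {1..N-1}"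
  shows "(-1) ^ (N - n) * critval D n > 0"
proof -
  have d: "degree D = N" "N \<ge> 1" using assms by (auto simp: normal_poly_def)
  have l: "rt D n < rt (pderiv D) n" "rt (pderiv D) n < rt D (n + 1)" using real_rooted_pderiv(2)[OF assms(2) d assms(3)] by auto
  show ?thesis unfolding critval_def
    by (rule rt_unimodal(1)[OF assms(2) d(1) normal_lead[OF assms(1)] assms(3) l])
qed

text \<open>Since \<open>D'\<close> vanishes at a critical point \<open>\<lambda>\<^sub>j\<close>, its displacement does not contribute to first order, and the derivative of
the critical value \<open>D(\<lambda>\<^sub>j)\<close> in the coefficient of degree \<open>k\<close> is \<open>\<lambda>\<^sub>j\<^sup>k\<close>. The inverse of this Vandermonde matrix consists of
the coefficients of the Lagrange basis polynomials.\<close>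

theorem critval_local_inverse:
  assumes N: "N \<ge> 2" and rr: "real_rooted (npoly N p0)" and p0: "\<And>k. k \<ge> N - 1 \<Longrightarrow> p0 k = 0"
    and c0: "\<And>n. n \<in> {1..N-1} \<Longrightarrow> c0 n = critval (npoly N p0) n"
  obtains X \<rho> where "\<And>k. ranalytic (\<lambda>c. X c k) c0" "X c0 = p0" "\<And>c k. k \<ge> N - 1 \<Longrightarrow> X c k = 0"
    "\<forall>\<^sub>F c in nhds c0. real_rooted (npoly N (X c)) \<and> (\<forall>n\<in>{1..N-1}. critval (npoly N (X c)) n = c n)"
    "\<rho> > 0" "\<forall>\<^sub>F c in nhds c0. \<forall>p. (\<forall>k<N-1. \<bar>p k - p0 k\<bar> < \<rho>) \<longrightarrow> (\<forall>k\<ge>N-1. p k = 0) \<longrightarrow>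
       (\<forall>n\<in>{1..N-1}. critval (npoly N p) n = c n) \<longrightarrow> p = X c"
proof -
  let ?J = "{..<N-1}" and ?D = "npoly N p0"
  define l where "l = rt (pderiv ?D)"
  have nD: "normal_poly N ?D" by (rule normal_npoly[OF N])
  then have dD: "degree ?D = N" by (simp add: normal_poly_def)
  have N1: "N \<ge> 1" using N by simp
  note PD = real_rooted_pderiv[OF rr dD N1]
  have dPD: "degree (pderiv ?D) = N - 1" using dD by (simp add: degree_pderiv)
  have dp: "degree (pderiv (npoly N p)) \<le> N - 1" for p
    using normal_npoly[OF N, of p] by (simp add: degree_pderiv normal_poly_def)
  have rnp: "ranalytic_poly (npoly N) p0" by (rule ranalytic_poly_npoly[OF N]) (rule ranalytic_coord)
  have rl: "ranalytic (\<lambda>p. rt (pderiv (npoly N p)) n) p0" if "n \<in> {1..N-1}" for n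
    by (rule ranalytic_rt(1)[OF ranalytic_poly_pderiv[OF rnp] dp dPD PD(1) that])
  have rc: "ranalytic (\<lambda>p. critval (npoly N p) n) p0" if "n \<in> {1..N-1}" for n
    unfolding critval_def by (rule ranalytic_poly_eval[OF rnp rl[OF that]])
  define E where "E j w = critval (npoly N (\<lambda>k. w (Inr k))) (Suc j) - w (Inl (Suc j))" for j and w :: "nat + nat \<Rightarrow> real"
  have inj: "inj_on l {1..N-1}" unfolding l_def
    by (rule inj_on_increasing) (use rt_less[OF PD(1)] dPD in auto)
  have fin: "finite {1..N-1}" by simp
  have Js: "Suc j \<in> {1..N-1}" if "j \<in> ?J" for j using that by auto
  \<comment> \<open>The inverse of the Vandermonde matrix.\<close>
  define B where "B k j = coeff (lagrange_basis l {1..N-1} (Suc j)) k" for k j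
  obtain X \<rho> where X: "\<And>k. ranalytic (\<lambda>c. X c k) c0" "X c0 = p0" "\<And>c k. k \<notin> ?J \<Longrightarrow> X c k = p0 k"
    "\<forall>\<^sub>F c in nhds c0. \<forall>j\<in>?J. E j (case_sum c (X c)) = 0" "\<rho> > 0"
    "\<forall>\<^sub>F c in nhds c0. \<forall>p. (\<forall>k\<in>?J. \<bar>p k - p0 k\<bar> < \<rho>) \<longrightarrow> (\<forall>k. k \<notin> ?J \<longrightarrow> p k = p0 k) \<longrightarrow>
       (\<forall>j\<in>?J. E j (case_sum c p) = 0) \<longrightarrow> p = X c"
  proof (rule ranalytic_implicit_function[of ?J E c0 p0 "\<lambda>j k. l (Suc j) ^ k" B])
    fix j assume j: "j \<in> ?J"
    show "ranalytic (E j) (case_sum c0 p0)" unfolding E_def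
      using ranalytic_reindex[of "\<lambda>p. critval (npoly N p) (Suc j)" "case_sum c0 p0" Inr] rc[OF Js[OF j]]
      by (intro ranalytic_diff ranalytic_coord) simp
    show "E j (case_sum c0 p0) = 0" using c0[OF Js[OF j]] by (simp add: E_def)
    fix k assume k: "k \<in> ?J"
    obtain d where d: "((\<lambda>t. rt (pderiv (npoly N (p0(k := p0 k + t)))) (Suc j)) has_field_derivative d) (at 0)"
      using ranalytic_partial_derivative[OF rl[OF Js[OF j]], of k] by blast
    let ?r = "\<lambda>t. rt (pderiv (npoly N (p0(k := p0 k + t)))) (Suc j)"
    have r0: "?r 0 = l (Suc j)" by (simp add: l_def)
    have lr: "poly (pderiv ?D) (l (Suc j)) = 0" unfolding l_def by (rule rt_root[OF PD(1)]) (use Js[OF j] dPD in simp)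
    have "((\<lambda>t. poly ?D (?r t)) has_field_derivative poly (pderiv ?D) (?r 0) * d) (at 0)"
      by (rule DERIV_chain2[OF poly_DERIV d])
    moreover have "((\<lambda>t. t * ?r t ^ k) has_field_derivative 1 * ?r 0 ^ k + (of_nat k * (d * ?r 0 ^ (k - Suc 0))) * 0) (at 0)"
      by (intro DERIV_mult DERIV_ident DERIV_power d)
    ultimately have "((\<lambda>t. poly ?D (?r t) + t * ?r t ^ k - c0 (Suc j)) has_field_derivative
        (poly (pderiv ?D) (?r 0) * d + (1 * ?r 0 ^ k + (of_nat k * (d * ?r 0 ^ (k - Suc 0))) * 0) - 0)) (at 0)"
      by (intro DERIV_diff DERIV_add DERIV_const)
    moreover have "(\<lambda>t. poly ?D (?r t) + t * ?r t ^ k - c0 (Suc j)) = (\<lambda>t. E j (case_sum c0 (p0(k := p0 k + t))))"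
      using k by (simp add: E_def critval_def npoly_upd poly_monom fun_eq_iff del: fun_upd_apply)
    ultimately show "((\<lambda>t. E j (case_sum c0 (p0(k := p0 k + t)))) has_field_derivative l (Suc j) ^ k) (at 0)"
      unfolding r0 lr by simp
  next
    fix j k assume j: "j \<in> ?J" and k: "k \<in> ?J"
    have "(\<Sum>i\<in>?J. B j i * l (Suc i) ^ k) = (\<Sum>n\<in>{1..N-1}. coeff (lagrange_basis l {1..N-1} n) j * l n ^ k)"
      unfolding B_def by (rule sum.reindex_bij_witness[of _ "\<lambda>n. n - 1" Suc]) auto
    also have "\<dots> = coeff (\<Sum>n\<in>{1..N-1}. smult (poly (monom 1 k) (l n)) (lagrange_basis l {1..N-1} n)) j"
      by (simp add: coeff_sum poly_monom mult.commute)
    also have "(\<Sum>n\<in>{1..N-1}. smult (poly (monom 1 k) (l n)) (lagrange_basis l {1..N-1} n)) = monom 1 k"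
      by (rule lagrange_interpolation[symmetric, OF fin inj]) (use k in \<open>simp add: degree_monom_eq\<close>)
    finally show "(\<Sum>i\<in>?J. B j i * l (Suc i) ^ k) = (if j = k then 1 else 0)" by auto
    have dl: "degree (lagrange_basis l {1..N-1} (Suc k)) \<le> N - 2"
      using degree_lagrange_basis[OF fin Js[OF k], of l] by simp
    have "(\<Sum>i\<in>?J. l (Suc j) ^ i * B i k) = (\<Sum>i\<le>N-2. coeff (lagrange_basis l {1..N-1} (Suc k)) i * l (Suc j) ^ i)"
      unfolding B_def by (intro sum.cong) (use N in auto)
    also have "\<dots> = poly (lagrange_basis l {1..N-1} (Suc k)) (l (Suc j))"
      by (rule poly_eq_sum_coeff[symmetric, OF dl])
    also have "\<dots> = (if j = k then 1 else 0)"
      using poly_lagrange_basis[OF fin inj Js[OF k] Js[OF j]] by auto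
    finally show "(\<Sum>i\<in>?J. l (Suc j) ^ i * B i k) = (if j = k then 1 else 0)" .
  next
    fix X \<rho> assume "\<And>j. ranalytic (\<lambda>z. X z j) c0" "X c0 = p0" "\<And>z j. j \<notin> ?J \<Longrightarrow> X z j = p0 j"
    "\<forall>\<^sub>F z in nhds c0. \<forall>j\<in>?J. E j (case_sum z (X z)) = 0" "\<rho> > 0"
    "\<forall>\<^sub>F z in nhds c0. \<forall>x. (\<forall>j\<in>?J. \<bar>x j - p0 j\<bar> < \<rho>) \<longrightarrow> (\<forall>j. j \<notin> ?J \<longrightarrow> x j = p0 j) \<longrightarrow>
       (\<forall>j\<in>?J. E j (case_sum z x) = 0) \<longrightarrow> x = X z"
    then show thesis by (rule that)
  qed simp
  have EJ: "(\<forall>j\<in>?J. E j (case_sum c p) = 0) \<longleftrightarrow> (\<forall>n\<in>{1..N-1}. critval (npoly N p) n = c n)" for c p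
  proof
    assume a: "\<forall>j\<in>?J. E j (case_sum c p) = 0"
    show "\<forall>n\<in>{1..N-1}. critval (npoly N p) n = c n"
    proof
      fix n assume "n \<in> {1..N-1}"
      then have "n - 1 \<in> ?J" "n = Suc (n - 1)" by auto
      moreover have "E j (case_sum c p) = critval (npoly N p) (Suc j) - c (Suc j)" for j by (simp add: E_def)
      ultimately show "critval (npoly N p) n = c n" using bspec[OF a, of "n - 1"] by simp
    qed
  next
    assume "\<forall>n\<in>{1..N-1}. critval (npoly N p) n = c n"
    then show "\<forall>j\<in>?J. E j (case_sum c p) = 0" using Js by (simp add: E_def)
  qed
  have rrX: "\<forall>\<^sub>F c in nhds c0. real_rooted (npoly N (X c)) \<and> degree (npoly N (X c)) = N"
  proof (rule eventually_ranalytic_map[where J = ?J])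
    show "\<forall>\<^sub>F p in nhds (X c0). real_rooted (npoly N p) \<and> degree (npoly N p) = N"
      unfolding X(2) by (rule ranalytic_rt(2)[OF rnp _ dD rr]) (use normal_npoly[OF N] in \<open>simp add: normal_poly_def\<close>)
    show "X c k = X c0 k" if "k \<notin> ?J" for c k using X(3)[OF that] by simp
  qed (use X(1) in auto)
  show ?thesis
  proof (rule that[of X \<rho>])
    show "\<forall>\<^sub>F c in nhds c0. real_rooted (npoly N (X c)) \<and> (\<forall>n\<in>{1..N-1}. critval (npoly N (X c)) n = c n)"
      using X(4) rrX unfolding EJ by eventually_elim blast
    show "\<forall>\<^sub>F c in nhds c0. \<forall>p. (\<forall>k<N-1. \<bar>p k - p0 k\<bar> < \<rho>) \<longrightarrow> (\<forall>k\<ge>N-1. p k = 0) \<longrightarrow>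
       (\<forall>n\<in>{1..N-1}. critval (npoly N p) n = c n) \<longrightarrow> p = X c"
      using X(6) unfolding EJ by eventually_elim (use p0 in \<open>auto simp: not_less\<close>)
    show "X c k = 0" if "k \<ge> N - 1" for c k using X(3)[of k c] p0[OF that] that by simp
  qed (use X in auto)
qed

section \<open>Bounds on critical points and properness\<close>

lemma degree_prod_linear:
  fixes l :: "'i \<Rightarrow> real"
  assumes "finite A"
  shows "degree (\<Prod>i\<in>A. [:- l i, 1:]) = card A" "lead_coeff (\<Prod>i\<in>A. [:- l i, 1:]) = 1"
proof -
  show "degree (\<Prod>i\<in>A. [:- l i, 1:]) = card A" by (subst degree_prod_eq_sum_degree) auto
  show "lead_coeff (\<Prod>i\<in>A. [:- l i, 1:]) = 1" by (subst lead_coeff_prod) simp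
qed

lemma coeff_prod_linear_bound:
  fixes l :: "'i \<Rightarrow> real"
  assumes "finite A" "\<And>i. i \<in> A \<Longrightarrow> \<bar>l i\<bar> \<le> R" "R \<ge> 0"
  shows "\<bar>coeff (\<Prod>i\<in>A. [:- l i, 1:]) k\<bar> \<le> (1 + R) ^ card A"
  using assms(1,2)
proof (induction A arbitrary: k rule: finite_induct)
  case empty
  then show ?case by (cases k) simp_all
next
  case (insert a A)
  let ?q = "\<Prod>i\<in>A. [:- l i, 1:]" and ?M = "(1 + R) ^ card A"
  have IH: "\<bar>coeff ?q k\<bar> \<le> ?M" for k using insert by auto
  have M: "?M \<ge> 0" using assms(3) by simp
  have la: "\<bar>l a\<bar> \<le> R" using insert.prems by auto
  have b: "\<bar>l a * coeff ?q k\<bar> \<le> R * ?M" for k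
    unfolding abs_mult by (rule mult_mono) (use la IH assms(3) in auto)
  have "\<bar>coeff ([:- l a, 1:] * ?q) k\<bar> \<le> R * ?M + ?M"
  proof (cases k)
    case 0
    have "\<bar>coeff ([:- l a, 1:] * ?q) k\<bar> = \<bar>l a * coeff ?q 0\<bar>" using 0 by simp
    then show ?thesis using b[of 0] M by linarith
  next
    case (Suc j)
    have "\<bar>coeff ([:- l a, 1:] * ?q) k\<bar> = \<bar>coeff ?q j - l a * coeff ?q (Suc j)\<bar>" using Suc by simp
    then show ?thesis using b[of "Suc j"] IH[of j] by linarith
  qed
  then show ?case using insert.hyps by (simp add: algebra_simps)
qed

lemma coeff_prod_linear_sum:
  fixes l :: "'i \<Rightarrow> real"
  assumes "finite A" "A \<noteq> {}"
  shows "coeff (\<Prod>i\<in>A. [:- l i, 1:]) (card A - 1) = - (\<Sum>i\<in>A. l i)"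
  using assms
proof (induction A rule: finite_ne_induct)
  case (singleton a) then show ?case by simp
next
  case (insert a A)
  let ?q = "\<Prod>i\<in>A. [:- l i, 1:]"
  obtain m where m: "card A = Suc m" using insert.hyps by (metis card_gt_0_iff gr0_implies_Suc)
  have "coeff ?q (Suc m) = 1" using degree_prod_linear[OF insert.hyps(1), of l] m by simp
  moreover have "coeff ?q m = - (\<Sum>i\<in>A. l i)" using insert.IH m by simp
  ultimately show ?case using insert.hyps m by simp
qed

text \<open>The vanishing coefficient of degree \<open>N - 1\<close> pins down the translations of a normalized polynomial: its critical points
have zero sum.\<close>

lemma normal_pderiv_factor:
  assumes D: "normal_poly N D" "real_rooted D" and N: "N \<ge> 2"
  shows "pderiv D = smult (real N / 2) (\<Prod>n\<in>{1..N-1}. [:- rt (pderiv D) n, 1:])"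
    "(\<Sum>n\<in>{1..N-1}. rt (pderiv D) n) = 0"
proof -
  have d: "degree D = N" "N \<ge> 1" using D N by (auto simp: normal_poly_def)
  note PD = real_rooted_pderiv[OF D(2) d]
  have dP: "degree (pderiv D) = N - 1" using d by (simp add: degree_pderiv)
  have l: "coeff (pderiv D) (N - 1) = real N / 2" unfolding coeff_pderiv using D N by (simp add: normal_poly_def)
  show f: "pderiv D = smult (real N / 2) (\<Prod>n\<in>{1..N-1}. [:- rt (pderiv D) n, 1:])"
    using real_rooted_factor[OF PD(1)] unfolding dP l .
  have "coeff (pderiv D) (N - 2) = 0" using D N by (simp add: coeff_pderiv normal_poly_def Suc_diff_Suc numeral_2_eq_2)
  moreover have "coeff (\<Prod>n\<in>{1..N-1}. [:- rt (pderiv D) n, 1:]) (N - 2) = - (\<Sum>n\<in>{1..N-1}. rt (pderiv D) n)"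
    using coeff_prod_linear_sum[of "{1..N-1}" "rt (pderiv D)"] N by (simp add: numeral_2_eq_2)
  ultimately show "(\<Sum>n\<in>{1..N-1}. rt (pderiv D) n) = 0" using N by (subst (asm) f) simp
qed

text \<open>Let \<open>4v\<close> be the length of the gap. On the middle half of the gap, of length \<open>2v\<close>, every critical point is at
distance at least \<open>v\<close>, hence \<open>|D'| \<ge> v\<^sup>N\<^sup>-\<^sup>1\<close> there. As \<open>D\<close> is monotone on the gap, the two critical values differ by at
least \<open>v\<^sup>N\<close>.\<close>

lemma critical_points_gap:
  assumes D: "normal_poly N D" "real_rooted D" and N: "N \<ge> 2"
    and K: "\<And>n. n \<in> {1..N-1} \<Longrightarrow> \<bar>critval D n\<bar> \<le> K" and n: "1 \<le> n" "n + 1 \<le> N - 1"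
  shows "rt (pderiv D) (n + 1) - rt (pderiv D) n \<le> 4 * max 1 (2 * K)"
proof -
  let ?l = "rt (pderiv D)" and ?Q = "pderiv D"
  have d: "degree D = N" "N \<ge> 1" using D N by (auto simp: normal_poly_def)
  note PD = real_rooted_pderiv[OF D(2) d]
  have dP: "degree ?Q = N - 1" using d by (simp add: degree_pderiv)
  have lc: "lead_coeff ?Q > 0" unfolding dP coeff_pderiv using D N by (simp add: normal_poly_def)
  define t where "t = (-1 :: real) ^ (N - 1 - n)"
  have at: "\<bar>t\<bar> = 1" by (simp add: t_def power_abs)
  \<comment> \<open>A quarter of the gap, so that its middle half keeps the distance \<open>v\<close> from
    both ends.\<close>
  define v where "v = (?l (n + 1) - ?l n) / 4"
  have v: "v > 0" using rt_less[OF PD(1), of n "n + 1"] n dP by (simp add: v_def)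
  have ln: "?l (n + 1) = ?l n + 4 * v" by (simp add: v_def field_simps)
  have sgn: "t * poly ?Q x > 0" if "?l n < x" "x < ?l (n + 1)" for x
    using real_rooted_sign[OF PD(1) lc, of n x] that n dP by (simp add: t_def)
  have mvt: "\<exists>z. x < z \<and> z < y \<and> t * poly D y - t * poly D x = (y - x) * (t * poly ?Q z)" if xy: "x < y" for x y
  proof -
    obtain z where "x < z" "z < y" "poly D y - poly D x = (y - x) * poly ?Q z" using poly_MVT[OF xy, of D] by blast
    moreover from this have "t * (poly D y - poly D x) = t * ((y - x) * poly ?Q z)" by simp
    ultimately show ?thesis by (intro exI[of _ z]) (simp add: algebra_simps)
  qed
  have inc: "t * poly D y - t * poly D x \<ge> 0" if xy: "x < y" "?l n \<le> x" "y \<le> ?l (n + 1)" for x y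
  proof -
    obtain z where z: "x < z" "z < y" "t * poly D y - t * poly D x = (y - x) * (t * poly ?Q z)"
      using mvt[OF xy(1)] by blast
    have q: "t * poly ?Q z > 0" using sgn[of z] z xy by simp
    have "(y - x) * (t * poly ?Q z) > 0" by (rule mult_pos_pos[OF _ q]) (use xy in simp)
    then show ?thesis using z(3) by linarith
  qed
  have "t * poly D (?l n + v) - t * poly D (?l n) \<ge> 0" by (rule inc) (use v ln in auto)
  moreover have "t * poly D (?l n + 4 * v) - t * poly D (?l n + 3 * v) \<ge> 0" by (rule inc) (use v ln in auto)
  moreover have "t * poly D (?l n + 3 * v) - t * poly D (?l n + v) \<ge> v ^ N"
  proof -
    obtain z where z: "?l n + v < z" "z < ?l n + 3 * v" "t * poly D (?l n + 3 * v) - t * poly D (?l n + v) = (?l n + 3 * v - (?l n + v)) * (t * poly ?Q z)"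
      using mvt[of "?l n + v" "?l n + 3 * v"] v by auto
    have pos: "t * poly ?Q z > 0" using sgn[of z] z ln v by simp
    have far: "v \<le> \<bar>z - ?l i\<bar>" if "i \<in> {1..N-1}" for i
    proof (cases "i \<le> n")
      case True
      then have "?l i \<le> ?l n" using that n dP by (intro rt_le[OF PD(1)]) auto
      then show ?thesis using z(1) v by linarith
    next
      case False
      then have "?l (n + 1) \<le> ?l i" using that n dP by (intro rt_le[OF PD(1)]) auto
      then show ?thesis using z(2) v ln by linarith
    qed
    have "v ^ (N - 1) = (\<Prod>i\<in>{1..N-1}. v)" by simp
    also have "\<dots> \<le> (\<Prod>i\<in>{1..N-1}. \<bar>z - ?l i\<bar>)" by (rule prod_mono) (use far v in auto)
    finally have pr: "v ^ (N - 1) \<le> (\<Prod>i\<in>{1..N-1}. \<bar>z - ?l i\<bar>)" .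
    have "t * poly ?Q z = \<bar>t * poly ?Q z\<bar>" using pos by simp
    also have "\<dots> = real N / 2 * (\<Prod>i\<in>{1..N-1}. \<bar>z - ?l i\<bar>)"
      by (subst normal_pderiv_factor(1)[OF D N]) (simp add: abs_mult at poly_prod abs_prod)
    also have "\<dots> \<ge> 1 * v ^ (N - 1)" using N pr v by (intro mult_mono) auto
    finally have "t * poly ?Q z \<ge> v ^ (N - 1)" by simp
    then have "(2 * v) * (t * poly ?Q z) \<ge> (2 * v) * v ^ (N - 1)" using v by (intro mult_left_mono) auto
    moreover have "v * v ^ (N - 1) = v ^ N" using N by (cases N) auto
    moreover have "v ^ N > 0" using v by simp
    ultimately show ?thesis using z(3) by simp
  qed
  ultimately have ge: "t * critval D (n + 1) - t * critval D n \<ge> v ^ N" unfolding critval_def ln by linarith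
  have "\<bar>t * critval D (n + 1)\<bar> \<le> K" "\<bar>t * critval D n\<bar> \<le> K" using K[of "n + 1"] K[of n] n by (simp_all add: abs_mult at)
  then have vN: "v ^ N \<le> 2 * K" using ge by linarith
  have "v \<le> max 1 (2 * K)"
  proof (cases "v \<le> 1")
    case False
    then have "v ^ 1 \<le> v ^ N" using d by (intro power_increasing) auto
    then show ?thesis using vN by simp
  qed simp
  then show ?thesis by (simp add: v_def)
qed

text \<open>The gaps bound the differences of critical points, and the zero sum then bounds the critical points themselves. They
determine \<open>D'\<close>, and one critical value determines the constant coefficient.\<close>

lemma critval_bounded:
  assumes N: "N \<ge> 2" and K: "K \<ge> 0"
  shows "\<exists>M. \<forall>D. normal_poly N D \<longrightarrow> real_rooted D \<longrightarrow> (\<forall>n\<in>{1..N-1}. \<bar>critval D n\<bar> \<le> K) \<longrightarrow>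
     (\<forall>n\<in>{1..N-1}. \<bar>rt (pderiv D) n\<bar> \<le> M) \<and> (\<forall>k. \<bar>coeff D k\<bar> \<le> M)"
proof -
  define R where "R = real N * (4 * max 1 (2 * K))"
  define M1 where "M1 = real N * (1 + R) ^ (N - 1)"
  define M where "M = R + M1 + (K + (\<Sum>k\<in>{1..N}. M1 * R ^ k)) + 1"
  have R: "R \<ge> 0" by (simp add: R_def)
  have M1: "M1 \<ge> 0" using R by (simp add: M1_def)
  have S: "(\<Sum>k\<in>{1..N}. M1 * R ^ k) \<ge> 0" using R M1 by (intro sum_nonneg) simp
  show ?thesis
  proof (intro exI[of _ M] allI impI)
    fix D assume D: "normal_poly N D" "real_rooted D" and cv: "\<forall>n\<in>{1..N-1}. \<bar>critval D n\<bar> \<le> K"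
    let ?l = "rt (pderiv D)"
    have d: "degree D = N" "N \<ge> 1" using D N by (auto simp: normal_poly_def)
    note PD = real_rooted_pderiv[OF D(2) d]
    have dP: "degree (pderiv D) = N - 1" using d by (simp add: degree_pderiv)
    have gap: "?l j - ?l i \<le> real (j - i) * (4 * max 1 (2 * K))" if "1 \<le> i" "i \<le> j" "j \<le> N - 1" for i j
      using that(2,3)
    proof (induction rule: dec_induct)
      case (step n)
      have "?l (n + 1) - ?l n \<le> 4 * max 1 (2 * K)"
        by (rule critical_points_gap[OF D N]) (use cv step that(1) in auto)
      then show ?case using step by (simp add: Suc_diff_le algebra_simps)
    qed simp
    have spread: "\<bar>?l j - ?l i\<bar> \<le> R" if "i \<in> {1..N-1}" "j \<in> {1..N-1}" for i j
    proof -
      have a: "\<bar>?l j - ?l i\<bar> \<le> R" if "i \<in> {1..N-1}" "j \<in> {1..N-1}" "i \<le> j" for i j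
      proof -
        have "real (j - i) * (4 * max 1 (2 * K)) \<le> R" unfolding R_def by (rule mult_right_mono) (use that in auto)
        moreover have "?l i \<le> ?l j" using that dP by (intro rt_le[OF PD(1)]) auto
        ultimately show ?thesis using gap[of i j] that by auto
      qed
      show ?thesis using a[of i j] a[of j i] that by (cases "i \<le> j") (auto simp: abs_minus_commute)
    qed
    have lR: "\<bar>?l n\<bar> \<le> R" if n: "n \<in> {1..N-1}" for n
    proof -
      have "real (N - 1) * \<bar>?l n\<bar> = \<bar>(\<Sum>i\<in>{1..N-1}. ?l n - ?l i)\<bar>"
        using normal_pderiv_factor(2)[OF D N] by (simp add: sum_subtractf abs_mult)
      also have "\<dots> \<le> (\<Sum>i\<in>{1..N-1}. \<bar>?l n - ?l i\<bar>)" by (rule sum_abs)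
      also have "\<dots> \<le> (\<Sum>i\<in>{1..N-1}. R)" by (intro sum_mono spread n)
      also have "\<dots> = real (N - 1) * R" by simp
      finally show ?thesis using N by simp
    qed
    have cM1: "\<bar>coeff D k\<bar> \<le> M1" if "k \<ge> 1" for k
    proof -
      obtain j where j: "k = Suc j" using \<open>k \<ge> 1\<close> by (metis Suc_le_D One_nat_def)
      have "\<bar>coeff (pderiv D) j\<bar> = real N / 2 * \<bar>coeff (\<Prod>n\<in>{1..N-1}. [:- ?l n, 1:]) j\<bar>"
        by (subst normal_pderiv_factor(1)[OF D N]) (simp add: abs_mult)
      also have "\<dots> \<le> real N * (1 + R) ^ (N - 1)"
        using coeff_prod_linear_bound[of "{1..N-1}" ?l R j] lR R by (intro mult_mono) auto
      finally have "real (Suc j) * \<bar>coeff D k\<bar> \<le> M1" by (simp add: coeff_pderiv j M1_def abs_mult del: of_nat_Suc)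
      moreover have "1 * \<bar>coeff D k\<bar> \<le> real (Suc j) * \<bar>coeff D k\<bar>" by (intro mult_right_mono) auto
      ultimately show ?thesis by linarith
    qed
    have one: "1 \<in> {1..N-1}" using N by auto
    have "poly D (?l 1) = (\<Sum>k\<le>N. coeff D k * ?l 1 ^ k)" by (rule poly_eq_sum_coeff) (use d in simp)
    also have "{..N} = insert 0 {1..N}" by auto
    finally have "coeff D 0 = critval D 1 - (\<Sum>k\<in>{1..N}. coeff D k * ?l 1 ^ k)" by (simp add: critval_def)
    moreover have "\<bar>\<Sum>k\<in>{1..N}. coeff D k * ?l 1 ^ k\<bar> \<le> (\<Sum>k\<in>{1..N}. M1 * R ^ k)"
    proof (rule order_trans[OF sum_abs sum_mono])
      fix k assume "k \<in> {1..N}"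
      then show "\<bar>coeff D k * ?l 1 ^ k\<bar> \<le> M1 * R ^ k"
        unfolding abs_mult power_abs using cM1 lR[OF one] M1 by (intro mult_mono power_mono) auto
    qed
    moreover have "\<bar>critval D 1\<bar> \<le> K" using cv one by blast
    ultimately have "\<bar>coeff D 0\<bar> \<le> K + (\<Sum>k\<in>{1..N}. M1 * R ^ k)" by linarith
    then have "\<bar>coeff D k\<bar> \<le> M" for k using cM1[of k] R M1 S K by (cases "k = 0") (auto simp: M_def)
    moreover have "\<bar>?l n\<bar> \<le> M" if "n \<in> {1..N-1}" for n using lR[OF that] M1 S K by (auto simp: M_def)
    ultimately show "(\<forall>n\<in>{1..N-1}. \<bar>?l n\<bar> \<le> M) \<and> (\<forall>k. \<bar>coeff D k\<bar> \<le> M)" by blast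
  qed
qed

lemma bounded_convergent_subseq:
  fixes u :: "nat \<Rightarrow> 'i \<Rightarrow> real"
  assumes "finite F" "\<And>k i. i \<in> F \<Longrightarrow> \<bar>u k i\<bar> \<le> M"
  shows "\<exists>r l. strict_mono (r :: nat \<Rightarrow> nat) \<and> (\<forall>i\<in>F. (\<lambda>k. u (r k) i) \<longlonglongrightarrow> l i)"
  using assms
proof (induction F rule: finite_induct)
  case empty
  show ?case by (intro exI[of _ id]) (auto simp: strict_mono_def)
next
  case (insert a F)
  then obtain r l where r: "strict_mono (r :: nat \<Rightarrow> nat)" "\<forall>i\<in>F. (\<lambda>k. u (r k) i) \<longlonglongrightarrow> l i" by blast
  have "bounded (range (\<lambda>k. u (r k) a))" unfolding bounded_iff using insert.prems by auto
  then obtain x r' where r': "strict_mono (r' :: nat \<Rightarrow> nat)" "((\<lambda>k. u (r k) a) \<circ> r') \<longlonglongrightarrow> x"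
    using bounded_imp_convergent_subsequence by blast
  show ?case
  proof (intro exI[of _ "r \<circ> r'"] exI[of _ "l(a := x)"] conjI ballI)
    show "strict_mono (r \<circ> r')" using r(1) r'(1) by (rule strict_mono_o)
    fix i assume "i \<in> insert a F"
    show "(\<lambda>k. u ((r \<circ> r') k) i) \<longlonglongrightarrow> (l(a := x)) i"
    proof (cases "i = a")
      case True then show ?thesis using r'(2) by (simp add: o_def)
    next
      case False
      then have "(\<lambda>k. u (r k) i) \<longlonglongrightarrow> l i" using r(2) \<open>i \<in> insert a F\<close> by auto
      from LIMSEQ_subseq_LIMSEQ[OF this r'(1)] show ?thesis using False by (simp add: o_def)
    qed
  qed
qed

text \<open>The padding by zeros makes \<open>p\<close> unique as a function whenever the polynomial is.\<close>

definition crit_preimage :: "nat \<Rightarrow> (nat \<Rightarrow> real) \<Rightarrow> (nat \<Rightarrow> real) \<Rightarrow> bool" where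
  "crit_preimage N c p \<longleftrightarrow> (\<forall>k\<ge>N-1. p k = 0) \<and> real_rooted (npoly N p) \<and> (\<forall>n\<in>{1..N-1}. critval (npoly N p) n = c n)"

lemma tendsto_poly_npoly:
  assumes N: "N \<ge> 2" and p: "\<And>k. k < N - 1 \<Longrightarrow> (\<lambda>i. p i k) \<longlonglongrightarrow> q k" and x: "x \<longlonglongrightarrow> y"
  shows "(\<lambda>i. poly (npoly N (p i)) (x i)) \<longlonglongrightarrow> poly (npoly N q) y"
    "(\<lambda>i. poly (pderiv (npoly N (p i))) (x i)) \<longlonglongrightarrow> poly (pderiv (npoly N q)) y"
proof -
  have deg: "degree (npoly N p) \<le> N" "degree (pderiv (npoly N p)) \<le> N" for p
    using normal_npoly[OF N, of p] by (auto simp: normal_poly_def degree_pderiv)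
  have c: "(\<lambda>i. coeff (npoly N (p i)) k) \<longlonglongrightarrow> coeff (npoly N q) k" for k
    using p[of k] by (cases "k = N"; cases "k < N - 1") (simp_all add: coeff_npoly[OF N])
  show "(\<lambda>i. poly (npoly N (p i)) (x i)) \<longlonglongrightarrow> poly (npoly N q) y"
    unfolding poly_eq_sum_coeff[OF deg(1)] by (intro tendsto_intros c x)
  show "(\<lambda>i. poly (pderiv (npoly N (p i))) (x i)) \<longlonglongrightarrow> poly (pderiv (npoly N q)) y"
    unfolding poly_eq_sum_coeff[OF deg(2)] coeff_pderiv by (intro tendsto_intros c x)
qed

text \<open>Polynomials and critical points have convergent subsequences by \<open>critval_bounded\<close>. In the limit, consecutive critical
points cannot merge, as the critical values at them have opposite signs; so the limit polynomial has alternating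
values at \<open>N - 1\<close> points and is again real-rooted.\<close>

lemma critval_proper:
  assumes N: "N \<ge> 2" and p: "\<And>i. crit_preimage N (c i) (p i)"
    and c: "\<And>n. n \<in> {1..N-1} \<Longrightarrow> (\<lambda>i. c i n) \<longlonglongrightarrow> c' n" and alt: "\<And>n. n \<in> {1..N-1} \<Longrightarrow> (-1) ^ (N - n) * c' n > 0"
  shows "\<exists>r q. strict_mono (r :: nat \<Rightarrow> nat) \<and> (\<forall>k. (\<lambda>i. p (r i) k) \<longlonglongrightarrow> q k) \<and> crit_preimage N c' q"
proof -
  have "\<exists>K. \<forall>i. \<bar>c i n\<bar> \<le> K" if "n \<in> {1..N-1}" for n
    using convergent_imp_Bseq[OF convergentI[OF c[OF that]]] by (auto simp: Bseq_def)
  then obtain Kn where Kn: "\<And>n i. n \<in> {1..N-1} \<Longrightarrow> \<bar>c i n\<bar> \<le> Kn n" by metis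
  define K where "K = (\<Sum>n\<in>{1..N-1}. \<bar>Kn n\<bar>)"
  have K: "\<bar>c i n\<bar> \<le> K" if "n \<in> {1..N-1}" for i n
  proof -
    have "\<bar>Kn n\<bar> \<le> K" unfolding K_def using that by (intro member_le_sum) auto
    then show ?thesis using Kn[OF that, of i] by linarith
  qed
  have K0: "K \<ge> 0" unfolding K_def by (intro sum_nonneg) auto
  obtain M where M: "\<And>D. normal_poly N D \<Longrightarrow> real_rooted D \<Longrightarrow> \<forall>n\<in>{1..N-1}. \<bar>critval D n\<bar> \<le> K \<Longrightarrow>
     (\<forall>n\<in>{1..N-1}. \<bar>rt (pderiv D) n\<bar> \<le> M) \<and> (\<forall>k. \<bar>coeff D k\<bar> \<le> M)"
    using critval_bounded[OF N K0] by blast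
  define D where "D i = npoly N (p i)" for i
  have D: "normal_poly N (D i)" "real_rooted (D i)" "\<And>n. n \<in> {1..N-1} \<Longrightarrow> critval (D i) n = c i n" for i
    using normal_npoly[OF N] p by (auto simp: D_def crit_preimage_def)
  have DM: "(\<forall>n\<in>{1..N-1}. \<bar>rt (pderiv (D i)) n\<bar> \<le> M) \<and> (\<forall>k. \<bar>coeff (D i) k\<bar> \<le> M)" for i
    by (rule M[OF D(1,2)]) (use D(3) K in auto)
  define u where "u i = case_sum (p i) (rt (pderiv (D i)))" for i
  have "\<bar>u i j\<bar> \<le> M" if j: "j \<in> {..<N-1} <+> {1..N-1}" for i j
  proof -
    have "\<bar>p i k\<bar> \<le> M" if "k < N - 1" for k
      using DM[of i] that coeff_npoly[OF N, of "p i" k] by (auto simp: D_def split: if_splits) (metis less_irrefl_nat diff_le_self less_le_trans)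
    then show ?thesis using j DM[of i] by (auto simp: u_def)
  qed
  note ub = this
  have fin: "finite ({..<N-1} <+> {1..N-1})" by simp
  have "\<exists>r l. strict_mono (r :: nat \<Rightarrow> nat) \<and> (\<forall>j\<in>{..<N-1} <+> {1..N-1}. (\<lambda>k. u (r k) j) \<longlonglongrightarrow> l j)"
    by (rule bounded_convergent_subseq[OF fin ub])
  then obtain r l where r: "strict_mono (r :: nat \<Rightarrow> nat)"
    and "\<forall>j\<in>{..<N-1} <+> {1..N-1}. (\<lambda>k. u (r k) j) \<longlonglongrightarrow> l j" by (elim exE conjE) (rule that)
  then have l: "\<And>j. j \<in> {..<N-1} <+> {1..N-1} \<Longrightarrow> (\<lambda>k. u (r k) j) \<longlonglongrightarrow> l j" by (elim bspec)
  define q where "q k = (if k < N - 1 then l (Inl k) else 0)" for k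
  define \<kappa> where "\<kappa> n = l (Inr n)" for n
  have pq: "(\<lambda>i. p (r i) k) \<longlonglongrightarrow> q k" for k
  proof (cases "k < N - 1")
    case True then show ?thesis using l[of "Inl k"] by (simp add: u_def q_def InlI)
  next
    case False then show ?thesis using p by (simp add: q_def crit_preimage_def)
  qed
  have \<kappa>: "(\<lambda>i. rt (pderiv (D (r i))) n) \<longlonglongrightarrow> \<kappa> n" if "n \<in> {1..N-1}" for n
    using l[of "Inr n"] that by (simp add: u_def \<kappa>_def InrI)
  let ?D = "npoly N q"
  have dD: "degree (D i) = N" "N \<ge> 1" for i using D(1)[of i] N by (auto simp: normal_poly_def)
  note PD = real_rooted_pderiv[OF D(2) dD]
  have dP: "degree (pderiv (D i)) = N - 1" for i using dD by (simp add: degree_pderiv)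
  have root: "poly (pderiv ?D) (\<kappa> n) = 0" if n: "n \<in> {1..N-1}" for n
  proof -
    have "(\<lambda>i. poly (pderiv (npoly N (p (r i)))) (rt (pderiv (D (r i))) n)) \<longlonglongrightarrow> poly (pderiv ?D) (\<kappa> n)"
      by (rule tendsto_poly_npoly(2)[OF N pq \<kappa>[OF n]])
    moreover have "poly (pderiv (npoly N (p (r i)))) (rt (pderiv (D (r i))) n) = 0" for i
      using rt_root[OF PD(1)[of "r i"], of n] n dP by (simp add: D_def)
    ultimately show ?thesis by (simp add: LIMSEQ_const_iff)
  qed
  have val: "poly ?D (\<kappa> n) = c' n" if n: "n \<in> {1..N-1}" for n
  proof -
    have "(\<lambda>i. poly (npoly N (p (r i))) (rt (pderiv (D (r i))) n)) \<longlonglongrightarrow> poly ?D (\<kappa> n)"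
      by (rule tendsto_poly_npoly(1)[OF N pq \<kappa>[OF n]])
    moreover have "poly (npoly N (p (r i))) (rt (pderiv (D (r i))) n) = c (r i) n" for i
      using D(3)[OF n, of "r i"] by (simp add: D_def critval_def)
    moreover have "(\<lambda>i. c (r i) n) \<longlonglongrightarrow> c' n" using LIMSEQ_subseq_LIMSEQ[OF c[OF n] r] by (simp add: o_def)
    ultimately show ?thesis by (simp add: LIMSEQ_unique)
  qed
  have less: "\<kappa> i < \<kappa> j" if ij: "1 \<le> i" "i < j" "j \<le> N - 1" for i j
  proof -
    \<comment> \<open>The limits of consecutive critical points are distinct, as \<open>c'\<close> takes
      values of opposite signs.\<close>
    have st: "\<kappa> n < \<kappa> (Suc n)" if n: "1 \<le> n" "Suc n \<le> N - 1" for n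
    proof -
      have "\<kappa> n \<le> \<kappa> (Suc n)"
      proof (rule LIMSEQ_le[OF \<kappa> \<kappa>])
        have "rt (pderiv (D (r i))) n \<le> rt (pderiv (D (r i))) (Suc n)" for i
          by (rule rt_le[OF PD(1)]) (use n dP in auto)
        then show "\<exists>K. \<forall>i\<ge>K. rt (pderiv (D (r i))) n \<le> rt (pderiv (D (r i))) (Suc n)" by blast
      qed (use n in auto)
      moreover have "\<kappa> n \<noteq> \<kappa> (Suc n)"
      proof
        assume "\<kappa> n = \<kappa> (Suc n)"
        then have "c' n = c' (Suc n)" using val[of n] val[of "Suc n"] n by simp
        moreover have "N - n = Suc (N - Suc n)" using n by auto
        ultimately show False using alt[of n] alt[of "Suc n"] n by auto
      qed
      ultimately show ?thesis by simp
    qed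
    from ij(2) have "Suc i \<le> j" by simp
    then show ?thesis using ij(3)
    proof (induction rule: dec_induct)
      case base then show ?case using st[of i] ij(1) by simp
    next
      case (step m) then show ?case using st[of m] ij(1) by simp
    qed
  qed
  have nq: "normal_poly N ?D" by (rule normal_npoly[OF N])
  then have dq: "degree ?D = N" "lead_coeff ?D > 0" using normal_lead by (auto simp: normal_poly_def)
  have altq: "(-1) ^ (N - n) * poly ?D (\<kappa> n) > 0" if "n \<in> {1..N-1}" for n using alt[OF that] val[OF that] by simp
  have rq: "real_rooted ?D" by (rule alternating_real_rooted(1)[OF dq(1) dD(2) dq(2) less altq])
  have dPq: "degree (pderiv ?D) = N - 1" using dq by (simp add: degree_pderiv)
  have nz: "pderiv ?D \<noteq> 0" using dq N by (auto simp: pderiv_eq_0_iff)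
  have "rt (pderiv ?D) n = \<kappa> n" if "n \<in> {1..N-1}" for n
    by (rule real_rootedI(2)[OF nz dPq, of \<kappa>]) (use root less that in auto)
  then have "crit_preimage N c' q" using rq val by (simp add: crit_preimage_def critval_def q_def)
  then show ?thesis using r pq by blast
qed

section \<open>Polynomials with prescribed critical values\<close>

text \<open>Chebyshev polynomials up to scaling of the variable, characterized by their critical values.\<close>

definition equioscillating :: "nat \<Rightarrow> real poly \<Rightarrow> bool" where
  "equioscillating N D \<longleftrightarrow> normal_poly N D \<and> real_rooted D \<and> (\<forall>n\<in>{1..N-1}. critval D n = (-1) ^ (N - n))"

lemma coeff_chebyshev_operator:
  fixes D :: "real poly"
  shows "coeff (smult ((real N)\<^sup>2) D - [:0, 1:] * pderiv D - [:-s, 0, 1:] * pderiv (pderiv D)) k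
     = ((real N)\<^sup>2 - (real k)\<^sup>2) * coeff D k + s * real (k + 2) * real (k + 1) * coeff D (k + 2)"
proof -
  consider "k = 0" | "k = 1" | j where "k = Suc (Suc j)" by (metis One_nat_def not0_implies_Suc)
  then show ?thesis
    by cases (simp_all add: coeff_pderiv power2_eq_square algebra_simps numeral_2_eq_2 del: of_nat_Suc, simp_all add: algebra_simps)
qed

text \<open>The Chebyshev differential equation. Put \<open>G = N\<^sup>2 D - \<lambda> D' - (\<lambda>\<^sup>2 - s) D''\<close>, the constant \<open>s\<close> being chosen so as to make the
degree of \<open>G\<close> less than \<open>N - 2\<close>. The function \<open>S = D\<^sup>2 - 1 - (\<lambda>\<^sup>2 - s) D'\<^sup>2 / N\<^sup>2\<close> vanishes at all the critical points, and
\<open>S' = 2 D' G / N\<^sup>2\<close>; by Rolle's theorem \<open>G\<close> has a root between any two consecutive ones. These \<open>N - 2\<close> roots are too many,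
so \<open>G = 0\<close>.\<close>

lemma equioscillating_ode:
  assumes D: "equioscillating N D" and N: "N \<ge> 2"
  defines "s \<equiv> - 8 * coeff D (N - 2) / real N"
  shows "s > 0" "\<And>k. ((real N)\<^sup>2 - (real k)\<^sup>2) * coeff D k = - s * real (k + 2) * real (k + 1) * coeff D (k + 2)"
proof -
  let ?Q = "pderiv D" let ?l = "rt ?Q"
  have nD: "normal_poly N D" and rr: "real_rooted D" and cv: "\<And>n. n \<in> {1..N-1} \<Longrightarrow> poly D (?l n) = (-1) ^ (N - n)"
    using D by (auto simp: equioscillating_def critval_def)
  have d: "degree D = N" "N \<ge> 1" using nD N by (auto simp: normal_poly_def)
  have lc: "lead_coeff D > 0" using normal_lead[OF nD] .
  note PD = real_rooted_pderiv[OF rr d]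
  have dP: "degree ?Q = N - 1" using d by (simp add: degree_pderiv)
  have Ql: "poly ?Q (?l n) = 0" if "n \<in> {1..N-1}" for n by (rule rt_root[OF PD(1)]) (use that dP in auto)
  define G where "G = smult ((real N)\<^sup>2) D - [:0, 1:] * ?Q - [:-s, 0, 1:] * pderiv ?Q"
  define S where "S = D\<^sup>2 - 1 - smult (1 / (real N)\<^sup>2) ([:-s, 0, 1:] * ?Q\<^sup>2)"
  have N0: "real N > 0" using N by simp
  have coeffG: "coeff G k = ((real N)\<^sup>2 - (real k)\<^sup>2) * coeff D k + s * real (k + 2) * real (k + 1) * coeff D (k + 2)" for k
    unfolding G_def by (rule coeff_chebyshev_operator)
  have G_high: "coeff G k = 0" if "k \<ge> N - 2" for k
  proof -
    have hi: "coeff D j = 0" if "j > N" for j using that d by (simp add: coeff_eq_0)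
    consider "k = N - 2" | "k = N - 1" | "k = N" | "k > N" using \<open>k \<ge> N - 2\<close> by linarith
    then show ?thesis
    proof cases
      case 1
      obtain m where m: "N = m + 2" using N by (metis add.commute le_Suc_ex)
      have "coeff D (m + 2) = 1/2" using nD m by (simp add: normal_poly_def)
      moreover have "k = m" using 1 m by simp
      moreover have "s * real (m + 2) = - 8 * coeff D m" using m N0 by (simp add: s_def)
      moreover have "coeff G m = ((real (m + 2))\<^sup>2 - (real m)\<^sup>2) * coeff D m + s * real (m + 2) * real (m + 1) * coeff D (m + 2)"
        using coeffG[of m] unfolding m .
      ultimately have "coeff G k = ((real (m + 2))\<^sup>2 - (real m)\<^sup>2) * coeff D m + - 8 * coeff D m * real (m + 1) * (1/2)"
        by (simp only:)
      then show ?thesis by (simp add: power2_eq_square algebra_simps)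
    next
      case 2
      then show ?thesis using nD hi[of "k + 2"] N unfolding coeffG by (simp add: normal_poly_def)
    next
      case 3
      then show ?thesis using hi[of "k + 2"] unfolding coeffG by simp
    next
      case 4
      then show ?thesis using hi[of k] hi[of "k + 2"] unfolding coeffG by simp
    qed
  qed
  have dS: "pderiv S = smult (2 / (real N)\<^sup>2) (?Q * G)"
  proof (rule poly_ext)
    fix x
    show "poly (pderiv S) x = poly (smult (2 / (real N)\<^sup>2) (?Q * G)) x"
      using N0 by (simp add: S_def G_def pderiv_diff pderiv_smult pderiv_mult pderiv_pCons power2_eq_square)
        (simp add: field_simps)
  qed
  have S0: "poly S (?l n) = 0" if "n \<in> {1..N-1}" for n
    using cv[OF that] Ql[OF that] by (simp add: S_def power2_eq_square flip: power_mult_distrib)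
  have "\<exists>x. ?l n < x \<and> x < ?l (n + 1) \<and> poly G x = 0" if n: "n \<in> {1..N-2}" for n
  proof -
    have n': "n \<in> {1..N-1}" "n + 1 \<in> {1..N-1}" using n by auto
    have lt: "?l n < ?l (n + 1)" by (rule rt_less[OF PD(1)]) (use n dP in auto)
    obtain x where x: "?l n < x" "x < ?l (n + 1)" "poly S (?l (n + 1)) - poly S (?l n) = (?l (n + 1) - ?l n) * poly (pderiv S) x"
      using poly_MVT[OF lt, of S] by blast
    then have "poly (pderiv S) x = 0" using S0[OF n'(1)] S0[OF n'(2)] lt by simp
    then have "poly ?Q x * poly G x = 0" using N0 by (simp add: dS)
    moreover have "poly ?Q x \<noteq> 0"
    proof -
      have lq: "lead_coeff ?Q > 0" unfolding dP coeff_pderiv using nD N by (simp add: normal_poly_def)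
      have nq: "n \<le> degree ?Q" using n dP by auto
      have "(-1) ^ (degree ?Q - n) * poly ?Q x > 0" by (rule real_rooted_sign[OF PD(1) lq nq]) (use x in auto)
      then show ?thesis by auto
    qed
    ultimately show ?thesis using x by auto
  qed
  then obtain \<xi> where \<xi>: "\<And>n. n \<in> {1..N-2} \<Longrightarrow> ?l n < \<xi> n \<and> \<xi> n < ?l (n + 1) \<and> poly G (\<xi> n) = 0" by metis
  have G0: "G = 0"
  proof (rule ccontr)
    assume G: "G \<noteq> 0"
    have "\<xi> i < \<xi> j" if ij: "i \<in> {1..N-2}" "j \<in> {1..N-2}" "i < j" for i j
    proof -
      have "?l (i + 1) \<le> ?l j" by (rule rt_le[OF PD(1)]) (use ij dP in auto)
      then show ?thesis using \<xi>[OF ij(1)] \<xi>[OF ij(2)] by linarith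
    qed
    then have "inj_on \<xi> {1..N-2}" by (rule inj_on_increasing)
    then have "card (\<xi> ` {1..N-2}) = N - 2" by (simp add: card_image)
    moreover have "card (\<xi> ` {1..N-2}) \<le> card {x. poly G x = 0}"
      by (rule card_mono[OF poly_roots_finite[OF G]]) (use \<xi> in auto)
    moreover have "card {x. poly G x = 0} \<le> degree G" by (rule card_poly_roots_bound[OF G])
    moreover have "\<not> degree G \<ge> N - 2" using G_high[of "degree G"] G by auto
    ultimately show False by linarith
  qed
  show "((real N)\<^sup>2 - (real k)\<^sup>2) * coeff D k = - s * real (k + 2) * real (k + 1) * coeff D (k + 2)" for k
    using coeffG[of k] unfolding G0 by simp
  have one: "1 \<in> {1..N-1}" using N by auto
  let ?t = "(-1 :: real) ^ (N - 1)"
  have "poly G (?l 1) = 0" by (simp add: G0)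
  \<comment> \<open>At a critical point the equation compares \<open>D\<close> with \<open>D''\<close>, whose
    signs are opposite; this gives \<open>s > 0\<close>.\<close>
  then have e: "(real N)\<^sup>2 * poly D (?l 1) = ((?l 1)\<^sup>2 - s) * poly (pderiv ?Q) (?l 1)"
    using Ql[OF one] by (simp add: G_def power2_eq_square algebra_simps)
  have tt: "?t * poly D (?l 1) = 1" using cv[OF one] by (simp flip: power_mult_distrib)
  have neg: "?t * poly (pderiv ?Q) (?l 1) < 0" by (rule rt_second_deriv[OF rr d(1) lc one])
  have "?t * ((real N)\<^sup>2 * poly D (?l 1)) = ?t * (((?l 1)\<^sup>2 - s) * poly (pderiv ?Q) (?l 1))" using e by (rule arg_cong)
  then have eq: "(real N)\<^sup>2 = ((?l 1)\<^sup>2 - s) * (?t * poly (pderiv ?Q) (?l 1))"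
    using tt by (simp only: mult.left_commute[of ?t])
  have "(real N)\<^sup>2 > 0" using N0 by simp
  then have pos: "((?l 1)\<^sup>2 - s) * (?t * poly (pderiv ?Q) (?l 1)) > 0" by (simp only: eq)
  have "(?l 1)\<^sup>2 - s < 0"
  proof (rule ccontr)
    assume ge: "\<not> (?l 1)\<^sup>2 - s < 0"
    have "((?l 1)\<^sup>2 - s) * (?t * poly (pderiv ?Q) (?l 1)) \<le> 0"
      by (rule mult_nonneg_nonpos) (use neg ge in linarith)+
    then show False using pos by linarith
  qed
  then show "s > 0" using zero_le_power2[of "?l 1"] by linarith
qed

text \<open>By the recursion for the coefficients, two solutions satisfy \<open>D\<^sub>1(\<lambda>) = r\<^sup>N D\<^sub>2(\<lambda>/r)\<close> with \<open>r > 0\<close>. Scaling multiplies the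
critical values by \<open>r\<^sup>N\<close>, and their moduli are \<open>1\<close> on both sides; so \<open>r = 1\<close>.\<close>

theorem equioscillating_unique:
  assumes D1: "equioscillating N D1" and D2: "equioscillating N D2" and N: "N \<ge> 2"
  shows "D1 = D2"
proof -
  define s1 where "s1 = - 8 * coeff D1 (N - 2) / real N"
  define s2 where "s2 = - 8 * coeff D2 (N - 2) / real N"
  note o1 = equioscillating_ode[OF D1 N, folded s1_def] and o2 = equioscillating_ode[OF D2 N, folded s2_def]
  define r where "r = sqrt (s1 / s2)"
  have r: "r > 0" "s1 = r\<^sup>2 * s2" using o1(1) o2(1) by (simp_all add: r_def)
  have n1: "normal_poly N D1" and n2: "normal_poly N D2" using D1 D2 by (auto simp: equioscillating_def)
  have cf: "coeff D1 k = r ^ (N - k) * coeff D2 k" if "k \<le> N" for k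
    using that
  proof (induction "N - k" arbitrary: k rule: less_induct)
    case less
    consider "k = N" | "k = N - 1" "k < N" | "k + 2 \<le> N" using less.prems by linarith
    then show ?case
    proof cases
      case 3
      have IH: "coeff D1 (k + 2) = r ^ (N - (k + 2)) * coeff D2 (k + 2)" by (rule less.hyps) (use 3 in auto)
      have "N - k = 2 + (N - (k + 2))" using 3 by simp
      then have p: "r ^ (N - k) = r\<^sup>2 * r ^ (N - (k + 2))" by (simp only: power_add)
      have "((real N)\<^sup>2 - (real k)\<^sup>2) * coeff D1 k = - s1 * real (k + 2) * real (k + 1) * coeff D1 (k + 2)" by (rule o1(2))
      also have "\<dots> = r\<^sup>2 * r ^ (N - (k + 2)) * (- s2 * real (k + 2) * real (k + 1) * coeff D2 (k + 2))"
        unfolding IH r(2) by (simp only: mult_ac minus_mult_left[symmetric] minus_mult_right[symmetric])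
      also have "\<dots> = r ^ (N - k) * (((real N)\<^sup>2 - (real k)\<^sup>2) * coeff D2 k)" unfolding o2(2) p ..
      finally have "((real N)\<^sup>2 - (real k)\<^sup>2) * coeff D1 k = ((real N)\<^sup>2 - (real k)\<^sup>2) * (r ^ (N - k) * coeff D2 k)"
        by (simp only: mult_ac)
      moreover have "(real N)\<^sup>2 - (real k)\<^sup>2 \<noteq> 0" using 3 by simp
      ultimately show ?thesis by simp
    qed (use n1 n2 in \<open>auto simp: normal_poly_def\<close>)
  qed
  have d: "degree D1 = N" "degree D2 = N" using n1 n2 by (auto simp: normal_poly_def)
  have scale: "poly D1 x = r ^ N * poly D2 (x / r)" for x
  proof -
    have "poly D1 x = (\<Sum>k\<le>N. coeff D1 k * x ^ k)" by (rule poly_eq_sum_coeff) (simp add: d)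
    also have "\<dots> = (\<Sum>k\<le>N. r ^ N * (coeff D2 k * (x / r) ^ k))"
    proof (rule sum.cong)
      fix k assume "k \<in> {..N}"
      then have "r ^ N = r ^ (N - k) * r ^ k" by (simp flip: power_add)
      then show "coeff D1 k * x ^ k = r ^ N * (coeff D2 k * (x / r) ^ k)"
        using cf[of k] \<open>k \<in> {..N}\<close> r(1) by (simp add: power_divide)
    qed simp
    also have "\<dots> = r ^ N * poly D2 (x / r)"
      unfolding sum_distrib_left[symmetric] by (subst poly_eq_sum_coeff[of D2 N]) (simp_all add: d)
    finally show ?thesis .
  qed
  have pc: "D1 = smult (r ^ N) (pcompose D2 [:0, 1 / r:])"
  proof (rule poly_ext)
    fix x show "poly D1 x = poly (smult (r ^ N) (pcompose D2 [:0, 1 / r:])) x" using scale[of x] by (simp add: poly_pcompose)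
  qed
  have rr: "real_rooted D1" "real_rooted D2" using D1 D2 by (auto simp: equioscillating_def)
  have N1: "N \<ge> 1" using N by simp
  note P1 = real_rooted_pderiv[OF rr(1) d(1) N1] and P2 = real_rooted_pderiv[OF rr(2) d(2) N1]
  let ?l = "rt (pderiv D1) 1"
  have "poly (pderiv D1) ?l = 0" by (rule rt_root[OF P1(1)]) (use N d in \<open>simp add: degree_pderiv\<close>)
  then have "poly (pderiv D2) (?l / r) = 0" using r(1)
    by (subst (asm) pc) (simp add: pderiv_smult pderiv_pcompose poly_pcompose pderiv_pCons)
  then have "?l / r \<in> {x. poly (pderiv D2) x = 0}" by simp
  then obtain j where j: "j \<in> {1..N-1}" "?l / r = rt (pderiv D2) j"
    unfolding rt_image[OF P2(1)] using d by (auto simp: degree_pderiv)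
  have "\<bar>poly D1 ?l\<bar> = 1" using D1 N by (auto simp: equioscillating_def critval_def power_abs)
  moreover have "\<bar>poly D2 (?l / r)\<bar> = 1" using D2 j by (auto simp: equioscillating_def critval_def power_abs)
  ultimately have "r ^ N = 1" using scale[of ?l] r(1) by (simp add: abs_mult power_abs)
  then have r1: "r = 1" using power_eq_imp_eq_base[of r N 1] r(1) N by simp
  show ?thesis
  proof (rule poly_eqI)
    fix k show "coeff D1 k = coeff D2 k"
      using cf[of k] d by (cases "k \<le> N") (simp_all add: r1 coeff_eq_0)
  qed
qed

text \<open>Connectedness of the unit interval, as an induction principle along a segment.\<close>

lemma segment_induct:
  fixes c0 c1 :: "nat \<Rightarrow> real"
  defines "c \<equiv> \<lambda>t n. (1 - t) * c0 n + t * c1 n"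
  assumes P0: "P c0"
    and op: "\<And>t. 0 \<le> t \<Longrightarrow> t \<le> 1 \<Longrightarrow> P (c t) \<Longrightarrow> \<forall>\<^sub>F c' in nhds (c t). P c'"
    and cl: "\<And>ts t. \<lbrakk>\<And>i::nat. 0 \<le> ts i \<and> ts i \<le> 1 \<and> P (c (ts i)); ts \<longlonglongrightarrow> t; 0 \<le> t; t \<le> 1\<rbrakk> \<Longrightarrow> P (c t)"
  shows "P c1"
proof -
  let ?T = "{t \<in> {0..1}. P (c t)}"
  have "openin (top_of_set {0..1}) ?T"
    unfolding openin_euclidean_subtopology_iff
  proof (intro conjI ballI)
    fix t assume t: "t \<in> ?T"
    then have "\<forall>\<^sub>F c' in nhds (c t). P c'" by (intro op) auto
    then obtain S where S: "open S" "c t \<in> S" "\<And>c'. c' \<in> S \<Longrightarrow> P c'" unfolding eventually_nhds by blast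
    have "continuous_on UNIV c" unfolding c_def
      by (intro continuous_on_coordinatewise_then_product continuous_intros)
    from open_vimage[OF S(1) this] S(2) obtain e where e: "e > 0" "ball t e \<subseteq> c -` S"
      by (metis open_contains_ball vimageI)
    show "\<exists>e>0. \<forall>t'\<in>{0..1}. dist t' t < e \<longrightarrow> t' \<in> ?T"
    proof (intro exI[of _ e] conjI e(1) ballI impI)
      fix t' :: real assume "t' \<in> {0..1}" "dist t' t < e"
      then have "t' \<in> ball t e" by (simp add: dist_commute)
      then have "c t' \<in> S" using e(2) by blast
      then show "t' \<in> ?T" using S(3) \<open>t' \<in> {0..1}\<close> by simp
    qed
  qed auto
  moreover have "closed ?T" unfolding closed_sequential_limits
  proof (intro allI impI, elim conjE)
    fix ts t assume ts: "\<forall>i. ts i \<in> ?T" "ts \<longlonglongrightarrow> t"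
    have "t \<in> {0..1}" by (rule closed_sequentially[OF closed_atLeastAtMost _ ts(2)]) (use ts(1) in auto)
    moreover from this have "P (c t)" by (intro cl[OF _ ts(2)]) (use ts(1) in auto)
    ultimately show "t \<in> ?T" by simp
  qed
  then have "closedin (top_of_set {0..1}) ?T" by (rule closed_subset[rotated]) auto
  ultimately have dich: "?T = {} \<or> ?T = {0..1}"
    using connected_Icc[of "0::real" 1] unfolding connected_clopen by blast
  have "0 \<in> ?T" using P0 by (simp add: c_def)
  then have "?T \<noteq> {}" by (metis empty_iff)
  with dich have T1: "?T = {0..1}" by (elim disjE) (erule notE, assumption+)
  have "1 \<in> ?T" by (rule ssubst[OF T1]) simp
  then have "P (c 1)" by simp
  then show ?thesis by (simp add: c_def)
qed

lemma segment_alternating: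
  assumes "0 \<le> t" "t \<le> 1" "s * a > 0" "s * b > (0::real)"
  shows "s * ((1 - t) * a + t * b) > 0"
proof -
  have "s * ((1 - t) * a + t * b) = (1 - t) * (s * a) + t * (s * b)" by (simp add: algebra_simps)
  also have "\<dots> > 0"
  proof (cases "t = 0")
    case False
    then have "t * (s * b) > 0" "(1 - t) * (s * a) \<ge> 0" using assms by simp_all
    then show ?thesis by linarith
  qed (use assms in simp)
  finally show ?thesis .
qed

definition alternating :: "nat \<Rightarrow> (nat \<Rightarrow> real) \<Rightarrow> bool" where
  "alternating N c \<longleftrightarrow> (\<forall>n\<in>{1..N-1}. (-1) ^ (N - n) * c n > 0)"

text \<open>An arithmetic progression centred at \<open>0\<close>, so that the roots have zero sum.\<close>

lemma exists_normal_real_rooted: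
  assumes "N \<ge> 2" shows "\<exists>D. normal_poly N D \<and> real_rooted D"
proof -
  define z where "z i = real i - (real N + 1) / 2" for i
  define D where "D = smult (1/2) (\<Prod>i\<in>{1..N}. [:- z i, 1:])"
  have d: "degree (\<Prod>i\<in>{1..N}. [:- z i, 1:]) = N" "lead_coeff (\<Prod>i\<in>{1..N}. [:- z i, 1:]) = 1"
    using degree_prod_linear[of "{1..N}" z] by auto
  have "(\<Sum>i\<in>{1..N}. real i) = real N * (real N + 1) / 2"
  proof (induction N)
    case (Suc N) then show ?case by (simp add: field_simps)
  qed simp
  then have "(\<Sum>i\<in>{1..N}. z i) = 0" by (simp add: z_def sum_subtractf)
  then have "coeff (\<Prod>i\<in>{1..N}. [:- z i, 1:]) (N - 1) = 0"
    using coeff_prod_linear_sum[of "{1..N}" z] assms by simp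
  then have n: "normal_poly N D" using d by (simp add: D_def normal_poly_def)
  have D0: "D \<noteq> 0" "degree D = N" using n assms by (auto simp: normal_poly_def)
  have "real_rooted D"
    by (rule real_rootedI(1)[OF D0, of z]) (auto simp: D_def poly_prod z_def)
  then show ?thesis using n by blast
qed

lemma crit_preimage_coeffs:
  assumes N: "N \<ge> 2" and D: "normal_poly N D" "real_rooted D" "\<And>n. n \<in> {1..N-1} \<Longrightarrow> critval D n = c n"
  defines "p \<equiv> (\<lambda>k. if k < N - 1 then coeff D k else 0)"
  shows "crit_preimage N c p" "npoly N p = D"
proof -
  show e: "npoly N p = D" by (rule npoly_coeff[OF N D(1)]) (simp add: p_def)
  show "crit_preimage N c p" unfolding crit_preimage_def e using D by (simp add: p_def)
qed

text \<open>Along the segment from the critical values of any normalized polynomial to the given ones, the sequences with a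
preimage form a set that is open by \<open>critval_local_inverse\<close> and closed by \<open>critval_proper\<close>.\<close>

theorem critval_surj:
  assumes N: "N \<ge> 2" and alt: "alternating N c1"
  shows "\<exists>p. crit_preimage N c1 p"
proof -
  obtain D where D: "normal_poly N D" "real_rooted D" using exists_normal_real_rooted[OF N] by blast
  define c0 where "c0 = critval D"
  have alt0: "alternating N c0" unfolding alternating_def c0_def using critval_sign[OF D] by blast
  have altt: "(-1) ^ (N - n) * ((1 - t) * c0 n + t * c1 n) > 0" if "0 \<le> t" "t \<le> 1" "n \<in> {1..N-1}" for t n
    by (rule segment_alternating) (use that alt alt0 in \<open>auto simp: alternating_def\<close>)
  show ?thesis
  proof (rule segment_induct[of "\<lambda>c. \<exists>p. crit_preimage N c p" c0])
    show "\<exists>p. crit_preimage N c0 p" using crit_preimage_coeffs[OF N D, of c0] by (auto simp: c0_def)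
  next
    fix t :: real assume "\<exists>p. crit_preimage N (\<lambda>n. (1 - t) * c0 n + t * c1 n) p"
    then obtain p where p: "\<forall>k\<ge>N-1. p k = 0" "real_rooted (npoly N p)" "\<forall>n\<in>{1..N-1}. critval (npoly N p) n = (1 - t) * c0 n + t * c1 n"
      by (auto simp: crit_preimage_def)
    obtain X \<rho> where X: "\<And>c k. k \<ge> N - 1 \<Longrightarrow> X c k = 0"
      "\<forall>\<^sub>F c in nhds (\<lambda>n. (1 - t) * c0 n + t * c1 n). real_rooted (npoly N (X c)) \<and> (\<forall>n\<in>{1..N-1}. critval (npoly N (X c)) n = c n)"
      by (rule critval_local_inverse[OF N p(2), of "\<lambda>n. (1 - t) * c0 n + t * c1 n"]) (use p in auto)
    show "\<forall>\<^sub>F c' in nhds (\<lambda>n. (1 - t) * c0 n + t * c1 n). \<exists>p. crit_preimage N c' p"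
      using X(2)
    proof eventually_elim
      case (elim c)
      then have "crit_preimage N c (X c)" using X(1) by (simp add: crit_preimage_def)
      then show ?case by blast
    qed
  next
    fix ts :: "nat \<Rightarrow> real" and t
    assume ts: "\<And>i. 0 \<le> ts i \<and> ts i \<le> 1 \<and> (\<exists>p. crit_preimage N (\<lambda>n. (1 - ts i) * c0 n + ts i * c1 n) p)"
      and lim: "ts \<longlonglongrightarrow> t" and t: "0 \<le> t" "t \<le> 1"
    from ts obtain p where p: "\<And>i. crit_preimage N (\<lambda>n. (1 - ts i) * c0 n + ts i * c1 n) (p i)" by metis
    have "(\<lambda>i. (1 - ts i) * c0 n + ts i * c1 n) \<longlonglongrightarrow> (1 - t) * c0 n + t * c1 n" for n
      by (intro tendsto_intros lim)
    then have "\<exists>r q. strict_mono (r :: nat \<Rightarrow> nat) \<and> (\<forall>k. (\<lambda>i. p (r i) k) \<longlonglongrightarrow> q k) \<and> crit_preimage N (\<lambda>n. (1 - t) * c0 n + t * c1 n) q"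
      by (intro critval_proper[OF N, of "\<lambda>i n. (1 - ts i) * c0 n + ts i * c1 n"] p altt t)
    then show "\<exists>p. crit_preimage N (\<lambda>n. (1 - t) * c0 n + t * c1 n) p" by blast
  qed
qed

text \<open>Along the segment to the critical values \<open>\<plusminus>1\<close>, having two different preimages is an open condition, because both of them
continue. It is also closed: the preimages subconverge, and their limits differ, since \<open>critval_local_inverse\<close> excludes
two preimages close to one polynomial. At the end of the segment it contradicts \<open>equioscillating_unique\<close>.\<close>

theorem critval_inj:
  assumes N: "N \<ge> 2" and alt: "alternating N c0" and p: "crit_preimage N c0 p" and p': "crit_preimage N c0 p'"
  shows "p = p'"
proof (rule ccontr)
  assume ne: "p \<noteq> p'"
  \<comment> \<open>The property that spreads along the segment.\<close>
  define P where "P c \<longleftrightarrow> (\<exists>p p'. p \<noteq> p' \<and> crit_preimage N c p \<and> crit_preimage N c p')" for c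
  define c1 where "c1 n = (-1 :: real) ^ (N - n)" for n
  let ?c = "\<lambda>t n. (1 - t) * c0 n + t * c1 n"
  have alt1: "alternating N c1" by (simp add: alternating_def c1_def flip: power_mult_distrib)
  have altt: "(-1) ^ (N - n) * ?c t n > 0" if "0 \<le> t" "t \<le> 1" "n \<in> {1..N-1}" for t n
    by (rule segment_alternating) (use that alt alt1 in \<open>auto simp: alternating_def\<close>)
  have contc: "continuous_on UNIV ?c"
    by (intro continuous_on_coordinatewise_then_product continuous_intros)
  have "P c1"
  proof (rule segment_induct[of P c0])
    show "P c0" using ne p p' by (auto simp: P_def)
  next
    fix t :: real assume "P (?c t)"
    then obtain p p' where pp: "p \<noteq> p'" "crit_preimage N (?c t) p" "crit_preimage N (?c t) p'" by (auto simp: P_def)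
    have loc: "\<exists>X. (\<forall>k. ranalytic (\<lambda>c. X c k) (?c t)) \<and> X (?c t) = p \<and> (\<forall>\<^sub>F c in nhds (?c t). crit_preimage N c (X c))"
      if "crit_preimage N (?c t) p" for p
    proof -
      have p: "\<And>k. k \<ge> N - 1 \<Longrightarrow> p k = 0" "real_rooted (npoly N p)" "\<And>n. n \<in> {1..N-1} \<Longrightarrow> ?c t n = critval (npoly N p) n"
        using that by (auto simp: crit_preimage_def)
      obtain X \<rho> where X: "\<And>k. ranalytic (\<lambda>c. X c k) (?c t)" "X (?c t) = p" "\<And>c k. k \<ge> N - 1 \<Longrightarrow> X c k = 0"
        "\<forall>\<^sub>F c in nhds (?c t). real_rooted (npoly N (X c)) \<and> (\<forall>n\<in>{1..N-1}. critval (npoly N (X c)) n = c n)"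
        by (rule critval_local_inverse[OF N p(2,1,3)]) auto
      show ?thesis using X by (intro exI[of _ X]) (auto simp: crit_preimage_def)
    qed
    obtain X where X: "\<And>k. ranalytic (\<lambda>c. X c k) (?c t)" "X (?c t) = p" "\<forall>\<^sub>F c in nhds (?c t). crit_preimage N c (X c)"
      using loc[OF pp(2)] by blast
    obtain X' where X': "\<And>k. ranalytic (\<lambda>c. X' c k) (?c t)" "X' (?c t) = p'" "\<forall>\<^sub>F c in nhds (?c t). crit_preimage N c (X' c)"
      using loc[OF pp(3)] by blast
    obtain k where k: "p k \<noteq> p' k" using pp(1) by blast
    have "X (?c t) k - X' (?c t) k \<noteq> 0" using k X(2) X'(2) by simp
    then have "(X (?c t) k - X' (?c t) k) * (X (?c t) k - X' (?c t) k) > 0" using not_real_square_gt_zero by blast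
    then have "\<forall>\<^sub>F c in nhds (?c t). (X c k - X' c k) * (X c k - X' c k) > 0"
      by (intro ranalytic_pos[OF ranalytic_mult[OF ranalytic_diff ranalytic_diff]] X(1) X'(1))
    then show "\<forall>\<^sub>F c in nhds (?c t). P c"
      using X(3) X'(3)
    proof eventually_elim
      case (elim c)
      then have "X c \<noteq> X' c" by auto
      then show ?case using elim unfolding P_def by blast
    qed
  next
    fix ts :: "nat \<Rightarrow> real" and t
    assume ts: "\<And>i. 0 \<le> ts i \<and> ts i \<le> 1 \<and> P (?c (ts i))" and lim: "ts \<longlonglongrightarrow> t" and t: "0 \<le> t" "t \<le> 1"
    from ts obtain p p' where p: "\<And>i. p i \<noteq> p' i" "\<And>i. crit_preimage N (?c (ts i)) (p i)" "\<And>i. crit_preimage N (?c (ts i)) (p' i)"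
      unfolding P_def by metis
    have lc: "(\<lambda>i. ?c (ts i) n) \<longlonglongrightarrow> ?c t n" for n by (intro tendsto_intros lim)
    have "\<exists>r q. strict_mono (r :: nat \<Rightarrow> nat) \<and> (\<forall>k. (\<lambda>i. p (r i) k) \<longlonglongrightarrow> q k) \<and> crit_preimage N (?c t) q"
      by (rule critval_proper[OF N p(2) lc altt[OF t]])
    then obtain r q where r: "strict_mono (r :: nat \<Rightarrow> nat)" "\<And>k. (\<lambda>i. p (r i) k) \<longlonglongrightarrow> q k" "crit_preimage N (?c t) q" by blast
    have lc': "(\<lambda>i. ?c (ts (r i)) n) \<longlonglongrightarrow> ?c t n" for n
      using LIMSEQ_subseq_LIMSEQ[OF lc r(1)] by (simp add: o_def)
    have "\<exists>r' q'. strict_mono (r' :: nat \<Rightarrow> nat) \<and> (\<forall>k. (\<lambda>i. p' (r (r' i)) k) \<longlonglongrightarrow> q' k) \<and> crit_preimage N (?c t) q'"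
      by (rule critval_proper[OF N p(3) lc' altt[OF t]])
    then obtain r' q' where r': "strict_mono (r' :: nat \<Rightarrow> nat)" "\<And>k. (\<lambda>i. p' (r (r' i)) k) \<longlonglongrightarrow> q' k" "crit_preimage N (?c t) q'" by blast
    define R where "R = (\<lambda>i. r (r' i))"
    have R: "strict_mono R" using strict_mono_o[OF r(1) r'(1)] by (simp add: R_def o_def)
    have pR: "(\<lambda>i. p (R i) k) \<longlonglongrightarrow> q k" for k using LIMSEQ_subseq_LIMSEQ[OF r(2) r'(1)] by (simp add: o_def R_def)
    have p'R: "(\<lambda>i. p' (R i) k) \<longlonglongrightarrow> q' k" for k using r'(2) by (simp add: R_def)
    show "P (?c t)"
    proof (cases "q = q'")
      case False then show ?thesis using r(3) r'(3) unfolding P_def by blast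
    next
      case True
      have q: "\<And>k. k \<ge> N - 1 \<Longrightarrow> q k = 0" "real_rooted (npoly N q)" "\<And>n. n \<in> {1..N-1} \<Longrightarrow> ?c t n = critval (npoly N q) n"
        using r(3) by (auto simp: crit_preimage_def)
      obtain X \<rho> where \<rho>: "\<rho> > 0" and X: "\<forall>\<^sub>F c in nhds (?c t). \<forall>p. (\<forall>k<N-1. \<bar>p k - q k\<bar> < \<rho>) \<longrightarrow> (\<forall>k\<ge>N-1. p k = 0) \<longrightarrow>
         (\<forall>n\<in>{1..N-1}. critval (npoly N p) n = c n) \<longrightarrow> p = X c"
        by (rule critval_local_inverse[OF N q(2,1,3)]) auto
      obtain S where S: "open S" "?c t \<in> S" "\<And>c p. c \<in> S \<Longrightarrow> (\<forall>k<N-1. \<bar>p k - q k\<bar> < \<rho>) \<Longrightarrow> (\<forall>k\<ge>N-1. p k = 0) \<Longrightarrow>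
         (\<forall>n\<in>{1..N-1}. critval (npoly N p) n = c n) \<Longrightarrow> p = X c"
        using X unfolding eventually_nhds by blast
      have "open (?c -` S)" "t \<in> ?c -` S" using open_vimage[OF S(1) contc] S(2) by auto
      moreover have "(\<lambda>i. ts (R i)) \<longlonglongrightarrow> t" using LIMSEQ_subseq_LIMSEQ[OF lim R] by (simp add: o_def)
      ultimately have e1: "\<forall>\<^sub>F i in sequentially. ts (R i) \<in> ?c -` S" by (rule topological_tendstoD[rotated])
      have e2: "\<forall>\<^sub>F i in sequentially. \<forall>k\<in>{..<N-1}. dist (p (R i) k) (q k) < \<rho>"
        by (intro eventually_ball_finite ballI tendstoD[OF pR \<rho>]) simp
      have e3: "\<forall>\<^sub>F i in sequentially. \<forall>k\<in>{..<N-1}. dist (p' (R i) k) (q' k) < \<rho>"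
        by (intro eventually_ball_finite ballI tendstoD[OF p'R \<rho>]) simp
      have "\<forall>\<^sub>F i in sequentially. p (R i) = p' (R i)"
        using e1 e2 e3
      proof eventually_elim
        case (elim i)
        have "p (R i) = X (?c (ts (R i)))"
          by (rule S(3)) (use elim p(2)[of "R i"] in \<open>auto simp: crit_preimage_def dist_real_def\<close>)
        moreover have "p' (R i) = X (?c (ts (R i)))"
          by (rule S(3)) (use elim p(3)[of "R i"] True in \<open>auto simp: crit_preimage_def dist_real_def\<close>)
        ultimately show ?case by simp
      qed
      then have False using p(1) by (simp add: eventually_False)
      then show ?thesis ..
    qed
  qed
  then obtain p p' where pp: "p \<noteq> p'" "crit_preimage N c1 p" "crit_preimage N c1 p'" by (auto simp: P_def)
  have "equioscillating N (npoly N p)" "equioscillating N (npoly N p')"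
    using pp normal_npoly[OF N] by (auto simp: equioscillating_def crit_preimage_def c1_def)
  then have e: "npoly N p = npoly N p'" by (rule equioscillating_unique[OF _ _ N])
  have "p k = p' k" for k
    using npoly_eqD[OF N e, of k] pp by (cases "k < N - 1") (auto simp: crit_preimage_def)
  then show False using pp(1) by blast
qed

definition cpoly :: "nat \<Rightarrow> (nat \<Rightarrow> real) \<Rightarrow> real poly" where
  "cpoly N c = (if alternating N c then npoly N (THE p. crit_preimage N c p) else monom (1/2) N)"

lemma cpoly:
  assumes N: "N \<ge> 2" and c: "alternating N c"
  shows "normal_poly N (cpoly N c)" "real_rooted (cpoly N c)" "\<And>n. n \<in> {1..N-1} \<Longrightarrow> critval (cpoly N c) n = c n"
    "\<And>D. \<lbrakk>normal_poly N D; real_rooted D; \<And>n. n \<in> {1..N-1} \<Longrightarrow> critval D n = c n\<rbrakk> \<Longrightarrow> D = cpoly N c"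
    "\<And>p. crit_preimage N c p \<Longrightarrow> cpoly N c = npoly N p"
proof -
  obtain p where p: "crit_preimage N c p" using critval_surj[OF N c] by blast
  have the: "(THE p. crit_preimage N c p) = p'" if "crit_preimage N c p'" for p'
    using that critval_inj[OF N c] by (intro the_equality) auto
  have cp: "cpoly N c = npoly N p" using c the[OF p] by (simp add: cpoly_def)
  show "normal_poly N (cpoly N c)" unfolding cp by (rule normal_npoly[OF N])
  show "real_rooted (cpoly N c)" "\<And>n. n \<in> {1..N-1} \<Longrightarrow> critval (cpoly N c) n = c n"
    unfolding cp using p by (auto simp: crit_preimage_def)
  show pe: "cpoly N c = npoly N p'" if "crit_preimage N c p'" for p' using c the[OF that] by (simp add: cpoly_def)
  show "D = cpoly N c" if "normal_poly N D" "real_rooted D" "\<And>n. n \<in> {1..N-1} \<Longrightarrow> critval D n = c n" for D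
    using pe[OF crit_preimage_coeffs(1)[OF N that]] crit_preimage_coeffs(2)[OF N that] by simp
qed

lemma cpoly_cong: "(\<And>n. n \<in> {1..N-1} \<Longrightarrow> c n = c' n) \<Longrightarrow> cpoly N c = cpoly N c'"
proof -
  assume a: "\<And>n. n \<in> {1..N-1} \<Longrightarrow> c n = c' n"
  have "crit_preimage N c = crit_preimage N c'" "alternating N c = alternating N c'"
    using a by (auto simp: crit_preimage_def alternating_def fun_eq_iff)
  then show ?thesis by (simp add: cpoly_def)
qed

text \<open>By uniqueness, the analytic local inverses patch together to the global one. The sequence is first set to zero outside
\<open>{1..N-1}\<close>, which does not affect the polynomial, so as to have only finitely many varying coordinates.\<close>

theorem ranalytic_cpoly:
  assumes N: "N \<ge> 2" and c: "\<And>n. n \<in> {1..N-1} \<Longrightarrow> ranalytic (\<lambda>z. c z n) z0" and alt: "alternating N (c z0)"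
  shows "ranalytic_poly (\<lambda>z. cpoly N (c z)) z0"
proof (rule ranalytic_polyI)
  show "degree (cpoly N (c z)) \<le> N" for z
    using normal_npoly[OF N] by (auto simp: cpoly_def normal_poly_def degree_monom_eq)
  fix k
  define c' where "c' z n = (if n \<in> {1..N-1} then c z n else 0)" for z n
  have cc: "cpoly N (c z) = cpoly N (c' z)" for z by (rule cpoly_cong) (simp add: c'_def)
  have alt': "alternating N (c' z0)" using alt by (simp add: alternating_def c'_def)
  obtain p where p: "crit_preimage N (c' z0) p" using critval_surj[OF N alt'] by blast
  have p': "\<And>k. k \<ge> N - 1 \<Longrightarrow> p k = 0" "real_rooted (npoly N p)" "\<And>n. n \<in> {1..N-1} \<Longrightarrow> c' z0 n = critval (npoly N p) n"
    using p by (auto simp: crit_preimage_def)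
  obtain X \<rho> where X: "\<And>k. ranalytic (\<lambda>c. X c k) (c' z0)" "\<And>c k. k \<ge> N - 1 \<Longrightarrow> X c k = 0"
     "\<forall>\<^sub>F c in nhds (c' z0). real_rooted (npoly N (X c)) \<and> (\<forall>n\<in>{1..N-1}. critval (npoly N (X c)) n = c n)"
    by (rule critval_local_inverse[OF N p'(2,1,3)]) auto
  have rX: "ranalytic_poly (\<lambda>c. npoly N (X c)) (c' z0)" by (rule ranalytic_poly_npoly[OF N X(1)])
  have e: "\<forall>\<^sub>F c in nhds (c' z0). coeff (npoly N (X c)) k = coeff (cpoly N c) k"
    using X(3)
  proof eventually_elim
    case (elim c)
    have cp: "crit_preimage N c (X c)" using elim X(2) by (simp add: crit_preimage_def)
    have "alternating N c" unfolding alternating_def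
    proof
      fix n assume n: "n \<in> {1..N-1}"
      show "(-1) ^ (N - n) * c n > 0" using critval_sign[OF normal_npoly[OF N, of "X c"] _ n] elim n by auto
    qed
    then show ?case using cpoly(5)[OF N _ cp] by simp
  qed
  have "ranalytic (\<lambda>c. coeff (cpoly N c) k) (c' z0)"
    by (rule ranalytic_cong[OF ranalytic_polyD[OF rX] e])
  then have "ranalytic (\<lambda>z. coeff (cpoly N (c' z)) k) z0"
    by (intro ranalytic_compose[of "{1..N-1}" c' z0 "\<lambda>_. 0" "\<lambda>c. coeff (cpoly N c) k"]) (use c in \<open>auto simp: c'_def\<close>)
  then show "ranalytic (\<lambda>z. coeff (cpoly N (c z)) k) z0" by (simp only: cc)
qed

section \<open>Divided differences around a critical point\<close>

text \<open>The divided difference of the power function, defined as a polynomial so that it makes sense for equal arguments.\<close>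

definition ddpow :: "nat \<Rightarrow> 'a \<Rightarrow> 'a \<Rightarrow> 'a::comm_ring_1" where
  "ddpow n u v = (\<Sum>i<n. v ^ (n - Suc i) * u ^ i)"

lemma ddpow: "u ^ n - v ^ n = (u - v) * ddpow n u v"
  unfolding ddpow_def by (rule power_diff_sumr2)

lemma norm_ddpow_le:
  fixes u v :: "'a::{real_normed_field}"
  assumes "norm u \<le> M" "norm v \<le> M" "M \<ge> 1"
  shows "norm (ddpow n u v / fact (2 * n)) \<le> (2 * M) ^ n / fact n"
proof -
  have "norm (ddpow n u v) \<le> (\<Sum>i<n. norm (v ^ (n - Suc i) * u ^ i))" unfolding ddpow_def by (rule norm_sum)
  also have "\<dots> \<le> (\<Sum>i<n. M ^ n)"
  proof (rule sum_mono)
    fix i assume i: "i \<in> {..<n}"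
    have "norm (v ^ (n - Suc i) * u ^ i) \<le> M ^ (n - Suc i) * M ^ i"
      unfolding norm_mult norm_power using assms by (intro mult_mono power_mono) auto
    also have "\<dots> = M ^ (n - 1)" using i by (simp flip: power_add)
    also have "\<dots> \<le> M ^ n" using assms(3) by (intro power_increasing) auto
    finally show "norm (v ^ (n - Suc i) * u ^ i) \<le> M ^ n" .
  qed
  also have "\<dots> = real n * M ^ n" by simp
  also have "\<dots> \<le> 2 ^ n * M ^ n" using assms(3) of_nat_less_two_power[of n, where ?'a = real] by (intro mult_right_mono) auto
  finally have a: "norm (ddpow n u v) \<le> (2 * M) ^ n" by (simp add: power_mult_distrib)
  have "norm (ddpow n u v / fact (2 * n)) = norm (ddpow n u v) / fact (2 * n)" by (simp add: norm_divide)
  also have "\<dots> \<le> (2 * M) ^ n / fact n"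
  proof (rule frac_le)
    show "(fact n :: real) \<le> fact (2 * n)" by (rule fact_mono) simp
  qed (use a assms(3) in auto)
  finally show ?thesis .
qed

lemma summable_pow_fact: "summable (\<lambda>n. x ^ n / fact n :: real)"
  using summable_exp[of x] by (simp add: divide_inverse mult.commute)

text \<open>The divided difference of the entire function \<open>C(y) = \<Sum>\<^sub>n y\<^sup>n / (2n)!\<close>, which is \<open>cosh \<surd>y\<close> for \<open>y \<ge> 0\<close>.\<close>

definition cosh_sqrt_dd :: "real \<Rightarrow> real \<Rightarrow> real" where
  "cosh_sqrt_dd u v = (\<Sum>n. ddpow n u v / fact (2 * n))"

definition cosh_sqrt :: "real \<Rightarrow> real" where
  "cosh_sqrt y = 1 + y * cosh_sqrt_dd y 0"

lemma summable_cosh_sqrt_dd: "summable (\<lambda>n. ddpow n u v / fact (2 * n) :: real)"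
proof -
  define M where "M = max 1 (max \<bar>u\<bar> \<bar>v\<bar>)"
  show ?thesis
    by (rule summable_comparison_test'[OF summable_pow_fact[of "2 * M"], of 0])
       (rule norm_ddpow_le, auto simp: M_def)
qed

lemma cosh_sqrt_sums: "(\<lambda>n. y ^ n / fact (2 * n)) sums cosh_sqrt y"
proof -
  have "(\<lambda>n. ddpow n y 0 / fact (2 * n)) sums cosh_sqrt_dd y 0"
    unfolding cosh_sqrt_dd_def by (rule summable_sums[OF summable_cosh_sqrt_dd])
  then have "(\<lambda>n. y * (ddpow n y 0 / fact (2 * n))) sums (y * cosh_sqrt_dd y 0)" by (rule sums_mult)
  moreover have "(\<lambda>n. 0 ^ n / fact (2 * n) :: real) sums 1"
    using sums_single[of 0 "\<lambda>_. 1 :: real"] by (rule sums_cong[THEN iffD1, rotated]) (auto simp: power_0_left)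
  ultimately have "(\<lambda>n. 0 ^ n / fact (2 * n) + y * (ddpow n y 0 / fact (2 * n))) sums cosh_sqrt y"
    unfolding cosh_sqrt_def by (rule sums_add[rotated])
  moreover have "0 ^ n / fact (2 * n) + y * (ddpow n y 0 / fact (2 * n)) = y ^ n / fact (2 * n)" for n
    using ddpow[of y n 0] by (simp add: add_divide_distrib[symmetric])
  ultimately show ?thesis by simp
qed

lemma cosh_sqrt_diff: "cosh_sqrt u - cosh_sqrt v = (u - v) * cosh_sqrt_dd u v"
proof -
  have "(\<lambda>n. u ^ n / fact (2 * n) - v ^ n / fact (2 * n)) sums (cosh_sqrt u - cosh_sqrt v)"
    by (rule sums_diff[OF cosh_sqrt_sums cosh_sqrt_sums])
  moreover have "u ^ n / fact (2 * n) - v ^ n / fact (2 * n) = (u - v) * (ddpow n u v / fact (2 * n))" for n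
    using ddpow[of u n v] by (simp add: diff_divide_distrib[symmetric])
  moreover have "(\<lambda>n. (u - v) * (ddpow n u v / fact (2 * n))) sums ((u - v) * cosh_sqrt_dd u v)"
    unfolding cosh_sqrt_dd_def by (intro sums_mult summable_sums summable_cosh_sqrt_dd)
  ultimately show ?thesis by (simp add: sums_unique2)
qed

lemma cosh_sqrt_square: "cosh_sqrt (x\<^sup>2) = cosh x"
proof -
  have "(\<lambda>n. if even n then x ^ n /\<^sub>R fact n else 0) sums cosh x" by (rule cosh_converges)
  then have "(\<lambda>n. x ^ (2 * n) /\<^sub>R fact (2 * n)) sums cosh x"
    by (subst (asm) sums_mono_reindex[of "\<lambda>n. 2 * n", symmetric]) (auto simp: strict_mono_def elim!: evenE)
  moreover have "x ^ (2 * n) /\<^sub>R fact (2 * n) = (x\<^sup>2) ^ n / fact (2 * n)" for n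
    by (subst power_mult) (simp only: real_scaleR_def divide_inverse mult.commute)
  ultimately have "(\<lambda>n. (x\<^sup>2) ^ n / fact (2 * n)) sums cosh x" by simp
  then show ?thesis using cosh_sqrt_sums[of "x\<^sup>2"] by (simp add: sums_unique2)
qed

text \<open>All the coefficients are nonnegative, and the term of degree \<open>n = 1\<close> is a positive constant.\<close>

lemma cosh_sqrt_dd_pos: "u \<ge> 0 \<Longrightarrow> v \<ge> 0 \<Longrightarrow> cosh_sqrt_dd u v > 0"
  unfolding cosh_sqrt_dd_def
  by (rule suminf_pos2[OF summable_cosh_sqrt_dd, of _ _ 1]) (auto simp: ddpow_def intro!: divide_nonneg_pos sum_nonneg)

lemma ranalytic_cosh_sqrt_dd:
  assumes "ranalytic f p" "ranalytic g p" shows "ranalytic (\<lambda>z. cosh_sqrt_dd (f z) (g z)) p"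
proof -
  from assms(1) obtain U F where U: "open U" "cplx p \<in> U" "holo U F" "\<And>z. cplx z \<in> U \<Longrightarrow> F (cplx z) = of_real (f z)"
    by (rule ranalyticE) blast
  from assms(2) obtain V G where V: "open V" "cplx p \<in> V" "holo V G" "\<And>z. cplx z \<in> V \<Longrightarrow> G (cplx z) = of_real (g z)"
    by (rule ranalyticE) blast
  \<comment> \<open>On the set where both arguments have modulus less than \<open>M\<close> the series
    converges uniformly.\<close>
  define M where "M = 1 + \<bar>f p\<bar> + \<bar>g p\<bar>"
  define U1 where "U1 = {z \<in> U. F z \<in> ball 0 M}"
  define V1 where "V1 = {z \<in> V. G z \<in> ball 0 M}"
  have op: "open (U1 \<inter> V1)" unfolding U1_def V1_def
    by (intro open_Int open_holo_preimage[OF U(1,3)] open_holo_preimage[OF V(1,3)] open_ball)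
  have hF: "holo (U1 \<inter> V1) F" by (rule holo_subset[OF U(3)]) (auto simp: U1_def)
  have hG: "holo (U1 \<inter> V1) G" by (rule holo_subset[OF V(3)]) (auto simp: V1_def)
  have hpow: "holo W (\<lambda>z. H z ^ n)" if "holo W H" for W H and n :: nat
    by (induction n) (simp_all add: holo_const holo_mult that)
  show ?thesis
  proof (rule ranalyticI[OF op, of _ "\<lambda>z. \<Sum>n. ddpow n (F z) (G z) / fact (2 * n)"])
    show "cplx p \<in> U1 \<inter> V1" using U(2,4) V(2,4) by (auto simp: U1_def V1_def M_def)
    show "holo (U1 \<inter> V1) (\<lambda>z. \<Sum>n. ddpow n (F z) (G z) / fact (2 * n))"
    proof (rule holo_suminf[OF _ _ summable_pow_fact[of "2 * M"]])
      show "holo (U1 \<inter> V1) (\<lambda>z. ddpow n (F z) (G z) / fact (2 * n))" for n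
        unfolding ddpow_def divide_inverse by (intro holo_mult holo_sum hpow hF hG holo_const)
      show "norm (ddpow n (F z) (G z) / fact (2 * n)) \<le> (2 * M) ^ n / fact n" if "z \<in> U1 \<inter> V1" for n z
        by (rule norm_ddpow_le) (use that in \<open>auto simp: U1_def V1_def M_def\<close>)
    qed
    fix z assume z: "cplx z \<in> U1 \<inter> V1"
    have e: "F (cplx z) = of_real (f z)" "G (cplx z) = of_real (g z)" using z U(4) V(4) by (auto simp: U1_def V1_def)
    have "ddpow n (F (cplx z)) (G (cplx z)) / fact (2 * n) = complex_of_real (ddpow n (f z) (g z) / fact (2 * n))" for n
      unfolding e ddpow_def by simp
    then show "(\<Sum>n. ddpow n (F (cplx z)) (G (cplx z)) / fact (2 * n)) = complex_of_real (cosh_sqrt_dd (f z) (g z))"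
      unfolding cosh_sqrt_dd_def by (simp only: suminf_of_real[OF summable_cosh_sqrt_dd])
  qed
qed

lemma ranalytic_cosh_sqrt: "ranalytic f p \<Longrightarrow> ranalytic (\<lambda>z. cosh_sqrt (f z)) p"
  unfolding cosh_sqrt_def by (intro ranalytic_add ranalytic_const ranalytic_mult ranalytic_cosh_sqrt_dd)

lemma cosh_sqrt_has_derivative: "(cosh_sqrt has_field_derivative cosh_sqrt_dd y y) (at y)"
proof -
  have r: "ranalytic (\<lambda>w::unit \<Rightarrow> real. cosh_sqrt_dd (w ()) y) (\<lambda>_. y)"
    by (rule ranalytic_cosh_sqrt_dd[OF ranalytic_coord ranalytic_const])
  have "((\<lambda>t. cosh_sqrt_dd t y) \<longlongrightarrow> cosh_sqrt_dd y y) (nhds y)"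
  proof (rule topological_tendstoI)
    fix S :: "real set" assume S: "open S" "cosh_sqrt_dd y y \<in> S"
    from topological_tendstoD[OF ranalytic_tendsto[OF r] S(1)] S(2)
    obtain T where T: "open T" "(\<lambda>_. y) \<in> T" "\<And>w. w \<in> T \<Longrightarrow> cosh_sqrt_dd (w ()) y \<in> S"
      unfolding eventually_nhds by auto
    have "continuous_on UNIV (\<lambda>t::real. \<lambda>_::unit. t)" by (intro continuous_on_coordinatewise_then_product continuous_intros)
    then have "open ((\<lambda>t::real. \<lambda>_::unit. t) -` T)" using T(1) by (intro open_vimage)
    then show "\<forall>\<^sub>F t in nhds y. cosh_sqrt_dd t y \<in> S" unfolding eventually_nhds
      using T(2,3) by (intro exI[of _ "(\<lambda>t::real. \<lambda>_::unit. t) -` T"]) auto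
  qed
  then have "isCont (\<lambda>t. cosh_sqrt_dd t y) y" by (simp add: isCont_def tendsto_nhds_iff)
  moreover have "\<forall>z. cosh_sqrt z - cosh_sqrt y = cosh_sqrt_dd z y * (z - y)" using cosh_sqrt_diff by (simp add: mult.commute)
  ultimately show ?thesis unfolding CARAT_DERIV by (intro exI[of _ "\<lambda>t. cosh_sqrt_dd t y"]) simp
qed

text \<open>Horner's scheme expresses the coefficients of the quotient recursively, from the top degree downwards.\<close>

lemma ranalytic_synthetic_div:
  assumes p: "ranalytic_poly p z0" and c: "ranalytic c z0"
  shows "ranalytic_poly (\<lambda>z. synthetic_div (p z) (c z)) z0"
proof (rule ranalytic_polyI)
  let ?d = "deg_bound p"
  show dg: "degree (synthetic_div (p z) (c z)) \<le> ?d" for z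
    using deg_bound[OF p, of z] by (simp add: degree_synthetic_div)
  have rec: "coeff (synthetic_div (p z) (c z)) n = coeff (p z) (Suc n) + c z * coeff (synthetic_div (p z) (c z)) (Suc n)" for z n
    using arg_cong[OF synthetic_div_correct[of "p z" "c z"], of "\<lambda>q. coeff q (Suc n)"] by simp
  have "ranalytic (\<lambda>z. coeff (synthetic_div (p z) (c z)) (Suc ?d - j)) z0" if "j \<le> Suc ?d" for j
    using that
  proof (induction j)
    case 0
    have "coeff (synthetic_div (p z) (c z)) (Suc ?d) = 0" for z using dg[of z] by (simp add: coeff_eq_0)
    then show ?case by (simp add: ranalytic_const)
  next
    case (Suc j)
    have e: "Suc (Suc ?d - Suc j) = Suc ?d - j" using Suc.prems by simp
    show ?case unfolding rec[of _ "Suc ?d - Suc j"] e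
      by (intro ranalytic_add ranalytic_mult c ranalytic_polyD[OF p] Suc.IH) (use Suc.prems in simp)
  qed
  then have r: "ranalytic (\<lambda>z. coeff (synthetic_div (p z) (c z)) k) z0" if "k \<le> Suc ?d" for k
    using that by (metis diff_diff_cancel diff_le_self)
  show "ranalytic (\<lambda>z. coeff (synthetic_div (p z) (c z)) k) z0" for k
  proof (cases "k \<le> Suc ?d")
    case False
    then have "coeff (synthetic_div (p z) (c z)) k = 0" for z using dg[of z] by (simp add: coeff_eq_0)
    then show ?thesis by (simp add: ranalytic_const)
  qed (rule r)
qed

text \<open>The second divided difference \<open>(p(x) - p(c) - p'(c) (x - c)) / (x - c)\<^sup>2\<close> as a polynomial in \<open>x\<close>.\<close>

definition sdiv2 :: "real poly \<Rightarrow> real \<Rightarrow> real poly" where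
  "sdiv2 p c = synthetic_div (synthetic_div p c) c"

lemma synthetic_div_eq: "p = [:poly p c:] + [:-c, 1:] * synthetic_div p (c::real)"
  using synthetic_div_correct[of p c] by (simp add: algebra_simps)

lemma poly_synthetic_div: "poly p x = poly p c + (x - c) * poly (synthetic_div p c) (x::real)"
  using arg_cong[OF synthetic_div_eq[of p c], of "\<lambda>q. poly q x"] by (simp add: algebra_simps)

lemma poly_synthetic_div_same: "poly (synthetic_div p c) c = poly (pderiv p) (c::real)"
proof -
  have "pderiv p = pderiv ([:poly p c:] + [:-c, 1:] * synthetic_div p c)" by (rule arg_cong[OF synthetic_div_eq])
  also have "\<dots> = synthetic_div p c + [:-c, 1:] * pderiv (synthetic_div p c)"
    by (simp only: pderiv_add pderiv_mult) (simp add: pderiv_pCons)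
  finally show ?thesis by simp
qed

lemma pderiv_synthetic_div_same: "2 * poly (pderiv (synthetic_div p c)) c = poly (pderiv (pderiv p)) (c::real)"
proof -
  let ?q = "synthetic_div p c"
  have "pderiv p = pderiv ([:poly p c:] + [:-c, 1:] * ?q)" by (rule arg_cong[OF synthetic_div_eq])
  also have "\<dots> = ?q + [:-c, 1:] * pderiv ?q"
    by (simp only: pderiv_add pderiv_mult) (simp add: pderiv_pCons)
  finally have "pderiv (pderiv p) = pderiv (?q + [:-c, 1:] * pderiv ?q)" by (rule arg_cong)
  also have "\<dots> = pderiv ?q + pderiv ?q + [:-c, 1:] * pderiv (pderiv ?q)"
    by (simp only: pderiv_add pderiv_mult) (simp add: pderiv_pCons)
  finally show ?thesis by simp
qed

lemma poly_sdiv2: "poly p x = poly p c + (x - c) * poly (pderiv p) c + (x - c)\<^sup>2 * poly (sdiv2 p c) (x::real)"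
  using poly_synthetic_div[of p x c] poly_synthetic_div[of "synthetic_div p c" x c]
  by (simp add: sdiv2_def poly_synthetic_div_same algebra_simps power2_eq_square)

lemma poly_sdiv2_same: "2 * poly (sdiv2 p c) c = poly (pderiv (pderiv p)) (c::real)"
  unfolding sdiv2_def poly_synthetic_div_same by (rule pderiv_synthetic_div_same)

lemma ranalytic_sdiv2:
  "ranalytic_poly p z0 \<Longrightarrow> ranalytic c z0 \<Longrightarrow> ranalytic_poly (\<lambda>z. sdiv2 (p z) (c z)) z0"
  unfolding sdiv2_def by (intro ranalytic_synthetic_div)

text \<open>With \<open>l = \<lambda>\<^sub>n\<close>, the drop of \<open>s\<^sub>n D\<close> from its maximum is \<open>(l - x)\<^sup>2\<close> times a factor \<open>R\<close>. Away from \<open>l\<close> the factor is positive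
because the maximum is strict, and at \<open>l\<close> because the second derivative does not vanish.\<close>

lemma critical_gap_identity:
  assumes rr: "real_rooted D" and deg: "degree D = N" and lc: "lead_coeff D > 0" and n: "n \<in> {1..N-1}"
  defines "s \<equiv> (-1 :: real) ^ (N - n)" and "l \<equiv> rt (pderiv D) n"
  shows "s * poly D l - s * poly D x = (l - x)\<^sup>2 * (- s * poly (sdiv2 D l) x)"
    "rt D n < x \<Longrightarrow> x < rt D (n + 1) \<Longrightarrow> - s * poly (sdiv2 D l) x > 0"
proof -
  have N: "N \<ge> 1" using n by auto
  note PD = real_rooted_pderiv[OF rr deg N]
  have l0: "poly (pderiv D) l = 0" unfolding l_def by (rule rt_root[OF PD(1)]) (use n deg in \<open>simp add: degree_pderiv\<close>)
  show e: "s * poly D l - s * poly D x = (l - x)\<^sup>2 * (- s * poly (sdiv2 D l) x)" for x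
  proof -
    have pd: "poly D x = poly D l + (x - l)\<^sup>2 * poly (sdiv2 D l) x" using poly_sdiv2[of D x l] l0 by simp
    show ?thesis unfolding pd by (simp add: algebra_simps power2_eq_square)
  qed
  assume x: "rt D n < x" "x < rt D (n + 1)"
  show "- s * poly (sdiv2 D l) x > 0"
  proof (cases "x = l")
    case True
    have "s * (2 * poly (sdiv2 D l) l) < 0"
      unfolding poly_sdiv2_same using rt_second_deriv[OF rr deg lc n] by (simp only: s_def l_def)
    then show ?thesis unfolding True by linarith
  next
    case False
    have "s * poly D x < s * poly D l"
      using rt_unimodal(2)[OF rr deg lc n, of x l] rt_unimodal(3)[OF rr deg lc n, of l x] x False
      by (cases x l rule: linorder_cases) (auto simp: s_def l_def)
    then have "(l - x)\<^sup>2 * (- s * poly (sdiv2 D l) x) > 0" using e[of x] by linarith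
    then show ?thesis by (rule zero_less_mult_pos) (use False in simp)
  qed
qed

text \<open>Differentiating \<open>s\<^sub>n D(x) = s\<^sub>n D(l) - (l - x)\<^sup>2 R(x)\<close> gives \<open>s\<^sub>n D'(x) = (l - x) (2 R(x) - (l - x) R'(x))\<close>, and \<open>s\<^sub>n D'\<close> has the
sign of \<open>l - x\<close>. The expression is, up to a negative factor, the derivative of \<open>(l - x) \<surd>R(x)\<close>.\<close>

lemma critical_gap_identity_deriv:
  assumes rr: "real_rooted D" and deg: "degree D = N" and lc: "lead_coeff D > 0" and n: "n \<in> {1..N-1}"
  defines "s \<equiv> (-1 :: real) ^ (N - n)" and "l \<equiv> rt (pderiv D) n"
  defines "R \<equiv> smult (- s) (sdiv2 D l)"
  assumes x: "rt D n < x" "x < rt D (n + 1)"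
  shows "2 * poly R x - (l - x) * poly (pderiv R) x > 0"
proof -
  have id: "(l - x) * (2 * poly R x - (l - x) * poly (pderiv R) x) = s * poly (pderiv D) x"
  proof -
    have "smult s D = [:s * poly D l:] - [:l, -1:]\<^sup>2 * R"
    proof (rule poly_ext)
      fix t show "poly (smult s D) t = poly ([:s * poly D l:] - [:l, -1:]\<^sup>2 * R) t"
        using critical_gap_identity(1)[OF rr deg lc n, of t] by (simp add: s_def l_def R_def algebra_simps)
    qed
    then have "poly (pderiv (smult s D)) x = poly (pderiv ([:s * poly D l:] - [:l, -1:]\<^sup>2 * R)) x" by (rule arg_cong)
    then show ?thesis
      by (simp only: pderiv_diff pderiv_mult power2_eq_square pderiv_smult) (simp add: pderiv_pCons algebra_simps)
  qed
  show ?thesis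
  proof (cases x l rule: linorder_cases)
    case equal
    then show ?thesis using critical_gap_identity(2)[OF rr deg lc n x] by (simp add: R_def s_def l_def)
  next
    case less
    then have "(l - x) * (2 * poly R x - (l - x) * poly (pderiv R) x) > 0"
      unfolding id using rt_unimodal(4)[OF rr deg lc n, of x] x by (simp add: s_def l_def)
    then show ?thesis by (rule zero_less_mult_pos) (use less in simp)
  next
    case greater
    then have "(x - l) * (2 * poly R x - (l - x) * poly (pderiv R) x) > 0"
      using id rt_unimodal(5)[OF rr deg lc n, of x] x by (simp add: s_def l_def algebra_simps)
    then show ?thesis by (rule zero_less_mult_pos) (use greater in simp)
  qed
qed

lemma cosh_sqrt_strict_mono: "0 \<le> u \<Longrightarrow> u < v \<Longrightarrow> cosh_sqrt u < cosh_sqrt v"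
proof -
  assume "0 \<le> u" "u < v"
  then have "(v - u) * cosh_sqrt_dd v u > 0" by (intro mult_pos_pos cosh_sqrt_dd_pos) auto
  then show ?thesis using cosh_sqrt_diff[of v u] by linarith
qed

lemma cosh_sqrt_ge_1: "y \<ge> 0 \<Longrightarrow> cosh_sqrt y \<ge> 1"
  using cosh_sqrt_square[of "sqrt y"] cosh_real_ge_1[of "sqrt y"] by simp

lemma level_point_unique:
  assumes rr: "real_rooted D" and deg: "degree D = N" and lc: "lead_coeff D > 0" and n: "n \<in> {1..N-1}"
  defines "s \<equiv> (-1 :: real) ^ (N - n)" and "l \<equiv> rt (pderiv D) n"
  assumes t: "rt D n < t" "t < rt D (n + 1)" "s * poly D t = v" "sgn (l - t) = e"
    and t': "rt D n < t'" "t' < rt D (n + 1)" "s * poly D t' = v" "sgn (l - t') = e"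
  shows "t = t'"
proof -
  note um = rt_unimodal(2,3)[OF rr deg lc n, folded s_def l_def]
  have "\<not> a < b" if a: "rt D n < a" "a < rt D (n + 1)" "s * poly D a = v" "sgn (l - a) = e"
    and b: "rt D n < b" "b < rt D (n + 1)" "s * poly D b = v" "sgn (l - b) = e" for a b
  proof
    assume ab: "a < b"
    show False
    proof (cases "b \<le> l")
      case True
      then show False using um(1)[of a b] a b ab by simp
    next
      case False
      then have "sgn (l - a) = -1" using a(4) b(4) by (simp add: sgn_if split: if_splits)
      then have "l \<le> a" by (simp add: sgn_if split: if_splits)
      then show False using um(2)[of a b] a b ab by simp
    qed
  qed
  from this[OF t t'] this[OF t' t] show ?thesis by simp
qed

text \<open>The value \<open>cosh u\<close> lies between \<open>0\<close>, the value at the neighbouring roots, and the maximum, which it attains only for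
\<open>v = 0\<close>.\<close>

lemma level_point_exists:
  assumes rr: "real_rooted D" and deg: "degree D = N" and lc: "lead_coeff D > 0" and n: "n \<in> {1..N-1}"
  defines "s \<equiv> (-1 :: real) ^ (N - n)" and "l \<equiv> rt (pderiv D) n"
  assumes top: "s * poly D l = cosh_sqrt (u\<^sup>2 + v\<^sup>2)"
  shows "\<exists>t. rt D n < t \<and> t < rt D (n + 1) \<and> s * poly D t = cosh u \<and> sgn (l - t) = sgn v"
proof -
  have N: "N \<ge> 1" using n by auto
  have r0: "poly D (rt D n) = 0" "poly D (rt D (n + 1)) = 0" using n deg by (auto intro!: rt_root[OF rr])
  have l: "rt D n < l" "l < rt D (n + 1)" using real_rooted_pderiv(2)[OF rr deg N n] by (auto simp: l_def)
  have pos: "cosh u > 0" by (rule cosh_real_pos)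
  show ?thesis
  proof (cases "v = 0")
    case True
    then show ?thesis using l top by (intro exI[of _ l]) (simp add: cosh_sqrt_square)
  next
    case False
    have hi: "cosh u < s * poly D l" unfolding top cosh_sqrt_square[symmetric] by (rule cosh_sqrt_strict_mono) (use False in auto)
    show ?thesis
    proof (cases "v > 0")
      case True
      obtain t where t: "rt D n \<le> t" "t \<le> l" "poly (smult s D) t = cosh u"
        using IVT_poly_value[of "rt D n" l "smult s D" "cosh u"] l r0 pos hi by auto
      have "t \<noteq> rt D n" "t \<noteq> l" using t(3) r0 pos hi by auto
      then show ?thesis using t l True by (intro exI[of _ t]) (simp add: sgn_if)
    next
      case v: False
      obtain t where t: "l \<le> t" "t \<le> rt D (n + 1)" "poly (smult (- s) D) t = - cosh u"
        using IVT_poly_value[of l "rt D (n + 1)" "smult (- s) D" "- cosh u"] l r0 pos hi by auto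
      have "t \<noteq> rt D (n + 1)" "t \<noteq> l" using t(3) r0 pos hi by auto
      then show ?thesis using t l v False by (intro exI[of _ t]) (simp add: sgn_if)
    qed
  qed
qed

section \<open>Analyticity of the Marchenko-Ostrovsky mapping\<close>

definition uncoords :: "(nat + nat \<Rightarrow> real) \<Rightarrow> (nat \<Rightarrow> real) \<times> (nat \<Rightarrow> real)" where
  "uncoords w = (\<lambda>n. w (Inl n), \<lambda>n. w (Inr n))"

lemma uncoords_coords [simp]: "uncoords (coords q) = q"
  by (cases q) (simp add: uncoords_def coords_def)

lemma coords_simps [simp]: "coords (u, v) (Inl n) = u n" "coords (u, v) (Inr n) = v n"
  by (simp_all add: coords_def)

text \<open>The monic multiple of \<open>\<phi>\<^sub>N\<close> as a function of the coordinates of \<open>q\<close>, on the whole coordinate space.\<close>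

definition coords_B :: "nat \<Rightarrow> (nat + nat \<Rightarrow> real) \<Rightarrow> real poly" where
  "coords_B N w = jmonic (\<lambda>i. exp (2 * w (Inl i))) (\<lambda>n. w (Inr n)) N"

lemma ranalytic_jmonic:
  assumes "\<And>i. ranalytic (\<lambda>z. al z i) z0" "\<And>i. ranalytic (\<lambda>z. be z i) z0"
  shows "ranalytic_poly (\<lambda>z. jmonic (al z) (be z) n) z0"
proof (induction n rule: induct_nat_012)
  case (ge2 n)
  show ?case unfolding jmonic.simps
    by (intro ranalytic_poly_smult ranalytic_poly_diff ranalytic_poly_mult ranalytic_poly_pCons
          ranalytic_const ranalytic_uminus ranalytic_poly_const assms ge2)
qed (simp_all only: jmonic.simps ranalytic_poly_const)

lemma ranalytic_coords_B: "ranalytic_poly (coords_B N) w0"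
  unfolding coords_B_def[abs_def]
  by (intro ranalytic_jmonic ranalytic_exp ranalytic_mult ranalytic_const ranalytic_coord)

lemma ranalytic_phi: "ranalytic_poly (\<lambda>w. phi N (uncoords w) n) w0"
  and ranalytic_theta: "ranalytic_poly (\<lambda>w. theta N (uncoords w) n) w0"
  unfolding phi_def theta_def uncoords_def prod.case
  by (intro ranalytic_jacobi_poly;
      simp add: acoeff_def bcoeff_def periodic_def ranalytic_exp ranalytic_coord)+

lemma degree_phi_le: "degree (phi N q (N + 1)) \<le> N"
proof -
  obtain x b where q: "q = (x, b)" by (cases q)
  have "smult (\<Prod>i=1..<N+1. exp (x i)) (phi N q (N + 1)) = jmonic (\<lambda>i. exp (2 * x i)) b (N + 1)"
    unfolding q by (rule phi_eq_jmonic) simp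
  moreover have "(\<Prod>i=1..<N+1. exp (x i)) \<noteq> 0" by (simp add: prod_zero_iff)
  ultimately show ?thesis using degree_jmonic[of "\<lambda>i. exp (2 * x i)" b N]
    by (metis Suc_eq_plus1 degree_smult_eq order_refl)
qed

lemma degree_Lyapunov_le: "N \<ge> 2 \<Longrightarrow> degree (Lyapunov N q) \<le> N"
proof -
  assume N: "N \<ge> 2"
  obtain x b where q: "q = (x, b)" by (cases q)
  obtain k where k: "N = Suc (Suc k)" using N by (metis add_2_eq_Suc le_Suc_ex)
  have "degree (theta N q N) \<le> k" unfolding theta_def q k using degree_jacobi_poly_theta by simp
  then have "degree (phi N q (N + 1) + theta N q N) \<le> N" using degree_phi_le[of N q] k by (intro degree_add_le) auto
  then show ?thesis unfolding Lyapunov_def by (rule order_trans[OF degree_smult_le])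
qed

lemma ranalytic_Lyapunov: "ranalytic_poly (\<lambda>w. Lyapunov N (uncoords w)) w0"
  unfolding Lyapunov_def
  by (intro ranalytic_poly_smult ranalytic_poly_add ranalytic_phi ranalytic_theta ranalytic_const)

lemma sgn_square_eq: "a\<^sup>2 = b\<^sup>2 \<Longrightarrow> sgn a = sgn b \<Longrightarrow> a = (b::real)"
  by (auto simp: power2_eq_iff sgn_if split: if_splits)

text \<open>The square root in the definition of \<open>\<psi>\<^sub>2\<^sub>,\<^sub>n\<close> is extracted up to a positive factor: its zero and its sign both come from
\<open>\<lambda>\<^sub>n - \<nu>\<^sub>n\<close>. The number \<open>y = |\<psi>\<^sub>n|\<^sup>2\<close> enters only through the equation that determines it, so that the implicit function theorem can
supply it as an analytic function even where \<open>|\<psi>\<^sub>n|\<close> is not differentiable.\<close>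

lemma psi2_formula:
  assumes x: "x \<in> Hspace N" and b: "b \<in> Hspace N" and N: "N \<ge> 2" and n: "n \<in> {1..N-1}"
  defines "D \<equiv> Lyapunov N (x, b)" and "\<nu> \<equiv> rt (jmonic (\<lambda>i. exp (2 * x i)) b N) n" and "s \<equiv> (-1 :: real) ^ (N - n)"
  defines "l \<equiv> rt (pderiv D) n"
  assumes y: "cosh_sqrt y = s * poly D l" "cosh_sqrt_dd y 0 > 0"
  shows "psi2 N (x, b) n = (l - \<nu>) * sqrt ((- s * poly (sdiv2 D l) \<nu>) / cosh_sqrt_dd y ((psi1 N (x, b) n)\<^sup>2))"
proof -
  let ?p1 = "psi1 N (x, b) n" and ?p2 = "psi2 N (x, b) n" and ?h = "psi_abs N (x, b) n"
  note ch = psi_characterization[OF x b N n, folded D_def \<nu>_def s_def, folded l_def]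
  have dD: "degree D = N" and lc: "lead_coeff D > 0" using periodic_data(5,6)[OF x b N] by (auto simp: D_def)
  have "cosh_sqrt 0 = 1" by (simp add: cosh_sqrt_def)
  moreover have "cosh_sqrt y \<ge> 1" using y(1) ch(7) cosh_real_ge_1[of ?h] by simp
  ultimately have "y * cosh_sqrt_dd y 0 \<ge> 0" using cosh_sqrt_diff[of y 0] by simp
  \<comment> \<open>For negative \<open>y\<close> the equation \<open>C(y) = c\<close> with \<open>c \<ge>
    1\<close> can only hold if \<open>K(y, 0) \<le> 0\<close>.\<close>
  then have y0: "y \<ge> 0" using y(2) by (simp add: zero_le_mult_iff)
  have "cosh_sqrt y = cosh_sqrt (?h\<^sup>2)" using y(1) ch(7) by (simp add: cosh_sqrt_square)
  then have "(y - ?h\<^sup>2) * cosh_sqrt_dd y (?h\<^sup>2) = 0" using cosh_sqrt_diff[of y "?h\<^sup>2"] by simp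
  \<comment> \<open>The function \<open>C\<close> is injective on the nonnegative reals.\<close>
  then have yh: "y = ?h\<^sup>2" using cosh_sqrt_dd_pos[OF y0, of "?h\<^sup>2"] by simp
  let ?K = "cosh_sqrt_dd y (?p1\<^sup>2)" and ?R = "- s * poly (sdiv2 D l) \<nu>"
  have K: "?K > 0" by (rule cosh_sqrt_dd_pos[OF y0]) simp
  have R: "?R > 0" unfolding s_def l_def by (rule critical_gap_identity(2)[OF ch(1) dD lc n ch(2,3)])
  have "?p2\<^sup>2 * ?K = (?h\<^sup>2 - ?p1\<^sup>2) * ?K" using ch(9) by simp
  also have "\<dots> = cosh_sqrt y - cosh_sqrt (?p1\<^sup>2)" using cosh_sqrt_diff[of y "?p1\<^sup>2"] by (simp add: yh)
  also have "\<dots> = s * poly D l - s * poly D \<nu>" using y(1) ch(6) by (simp add: cosh_sqrt_square)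
  also have "\<dots> = (l - \<nu>)\<^sup>2 * ?R" unfolding s_def l_def by (rule critical_gap_identity(1)[OF ch(1) dD lc n])
  finally have "?p2\<^sup>2 = (l - \<nu>)\<^sup>2 * (?R / ?K)" using K by (simp add: field_simps)
  moreover have "(sqrt (?R / ?K))\<^sup>2 = ?R / ?K" using R K by (intro real_sqrt_pow2 divide_nonneg_pos) linarith+
  ultimately have sq: "?p2\<^sup>2 = ((l - \<nu>) * sqrt (?R / ?K))\<^sup>2" by (simp only: power_mult_distrib)
  have "?R / ?K > 0" using R K by (rule divide_pos_pos)
  then have "sgn ((l - \<nu>) * sqrt (?R / ?K)) = sgn (l - \<nu>)" unfolding sgn_mult by simp
  then show ?thesis using ch(10) by (intro sgn_square_eq[OF sq]) simp
qed

text \<open>All the ingredients of \<open>\<psi>\<^sub>1\<close> and of \<open>psi2_formula\<close> are analytic functions of the coordinates near points of \<open>\<H>\<^sup>2\<close>.\<close>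

theorem psi_real_analytic:
  assumes N: "N \<ge> 2" and n: "n \<in> {1..N-1}"
  shows "real_analytic_fun N (Hspace N \<times> Hspace N) (\<lambda>q. psi1 N q n)"
    "real_analytic_fun N (Hspace N \<times> Hspace N) (\<lambda>q. psi2 N q n)"
proof -
  let ?S = "Hspace N \<times> Hspace N"
  define s where "s = (-1 :: real) ^ (N - n)"
  define D where "D w = Lyapunov N (uncoords w)" for w
  define \<nu> where "\<nu> w = rt (coords_B N w) n" for w
  define l where "l w = rt (pderiv (D w)) n" for w
  define p1 where "p1 w = ln (s * poly (phi N (uncoords w) (N + 1)) (\<nu> w))" for w
  have N1: "N \<ge> 1" using N by simp
  have fB: "coords_B N (coords (x, b)) = jmonic (\<lambda>i. exp (2 * x i)) b N" for x b by (simp add: coords_B_def)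
  have ch: "real_rooted (D (coords (x, b)))" "rt (D (coords (x, b))) n < \<nu> (coords (x, b))" "\<nu> (coords (x, b)) < rt (D (coords (x, b))) (n + 1)"
     "s * poly (phi N (x, b) (N + 1)) (\<nu> (coords (x, b))) > 0" "psi1 N (x, b) n = p1 (coords (x, b))"
     "cosh (psi_abs N (x, b) n) = s * poly (D (coords (x, b))) (l (coords (x, b)))"
     "degree (D (coords (x, b))) = N" "lead_coeff (D (coords (x, b))) > 0" "real_rooted (coords_B N (coords (x, b)))" "degree (coords_B N (coords (x, b))) = N - 1"
    if q: "x \<in> Hspace N" "b \<in> Hspace N" for x b
    using psi_characterization(1-5,7)[OF q N n] periodic_data(2,5,6)[OF q N]
    by (simp_all add: D_def \<nu>_def l_def p1_def s_def fB interlaced_def)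
  have rn: "ranalytic \<nu> (coords (x, b))" if q: "x \<in> Hspace N" "b \<in> Hspace N" for x b
    unfolding \<nu>_def
  proof (rule ranalytic_rt(1)[of "coords_B N" "coords (x, b)" "N - 1", OF ranalytic_coords_B _ ch(10)[OF q] ch(9)[OF q] n])
    show "degree (coords_B N w) \<le> N - 1" for w
      using N degree_jmonic[of "\<lambda>i. exp (2 * w (Inl i))" "\<lambda>n. w (Inr n)" "N - 1"] by (simp add: coords_B_def)
  qed
  have rD: "ranalytic_poly D w0" for w0 unfolding D_def by (rule ranalytic_Lyapunov)
  have dPD: "degree (pderiv (D w)) \<le> N - 1" for w
    using degree_Lyapunov_le[OF N, of "uncoords w"] by (simp add: D_def degree_pderiv)
  have rl: "ranalytic l (coords (x, b))" if q: "x \<in> Hspace N" "b \<in> Hspace N" for x b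
    unfolding l_def
  proof (rule ranalytic_rt(1)[of "\<lambda>w. pderiv (D w)" "coords (x, b)" "N - 1"])
    show "ranalytic_poly (\<lambda>w. pderiv (D w)) (coords (x, b))" by (rule ranalytic_poly_pderiv[OF rD])
    show "degree (pderiv (D (coords (x, b)))) = N - 1" by (simp only: degree_pderiv ch(7)[OF q])
    show "real_rooted (pderiv (D (coords (x, b))))" by (rule real_rooted_pderiv(1)[OF ch(1,7)[OF q] N1])
  qed (rule dPD n)+
  have rp1: "ranalytic p1 (coords (x, b))" if q: "x \<in> Hspace N" "b \<in> Hspace N" for x b
    unfolding p1_def
    by (intro ranalytic_ln ranalytic_mult ranalytic_const ranalytic_poly_eval ranalytic_phi rn q) (use ch(4)[OF q] in simp)
  have SR: "?S \<subseteq> Rn N \<times> Rn N" by (auto simp: Hspace_def)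
  show "real_analytic_fun N ?S (\<lambda>q. psi1 N q n)"
  proof (rule real_analytic_funI[OF SR])
    fix p assume "p \<in> ?S"
    then obtain x b where p: "p = (x, b)" "x \<in> Hspace N" "b \<in> Hspace N" by auto
    have "\<forall>z\<in>?S. coords z = w \<longrightarrow> psi1 N z n = p1 w" for w using ch(5) by auto
    then show "\<exists>g. ranalytic g (coords p) \<and> (\<forall>\<^sub>F w in nhds (coords p). \<forall>z\<in>?S. coords z = w \<longrightarrow> psi1 N z n = g w)"
      using rp1[OF p(2,3)] p(1) by (intro exI[of _ p1]) simp
  qed
  show "real_analytic_fun N ?S (\<lambda>q. psi2 N q n)"
  proof (rule real_analytic_funI[OF SR])
    fix p assume "p \<in> ?S"
    then obtain x b where p: "p = (x, b)" and q: "x \<in> Hspace N" "b \<in> Hspace N" by auto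
    let ?w0 = "coords (x, b)"
    define y0 where "y0 = (psi_abs N (x, b) n)\<^sup>2"
    have y0: "y0 \<ge> 0" by (simp add: y0_def)
    \<comment> \<open>The square \<open>|\<psi>\<^sub>n|\<^sup>2\<close> is the solution \<open>y\<close> of
      \<open>C(y) = s\<^sub>n \<Delta>(\<lambda>\<^sub>n)\<close>.\<close>
    define f where "f w y = cosh_sqrt y - s * poly (D w) (l w)" for w y
    have rP: "ranalytic (\<lambda>w. s * poly (D w) (l w)) ?w0"
      by (intro ranalytic_mult ranalytic_const ranalytic_poly_eval rD rl q)
    obtain X \<rho> where X: "ranalytic X ?w0" "X ?w0 = y0" "\<forall>\<^sub>F w in nhds ?w0. f w (X w) = 0"
    proof (rule ranalytic_implicit_function_1[of f ?w0 y0 "cosh_sqrt_dd y0 y0"])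
      show "ranalytic (\<lambda>v. f (\<lambda>i. v (Inl i)) (v (Inr ()))) (case_sum ?w0 (\<lambda>_. y0))"
        unfolding f_def by (rule ranalytic_diff[OF ranalytic_cosh_sqrt[OF ranalytic_coord] ranalytic_parameter[OF rP]])
      show "f ?w0 y0 = 0" using ch(6)[OF q] by (simp add: f_def y0_def cosh_sqrt_square)
      show "(f ?w0 has_field_derivative cosh_sqrt_dd y0 y0) (at y0)"
        unfolding f_def[abs_def] using DERIV_diff[OF cosh_sqrt_has_derivative[of y0] DERIV_const] by simp
      show "cosh_sqrt_dd y0 y0 \<noteq> 0" using cosh_sqrt_dd_pos[OF y0 y0] by simp
    qed
    define g where "g w = (l w - \<nu> w) * sqrt ((- s * poly (sdiv2 (D w) (l w)) (\<nu> w)) / cosh_sqrt_dd (X w) ((p1 w)\<^sup>2))" for w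
    have R0: "- s * poly (sdiv2 (D ?w0) (l ?w0)) (\<nu> ?w0) > 0"
      unfolding s_def l_def by (rule critical_gap_identity(2)[OF ch(1,7,8)[OF q] n ch(2,3)[OF q]])
    have K0: "cosh_sqrt_dd (X ?w0) ((p1 ?w0)\<^sup>2) > 0" using cosh_sqrt_dd_pos[OF y0] X(2) by simp
    have rg: "ranalytic g ?w0" unfolding g_def
      by (intro ranalytic_mult ranalytic_diff ranalytic_sqrt ranalytic_divide ranalytic_uminus ranalytic_const
          ranalytic_poly_eval ranalytic_sdiv2 ranalytic_cosh_sqrt_dd ranalytic_power rD rl rn rp1 q X(1) divide_pos_pos)
         (use R0 K0 in linarith)+
    have "cosh_sqrt_dd (X ?w0) 0 > 0" using cosh_sqrt_dd_pos[OF y0] X(2) by simp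
    then have ev: "\<forall>\<^sub>F w in nhds ?w0. cosh_sqrt_dd (X w) 0 > 0" by (rule ranalytic_pos[OF ranalytic_cosh_sqrt_dd[OF X(1) ranalytic_const]])
    have "\<forall>\<^sub>F w in nhds ?w0. \<forall>z\<in>?S. coords z = w \<longrightarrow> psi2 N z n = g w"
      using X(3) ev
    proof eventually_elim
      case (elim w)
      show ?case
      proof (intro ballI impI)
        fix z assume z: "z \<in> ?S" "coords z = w"
        then obtain x' b' where z': "z = (x', b')" and q': "x' \<in> Hspace N" "b' \<in> Hspace N" by auto
        have w: "w = coords (x', b')" using z z' by simp
        have "psi2 N (x', b') n = (l w - \<nu> w) * sqrt ((- s * poly (sdiv2 (D w) (l w)) (\<nu> w)) / cosh_sqrt_dd (X w) ((psi1 N (x', b') n)\<^sup>2))"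
          using psi2_formula[OF q' N n, of "X w"] elim by (simp add: w D_def \<nu>_def l_def s_def f_def fB)
        then show "psi2 N z n = g w" unfolding g_def z' using ch(5)[OF q'] by (simp add: w)
      qed
    qed
    then show "\<exists>g. ranalytic g (coords p) \<and> (\<forall>\<^sub>F w in nhds (coords p). \<forall>z\<in>?S. coords z = w \<longrightarrow> psi2 N z n = g w)"
      unfolding p using rg by (intro exI[of _ g]) simp
  qed
qed

section \<open>The inverse mapping\<close>

text \<open>From here on \<open>w\<close> stands for the coordinates of a point \<open>\<psi>\<close> in the target space: \<open>w (Inl n) = \<psi>\<^sub>1\<^sub>,\<^sub>n\<close> and \<open>w (Inr n) = \<psi>\<^sub>2\<^sub>,\<^sub>n\<close>. The
definitions that follow reconstruct the objects attached to the preimage of \<open>\<psi>\<close>, starting with the critical values of the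
Lyapunov function.\<close>

definition inv_critval :: "nat \<Rightarrow> (nat + nat \<Rightarrow> real) \<Rightarrow> nat \<Rightarrow> real" where
  "inv_critval N w n = (-1) ^ (N - n) * cosh_sqrt ((w (Inl n))\<^sup>2 + (w (Inr n))\<^sup>2)"

definition inv_Lyapunov :: "nat \<Rightarrow> (nat + nat \<Rightarrow> real) \<Rightarrow> real poly" where
  "inv_Lyapunov N w = cpoly N (inv_critval N w)"

definition inv_dirichlet :: "nat \<Rightarrow> (nat + nat \<Rightarrow> real) \<Rightarrow> nat \<Rightarrow> real" where
  "inv_dirichlet N w n = (THE t. rt (inv_Lyapunov N w) n < t \<and> t < rt (inv_Lyapunov N w) (n + 1) \<and>
     (-1) ^ (N - n) * poly (inv_Lyapunov N w) t = cosh (w (Inl n)) \<and> sgn (rt (pderiv (inv_Lyapunov N w)) n - t) = sgn (w (Inr n)))"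

lemma sign_square [simp]: "(-1) ^ k * ((-1) ^ k * c) = (c :: real)"
  by (simp flip: mult.assoc power_add add: mult_2[symmetric])

lemma alternating_inv_critval: "alternating N (inv_critval N w)"
  unfolding alternating_def inv_critval_def using cosh_sqrt_ge_1 by (auto intro: less_le_trans[OF zero_less_one])

lemma inv_Lyapunov:
  assumes N: "N \<ge> 2"
  shows "normal_poly N (inv_Lyapunov N w)" "real_rooted (inv_Lyapunov N w)" "degree (inv_Lyapunov N w) = N" "lead_coeff (inv_Lyapunov N w) > 0"
    "n \<in> {1..N-1} \<Longrightarrow> (-1) ^ (N - n) * poly (inv_Lyapunov N w) (rt (pderiv (inv_Lyapunov N w)) n) = cosh_sqrt ((w (Inl n))\<^sup>2 + (w (Inr n))\<^sup>2)"
proof -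
  note c = cpoly(1,2,3)[OF N alternating_inv_critval[of N w], folded inv_Lyapunov_def]
  show n: "normal_poly N (inv_Lyapunov N w)" "real_rooted (inv_Lyapunov N w)" by (rule c)+
  then show "degree (inv_Lyapunov N w) = N" "lead_coeff (inv_Lyapunov N w) > 0" by (auto simp: normal_poly_def intro: normal_lead)
  show "(-1) ^ (N - n) * poly (inv_Lyapunov N w) (rt (pderiv (inv_Lyapunov N w)) n) = cosh_sqrt ((w (Inl n))\<^sup>2 + (w (Inr n))\<^sup>2)" if "n \<in> {1..N-1}"
    using c(3)[OF that] by (simp add: critval_def inv_critval_def)
qed

lemma inv_dirichlet_eqI:
  assumes N: "N \<ge> 2" and n: "n \<in> {1..N-1}"
    and t: "rt (inv_Lyapunov N w) n < t" "t < rt (inv_Lyapunov N w) (n + 1)" "(-1) ^ (N - n) * poly (inv_Lyapunov N w) t = cosh (w (Inl n))"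
      "sgn (rt (pderiv (inv_Lyapunov N w)) n - t) = sgn (w (Inr n))"
  shows "inv_dirichlet N w n = t"
  unfolding inv_dirichlet_def
proof (rule the_equality)
  fix t' assume "rt (inv_Lyapunov N w) n < t' \<and> t' < rt (inv_Lyapunov N w) (n + 1) \<and>
     (-1) ^ (N - n) * poly (inv_Lyapunov N w) t' = cosh (w (Inl n)) \<and> sgn (rt (pderiv (inv_Lyapunov N w)) n - t') = sgn (w (Inr n))"
  then show "t' = t"
    by (elim conjE) (rule level_point_unique[OF inv_Lyapunov(2,3,4)[OF N] n _ _ _ _ t])
qed (intro conjI t)

lemma inv_dirichlet:
  assumes N: "N \<ge> 2" and n: "n \<in> {1..N-1}"
  shows "rt (inv_Lyapunov N w) n < inv_dirichlet N w n" "inv_dirichlet N w n < rt (inv_Lyapunov N w) (n + 1)"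
    "(-1) ^ (N - n) * poly (inv_Lyapunov N w) (inv_dirichlet N w n) = cosh (w (Inl n))"
    "sgn (rt (pderiv (inv_Lyapunov N w)) n - inv_dirichlet N w n) = sgn (w (Inr n))"
proof -
  obtain t where t: "rt (inv_Lyapunov N w) n < t" "t < rt (inv_Lyapunov N w) (n + 1)" "(-1) ^ (N - n) * poly (inv_Lyapunov N w) t = cosh (w (Inl n))"
      "sgn (rt (pderiv (inv_Lyapunov N w)) n - t) = sgn (w (Inr n))"
    using level_point_exists[OF inv_Lyapunov(2,3,4)[OF N] n inv_Lyapunov(5)[OF N n, where w = w]] by (elim exE conjE) (rule that)
  show "rt (inv_Lyapunov N w) n < inv_dirichlet N w n" "inv_dirichlet N w n < rt (inv_Lyapunov N w) (n + 1)"
    "(-1) ^ (N - n) * poly (inv_Lyapunov N w) (inv_dirichlet N w n) = cosh (w (Inl n))"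
    "sgn (rt (pderiv (inv_Lyapunov N w)) n - inv_dirichlet N w n) = sgn (w (Inr n))"
    unfolding inv_dirichlet_eqI[OF N n t] by (rule t)+
qed

lemma inv_dirichlet_less:
  assumes N: "N \<ge> 2" and ij: "1 \<le> i" "i < j" "j \<le> N - 1"
  shows "inv_dirichlet N w i < inv_dirichlet N w j"
proof -
  have "inv_dirichlet N w i < rt (inv_Lyapunov N w) (i + 1)" by (rule inv_dirichlet(2)[OF N]) (use ij in auto)
  also have "\<dots> \<le> rt (inv_Lyapunov N w) j" by (rule rt_le[OF inv_Lyapunov(2)[OF N]]) (use ij inv_Lyapunov(3)[OF N] in auto)
  also have "\<dots> < inv_dirichlet N w j" by (rule inv_dirichlet(1)[OF N]) (use ij in auto)
  finally show ?thesis .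
qed

lemma inj_inv_dirichlet: "N \<ge> 2 \<Longrightarrow> inj_on (inv_dirichlet N w) {1..N-1}"
  by (rule inj_on_increasing) (rule inv_dirichlet_less, auto)

lemma ranalytic_inv_Lyapunov:
  assumes N: "N \<ge> 2"
  shows "ranalytic_poly (inv_Lyapunov N) w0"
  unfolding inv_Lyapunov_def[abs_def]
proof (rule ranalytic_cpoly[OF N])
  show "alternating N (inv_critval N w0)" by (rule alternating_inv_critval)
  show "ranalytic (\<lambda>w. inv_critval N w n) w0" for n
    unfolding inv_critval_def by (intro ranalytic_mult ranalytic_const ranalytic_cosh_sqrt ranalytic_add ranalytic_power ranalytic_coord)
qed

lemma ranalytic_rt_inv_Lyapunov:
  assumes N: "N \<ge> 2"
  shows "n \<in> {1..N} \<Longrightarrow> ranalytic (\<lambda>w. rt (inv_Lyapunov N w) n) w0"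
    "n \<in> {1..N-1} \<Longrightarrow> ranalytic (\<lambda>w. rt (pderiv (inv_Lyapunov N w)) n) w0"
proof -
  show "ranalytic (\<lambda>w. rt (inv_Lyapunov N w) n) w0" if "n \<in> {1..N}"
    by (rule ranalytic_rt(1)[of "inv_Lyapunov N" w0 N, OF ranalytic_inv_Lyapunov[OF N] _ inv_Lyapunov(3)[OF N] inv_Lyapunov(2)[OF N] that]) (simp add: inv_Lyapunov(3)[OF N])
  show "ranalytic (\<lambda>w. rt (pderiv (inv_Lyapunov N w)) n) w0" if "n \<in> {1..N-1}"
    by (rule ranalytic_rt(1)[of "\<lambda>w. pderiv (inv_Lyapunov N w)" w0 "N - 1", OF ranalytic_poly_pderiv[OF ranalytic_inv_Lyapunov[OF N]] _ _ real_rooted_pderiv(1)[OF inv_Lyapunov(2,3)[OF N]] that])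
       (use N in \<open>simp_all add: degree_pderiv inv_Lyapunov(3)[OF N]\<close>)
qed

lemma DERIV_linear_times_sqrt:
  fixes p :: "real poly"
  assumes p: "poly p x > 0"
  shows "((\<lambda>t. (l - t) * sqrt (poly p t) - c) has_field_derivative
     (l - x) * (poly (pderiv p) x / (2 * sqrt (poly p x))) - sqrt (poly p x)) (at x)"
proof -
  have d1: "((\<lambda>t. sqrt (poly p t)) has_field_derivative inverse (sqrt (poly p x)) / 2 * poly (pderiv p) x) (at x)"
    by (rule DERIV_chain2[where f = sqrt and g = "poly p", OF DERIV_real_sqrt[OF p] poly_DERIV])
  have d2: "((\<lambda>t. l - t) has_field_derivative 0 - 1) (at x)" by (rule DERIV_diff[OF DERIV_const DERIV_ident])
  have d3: "((\<lambda>t. c) has_field_derivative 0) (at x)" by (rule DERIV_const)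
  have eq: "(0 - 1) * r + inverse r / 2 * v * u - 0 = u * (v / (2 * r)) - r" for r u v :: real
    by (simp add: inverse_eq_divide mult.commute)
  show ?thesis using DERIV_diff[OF DERIV_mult[OF d2 d1] d3] unfolding eq .
qed

text \<open>The equation \<open>s\<^sub>n D(t) = cosh \<psi>\<^sub>1\<^sub>,\<^sub>n\<close> is degenerate at \<open>t = \<lambda>\<^sub>n\<close>. The equivalent equation \<open>(\<lambda>\<^sub>n - t) \<surd>R(t) = \<psi>\<^sub>2\<^sub>,\<^sub>n \<surd>K\<close> is not: its left hand
side is strictly decreasing by \<open>critical_gap_identity_deriv\<close>, and it incorporates the choice of the side of \<open>\<lambda>\<^sub>n\<close>.\<close>

lemma ranalytic_inv_dirichlet:
  assumes N: "N \<ge> 2" and n: "n \<in> {1..N-1}"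
  shows "ranalytic (\<lambda>w. inv_dirichlet N w n) w0"
proof -
  define s where "s = (-1 :: real) ^ (N - n)"
  define l where "l w = rt (pderiv (inv_Lyapunov N w)) n" for w
  define R where "R w = smult (- s) (sdiv2 (inv_Lyapunov N w) (l w))" for w
  define K where "K w = cosh_sqrt_dd ((w (Inl n))\<^sup>2 + (w (Inr n))\<^sup>2) ((w (Inl n))\<^sup>2)" for w :: "nat + nat \<Rightarrow> real"
  define f where "f w t = (l w - t) * sqrt (poly (R w) t) - w (Inr n) * sqrt (K w)" for w t
  let ?\<nu> = "inv_dirichlet N w0 n"
  have Kpos: "K w > 0" for w unfolding K_def by (rule cosh_sqrt_dd_pos) auto
  have Rpos: "poly (R w) t > 0" if "rt (inv_Lyapunov N w) n < t" "t < rt (inv_Lyapunov N w) (n + 1)" for w t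
    using critical_gap_identity(2)[OF inv_Lyapunov(2,3,4)[OF N] n that] by (simp add: R_def l_def s_def)
  have gap_id: "(l w - t)\<^sup>2 * poly (R w) t = (w (Inr n))\<^sup>2 * K w + cosh (w (Inl n)) - s * poly (inv_Lyapunov N w) t" for w t
  proof -
    have "(l w - t)\<^sup>2 * poly (R w) t = s * poly (inv_Lyapunov N w) (l w) - s * poly (inv_Lyapunov N w) t"
      using critical_gap_identity(1)[OF inv_Lyapunov(2,3,4)[OF N] n, of w t] by (simp add: R_def l_def s_def)
    also have "s * poly (inv_Lyapunov N w) (l w) = cosh_sqrt ((w (Inl n))\<^sup>2) + (w (Inr n))\<^sup>2 * K w"
      using inv_Lyapunov(5)[OF N n, of w] cosh_sqrt_diff[of "(w (Inl n))\<^sup>2 + (w (Inr n))\<^sup>2" "(w (Inl n))\<^sup>2"] by (simp add: l_def s_def K_def)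
    finally show ?thesis by (simp add: cosh_sqrt_square)
  qed
  note \<nu> = inv_dirichlet[OF N n, of w0]
  have R0: "poly (R w0) ?\<nu> > 0" by (rule Rpos[OF \<nu>(1,2)])
  have rl: "ranalytic l w0" unfolding l_def[abs_def] by (rule ranalytic_rt_inv_Lyapunov(2)[OF N n])
  have rR: "ranalytic_poly R w0" unfolding R_def[abs_def]
    by (intro ranalytic_poly_smult ranalytic_const ranalytic_sdiv2 ranalytic_inv_Lyapunov N rl)
  have rK: "ranalytic (\<lambda>w. w (Inr n) * sqrt (K w)) w0"
    by (intro ranalytic_mult ranalytic_coord ranalytic_sqrt Kpos)
       (unfold K_def[abs_def], intro ranalytic_cosh_sqrt_dd ranalytic_add ranalytic_power ranalytic_coord)
  \<comment> \<open>The derivative of \<open>f w0\<close> at \<open>\<nu>\<^sub>n\<close>.\<close>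
  define a where "a = (l w0 - ?\<nu>) * (poly (pderiv (R w0)) ?\<nu> / (2 * sqrt (poly (R w0) ?\<nu>))) - sqrt (poly (R w0) ?\<nu>)"
  obtain X \<rho> where X: "ranalytic X w0" "X w0 = ?\<nu>" "\<forall>\<^sub>F w in nhds w0. f w (X w) = 0"
  proof (rule ranalytic_implicit_function_1[of f w0 ?\<nu> a])
    show "ranalytic (\<lambda>v. f (\<lambda>i. v (Inl i)) (v (Inr ()))) (case_sum w0 (\<lambda>_. ?\<nu>))"
      unfolding f_def
      by (rule ranalytic_diff[OF ranalytic_mult[OF ranalytic_diff[OF ranalytic_parameter[OF rl] ranalytic_coord]
            ranalytic_sqrt[OF ranalytic_poly_eval[OF ranalytic_poly_parameter[OF rR] ranalytic_coord]]] ranalytic_parameter[OF rK]])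
         (simp add: R0)
    show "f w0 ?\<nu> = 0"
    proof -
      have "((l w0 - ?\<nu>) * sqrt (poly (R w0) ?\<nu>))\<^sup>2 = (l w0 - ?\<nu>)\<^sup>2 * poly (R w0) ?\<nu>" using R0 by (simp add: power_mult_distrib)
      also have "\<dots> = (w0 (Inr n))\<^sup>2 * K w0" using gap_id[of w0 ?\<nu>] \<nu>(3) by (simp add: s_def)
      also have "\<dots> = (w0 (Inr n) * sqrt (K w0))\<^sup>2" using Kpos[of w0] by (simp add: power_mult_distrib)
      finally have "(l w0 - ?\<nu>) * sqrt (poly (R w0) ?\<nu>) = w0 (Inr n) * sqrt (K w0)"
        by (rule sgn_square_eq) (use R0 Kpos[of w0] \<nu>(4) in \<open>simp add: sgn_mult l_def\<close>)
      then show ?thesis by (simp add: f_def)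
    qed
    show "(f w0 has_field_derivative a) (at ?\<nu>)"
      unfolding f_def a_def by (rule DERIV_linear_times_sqrt[OF R0])
    have "(u * (v / (2 * r)) - r) * (2 * r) = u * v - 2 * (r * r)" if "r > 0" for u v r :: real
      using that by (simp add: field_simps)
    from this[of "sqrt (poly (R w0) ?\<nu>)" "l w0 - ?\<nu>" "poly (pderiv (R w0)) ?\<nu>"]
    have "a * (2 * sqrt (poly (R w0) ?\<nu>)) = (l w0 - ?\<nu>) * poly (pderiv (R w0)) ?\<nu> - 2 * poly (R w0) ?\<nu>"
      using R0 by (simp add: a_def)
    also have "\<dots> < 0" using critical_gap_identity_deriv[OF inv_Lyapunov(2,3,4)[OF N] n \<nu>(1,2)] by (simp add: R_def l_def s_def)
    finally show "a \<noteq> 0" by auto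
  qed
  have n1: "n \<in> {1..N}" "n + 1 \<in> {1..N}" using n N by auto
  have ev1: "\<forall>\<^sub>F w in nhds w0. X w - rt (inv_Lyapunov N w) n > 0"
    by (rule ranalytic_pos[OF ranalytic_diff[OF X(1) ranalytic_rt_inv_Lyapunov(1)[OF N n1(1)]]]) (use \<nu>(1) X(2) in simp)
  have ev2: "\<forall>\<^sub>F w in nhds w0. rt (inv_Lyapunov N w) (n + 1) - X w > 0"
    by (rule ranalytic_pos[OF ranalytic_diff[OF ranalytic_rt_inv_Lyapunov(1)[OF N n1(2)] X(1)]]) (use \<nu>(2) X(2) in simp)
  have "\<forall>\<^sub>F w in nhds w0. X w = inv_dirichlet N w n"
    using X(3) ev1 ev2
  proof eventually_elim
    case (elim w)
    have x: "rt (inv_Lyapunov N w) n < X w" "X w < rt (inv_Lyapunov N w) (n + 1)" using elim by simp_all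
    have r: "poly (R w) (X w) > 0" by (rule Rpos[OF x])
    have e: "(l w - X w) * sqrt (poly (R w) (X w)) = w (Inr n) * sqrt (K w)" using elim(1) by (simp add: f_def)
    then have "sgn ((l w - X w) * sqrt (poly (R w) (X w))) = sgn (w (Inr n) * sqrt (K w))" by simp
    then have sg: "sgn (l w - X w) = sgn (w (Inr n))" using r Kpos[of w] by (simp add: sgn_mult)
    have "(l w - X w)\<^sup>2 * poly (R w) (X w) = ((l w - X w) * sqrt (poly (R w) (X w)))\<^sup>2" using r by (simp add: power_mult_distrib)
    also have "\<dots> = (w (Inr n))\<^sup>2 * K w" unfolding e using Kpos[of w] by (simp add: power_mult_distrib)
    finally have "s * poly (inv_Lyapunov N w) (X w) = cosh (w (Inl n))" using gap_id[of w "X w"] by simp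
    then show "X w = inv_dirichlet N w n" using inv_dirichlet_eqI[OF N n x, symmetric] sg by (simp add: s_def l_def)
  qed
  then show ?thesis by (rule ranalytic_cong[OF X(1)])
qed

definition inv_B :: "nat \<Rightarrow> (nat + nat \<Rightarrow> real) \<Rightarrow> real poly" where
  "inv_B N w = (\<Prod>n\<in>{1..N-1}. [:- inv_dirichlet N w n, 1:])"

text \<open>Lagrange interpolation of \<open>A - \<lambda>\<^sup>N\<close>, a polynomial of degree less than \<open>N - 1\<close>, from its values at the \<open>\<nu>\<^sub>n\<close>.\<close>

definition inv_A :: "nat \<Rightarrow> (nat + nat \<Rightarrow> real) \<Rightarrow> real poly" where
  "inv_A N w = monom 1 N + (\<Sum>n\<in>{1..N-1}. smult ((-1) ^ (N - n) * exp (w (Inl n)) - inv_dirichlet N w n ^ N)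
     (lagrange_basis (inv_dirichlet N w) {1..N-1} n))"

lemma inv_B:
  assumes N: "N \<ge> 2"
  shows "degree (inv_B N w) = N - 1" "lead_coeff (inv_B N w) = 1" "real_rooted (inv_B N w)"
    "\<And>n. n \<in> {1..N-1} \<Longrightarrow> rt (inv_B N w) n = inv_dirichlet N w n"
proof -
  show d: "degree (inv_B N w) = N - 1" "lead_coeff (inv_B N w) = 1"
    unfolding inv_B_def using degree_prod_linear[of "{1..N-1}" "inv_dirichlet N w"] by simp_all
  have ne: "inv_B N w \<noteq> 0" using d(2) by auto
  have root: "poly (inv_B N w) (inv_dirichlet N w i) = 0" if "i \<in> {1..N-1}" for i
    unfolding inv_B_def poly_prod using that by (intro prod_zero) (auto intro!: bexI[of _ i])
  show "real_rooted (inv_B N w)"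
    by (rule real_rootedI(1)[of "inv_B N w" "N - 1" "inv_dirichlet N w"]) (use ne d(1) root inv_dirichlet_less[OF N] in blast)+
  show "rt (inv_B N w) n = inv_dirichlet N w n" if "n \<in> {1..N-1}" for n
    by (rule real_rootedI(2)[of "inv_B N w" "N - 1" "inv_dirichlet N w"]) (use ne d(1) root inv_dirichlet_less[OF N] that in blast)+
qed

lemma coeff_inv_A_high:
  assumes N: "N \<ge> 2" and k: "k \<ge> N - 1"
  shows "coeff (inv_A N w) k = (if k = N then 1 else 0)"
proof -
  have "coeff (lagrange_basis (inv_dirichlet N w) {1..N-1} n) k = 0" if "n \<in> {1..N-1}" for n
    by (rule coeff_eq_0) (use degree_lagrange_basis[OF _ that, of "inv_dirichlet N w"] k N in simp)
  then show ?thesis by (simp add: inv_A_def coeff_sum)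
qed

lemma poly_inv_A:
  assumes N: "N \<ge> 2" and n: "n \<in> {1..N-1}"
  shows "poly (inv_A N w) (inv_dirichlet N w n) = (-1) ^ (N - n) * exp (w (Inl n))"
proof -
  let ?c = "\<lambda>k. (-1) ^ (N - k) * exp (w (Inl k)) - inv_dirichlet N w k ^ N"
  have "(\<Sum>k\<in>{1..N-1}. poly (smult (?c k) (lagrange_basis (inv_dirichlet N w) {1..N-1} k)) (inv_dirichlet N w n))
      = (\<Sum>k\<in>{1..N-1}. if k = n then ?c k else 0)"
    by (rule sum.cong) (simp_all only: poly_smult poly_lagrange_basis[OF finite_atLeastAtMost inj_inv_dirichlet[OF N] _ n] refl, simp)
  also have "\<dots> = ?c n" using n by (simp only: sum.delta' sum.delta finite_atLeastAtMost if_True)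
  finally show ?thesis unfolding inv_A_def poly_add poly_sum by (simp add: poly_monom)
qed

lemma interlaced_inv_A_inv_B:
  assumes N: "N \<ge> 2"
  shows "interlaced (N - 1) (inv_A N w) (inv_B N w)"
proof -
  have S: "Suc (N - 1) = N" using N by simp
  have "degree (inv_A N w) = N"
  proof (rule antisym)
    show "degree (inv_A N w) \<le> N" by (rule degree_le) (use coeff_inv_A_high[OF N] in auto)
    show "N \<le> degree (inv_A N w)" by (rule le_degree) (simp add: coeff_inv_A_high[OF N])
  qed
  moreover have "(-1) ^ (N - n) * poly (inv_A N w) (rt (inv_B N w) n) > 0" if "n \<in> {1..N-1}" for n
    unfolding inv_B(4)[OF N that] poly_inv_A[OF N that] by simp
  ultimately show ?thesis
    unfolding interlaced_def S using inv_B[OF N, where w = w] by (simp add: coeff_inv_A_high[OF N])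
qed

definition inv_x :: "nat \<Rightarrow> (nat + nat \<Rightarrow> real) \<Rightarrow> nat \<Rightarrow> real" where
  "inv_x N w = (\<lambda>i. if i \<in> {1..N-1} then ln (jal (N - 1) (inv_A N w) (inv_B N w) i) / 2
      else if i = N then - (\<Sum>j=1..N-1. ln (jal (N - 1) (inv_A N w) (inv_B N w) j) / 2) else 0)"

definition inv_b :: "nat \<Rightarrow> (nat + nat \<Rightarrow> real) \<Rightarrow> nat \<Rightarrow> real" where
  "inv_b N w = (\<lambda>i. if i \<in> {1..N} then jbe (N - 1) (inv_A N w) (inv_B N w) i else 0)"

lemma inv_x_inv_b:
  assumes N: "N \<ge> 2"
  shows "inv_x N w \<in> Hspace N" "inv_b N w \<in> Hspace N" "phi N (inv_x N w, inv_b N w) (N + 1) = inv_A N w"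
    "jmonic (\<lambda>i. exp (2 * inv_x N w i)) (inv_b N w) N = inv_B N w"
  using periodic_data_inverse[OF interlaced_inv_A_inv_B[OF N, of w] _ N] coeff_inv_A_high[OF N, of "N - 1" w] N
  by (simp_all add: inv_x_def inv_b_def)

lemma ranalytic_inv_x_inv_b:
  assumes N: "N \<ge> 2"
  shows "ranalytic (\<lambda>w. inv_x N w i) w0" "ranalytic (\<lambda>w. inv_b N w i) w0"
proof -
  note rn = ranalytic_inv_dirichlet[OF N]
  have rB: "ranalytic_poly (inv_B N) w0" unfolding inv_B_def[abs_def]
    by (intro ranalytic_poly_prod ranalytic_poly_pCons ranalytic_poly_const ranalytic_uminus rn)
  have "ranalytic_poly (\<lambda>w. lagrange_basis (inv_dirichlet N w) {1..N-1} n) w0" if n: "n \<in> {1..N-1}" for n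
    unfolding lagrange_basis_def
  proof (rule ranalytic_poly_prod)
    fix j assume j: "j \<in> {1..N-1} - {n}"
    have "inv_dirichlet N w0 n \<noteq> inv_dirichlet N w0 j" using inj_inv_dirichlet[OF N, of w0] n j by (auto dest: inj_onD)
    then show "ranalytic_poly (\<lambda>w. smult (1 / (inv_dirichlet N w n - inv_dirichlet N w j)) [:- inv_dirichlet N w j, 1:]) w0"
      using n j by (intro ranalytic_poly_smult ranalytic_divide ranalytic_const ranalytic_diff rn
        ranalytic_poly_pCons ranalytic_poly_const ranalytic_uminus) auto
  qed
  then have rA: "ranalytic_poly (inv_A N) w0" unfolding inv_A_def[abs_def]
    by (intro ranalytic_poly_add ranalytic_poly_const ranalytic_poly_sum ranalytic_poly_smult ranalytic_diff
        ranalytic_mult ranalytic_const ranalytic_exp ranalytic_coord ranalytic_power rn)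
  note I = interlaced_inv_A_inv_B[OF N, of w0]
  have J: "ranalytic (\<lambda>w. jal (N - 1) (inv_A N w) (inv_B N w) i) w0" "ranalytic (\<lambda>w. jbe (N - 1) (inv_A N w) (inv_B N w) i) w0" for i
    using ranalytic_jacobi_inverse[OF I rA rB, of i] by simp_all
  have L: "ranalytic (\<lambda>w. ln (jal (N - 1) (inv_A N w) (inv_B N w) j) / 2) w0" if "j \<in> {1..N-1}" for j
    by (intro ranalytic_divide ranalytic_ln J ranalytic_const) (use jmonic_inverse[OF I] that in auto)
  show "ranalytic (\<lambda>w. inv_b N w i) w0" unfolding inv_b_def
    by (cases "i \<in> {1..N}") (simp_all only: if_True if_False J ranalytic_const)
  show "ranalytic (\<lambda>w. inv_x N w i) w0"
  proof (cases "i \<in> {1..N-1}")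
    case True
    then show ?thesis unfolding inv_x_def using L[OF True] by (simp only: if_True)
  next
    case False
    show ?thesis
    proof (cases "i = N")
      case True
      then show ?thesis unfolding inv_x_def using False by (simp only: if_True if_False simp_thms) (intro ranalytic_uminus ranalytic_sum L)
    next
      case F: False
      show ?thesis unfolding inv_x_def using False F by (simp only: if_False ranalytic_const)
    qed
  qed
qed

lemma eq_if_high_coeffs_and_values_eq:
  fixes p q :: "real poly"
  assumes y: "inj_on y {1..m}" and m: "m \<ge> 1"
    and high: "\<And>k. k \<ge> m \<Longrightarrow> coeff p k = coeff q k" and val: "\<And>n. n \<in> {1..m} \<Longrightarrow> poly p (y n) = poly q (y n)"
  shows "p = q"
proof -
  have "degree (p - q) \<le> m - 1" by (rule degree_le) (use high in auto)
  then have d: "degree (p - q) < card {1..m}" using m by simp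
  have "p - q = (\<Sum>i\<in>{1..m}. smult (poly (p - q) (y i)) (lagrange_basis y {1..m} i))"
    by (rule lagrange_interpolation[OF _ y d]) simp
  also have "\<dots> = 0" using val by (intro sum.neutral) simp
  finally show ?thesis by simp
qed

lemma normal_coeff_high: "normal_poly N D \<Longrightarrow> k \<ge> N - 1 \<Longrightarrow> coeff D k = (if k = N then 1/2 else 0)"
  unfolding normal_poly_def by (cases "k > N") (auto simp: coeff_eq_0 le_less)

text \<open>The operator reconstructed from \<open>\<psi>\<close> has the prescribed Lyapunov function: at the \<open>N - 1\<close> points \<open>\<nu>\<^sub>n\<close> both take the value
\<open>s\<^sub>n cosh \<psi>\<^sub>1\<^sub>,\<^sub>n\<close>, and their two top coefficients agree. The rest is \<open>psi_characterization\<close>.\<close>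

theorem psi_inv_x_inv_b:
  assumes N: "N \<ge> 2" and n: "n \<in> {1..N-1}"
  shows "psi1 N (inv_x N w, inv_b N w) n = w (Inl n)" "psi2 N (inv_x N w, inv_b N w) n = w (Inr n)"
proof -
  let ?q = "(inv_x N w, inv_b N w)" and ?s = "(-1 :: real) ^ (N - n)"
  note I = inv_x_inv_b[OF N, of w]
  note pd = periodic_data[OF I(1,2) N, unfolded I(3,4)]
  have "Lyapunov N ?q = inv_Lyapunov N w"
  proof (rule eq_if_high_coeffs_and_values_eq[OF inj_inv_dirichlet[OF N]])
    have nl: "normal_poly N (Lyapunov N ?q)" using pd(5,6,7) by (simp add: normal_poly_def)
    show "coeff (Lyapunov N ?q) k = coeff (inv_Lyapunov N w) k" if "k \<ge> N - 1" for k
      by (simp only: normal_coeff_high[OF nl that] normal_coeff_high[OF inv_Lyapunov(1)[OF N] that])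
    fix k assume k: "k \<in> {1..N-1}"
    have r: "poly (inv_B N w) (inv_dirichlet N w k) = 0"
      using rt_root[OF inv_B(3)[OF N, where w = w], of k] inv_B(1)[OF N, where w = w] inv_B(4)[OF N k, where w = w] k by simp
    have "(-1) ^ (N - k) * poly (Lyapunov N ?q) (inv_dirichlet N w k) = (-1) ^ (N - k) *
        (((-1) ^ (N - k) * exp (w (Inl k)) + 1 / ((-1) ^ (N - k) * exp (w (Inl k)))) / 2)"
      using pd(8)[OF r] poly_inv_A[OF N k] by simp
    also have "\<dots> = (exp (w (Inl k)) + 1 / exp (w (Inl k))) / 2"
      by (cases "even (N - k)") simp_all
    also have "\<dots> = cosh (w (Inl k))" using cosh_ln[of "exp (w (Inl k))"] by simp
    also have "\<dots> = (-1) ^ (N - k) * poly (inv_Lyapunov N w) (inv_dirichlet N w k)" using inv_dirichlet(3)[OF N k] by simp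
    finally show "poly (Lyapunov N ?q) (inv_dirichlet N w k) = poly (inv_Lyapunov N w) (inv_dirichlet N w k)" by simp
  qed (use N in simp)
  note ch = psi_characterization[OF I(1,2) N n, unfolded I(3,4) this inv_B(4)[OF N n]]
  show p1: "psi1 N ?q n = w (Inl n)" unfolding ch(5) poly_inv_A[OF N n] by simp
  let ?r = "sqrt ((w (Inl n))\<^sup>2 + (w (Inr n))\<^sup>2)"
  have r2: "?r\<^sup>2 = (w (Inl n))\<^sup>2 + (w (Inr n))\<^sup>2" by simp
  have "cosh (psi_abs N ?q n) = cosh_sqrt (?r\<^sup>2)" unfolding ch(7) r2 by (rule inv_Lyapunov(5)[OF N n])
  then have "cosh (psi_abs N ?q n) = cosh ?r" by (simp only: cosh_sqrt_square)
  then have "(psi_abs N ?q n)\<^sup>2 = ?r\<^sup>2" using cosh_le_iff_square[of "psi_abs N ?q n" ?r] cosh_le_iff_square[of ?r "psi_abs N ?q n"] by linarith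
  then have "(psi2 N ?q n)\<^sup>2 = (w (Inr n))\<^sup>2" using ch(9) unfolding p1 r2 by linarith
  moreover have "sgn (psi2 N ?q n) = sgn (w (Inr n))" unfolding ch(10) by (rule inv_dirichlet(4)[OF N n])
  ultimately show "psi2 N ?q n = w (Inr n)" by (rule sgn_square_eq)
qed

text \<open>The Lyapunov function, the Dirichlet eigenvalues and hence \<open>A\<close> and \<open>B\<close> of a given operator have the properties that single
out the reconstructed ones.\<close>

theorem inv_x_inv_b_psi:
  assumes N: "N \<ge> 2" and x: "x \<in> Hspace N" and b: "b \<in> Hspace N"
  defines "w \<equiv> coords (psi N (x, b))"
  shows "(inv_x N w, inv_b N w) = (x, b)"
proof -
  let ?A = "phi N (x, b) (N + 1)" and ?B = "jmonic (\<lambda>i. exp (2 * x i)) b N" and ?D = "Lyapunov N (x, b)"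
  note pd = periodic_data[OF x b N]
  have w: "w (Inl n) = psi1 N (x, b) n" "w (Inr n) = psi2 N (x, b) n" if "n \<in> {1..N-1}" for n
    using that by (simp_all add: w_def psi_def)
  note ch = psi_characterization[OF x b N]
  have rr: "real_rooted ?D" using ch(1)[of 1] N by simp
  have D: "?D = inv_Lyapunov N w" unfolding inv_Lyapunov_def
  proof (rule cpoly(4)[OF N alternating_inv_critval _ rr])
    show "normal_poly N ?D" using pd(5,6,7) by (simp add: normal_poly_def)
    show "critval ?D n = inv_critval N w n" if n: "n \<in> {1..N-1}" for n
    proof -
      have "inv_critval N w n = (-1) ^ (N - n) * cosh (psi_abs N (x, b) n)"
        unfolding inv_critval_def w[OF n] ch(9)[OF n, symmetric] cosh_sqrt_square ..
      then show ?thesis unfolding ch(7)[OF n] by (simp add: critval_def)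
    qed
  qed
  have \<nu>: "inv_dirichlet N w n = rt ?B n" if n: "n \<in> {1..N-1}" for n
    by (rule inv_dirichlet_eqI[OF N n]) (use ch(2,3,6,10)[OF n] in \<open>simp_all add: D w[OF n]\<close>)
  have B: "?B = inv_B N w"
  proof -
    have "real_rooted ?B" "degree ?B = N - 1" "lead_coeff ?B = 1" using pd(2) by (auto simp: interlaced_def)
    then have "?B = (\<Prod>i\<in>{1..N-1}. [:- rt ?B i, 1:])" using real_rooted_factor[of ?B] by simp
    also have "\<dots> = inv_B N w" unfolding inv_B_def by (rule prod.cong) (simp_all only: \<nu>)
    finally show ?thesis .
  qed
  have A: "?A = inv_A N w"
  proof (rule eq_if_high_coeffs_and_values_eq[OF inj_inv_dirichlet[OF N]])
    show "coeff ?A k = coeff (inv_A N w) k" if k: "k \<ge> N - 1" for k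
    proof -
      have d: "degree ?A = N" "coeff ?A N = 1" using pd(2) N by (auto simp: interlaced_def)
      have "coeff ?A k = (if k = N then 1 else 0)"
        using d pd(3) k by (cases "k > N") (auto simp: coeff_eq_0 le_less)
      then show ?thesis by (simp only: coeff_inv_A_high[OF N k])
    qed
    fix n assume n: "n \<in> {1..N-1}"
    have "exp (w (Inl n)) = (-1) ^ (N - n) * poly ?A (rt ?B n)" using ch(4,5)[OF n] by (simp add: w[OF n])
    then show "poly ?A (inv_dirichlet N w n) = poly (inv_A N w) (inv_dirichlet N w n)" unfolding poly_inv_A[OF N n] by (simp add: \<nu>[OF n])
  qed (use N in simp)
  note I = inv_x_inv_b[OF N, of w]
  show ?thesis
    by (rule periodic_data_inj[OF I(1,2) x b N]) (simp_all only: I(3,4) A B)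
qed

lemma trivial_period: "Hspace 1 \<times> Hspace 1 = {(\<lambda>_. 0, \<lambda>_. 0)}" "Rn 0 \<times> Rn 0 = {(\<lambda>_. 0, \<lambda>_. 0)}"
proof -
  have "v = (\<lambda>_. 0)" if "v \<in> Hspace 1" for v
  proof
    fix i show "v i = 0" using that by (cases "i = 1") (auto simp: Hspace_def Rn_def)
  qed
  moreover have "(\<lambda>_. 0) \<in> Hspace 1" by (simp add: Hspace_def Rn_def)
  ultimately show "Hspace 1 \<times> Hspace 1 = {(\<lambda>_. 0, \<lambda>_. 0)}" by blast
  have "Rn 0 = {\<lambda>_. 0}" by (auto simp: Rn_def)
  then show "Rn 0 \<times> Rn 0 = {(\<lambda>_. 0, \<lambda>_. 0)}" by simp
qed

theorem theorem1p1:
  fixes N :: nat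
  assumes "N \<ge> 1"
  shows "bij_betw (psi N) (Hspace N \<times> Hspace N) (Rn (N - 1) \<times> Rn (N - 1)) \<and>
         real_analytic_map N (N - 1) (Hspace N \<times> Hspace N) (psi N) \<and>
         real_analytic_map (N - 1) N (Rn (N - 1) \<times> Rn (N - 1))
           (inv_into (Hspace N \<times> Hspace N) (psi N))"
proof (cases "N = 1")
  case True
  let ?o = "(\<lambda>_. 0 :: real, \<lambda>_. 0 :: real) :: (nat \<Rightarrow> real) \<times> (nat \<Rightarrow> real)"
  have "psi 1 ?o = ?o" by (simp add: psi_def)
  then have bij: "bij_betw (psi 1) {?o} {?o}" by (simp add: bij_betw_def)
  have "inv_into {?o} (psi 1) ?o = ?o" using bij_betw_inv_into_right[OF bij] bij_betw_inv_into[OF bij] by (auto simp: bij_betw_def)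
  then have "real_analytic_fun 0 {?o} (\<lambda>z. coords (inv_into {?o} (psi 1) z) j)" for j
  proof (intro real_analytic_funI)
    show "{?o} \<subseteq> Rn 0 \<times> Rn 0" by (simp add: trivial_period)
    fix p
    assume "inv_into {?o} (psi 1) ?o = ?o"
    then show "\<exists>g. ranalytic g (coords p) \<and>
        (\<forall>\<^sub>F w in nhds (coords p). \<forall>z\<in>{?o}. coords z = w \<longrightarrow> coords (inv_into {?o} (psi 1) z) j = g w)"
      by (intro exI[of _ "\<lambda>_. 0"] conjI ranalytic_const always_eventually) (cases j; simp)
  qed
  then have "real_analytic_map (1 - 1) 1 {?o} (inv_into {?o} (psi 1))" by (simp add: real_analytic_map_def)
  moreover have "real_analytic_map 1 (1 - 1) {?o} (psi 1)" by (auto simp: real_analytic_map_def)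
  ultimately show ?thesis using bij unfolding True trivial_period(1) by (intro conjI) (simp_all only: diff_self_eq_0 trivial_period(2))
next
  case False
  then have N: "N \<ge> 2" using assms by simp
  let ?S = "Hspace N \<times> Hspace N" and ?T = "Rn (N - 1) \<times> Rn (N - 1)"
  let ?G = "\<lambda>z. (inv_x N (coords z), inv_b N (coords z))"
  have GS: "?G z \<in> ?S" for z using inv_x_inv_b(1,2)[OF N] by simp
  have PG: "psi N (?G z) = z" if z: "z \<in> ?T" for z
  proof -
    obtain u v where uv: "z = (u, v)" "u \<in> Rn (N - 1)" "v \<in> Rn (N - 1)" using z by auto
    then show ?thesis using psi_inv_x_inv_b[OF N, of _ "coords z"] by (auto simp: psi_def fun_eq_iff Rn_def)
  qed
  have bij: "bij_betw (psi N) ?S ?T"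
  proof (rule bij_betw_byWitness[where f' = ?G])
    show "\<forall>q\<in>?S. ?G (psi N q) = q" using inv_x_inv_b_psi[OF N] by blast
    show "\<forall>z\<in>?T. psi N (?G z) = z" using PG by blast
    show "psi N ` ?S \<subseteq> ?T" by (auto simp: psi_def Rn_def)
    show "?G ` ?T \<subseteq> ?S" using GS by blast
  qed
  have inv: "inv_into ?S (psi N) z = ?G z" if "z \<in> ?T" for z
    using inv_into_f_f[OF bij_betw_imp_inj_on[OF bij] GS[of z]] PG[OF that] by simp
  have "real_analytic_map N (N - 1) ?S (psi N)"
    unfolding real_analytic_map_def
  proof (intro ballI)
    fix j assume "j \<in> {1..N-1} <+> {1..N-1}"
    then obtain n where n: "n \<in> {1..N-1}" "j = Inl n \<or> j = Inr n" by blast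
    then show "real_analytic_fun N ?S (\<lambda>q. coords (psi N q) j)"
      using psi_real_analytic[OF N n(1)] by (elim disjE) (simp_all only: psi_def coords_simps if_True)
  qed
  moreover have "real_analytic_map (N - 1) N ?T (inv_into ?S (psi N))"
    unfolding real_analytic_map_def
  proof (intro ballI real_analytic_funI[OF subset_refl])
    fix j p
    have "ranalytic (\<lambda>w. coords (inv_x N w, inv_b N w) j) (coords p)"
      by (cases j) (simp_all add: ranalytic_inv_x_inv_b[OF N])
    then show "\<exists>g. ranalytic g (coords p) \<and>
        (\<forall>\<^sub>F w in nhds (coords p). \<forall>z\<in>?T. coords z = w \<longrightarrow> coords (inv_into ?S (psi N) z) j = g w)"
      by (intro exI[of _ "\<lambda>w. coords (inv_x N w, inv_b N w) j"] conjI always_eventually) (auto simp: inv)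
  qed
  ultimately show ?thesis using bij by simp
qed

end
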